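(* Let $h<0$ and $\varpi\neq 0$ be such that the energy surface $\mathcal{M}(h,\varpi,\mathfrak{e})$ of the ellipsoid problem is a compact manifold diffeomorphic to $\mathbb{S}^3$ for small $\mathfrak{e}$. Then, for sufficiently small eccentricity $\mathfrak{e}$, the ellipsoid problem admits infinitely many relative periodic solutions within the compact energy surface $\mathcal{M}(h,\varpi,\mathfrak{e})$.
   Context: The ellipsoid problem. Use spherical coordinates $x=\rho\cos\theta\cos\varphi$, $y=\rho\sin\theta\cos\varphi$, $z=\rho\sin\varphi$ on $\mathbb{R}^3$. A massless satellite moves in the gravitational field of a uniformly mass-distributed body of total mass $M$, centered at the origin, whose boundary is the surface of revolution $\rho=R\left(1-\frac23\mathfrak{e}P_2(\sin\varphi)\right)$, where $P_2(x)=\frac{3x^2-1}{2}$, $R>0$ is the mean radius and $\mathfrak{e}$ is the eccentricity ($\mathfrak{e}>0$ oblate, $\mathfrak{e}<0$ prolate). With gravitational constant $G$ normalized by $GM=1$, the potential energy is $$U_{\mathfrak{e}}(\rho,\varphi)=-\frac{1}{\rho}+\frac25\,\mathfrak{e}\,\frac{R^2}{\rho^3}P_2(\sin\varphi)+O(\mathfrak{e}^2),$$ regarded as a smooth perturbation of the Kepler potential which is invariant under rotations about the $z$-axis and under the reflection $z\mapsto -z$. The angular momentum about the $z$-axis, $\varpi=\rho^2\cos^2\varphi\,\dot\theta$, is conserved; after fixing it, the kinetic energy is $$K_\varpi(\dot\rho,\dot\varphi)=\frac12(\dot\rho^2+\rho^2\dot\varphi^2)+\frac{\varpi^2}{2\rho^2\cos^2\varphi}$$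 (the last term being the contribution of $\dot\theta$), and the energy surface is $$\mathcal{M}(h,\varpi,\mathfrak{e})=\{(\dot\rho,\dot\varphi,\rho,\varphi):K_\varpi(\dot\rho,\dot\varphi)+U_{\mathfrak{e}}(\rho,\varphi)=h\}.$$ A relative periodic solution is a solution that becomes periodic modulo the $\theta$-coordinate, i.e. $(\dot\rho,\dot\varphi,\rho,\varphi)$ is periodic in time. *)

theory Defs
  imports "HOL-Analysis.Analysis"
begin

text \<open>
  Smoothness. On an open set, a map is of class C^k iff it is differentiable and all its
  directional derivatives are of class C^(k-1). Maps on arbitrary subsets of Euclidean space are
  smooth iff they extend smoothly near each point. With this convention a subset of Euclidean
  space that is diffeomorphic to a sphere is automatically an embedded submanifold.
\<close>

fun Ck_on :: "nat \<Rightarrow> ('a::euclidean_space \<Rightarrow> 'b::euclidean_space) \<Rightarrow> 'a set \<Rightarrow> bool" where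
  "Ck_on 0 f U \<longleftrightarrow> continuous_on U f"
| "Ck_on (Suc k) f U \<longleftrightarrow> (\<forall>x\<in>U. f differentiable (at x)) \<and>
     (\<forall>v. Ck_on k (\<lambda>x. frechet_derivative f (at x) v) U)"

definition smooth_map_on :: "'a::euclidean_space set \<Rightarrow> ('a \<Rightarrow> 'b::euclidean_space) \<Rightarrow> bool" where
  "smooth_map_on X f \<longleftrightarrow>
     (\<forall>x\<in>X. \<exists>U g. open U \<and> x \<in> U \<and> (\<forall>k. Ck_on k g U) \<and> (\<forall>y\<in>X \<inter> U. g y = f y))"

definition diffeomorphic ::
  "'a::euclidean_space set \<Rightarrow> 'b::euclidean_space set \<Rightarrow> bool" where
  "diffeomorphic X Y \<longleftrightarrow> (\<exists>f g. smooth_map_on X f \<and> smooth_map_on Y g \<and>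
     f ` X = Y \<and> g ` Y = X \<and> (\<forall>x\<in>X. g (f x) = x) \<and> (\<forall>y\<in>Y. f (g y) = y))"

text \<open>Here \<open>\<phi>\<close> is the latitude, so the rotation axis is \<open>\<phi> = \<plusminus>\<pi>/2\<close> and the equator is \<open>\<phi> = 0\<close>.\<close>

definition spherical :: "real \<Rightarrow> real \<Rightarrow> real \<Rightarrow> real^3" where
  "spherical \<rho> \<theta> \<phi> = vector [\<rho> * cos \<theta> * cos \<phi>, \<rho> * sin \<theta> * cos \<phi>, \<rho> * sin \<phi>]"

definition P2 :: "real \<Rightarrow> real" where
  "P2 x = (3 * x\<^sup>2 - 1) / 2"

definition ellipsoid :: "real \<Rightarrow> real \<Rightarrow> (real^3) set" where
  "ellipsoid R e = {spherical \<rho> \<theta> \<phi> | \<rho> \<theta> \<phi>.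
     \<phi> \<in> {-pi/2..pi/2} \<and> 0 \<le> \<rho> \<and> \<rho> \<le> R * (1 - 2/3 * e * P2 (sin \<phi>))}"

text \<open>
  The Newtonian potential of the homogeneous body, in units with \<open>G M = 1\<close>; the constant density
  times \<open>G\<close> is therefore the inverse of the volume. Outside the body it has the expansion
  \<open>- 1 / \<rho> + 2/5 * e * R\<^sup>2 / \<rho>^3 * P2 (sin \<phi>) + O(e\<^sup>2)\<close>.
\<close>

definition potential :: "real \<Rightarrow> real \<Rightarrow> real^3 \<Rightarrow> real" where
  "potential R e x =
     - (LINT y:ellipsoid R e|lborel. 1 / dist x y) / measure lborel (ellipsoid R e)"

definition kinetic :: "real \<Rightarrow> real \<Rightarrow> real \<Rightarrow> real \<Rightarrow> real \<Rightarrow> real" where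
  "kinetic \<omega> \<rho>' \<phi>' \<rho> \<phi> =
     (\<rho>'\<^sup>2 + \<rho>\<^sup>2 * \<phi>'\<^sup>2) / 2 + \<omega>\<^sup>2 / (2 * \<rho>\<^sup>2 * (cos \<phi>)\<^sup>2)"

text \<open>
  Configurations are the points off the rotation axis and outside the body. The exclusion of the
  body matters: only there is the potential a smooth perturbation of the Kepler potential. By
  rotational symmetry the potential at longitude 0 is the potential as a function of
  \<open>(\<rho>, \<phi>)\<close>.
\<close>

definition energy_surface ::
  "real \<Rightarrow> real \<Rightarrow> real \<Rightarrow> real \<Rightarrow> (real \<times> real \<times> real \<times> real) set" where
  "energy_surface R h \<omega> e = {(\<rho>', \<phi>', \<rho>, \<phi>).
     0 < \<rho> \<and> \<phi> \<in> {-pi/2<..<pi/2} \<and> spherical \<rho> 0 \<phi> \<notin> ellipsoid R e \<and>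
     kinetic \<omega> \<rho>' \<phi>' \<rho> \<phi> + potential R e (spherical \<rho> 0 \<phi>) = h}"

text \<open>
  A solution of the ellipsoid problem is a global solution of Newton's equation
  \<open>x'' = - grad U x\<close> that stays in the set of configurations, written in spherical coordinates.
\<close>

definition ellipsoid_solution ::
  "real \<Rightarrow> real \<Rightarrow> (real \<Rightarrow> real) \<Rightarrow> (real \<Rightarrow> real) \<Rightarrow> (real \<Rightarrow> real) \<Rightarrow> bool" where
  "ellipsoid_solution R e \<rho> \<theta> \<phi> \<longleftrightarrow>
     (\<forall>t. 0 < \<rho> t \<and> \<phi> t \<in> {-pi/2<..<pi/2} \<and> spherical (\<rho> t) (\<theta> t) (\<phi> t) \<notin> ellipsoid R e) \<and>
     (\<forall>t. \<rho> differentiable (at t) \<and> \<theta> differentiable (at t) \<and> \<phi> differentiable (at t)) \<and>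
     (\<exists>v g. \<forall>t.
        ((\<lambda>s. spherical (\<rho> s) (\<theta> s) (\<phi> s)) has_vector_derivative v t) (at t) \<and>
        (v has_vector_derivative - g t) (at t) \<and>
        GDERIV (potential R e) (spherical (\<rho> t) (\<theta> t) (\<phi> t)) :> g t)"

definition angular_momentum ::
  "(real \<Rightarrow> real) \<Rightarrow> (real \<Rightarrow> real) \<Rightarrow> (real \<Rightarrow> real) \<Rightarrow> real \<Rightarrow> real" where
  "angular_momentum \<rho> \<theta> \<phi> t = (\<rho> t)\<^sup>2 * (cos (\<phi> t))\<^sup>2 * deriv \<theta> t"

definition reduced_state ::
  "(real \<Rightarrow> real) \<Rightarrow> (real \<Rightarrow> real) \<Rightarrow> real \<Rightarrow> real \<times> real \<times> real \<times> real" where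
  "reduced_state \<rho> \<phi> t = (deriv \<rho> t, deriv \<phi> t, \<rho> t, \<phi> t)"

definition relative_periodic_solution ::
  "real \<Rightarrow> real \<Rightarrow> (real \<Rightarrow> real) \<Rightarrow> (real \<Rightarrow> real) \<Rightarrow> (real \<Rightarrow> real) \<Rightarrow> bool" where
  "relative_periodic_solution R e \<rho> \<theta> \<phi> \<longleftrightarrow> ellipsoid_solution R e \<rho> \<theta> \<phi> \<and>
     (\<exists>T>0. \<forall>t. reduced_state \<rho> \<phi> (t + T) = reduced_state \<rho> \<phi> t)"

text \<open>
  Solutions are counted by their orbits \<open>range (reduced_state \<rho> \<phi>)\<close>. Counting parametrised
  solutions instead would be meaningless, since time shifts and rotations of a single relative
  periodic solution already yield infinitely many of them.
\<close>

definition relative_periodic_orbits ::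
  "real \<Rightarrow> real \<Rightarrow> real \<Rightarrow> real \<Rightarrow> (real \<times> real \<times> real \<times> real) set set" where
  "relative_periodic_orbits R h \<omega> e = {range (reduced_state \<rho> \<phi>) | \<rho> \<theta> \<phi>.
     relative_periodic_solution R e \<rho> \<theta> \<phi> \<and>
     (\<forall>t. angular_momentum \<rho> \<theta> \<phi> t = \<omega>) \<and>
     range (reduced_state \<rho> \<phi>) \<subseteq> energy_surface R h \<omega> e}"

end

theory Submission
 imports Defs
begin

text \<open>
 Perturb the Kepler problem in the orbital elements \<open>p\<close> (eccentricity vector in the orbital plane)
 and \<open>S\<close> (sine of the inclination), with the argument of latitude \<open>u\<close> as independent variable: the
 elements then move with speed \<open>O(e)\<close>, and energy conservation confines them to a compact set.
 To first order one turn rotates \<open>p\<close> about the origin by \<open>2 * pi * e * rot S\<close>, where \<open>rot\<close> comes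
 from averaging the quadrupole term. The system is reversible under reflection at a node, so an
 orbit that crosses the equator with vanishing radial velocity at two nodes is periodic. An
 intermediate value argument gives such an orbit close to the circular one (the centre). Along the
 curve of orbits of energy \<open>h\<close> that start at a node with vanishing radial velocity, from the
 equatorial orbit \<open>S = 0\<close> to the centre, the angle swept about the centre in \<open>n\<close> turns changes by
 a multiple of \<open>n * e\<close>, because \<open>rot\<close> differs at the two ends. For large \<open>n\<close> it passes through
 many multiples of \<open>pi\<close>, and each passage is a symmetric, hence relative periodic, orbit.
\<close>

section \<open>Expansions in a small parameter with Lipschitz remainders\<close>

text \<open>The potential is an integral over the true body, so nothing may be read off from a
  formal series: that the body is a linear image of the ball up to \<open>O(e^2)\<close>, Newton's
  theorem and the sign of the quadrupole coefficient are all proved, with remainders that are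
  Lipschitz in position. The elements \<open>(p, S)\<close> obey equations that stay regular both at
  circular orbits (\<open>p = 0\<close>) and at equatorial ones (\<open>S = 0\<close>), which the
  curve of the intermediate value argument approaches at its two ends; perigee and node, taken as
  angles, would degenerate there. Per turn the twist between the ends is of order \<open>e\<close>
  and the error of the angle of order \<open>e^2\<close>, so one small \<open>e\<close> serves all
  \<open>n\<close>. Several starting points may lie on one orbit; the count is saved because a
  periodic orbit off the equatorial plane has finitely many node crossings. The hypothesis on the
  energy surface is turned into two inequalities at \<open>e = 0\<close>: the Kepler annulus is
  nondegenerate, and its inner radius exceeds \<open>R\<close>. They leave room for the compact set
  in which the elements live.\<close>

text \<open>
 \<open>expands k W Y f\<close>: on \<open>W \<times> Y\<close> the family \<open>f e\<close> is a polynomial in \<open>e\<close> of degree \<open>k\<close>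
 up to a remainder \<open>O(e^k)\<close>, where all coefficients and the remainder are bounded and Lipschitz
 in the second argument, uniformly in the first. A Lipschitz remainder is what allows relative
 estimates for two nearby orbits.
\<close>

definition ulip :: "'w set => 'y::metric_space set => (real => 'w => 'y => 'b::real_normed_vector) => bool" where
 "ulip W Y f \<longleftrightarrow> (\<exists>C. \<forall>\<^sub>F e in nhds 0. \<forall>w\<in>W. \<forall>y\<in>Y.
   norm (f e w y) <= C \<and> (\<forall>y'\<in>Y. norm (f e w y - f e w y') <= C * dist y y'))"

fun expands :: "nat => 'w set => 'y::metric_space set => (real => 'w => 'y => 'b::real_normed_vector) => bool" where
 "expands 0 W Y f \<longleftrightarrow> ulip W Y f"
| "expands (Suc k) W Y f \<longleftrightarrow> ulip W Y (%_. f 0) \<and>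
   (\<exists>g. expands k W Y g \<and> (\<forall>\<^sub>F e in nhds 0. \<forall>w\<in>W. \<forall>y\<in>Y. f e w y = f 0 w y + e *\<^sub>R g e w y))"

lemma ulipE:
 assumes "ulip W Y f"
 obtains C where "C > 0"
  "\<forall>\<^sub>F e in nhds 0. \<forall>w\<in>W. \<forall>y\<in>Y. norm (f e w y) <= C \<and> (\<forall>y'\<in>Y. norm (f e w y - f e w y') <= C * dist y y')"
proof -
 from assms obtain C where C: "\<forall>\<^sub>F e in nhds 0. \<forall>w\<in>W. \<forall>y\<in>Y.
   norm (f e w y) <= C \<and> (\<forall>y'\<in>Y. norm (f e w y - f e w y') <= C * dist y y')"
  unfolding ulip_def by blast
 have "\<forall>\<^sub>F e in nhds 0. \<forall>w\<in>W. \<forall>y\<in>Y.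
   norm (f e w y) <= max C 1 \<and> (\<forall>y'\<in>Y. norm (f e w y - f e w y') <= max C 1 * dist y y')"
  using C
 proof eventually_elim
  case (elim e)
  show ?case
  proof (intro ballI conjI)
   fix w y assume "w \<in> W" "y \<in> Y"
   then show "norm (f e w y) <= max C 1" using elim by (meson max.coboundedI1)
   fix y' assume "y' \<in> Y"
   have "norm (f e w y - f e w y') <= C * dist y y'" using elim \<open>w \<in> W\<close> \<open>y \<in> Y\<close> \<open>y' \<in> Y\<close> by blast
   also have "\<dots> <= max C 1 * dist y y'" by (intro mult_right_mono) auto
   finally show "norm (f e w y - f e w y') <= max C 1 * dist y y'" .
  qed
 qed
 then show thesis using that[of "max C 1"] by simp
qed

lemma ulip_cong:
 assumes "ulip W Y f" "\<forall>\<^sub>F e in nhds 0. \<forall>w\<in>W. \<forall>y\<in>Y. f e w y = g e w y"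
 shows "ulip W Y g"
proof -
 from assms(1) obtain C where "\<forall>\<^sub>F e in nhds 0. \<forall>w\<in>W. \<forall>y\<in>Y.
   norm (f e w y) <= C \<and> (\<forall>y'\<in>Y. norm (f e w y - f e w y') <= C * dist y y')"
  unfolding ulip_def by blast
 then have "\<forall>\<^sub>F e in nhds 0. \<forall>w\<in>W. \<forall>y\<in>Y.
   norm (g e w y) <= C \<and> (\<forall>y'\<in>Y. norm (g e w y - g e w y') <= C * dist y y')"
  using assms(2) by eventually_elim simp
 then show ?thesis unfolding ulip_def by blast
qed

text \<open>\<open>nhds 0\<close> contains \<open>0\<close> itself, so families that agree
  eventually also agree at \<open>e = 0\<close>; this identifies their leading coefficients.\<close>

lemma expands_cong:
 assumes "expands k W Y f" "\<forall>\<^sub>F e in nhds 0. \<forall>w\<in>W. \<forall>y\<in>Y. f e w y = g e w y"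
 shows "expands k W Y g"
proof (cases k)
 case 0
 then show ?thesis using assms ulip_cong by auto
next
 case (Suc l)
 have z: "\<forall>w\<in>W. \<forall>y\<in>Y. f 0 w y = g 0 w y" using eventually_nhds_x_imp_x[OF assms(2)] .
 from assms(1) Suc obtain h where h: "ulip W Y (%_. f 0)" "expands l W Y h"
  "\<forall>\<^sub>F e in nhds 0. \<forall>w\<in>W. \<forall>y\<in>Y. f e w y = f 0 w y + e *\<^sub>R h e w y" by auto
 have "ulip W Y (%_. g 0)" by (rule ulip_cong[OF h(1)]) (use z in auto)
 moreover have "\<forall>\<^sub>F e in nhds 0. \<forall>w\<in>W. \<forall>y\<in>Y. g e w y = g 0 w y + e *\<^sub>R h e w y"
  using h(3) assms(2) by eventually_elim (use z in auto)
 ultimately show ?thesis using h(2) Suc by auto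
qed

lemma ulip_at_0:
 assumes "ulip W Y f" shows "ulip W Y (%_. f 0)"
proof -
 from assms obtain C where "\<forall>\<^sub>F e in nhds 0. \<forall>w\<in>W. \<forall>y\<in>Y.
   norm (f e w y) <= C \<and> (\<forall>y'\<in>Y. norm (f e w y - f e w y') <= C * dist y y')"
  unfolding ulip_def by blast
 from eventually_nhds_x_imp_x[OF this] show ?thesis
  unfolding ulip_def by (intro exI[of _ C] always_eventually) simp
qed

lemma ulip_add:
 assumes "ulip W Y f" "ulip W Y g"
 shows "ulip W Y (%e w y. f e w y + g e w y)"
proof -
 obtain C where C: "C > 0" "\<forall>\<^sub>F e in nhds 0. \<forall>w\<in>W. \<forall>y\<in>Y. norm (f e w y) <= C \<and> (\<forall>y'\<in>Y. norm (f e w y - f e w y') <= C * dist y y')"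
  using ulipE[OF assms(1)] .
 obtain D where D: "D > 0" "\<forall>\<^sub>F e in nhds 0. \<forall>w\<in>W. \<forall>y\<in>Y. norm (g e w y) <= D \<and> (\<forall>y'\<in>Y. norm (g e w y - g e w y') <= D * dist y y')"
  using ulipE[OF assms(2)] .
 show ?thesis unfolding ulip_def
 proof (intro exI[of _ "C + D"])
  show "\<forall>\<^sub>F e in nhds 0. \<forall>w\<in>W. \<forall>y\<in>Y. norm (f e w y + g e w y) <= C + D \<and>
    (\<forall>y'\<in>Y. norm ((f e w y + g e w y) - (f e w y' + g e w y')) <= (C + D) * dist y y')"
   using C(2) D(2)
  proof eventually_elim
   case (elim e)
   show ?case
   proof (intro ballI conjI)
    fix w y assume wy: "w \<in> W" "y \<in> Y"
    show "norm (f e w y + g e w y) <= C + D"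
     using elim wy by (meson add_mono norm_triangle_le)
    fix y' assume y': "y' \<in> Y"
    have "norm ((f e w y + g e w y) - (f e w y' + g e w y')) <= norm (f e w y - f e w y') + norm (g e w y - g e w y')"
     by (metis add_diff_add norm_triangle_ineq)
    also have "\<dots> <= C * dist y y' + D * dist y y'" using elim wy y' by (meson add_mono)
    finally show "norm ((f e w y + g e w y) - (f e w y' + g e w y')) <= (C + D) * dist y y'"
     by (simp add: algebra_simps)
   qed
  qed
 qed
qed

lemma ulip_bounded_bilinear:
 assumes "bounded_bilinear op" "ulip W Y f" "ulip W Y g"
 shows "ulip W Y (%e w y. op (f e w y) (g e w y))"
proof -
 interpret bounded_bilinear op by fact
 obtain K where K: "K > 0" "\<And>a b. norm (op a b) <= norm a * norm b * K" using pos_bounded by blast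
 obtain C where C: "C > 0" "\<forall>\<^sub>F e in nhds 0. \<forall>w\<in>W. \<forall>y\<in>Y. norm (f e w y) <= C \<and> (\<forall>y'\<in>Y. norm (f e w y - f e w y') <= C * dist y y')"
  using ulipE[OF assms(2)] .
 obtain D where D: "D > 0" "\<forall>\<^sub>F e in nhds 0. \<forall>w\<in>W. \<forall>y\<in>Y. norm (g e w y) <= D \<and> (\<forall>y'\<in>Y. norm (g e w y - g e w y') <= D * dist y y')"
  using ulipE[OF assms(3)] .
 have le: "norm (op a b) <= A * B * K" if "norm a <= A" "norm b <= B" for a b A B
 proof -
  have "norm a * norm b <= A * B" using that by (meson mult_mono norm_ge_zero order_trans)
  then show ?thesis using K by (meson mult_right_mono order_trans less_imp_le)
 qed
 show ?thesis unfolding ulip_def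
 proof (intro exI[of _ "2 * C * D * K"])
  show "\<forall>\<^sub>F e in nhds 0. \<forall>w\<in>W. \<forall>y\<in>Y. norm (op (f e w y) (g e w y)) <= 2 * C * D * K \<and>
    (\<forall>y'\<in>Y. norm (op (f e w y) (g e w y) - op (f e w y') (g e w y')) <= 2 * C * D * K * dist y y')"
   using C(2) D(2)
  proof eventually_elim
   case (elim e)
   show ?case
   proof (intro ballI conjI)
    fix w y assume wy: "w \<in> W" "y \<in> Y"
    have "norm (op (f e w y) (g e w y)) <= C * D * K" using elim wy by (intro le) auto
    also have "\<dots> <= 2 * C * D * K" using C D K by simp
    finally show "norm (op (f e w y) (g e w y)) <= 2 * C * D * K" .
    fix y' assume y': "y' \<in> Y"
    have "op (f e w y) (g e w y) - op (f e w y') (g e w y') =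
     op (f e w y - f e w y') (g e w y) + op (f e w y') (g e w y - g e w y')"
     by (simp add: diff_left diff_right)
    also have "norm \<dots> <= (C * dist y y') * D * K + C * (D * dist y y') * K"
     using elim wy y' by (intro norm_triangle_mono le) auto
    finally show "norm (op (f e w y) (g e w y) - op (f e w y') (g e w y')) <= 2 * C * D * K * dist y y'"
     by (simp add: algebra_simps)
   qed
  qed
 qed
qed

lemma ulip_bounded_linear:
 assumes "bounded_linear T" "ulip W Y f"
 shows "ulip W Y (%e w y. T (f e w y))"
proof -
 interpret bounded_linear T by fact
 obtain K where K: "K > 0" "\<And>a. norm (T a) <= norm a * K" using pos_bounded by blast
 obtain C where C: "C > 0" "\<forall>\<^sub>F e in nhds 0. \<forall>w\<in>W. \<forall>y\<in>Y. norm (f e w y) <= C \<and> (\<forall>y'\<in>Y. norm (f e w y - f e w y') <= C * dist y y')"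
  using ulipE[OF assms(2)] .
 have le: "norm (T a) <= A * K" if "norm a <= A" for a A
  using K that by (meson mult_right_mono order_trans less_imp_le)
 show ?thesis unfolding ulip_def
 proof (intro exI[of _ "C * K"])
  show "\<forall>\<^sub>F e in nhds 0. \<forall>w\<in>W. \<forall>y\<in>Y. norm (T (f e w y)) <= C * K \<and>
    (\<forall>y'\<in>Y. norm (T (f e w y) - T (f e w y')) <= C * K * dist y y')"
   using C(2)
  proof eventually_elim
   case (elim e)
   show ?case
   proof (intro ballI conjI)
    fix w y assume wy: "w \<in> W" "y \<in> Y"
    show "norm (T (f e w y)) <= C * K" using elim wy by (intro le) auto
    fix y' assume y': "y' \<in> Y"
    have "norm (T (f e w y - f e w y')) <= C * dist y y' * K" using elim wy y' by (intro le) auto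
    then show "norm (T (f e w y) - T (f e w y')) <= C * K * dist y y'" by (simp add: diff ac_simps)
   qed
  qed
 qed
qed

lemma ulip_const_fun:
 assumes "\<And>w. w \<in> W ==> norm (c w) <= M"
 shows "ulip W Y (%_ w _. c w)"
proof -
 have "norm (c w) <= max M 0" if "w \<in> W" for w using assms[OF that] by simp
 then show ?thesis unfolding ulip_def by (intro exI[of _ "max M 0"] always_eventually) auto
qed

lemma ulip_imp_expands_const:
 fixes f :: "'w => 'y::metric_space => 'b::real_normed_vector"
 shows "ulip W Y (%_. f) ==> expands k W Y (%_. f)"
proof (induction k arbitrary: f)
 case (Suc k)
 have "ulip W Y (%_. (%_ _. 0::'b))" by (rule ulip_const_fun[of _ _ 0]) auto
 then have "expands k W Y (%_ _ _. 0::'b)" using Suc.IH[of "%_ _. 0"] by simp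
 then show ?case using Suc.prems by (auto intro!: exI[of _ "%_ _ _. 0"])
qed auto

lemma expands_const_fun:
 assumes "\<And>w. w \<in> W ==> norm (c w) <= M"
 shows "expands k W Y (%_ w _. c w)"
 by (rule ulip_imp_expands_const, rule ulip_const_fun) (use assms in auto)

lemma expands_const [intro]: "expands k W Y (%_ _ _. c)"
 by (rule expands_const_fun[where M = "norm c"]) auto

lemma expands_at_0: "expands k W Y f ==> expands l W Y (%_. f 0)"
 using ulip_imp_expands_const[of W Y "f 0" l] by (cases k) (auto dest: ulip_at_0)

lemma expands_ulip: "expands k W Y f ==> ulip W Y f"
proof (induction k arbitrary: f)
 case (Suc k)
 then obtain g where g: "ulip W Y (%_. f 0)" "expands k W Y g"
  "\<forall>\<^sub>F e in nhds 0. \<forall>w\<in>W. \<forall>y\<in>Y. f e w y = f 0 w y + e *\<^sub>R g e w y" by auto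
 have "\<forall>\<^sub>F e in nhds 0. norm (e::real) < 1"
  by (auto simp: eventually_nhds_metric intro!: exI[of _ 1])
 then have e: "ulip W Y (%e _ _. e::real)" unfolding ulip_def
  by (intro exI[of _ 1]) (auto elim!: eventually_mono)
 have "ulip W Y (%e w y. f 0 w y + e *\<^sub>R g e w y)"
  by (intro ulip_add g(1) ulip_bounded_bilinear[OF bounded_bilinear_scaleR] e Suc.IH g)
 then show ?case by (rule ulip_cong) (use g(3) in eventually_elim, auto)
qed auto

lemma expands_lower: "expands (Suc k) W Y f ==> expands k W Y f"
proof (induction k arbitrary: f)
 case 0
 then show ?case using expands_ulip by fastforce
next
 case (Suc k)
 then show ?case by auto
qed

lemma expands_step:
 assumes "ulip W Y (%_. f 0)" "expands k W Y g"
  "\<forall>\<^sub>F e in nhds 0. \<forall>w\<in>W. \<forall>y\<in>Y. f e w y = f 0 w y + e *\<^sub>R g e w y"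
 shows "expands (Suc k) W Y f"
 using assms by auto

lemma expandsE:
 assumes "expands (Suc k) W Y f"
 obtains g where "ulip W Y (%_. f 0)" "expands k W Y g"
  "\<forall>\<^sub>F e in nhds 0. \<forall>w\<in>W. \<forall>y\<in>Y. f e w y = f 0 w y + e *\<^sub>R g e w y"
 using assms by auto

text \<open>One factor \<open>e\<close> buys one order. In this way a remainder known only to be
  bounded and Lipschitz enters an expansion of higher order.\<close>

lemma expands_scale: "expands k W Y g ==> expands (Suc k) W Y (%e w y. e *\<^sub>R g e w y)"
 by (rule expands_step[where g = g]) (auto intro!: ulip_const_fun[where c = "%_. 0" and M = 0])

lemma expands_param [intro]: "expands k W Y (%e _ _. e::real)"
proof (cases k)
 case 0
 have "expands (Suc 0) W Y (%e w y. e *\<^sub>R (1::real))" by (rule expands_scale[OF expands_const])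
 from expands_lower[OF this] show ?thesis using 0 by simp
next
 case (Suc l)
 have "expands (Suc l) W Y (%e w y. e *\<^sub>R (1::real))" by (rule expands_scale[OF expands_const])
 then show ?thesis using Suc by simp
qed

lemma expands_add:
 "expands k W Y f ==> expands k W Y g ==> expands k W Y (%e w y. f e w y + g e w y)"
proof (induction k arbitrary: f g)
 case (Suc k)
 from expandsE[OF Suc.prems(1)] obtain f1 where f1: "ulip W Y (%_. f 0)" "expands k W Y f1"
  "\<forall>\<^sub>F e in nhds 0. \<forall>w\<in>W. \<forall>y\<in>Y. f e w y = f 0 w y + e *\<^sub>R f1 e w y" .
 from expandsE[OF Suc.prems(2)] obtain g1 where g1: "ulip W Y (%_. g 0)" "expands k W Y g1"
  "\<forall>\<^sub>F e in nhds 0. \<forall>w\<in>W. \<forall>y\<in>Y. g e w y = g 0 w y + e *\<^sub>R g1 e w y" .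
 show ?case
 proof (rule expands_step[where g = "%e w y. f1 e w y + g1 e w y"])
  show "\<forall>\<^sub>F e in nhds 0. \<forall>w\<in>W. \<forall>y\<in>Y. f e w y + g e w y = f 0 w y + g 0 w y + e *\<^sub>R (f1 e w y + g1 e w y)"
   using f1(3) g1(3) by eventually_elim (auto simp: algebra_simps)
 qed (use f1 g1 Suc.IH ulip_add in auto)
qed (auto intro: ulip_add)

lemma expands_bounded_linear:
 "bounded_linear T ==> expands k W Y f ==> expands k W Y (%e w y. T (f e w y))"
proof (induction k arbitrary: f)
 case (Suc k)
 interpret bounded_linear T by fact
 from expandsE[OF Suc.prems(2)] obtain f1 where f1: "ulip W Y (%_. f 0)" "expands k W Y f1"
  "\<forall>\<^sub>F e in nhds 0. \<forall>w\<in>W. \<forall>y\<in>Y. f e w y = f 0 w y + e *\<^sub>R f1 e w y" .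
 show ?case
 proof (rule expands_step[where g = "%e w y. T (f1 e w y)"])
  show "\<forall>\<^sub>F e in nhds 0. \<forall>w\<in>W. \<forall>y\<in>Y. T (f e w y) = T (f 0 w y) + e *\<^sub>R T (f1 e w y)"
   using f1(3) by eventually_elim (auto simp: add scaleR)
 qed (use f1 Suc ulip_bounded_linear in auto)
qed (auto intro: ulip_bounded_linear)

lemma expands_bounded_bilinear:
 assumes "bounded_bilinear op"
 shows "expands k W Y f ==> expands k W Y g ==> expands k W Y (%e w y. op (f e w y) (g e w y))"
proof (induction k arbitrary: f g)
 case (Suc k)
 interpret bounded_bilinear op by fact
 from expandsE[OF Suc.prems(1)] obtain f1 where f1: "ulip W Y (%_. f 0)" "expands k W Y f1"
  "\<forall>\<^sub>F e in nhds 0. \<forall>w\<in>W. \<forall>y\<in>Y. f e w y = f 0 w y + e *\<^sub>R f1 e w y" .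
 from expandsE[OF Suc.prems(2)] obtain g1 where g1: "ulip W Y (%_. g 0)" "expands k W Y g1"
  "\<forall>\<^sub>F e in nhds 0. \<forall>w\<in>W. \<forall>y\<in>Y. g e w y = g 0 w y + e *\<^sub>R g1 e w y" .
 show ?case
 proof (rule expands_step[where g = "%e w y. op (f1 e w y) (g e w y) + op (f 0 w y) (g1 e w y)"])
  show "\<forall>\<^sub>F e in nhds 0. \<forall>w\<in>W. \<forall>y\<in>Y. op (f e w y) (g e w y) = op (f 0 w y) (g 0 w y) +
    e *\<^sub>R (op (f1 e w y) (g e w y) + op (f 0 w y) (g1 e w y))"
   using f1(3) g1(3)
   by eventually_elim (auto simp: add_left add_right scaleR_left scaleR_right scaleR_add_right)
  show "expands k W Y (%e w y. op (f1 e w y) (g e w y) + op (f 0 w y) (g1 e w y))"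
   using Suc f1 g1 expands_lower expands_at_0 by (intro expands_add Suc.IH) blast+
 qed (use f1 g1 ulip_bounded_bilinear[OF assms] in auto)
qed (auto intro: ulip_bounded_bilinear[OF assms])

lemma expands_mult:
 fixes f g :: "real => 'w => 'y::metric_space => 'b::real_normed_algebra"
 shows "expands k W Y f ==> expands k W Y g ==> expands k W Y (%e w y. f e w y * g e w y)"
 by (rule expands_bounded_bilinear[OF bounded_bilinear_mult])

lemma expands_minus: "expands k W Y f ==> expands k W Y (%e w y. - f e w y)"
 by (rule expands_bounded_linear[OF bounded_linear_minus[OF bounded_linear_ident]])

lemma expands_diff:
 "expands k W Y f ==> expands k W Y g ==> expands k W Y (%e w y. f e w y - g e w y)"
 using expands_add[OF _ expands_minus, of k W Y f g] by simp

lemma expands_power: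
 fixes f :: "real => 'w => 'y::metric_space => 'b::real_normed_algebra_1"
 shows "expands k W Y f ==> expands k W Y (%e w y. f e w y ^ n)"
 by (induction n) (auto intro: expands_mult)

lemma ulip_inverse:
 fixes f :: "real => 'w => 'y::metric_space => 'b::real_normed_field"
 assumes "ulip W Y f" "m > 0" "\<forall>\<^sub>F e in nhds 0. \<forall>w\<in>W. \<forall>y\<in>Y. m <= norm (f e w y)"
 shows "ulip W Y (%e w y. inverse (f e w y))"
proof -
 obtain C where C: "C > 0" "\<forall>\<^sub>F e in nhds 0. \<forall>w\<in>W. \<forall>y\<in>Y. norm (f e w y) <= C \<and> (\<forall>y'\<in>Y. norm (f e w y - f e w y') <= C * dist y y')"
  using ulipE[OF assms(1)] .
 show ?thesis unfolding ulip_def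
 proof (intro exI[of _ "max (1 / m) (C / m^2)"])
  show "\<forall>\<^sub>F e in nhds 0. \<forall>w\<in>W. \<forall>y\<in>Y. norm (inverse (f e w y)) <= max (1 / m) (C / m^2) \<and>
    (\<forall>y'\<in>Y. norm (inverse (f e w y) - inverse (f e w y')) <= max (1 / m) (C / m^2) * dist y y')"
   using C(2) assms(3)
  proof eventually_elim
   case (elim e)
   show ?case
   proof (intro ballI conjI)
    fix w y assume wy: "w \<in> W" "y \<in> Y"
    have inv: "norm (inverse (f e w z)) <= 1 / m" if "z \<in> Y" for z
    proof -
     have "m <= norm (f e w z)" using elim wy that by blast
     then have "inverse (norm (f e w z)) <= inverse m" using \<open>m > 0\<close> by (rule le_imp_inverse_le)
     then show ?thesis using norm_inverse[of "f e w z"] by (simp add: inverse_eq_divide norm_divide)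
    qed
    show "norm (inverse (f e w y)) <= max (1 / m) (C / m^2)" using inv[OF wy(2)] by simp
    fix y' assume y': "y' \<in> Y"
    have nz: "f e w y ~= 0" "f e w y' ~= 0" using elim wy y' \<open>m > 0\<close> by (metis not_le norm_zero)+
    have "inverse (f e w y) - inverse (f e w y') = (f e w y' - f e w y) * (inverse (f e w y) * inverse (f e w y'))"
     using nz by (simp add: field_simps)
    then have "norm (inverse (f e w y) - inverse (f e w y')) = norm (f e w y - f e w y') * (norm (inverse (f e w y)) * norm (inverse (f e w y')))"
     by (simp add: norm_mult norm_minus_commute)
    also have "\<dots> <= (C * dist y y') * ((1/m) * (1/m))"
     using elim wy y' inv C(1) \<open>m > 0\<close> by (intro mult_mono) auto
    also have "\<dots> = (C / m^2) * dist y y'" by (simp add: power2_eq_square)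
    also have "\<dots> <= max (1 / m) (C / m^2) * dist y y'" by (intro mult_right_mono) auto
    finally show "norm (inverse (f e w y) - inverse (f e w y')) <= max (1 / m) (C / m^2) * dist y y'" .
   qed
  qed
 qed
qed

text \<open>From \<open>1/f - 1/f0 = - (f - f0) / (f f0)\<close> the difference quotient contains
  \<open>1/f\<close> only to the order \<open>k\<close> provided by the induction
  hypothesis.\<close>

lemma expands_inverse:
 fixes f :: "real => 'w => 'y::metric_space => 'b::real_normed_field"
 assumes "m > 0" "\<forall>\<^sub>F e in nhds 0. \<forall>w\<in>W. \<forall>y\<in>Y. m <= norm (f e w y)"
 shows "expands k W Y f ==> expands k W Y (%e w y. inverse (f e w y))"
proof (induction k)
 case 0
 then show ?case using ulip_inverse[OF _ assms] by auto
next
 case (Suc k)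
 from expandsE[OF Suc.prems] obtain f1 where f1: "ulip W Y (%_. f 0)" "expands k W Y f1"
  "\<forall>\<^sub>F e in nhds 0. \<forall>w\<in>W. \<forall>y\<in>Y. f e w y = f 0 w y + e *\<^sub>R f1 e w y" .
 have z: "\<forall>w\<in>W. \<forall>y\<in>Y. m <= norm (f 0 w y)" using eventually_nhds_x_imp_x[OF assms(2)] .
 have i: "expands k W Y (%e w y. inverse (f e w y))" using Suc expands_lower by blast
 show ?case
 proof (rule expands_step[where g = "%e w y. - (f1 e w y * (inverse (f e w y) * inverse (f 0 w y)))"])
  show "ulip W Y (%_ w y. inverse (f 0 w y))"
   by (rule ulip_inverse[OF f1(1) assms(1)]) (use z in auto)
  show "expands k W Y (%e w y. - (f1 e w y * (inverse (f e w y) * inverse (f 0 w y))))"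
   by (intro expands_minus expands_mult f1 i expands_at_0[OF i])
  show "\<forall>\<^sub>F e in nhds 0. \<forall>w\<in>W. \<forall>y\<in>Y. inverse (f e w y) = inverse (f 0 w y) +
    e *\<^sub>R - (f1 e w y * (inverse (f e w y) * inverse (f 0 w y)))"
   using f1(3) assms(2)
  proof eventually_elim
   case (elim e)
   show ?case
   proof (intro ballI)
    fix w y assume wy: "w \<in> W" "y \<in> Y"
    have nz: "f e w y ~= 0" "f 0 w y ~= 0" using elim wy z \<open>m > 0\<close> by (metis not_le norm_zero)+
    have "e *\<^sub>R f1 e w y = f e w y - f 0 w y" using elim wy by auto
    then have "e *\<^sub>R - (f1 e w y * (inverse (f e w y) * inverse (f 0 w y))) = - ((f e w y - f 0 w y) * (inverse (f e w y) * inverse (f 0 w y)))"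
     by (metis scaleR_minus_right mult_scaleR_left)
    then show "inverse (f e w y) = inverse (f 0 w y) + e *\<^sub>R - (f1 e w y * (inverse (f e w y) * inverse (f 0 w y)))"
     using nz by (simp add: field_simps)
   qed
  qed
 qed
qed

lemma expands_divide:
 fixes f g :: "real => 'w => 'y::metric_space => 'b::real_normed_field"
 assumes "expands k W Y f" "expands k W Y g" "m > 0" "\<forall>\<^sub>F e in nhds 0. \<forall>w\<in>W. \<forall>y\<in>Y. m <= norm (g e w y)"
 shows "expands k W Y (%e w y. f e w y / g e w y)"
 using expands_mult[OF assms(1) expands_inverse[OF assms(3,4,2)]] by (simp add: divide_inverse)

lemma sqrt_diff_eq: "a > 0 ==> b > 0 ==> sqrt a - sqrt b = (a - b) * inverse (sqrt a + sqrt b)"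
proof -
 assume "a > 0" "b > 0"
 then have "0 < sqrt a + sqrt b" "(sqrt a - sqrt b) * (sqrt a + sqrt b) = a - b"
  by (auto simp: algebra_simps intro: add_pos_pos)
 then show "sqrt a - sqrt b = (a - b) * inverse (sqrt a + sqrt b)" by (simp add: field_simps)
qed

lemma ulip_sqrt:
 assumes "ulip W Y f" "m > 0" "\<forall>\<^sub>F e in nhds 0. \<forall>w\<in>W. \<forall>y\<in>Y. m <= f e w y"
 shows "ulip W Y (%e w y. sqrt (f e w y))"
proof -
 obtain C where C: "C > 0" "\<forall>\<^sub>F e in nhds 0. \<forall>w\<in>W. \<forall>y\<in>Y. norm (f e w y) <= C \<and> (\<forall>y'\<in>Y. norm (f e w y - f e w y') <= C * dist y y')"
  using ulipE[OF assms(1)] .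
 show ?thesis unfolding ulip_def
 proof (intro exI[of _ "max (sqrt C) (C / sqrt m)"])
  show "\<forall>\<^sub>F e in nhds 0. \<forall>w\<in>W. \<forall>y\<in>Y. norm (sqrt (f e w y)) <= max (sqrt C) (C / sqrt m) \<and>
    (\<forall>y'\<in>Y. norm (sqrt (f e w y) - sqrt (f e w y')) <= max (sqrt C) (C / sqrt m) * dist y y')"
   using C(2) assms(3)
  proof eventually_elim
   case (elim e)
   show ?case
   proof (intro ballI conjI)
    fix w y assume wy: "w \<in> W" "y \<in> Y"
    have p: "m <= f e w y" using elim wy by auto
    have "norm (f e w y) <= C" using elim wy by auto
    then have "sqrt (f e w y) <= sqrt C" by simp
    then show "norm (sqrt (f e w y)) <= max (sqrt C) (C / sqrt m)" using p \<open>m > 0\<close> by (simp add: le_max_iff_disj)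
    fix y' assume y': "y' \<in> Y"
    have p': "m <= f e w y'" using elim wy y' by auto
    have s: "sqrt m <= sqrt (f e w y) + sqrt (f e w y')" using p p' \<open>m > 0\<close>
     by (smt (verit) real_sqrt_le_iff real_sqrt_ge_zero)
    have "norm (sqrt (f e w y) - sqrt (f e w y')) = norm (f e w y - f e w y') * inverse (sqrt (f e w y) + sqrt (f e w y'))"
     using sqrt_diff_eq[of "f e w y" "f e w y'"] p p' \<open>m > 0\<close> s by (simp add: abs_mult)
    also have "\<dots> <= (C * dist y y') * inverse (sqrt m)"
     using elim wy y' C(1) \<open>m > 0\<close> s order_trans[OF _ s, of 0] by (intro mult_mono le_imp_inverse_le) auto
    also have "\<dots> = (C / sqrt m) * dist y y'" by (simp add: divide_inverse)
    also have "\<dots> <= max (sqrt C) (C / sqrt m) * dist y y'" by (intro mult_right_mono) auto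
    finally show "norm (sqrt (f e w y) - sqrt (f e w y')) <= max (sqrt C) (C / sqrt m) * dist y y'" .
   qed
  qed
 qed
qed

text \<open>Rationalising, the difference quotient is \<open>f1 / (sqrt f + sqrt f0)\<close>, so the
  induction step reduces to the expansion of an inverse.\<close>

lemma expands_sqrt:
 assumes "m > 0" "\<forall>\<^sub>F e in nhds 0. \<forall>w\<in>W. \<forall>y\<in>Y. m <= f e w y"
 shows "expands k W Y f ==> expands k W Y (%e w y. sqrt (f e w y))"
proof (induction k)
 case 0
 then show ?case using ulip_sqrt[OF _ assms] by auto
next
 case (Suc k)
 from expandsE[OF Suc.prems] obtain f1 where f1: "ulip W Y (%_. f 0)" "expands k W Y f1"
  "\<forall>\<^sub>F e in nhds 0. \<forall>w\<in>W. \<forall>y\<in>Y. f e w y = f 0 w y + e *\<^sub>R f1 e w y" .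
 have z: "\<forall>w\<in>W. \<forall>y\<in>Y. m <= f 0 w y" using eventually_nhds_x_imp_x[OF assms(2)] .
 have i: "expands k W Y (%e w y. sqrt (f e w y))" using Suc expands_lower by blast
 have "expands k W Y (%e w y. inverse (sqrt (f e w y) + sqrt (f 0 w y)))"
 proof (rule expands_inverse[where m = "sqrt m"])
  show "\<forall>\<^sub>F e in nhds 0. \<forall>w\<in>W. \<forall>y\<in>Y. sqrt m <= norm (sqrt (f e w y) + sqrt (f 0 w y))"
   using assms(2)
  proof eventually_elim
   case (elim e)
   show ?case
   proof (intro ballI)
    fix w y assume "w \<in> W" "y \<in> Y"
    then have "m <= f e w y" "m <= f 0 w y" using elim z by auto
     then have "sqrt m <= sqrt (f e w y)" "0 <= sqrt (f 0 w y)" using \<open>m > 0\<close> by auto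
     then show "sqrt m <= norm (sqrt (f e w y) + sqrt (f 0 w y))" unfolding real_norm_def by linarith
   qed
  qed
 qed (use assms(1) i expands_at_0[OF i] in \<open>auto intro!: expands_add\<close>)
 note inv = this
 show ?case
 proof (rule expands_step[where g = "%e w y. f1 e w y * inverse (sqrt (f e w y) + sqrt (f 0 w y))"])
  show "ulip W Y (%_ w y. sqrt (f 0 w y))"
   by (rule ulip_sqrt[OF f1(1) assms(1)]) (use z in auto)
  show "expands k W Y (%e w y. f1 e w y * inverse (sqrt (f e w y) + sqrt (f 0 w y)))"
   by (intro expands_mult f1 inv)
  show "\<forall>\<^sub>F e in nhds 0. \<forall>w\<in>W. \<forall>y\<in>Y. sqrt (f e w y) = sqrt (f 0 w y) +
    e *\<^sub>R (f1 e w y * inverse (sqrt (f e w y) + sqrt (f 0 w y)))"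
   using f1(3) assms(2)
  proof eventually_elim
   case (elim e)
   show ?case
   proof (intro ballI)
    fix w y assume wy: "w \<in> W" "y \<in> Y"
    then have "0 < f e w y" "0 < f 0 w y" using elim z \<open>m > 0\<close> by fastforce+
    note sqrt_diff_eq[OF this]
    moreover have "e * f1 e w y = f e w y - f 0 w y" using elim wy by auto
    ultimately show "sqrt (f e w y) = sqrt (f 0 w y) + e *\<^sub>R (f1 e w y * inverse (sqrt (f e w y) + sqrt (f 0 w y)))"
     by (metis add.commute diff_add_cancel mult.assoc real_scaleR_def)
   qed
  qed
 qed
qed

text \<open>Composition is treated at order 0 because a Lipschitz outer function has no Taylor
  expansion. For higher orders the leading term is handled by algebra and only the remainder is
  composed.\<close>

lemma ulip_compose:
 fixes f :: "real => unit => 'x::real_normed_vector => 'b::real_normed_vector"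
 assumes "ulip UNIV X f" "ulip W Y (g :: real => 'w => 'y::metric_space => 'x)"
  "\<forall>\<^sub>F e in nhds 0. \<forall>w\<in>W. \<forall>y\<in>Y. g e w y \<in> X"
 shows "ulip W Y (%e w y. f e () (g e w y))"
proof -
 obtain C where C: "C > 0" "\<forall>\<^sub>F e in nhds 0. \<forall>w\<in>UNIV. \<forall>y\<in>X. norm (f e w y) <= C \<and> (\<forall>y'\<in>X. norm (f e w y - f e w y') <= C * dist y y')"
  using ulipE[OF assms(1)] .
 obtain D where D: "D > 0" "\<forall>\<^sub>F e in nhds 0. \<forall>w\<in>W. \<forall>y\<in>Y. norm (g e w y) <= D \<and> (\<forall>y'\<in>Y. norm (g e w y - g e w y') <= D * dist y y')"
  using ulipE[OF assms(2)] .
 show ?thesis unfolding ulip_def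
 proof (intro exI[of _ "max C (C * D)"])
  show "\<forall>\<^sub>F e in nhds 0. \<forall>w\<in>W. \<forall>y\<in>Y. norm (f e () (g e w y)) <= max C (C * D) \<and>
    (\<forall>y'\<in>Y. norm (f e () (g e w y) - f e () (g e w y')) <= max C (C * D) * dist y y')"
   using C(2) D(2) assms(3)
  proof eventually_elim
   case (elim e)
   show ?case
   proof (intro ballI conjI)
    fix w y assume wy: "w \<in> W" "y \<in> Y"
    show "norm (f e () (g e w y)) <= max C (C * D)" using elim wy by (simp add: le_max_iff_disj)
    fix y' assume y': "y' \<in> Y"
    have "norm (f e () (g e w y) - f e () (g e w y')) <= C * dist (g e w y) (g e w y')"
     using elim wy y' by simp
    also have "\<dots> <= C * (D * dist y y')" using elim wy y' C(1) by (simp add: dist_norm)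
    also have "\<dots> <= max C (C * D) * dist y y'" by (simp add: mult.assoc[symmetric] mult_right_mono)
    finally show "norm (f e () (g e w y) - f e () (g e w y')) <= max C (C * D) * dist y y'" .
   qed
  qed
 qed
qed

section \<open>Globally Lipschitz differential equations\<close>

text \<open>Gronwall in an inner product space: \<open>exp (- 2 L u) |z|^2\<close> does not
  increase. The squared norm is differentiable also where \<open>z\<close> vanishes.\<close>

lemma norm_growth_forward:
 fixes z :: "real => 'a::real_inner"
 assumes "a <= b" "\<And>u. u \<in> {a..b} ==> (z has_vector_derivative z' u) (at u)"
  "\<And>u. u \<in> {a..b} ==> norm (z' u) <= L * norm (z u)"
 shows "norm (z b) <= exp (L * (b - a)) * norm (z a)"
proof -
 define f where "f u = (z u \<bullet> z u) * exp (- 2 * L * u)" for u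
 have "f b <= f a"
 proof (rule DERIV_nonpos_imp_nonincreasing[OF assms(1)])
  fix u assume u: "a <= u" "u <= b"
  have d: "(z has_derivative (%h. h *\<^sub>R z' u)) (at u)"
   using assms(2)[of u] u by (simp add: has_vector_derivative_def)
  have "(f has_real_derivative (2 * (z' u \<bullet> z u) * exp (- 2 * L * u) + (z u \<bullet> z u) * (exp (- 2 * L * u) * (- 2 * L)))) (at u)"
   unfolding f_def has_field_derivative_def
   by (rule derivative_eq_intros d refl)+ (auto simp: algebra_simps inner_commute)
  moreover have "z' u \<bullet> z u <= L * (z u \<bullet> z u)"
  proof -
   have "z' u \<bullet> z u <= norm (z' u) * norm (z u)" by (rule norm_cauchy_schwarz)
   also have "\<dots> <= L * norm (z u) * norm (z u)" using assms(3)[of u] u by (intro mult_right_mono) auto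
   finally show ?thesis by (simp add: power2_norm_eq_inner[symmetric] power2_eq_square)
  qed
  then have "2 * (z' u \<bullet> z u - L * (z u \<bullet> z u)) * exp (- 2 * L * u) <= 0"
   by (simp only: mult_le_0_iff exp_ge_zero) simp
  then have "2 * (z' u \<bullet> z u) * exp (- 2 * L * u) + (z u \<bullet> z u) * (exp (- 2 * L * u) * (- 2 * L)) <= 0"
   by (simp add: algebra_simps)
  ultimately show "\<exists>y. (f has_real_derivative y) (at u) \<and> y <= 0" by blast
 qed
 then have "(z b \<bullet> z b) * exp (- 2 * L * b) * exp (2 * L * b) <= (z a \<bullet> z a) * exp (- 2 * L * a) * exp (2 * L * b)"
  unfolding f_def by (intro mult_right_mono) auto
 then have "(norm (z b))\<^sup>2 <= (norm (z a))\<^sup>2 * exp (2 * L * (b - a))"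
  by (simp add: power2_norm_eq_inner mult.assoc exp_add[symmetric] algebra_simps)
 also have "\<dots> = (exp (L * (b - a)) * norm (z a))\<^sup>2"
  by (simp add: power_mult_distrib exp_double[symmetric] mult.assoc mult.commute)
 finally show ?thesis by (rule power2_le_imp_le) simp
qed

lemma norm_growth:
 fixes z :: "real => 'a::real_inner"
 assumes "\<And>u. u \<in> {min a b..max a b} ==> (z has_vector_derivative z' u) (at u)"
  "\<And>u. u \<in> {min a b..max a b} ==> norm (z' u) <= L * norm (z u)"
 shows "norm (z b) <= exp (L * \<bar>b - a\<bar>) * norm (z a)"
proof (cases "a <= b")
 case True
 then show ?thesis using norm_growth_forward[of a b z z' L] assms by simp
next
 case False
 define y where "y u = z (- u)" for u
 have "norm (y (- b)) <= exp (L * (- b - (- a))) * norm (y (- a))"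
 proof (rule norm_growth_forward[where z' = "%u. - z' (- u)"])
  fix u assume "u \<in> {- a..- b}"
  then have u: "- u \<in> {min a b..max a b}" using False by auto
  have "((z \<circ> uminus) has_vector_derivative (- 1) *\<^sub>R z' (- u)) (at u)"
   by (rule vector_diff_chain_at) (auto intro!: derivative_eq_intros assms(1)[OF u])
  then show "(y has_vector_derivative - z' (- u)) (at u)" by (simp add: y_def[abs_def] o_def)
  show "norm (- z' (- u)) <= L * norm (y u)" using assms(2)[OF u] by (simp add: y_def)
 qed (use False in auto)
 then show ?thesis using False by (simp add: y_def)
qed

lemma norm_diff_le_exp:
 fixes f :: "real => 'a::real_normed_vector"
 assumes "\<And>u. (f has_vector_derivative f' u) (at u)" "\<And>u. norm (f' u) <= c * exp (k * \<bar>u\<bar>)" "k > 0" "c \<ge> 0"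
 shows "norm (f u - f 0) <= c / k * (exp (k * \<bar>u\<bar>) - 1)"
proof -
 have pos: "norm (g u - g 0) <= c / k * (exp (k * u) - 1)"
  if "u > 0" "\<And>u. (g has_vector_derivative g' u) (at u)" "\<And>u. norm (g' u) <= c * exp (k * \<bar>u\<bar>)"
  for g g' and u :: real
 proof -
  have "norm (g u - g 0) <= c / k * exp (k * u) - c / k * exp (k * 0)"
  proof (rule differentiable_bound_general[OF \<open>u > 0\<close>, where f' = g' and \<phi>' = "%u. c * exp (k * u)"])
   show "continuous_on {0..u} g"
    using that(2) by (intro continuous_at_imp_continuous_on) (auto intro: has_vector_derivative_continuous)
   show "continuous_on {0..u} (%u. c / k * exp (k * u))" by (intro continuous_intros)
   fix x :: real assume x: "0 < x" "x < u"
   show "(g has_vector_derivative g' x) (at x)" by (rule that)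
   show "((%u. c / k * exp (k * u)) has_vector_derivative c * exp (k * x)) (at x)"
    using \<open>k > 0\<close> by (auto simp: has_real_derivative_iff_has_vector_derivative[symmetric] intro!: derivative_eq_intros)
   show "norm (g' x) <= c * exp (k * x)" using that(3)[of x] x by simp
  qed
  then show ?thesis by (simp add: algebra_simps)
 qed
 consider "u > 0" | "u = 0" | "u < 0" by linarith
 then show ?thesis
 proof cases
  case 1
  then show ?thesis using pos[OF 1 assms(1,2)] by simp
 next
  case 3
  have "norm (f (- (- u)) - f (- 0)) <= c / k * (exp (k * (- u)) - 1)"
  proof (rule pos[of "- u" "%u. f (- u)" "%u. - f' (- u)"])
   fix v
   have "((f \<circ> uminus) has_vector_derivative (- 1) *\<^sub>R f' (- v)) (at v)"
    by (rule vector_diff_chain_at) (auto intro!: derivative_eq_intros assms(1))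
   then show "((%u. f (- u)) has_vector_derivative - f' (- v)) (at v)" by (simp add: o_def)
   show "norm (- f' (- v)) <= c * exp (k * \<bar>v\<bar>)" using assms(2)[of "- v"] by simp
  qed (use 3 in auto)
  then show ?thesis using 3 by simp
 qed simp
qed

text \<open>Picard iteration on the whole line in one step: in the norm weighted by
  \<open>exp (- k |u|)\<close> with \<open>k >= 2 L\<close> the integral operator contracts by
  \<open>1/2\<close>. A bounded continuous \<open>z\<close> stands for the curve
  \<open>y0 + exp (k |u|) z u\<close>.\<close>

theorem global_solution_exists:
 fixes G :: "real => 'a::euclidean_space => 'a"
 assumes cont: "continuous_on UNIV (%(u, y). G u y)"
  and M: "\<And>u y. norm (G u y) <= M"
  and L: "\<And>u y y'. norm (G u y - G u y') <= L * norm (y - y')"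
 obtains y where "y 0 = y0" "\<And>u. (y has_vector_derivative G u (y u)) (at u)"
proof -
 define k where "k = 2 * max L 1"
 have k: "k \<ge> 2" "L <= k / 2" "k > 0" by (auto simp: k_def)
 have M0: "M \<ge> 0" using M[of 0 0] norm_ge_zero order_trans by blast
 define w where "w z s = y0 + exp (k * \<bar>s\<bar>) *\<^sub>R apply_bcontfun z s" for z :: "real \<Rightarrow>\<^sub>C 'a" and s :: real
 have wc: "continuous_on UNIV (w z)" for z
  unfolding w_def by (intro continuous_intros continuous_on_apply_bcontfun)
 have "\<exists>F. \<forall>u. (F has_vector_derivative G u (w z u)) (at u)" for z
 proof -
  have c: "continuous_on UNIV (%u. G u (w z u))"
   using continuous_on_compose2[OF cont, of UNIV "%u. (u, w z u)"]
     continuous_on_Pair[OF continuous_on_id wc[of z]] by simp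
  have "\<exists>F. \<forall>x. -\<infinity> < ereal x --> ereal x < \<infinity> --> (F has_vector_derivative G x (w z x)) (at x)"
   by (rule einterval_antiderivative) (use c in \<open>auto simp: continuous_on_eq_continuous_at\<close>)
  then show ?thesis by simp
 qed
 then obtain F0 where F0: "\<And>z u. (F0 z has_vector_derivative G u (w z u)) (at u)" by metis
 define F where "F z u = F0 z u - F0 z 0" for z u
 have F: "(F z has_vector_derivative G u (w z u)) (at u)" "F z 0 = 0" for z u
  using has_vector_derivative_diff[OF F0[of z u] has_vector_derivative_const[of "F0 z 0"]]
  by (auto simp: F_def[abs_def])
 have Fc: "continuous_on UNIV (F z)" for z
  using F(1) by (intro continuous_at_imp_continuous_on) (auto intro: has_vector_derivative_continuous)
 have Fb: "norm (F z u) <= M * exp (k * \<bar>u\<bar>)" for z u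
 proof -
  have "norm (F z u - F z 0) <= M / k * (exp (k * \<bar>u\<bar>) - 1)"
  proof (rule norm_diff_le_exp[OF F(1)])
   fix u
   have "norm (G u (w z u)) <= M * 1" using M by simp
   also have "\<dots> <= M * exp (k * \<bar>u\<bar>)" using M0 k by (intro mult_left_mono) auto
   finally show "norm (G u (w z u)) <= M * exp (k * \<bar>u\<bar>)" .
  qed (use M0 k in auto)
  also have "\<dots> <= M * exp (k * \<bar>u\<bar>)"
   using M0 k mult_left_mono[of 1 k M] by (intro mult_mono) (auto simp: field_simps)
  finally show ?thesis using F(2) by simp
 qed
 define T where "T z = Bcontfun (%u. exp (- k * \<bar>u\<bar>) *\<^sub>R F z u)" for z
 have T: "apply_bcontfun (T z) u = exp (- k * \<bar>u\<bar>) *\<^sub>R F z u" for z u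
 proof -
  have "(%u. exp (- k * \<bar>u\<bar>) *\<^sub>R F z u) \<in> bcontfun"
  proof (rule bcontfun_normI[where b = M])
   show "continuous_on UNIV (%u. exp (- k * \<bar>u\<bar>) *\<^sub>R F z u)" by (intro continuous_intros Fc)
   show "norm (exp (- k * \<bar>u\<bar>) *\<^sub>R F z u) <= M" for u
   proof -
    have "exp (- k * \<bar>u\<bar>) * norm (F z u) <= exp (- k * \<bar>u\<bar>) * (M * exp (k * \<bar>u\<bar>))"
     by (intro mult_left_mono Fb) auto
    also have "\<dots> = M" by (simp add: exp_minus field_simps)
    finally show ?thesis by simp
   qed
  qed
  then show ?thesis by (simp add: T_def Bcontfun_inverse)
 qed
 have "\<exists>!z. T z = z"
 proof (rule banach_fix_type[of "1/2"])
  show "\<forall>x y. dist (T x) (T y) <= 1 / 2 * dist x y"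
  proof (intro allI dist_bound)
   fix x y :: "real \<Rightarrow>\<^sub>C 'a" and u
   have "norm ((F x u - F y u) - (F x 0 - F y 0)) <= (L' * dist x y) / k * (exp (k * \<bar>u\<bar>) - 1)"
    if L': "L' = max L 0" for L'
   proof (rule norm_diff_le_exp)
    fix u
    show "((%u. F x u - F y u) has_vector_derivative G u (w x u) - G u (w y u)) (at u)"
     by (intro has_vector_derivative_diff F)
    have "norm (G u (w x u) - G u (w y u)) <= L' * norm (w x u - w y u)"
     using L[of u "w x u" "w y u"] L' by (meson max.cobounded1 mult_right_mono norm_ge_zero order_trans)
    also have "norm (w x u - w y u) = exp (k * \<bar>u\<bar>) * dist (x u) (y u)"
     by (simp add: w_def dist_norm scaleR_diff_right[symmetric])
    also have "L' * \<dots> <= L' * (exp (k * \<bar>u\<bar>) * dist x y)"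
     using L' dist_bounded[of x u y] by (intro mult_left_mono) auto
    finally show "norm (G u (w x u) - G u (w y u)) <= L' * dist x y * exp (k * \<bar>u\<bar>)"
     by (simp add: algebra_simps)
   qed (use k L' in auto)
   then have "norm (F x u - F y u) <= (max L 0 * dist x y) / k * (exp (k * \<bar>u\<bar>) - 1)"
    using F(2) by simp
   also have "\<dots> <= (1/2 * dist x y) * exp (k * \<bar>u\<bar>)"
   proof (rule mult_mono)
    have "max L 0 * dist x y <= (k / 2) * dist x y" using k by (intro mult_right_mono) auto
    then show "max L 0 * dist x y / k <= 1 / 2 * dist x y" using k by (simp add: field_simps)
   qed (use k in auto)
   finally have "exp (- k * \<bar>u\<bar>) * norm (F x u - F y u) <= exp (- k * \<bar>u\<bar>) * ((1/2 * dist x y) * exp (k * \<bar>u\<bar>))"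
    by (intro mult_left_mono) auto
   also have "\<dots> = 1/2 * dist x y" by (simp add: exp_minus field_simps)
   finally show "dist (T x u) (T y u) <= 1 / 2 * dist x y"
    by (simp add: T dist_norm scaleR_diff_right[symmetric])
  qed
 qed auto
 then obtain z where z: "T z = z" by blast
 have wz: "w z u = y0 + F z u" for u
 proof -
  have "w z u = y0 + exp (k * \<bar>u\<bar>) *\<^sub>R T z u" by (simp add: w_def z)
  also have "\<dots> = y0 + F z u" by (simp add: T exp_minus)
  finally show ?thesis .
 qed
 show thesis
 proof (rule that[of "%u. y0 + F z u"])
  show "((%u. y0 + F z u) has_vector_derivative G u (y0 + F z u)) (at u)" for u
   using has_vector_derivative_add[OF has_vector_derivative_const[of y0] F(1)[of z u]] by (simp add: wz)
 qed (simp add: F)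
qed

text \<open>At the infimum of the exit times from \<open>K'\<close> the curve is still in
  \<open>K'\<close>, hence for a while in \<open>K\<close>, and there \<open>step\<close> puts it
  back into \<open>K'\<close>. In the application \<open>step\<close> is energy conservation, which
  is available only as long as the curve has not left \<open>K\<close>.\<close>

lemma trapped_forever:
 fixes y :: "real => 'a::real_normed_vector"
 assumes cont: "continuous_on UNIV y" and K: "closed K'" "K' \<subseteq> interior K" and "y 0 \<in> K'"
  and step: "\<And>t. t \<ge> 0 ==> (\<And>u. u \<in> {0..t} ==> y u \<in> K) ==> y t \<in> K'"
 shows "t \<ge> 0 ==> y t \<in> K'"
proof (rule ccontr)
 assume t: "t \<ge> 0" "y t \<notin> K'"
 define B where "B = {u. u \<ge> 0 \<and> y u \<notin> K'}"
 have B: "t \<in> B" "bdd_below B" using t by (auto simp: B_def intro!: bdd_belowI[of _ 0])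
 define s where "s = Inf B"
 have s0: "s \<ge> 0" unfolding s_def using B by (intro cInf_greatest) (auto simp: B_def)
 have before: "y u \<in> K'" if "0 <= u" "u < s" for u
  using that cInf_lower[OF _ B(2), of u] by (force simp: s_def B_def)
 have ys: "y s \<in> K'"
 proof (cases "s = 0")
  case False
  have "s \<in> closure {0..<s}" using s0 False by simp
  moreover have "continuous_on (closure {0..<s}) y" using cont continuous_on_subset by blast
  ultimately show ?thesis
   using image_closure_subset[OF _ K(1), of "{0..<s}" y] before by fastforce
 qed (use assms in simp)
 have "open (y -` interior K)" using cont by (simp add: continuous_on_open_vimage)
 moreover have "s \<in> y -` interior K" using ys K by auto
 ultimately obtain d where d: "d > 0" "\<And>u. \<bar>u - s\<bar> < d ==> y u \<in> interior K"
  by (auto simp: open_dist dist_real_def)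
 have near: "y u \<in> K'" if "s <= u" "u < s + d" for u
 proof (rule step)
  fix v assume v: "v \<in> {0..u}"
  show "y v \<in> K"
  proof (cases "v < s")
   case True then show ?thesis using before[of v] v K interior_subset by auto
  next
   case False
   then have "\<bar>v - s\<bar> < d" using v that by auto
   from d(2)[OF this] show ?thesis using interior_subset by blast
  qed
 qed (use that s0 in auto)
 have "s + d <= u" if "u \<in> B" for u
  using near[of u] before[of u] that by (force simp: B_def)
 then have "s + d <= s" unfolding s_def using B(1) by (intro cInf_greatest) auto
 then show False using d(1) by simp
qed

declare expands.simps [simp del]

section \<open>The orbital elements and their averaged equations\<close>

lemma expands_eventually_ge:
 fixes f :: "real => 'w => 'y::metric_space => real"
 assumes "expands (Suc k) W Y f" "m > 0" "\<And>w y. w \<in> W ==> y \<in> Y ==> m <= f 0 w y"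
 shows "\<forall>\<^sub>F e in nhds 0. \<forall>w\<in>W. \<forall>y\<in>Y. m / 2 <= f e w y"
proof -
 from expandsE[OF assms(1)] obtain g where g: "expands k W Y g"
  "\<forall>\<^sub>F e in nhds 0. \<forall>w\<in>W. \<forall>y\<in>Y. f e w y = f 0 w y + e *\<^sub>R g e w y" .
 obtain C where C: "C > 0" "\<forall>\<^sub>F e in nhds 0. \<forall>w\<in>W. \<forall>y\<in>Y. norm (g e w y) <= C \<and> (\<forall>y'\<in>Y. norm (g e w y - g e w y') <= C * dist y y')"
  using ulipE[OF expands_ulip[OF g(1)]] .
 have "\<forall>\<^sub>F e in nhds 0. \<bar>e\<bar> < m / (2 * C)"
  using assms(2) C(1) by (auto simp: eventually_nhds_metric dist_real_def intro!: exI[of _ "m / (2 * C)"])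
 with g(2) C(2) show ?thesis
 proof eventually_elim
  case (elim e)
  show ?case
  proof (intro ballI)
   fix w y assume wy: "w \<in> W" "y \<in> Y"
   have "\<bar>e * g e w y\<bar> <= (m / (2 * C)) * C"
    unfolding abs_mult using elim wy C(1) by (intro mult_mono) auto
   then have "\<bar>e * g e w y\<bar> <= m / 2" using C(1) by simp
   moreover have "f e w y = f 0 w y + e * g e w y" using elim wy by simp
   ultimately show "m / 2 <= f e w y" using assms(3)[OF wy] by linarith
  qed
 qed
qed

lemma ulip_Pair:
 fixes f :: "real => 'w => 'y::metric_space => 'a::real_normed_vector" and g :: "real => 'w => 'y => 'b::real_normed_vector"
 assumes "ulip W Y f" "ulip W Y g"
 shows "ulip W Y (%e w y. (f e w y, g e w y))"
proof -
 have "bounded_linear (%x::'a. (x, 0::'b))" "bounded_linear (%x::'b. (0::'a, x))"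
  by (auto intro!: bounded_linear_Pair bounded_linear_zero bounded_linear_ident)
 from ulip_add[OF ulip_bounded_linear[OF this(1) assms(1)] ulip_bounded_linear[OF this(2) assms(2)]]
 show ?thesis by simp
qed

text \<open>
 \<open>S\<close> is the sine of the inclination and \<open>u\<close> the argument of latitude. The complex number
 \<open>p\<close> encodes eccentricity and argument of perigee; it is constant along Kepler orbits:
 \<open>p * cis (-u) = (L\<^sup>2/\<rho> - 1) - \<i> L \<rho>'\<close>, where \<open>L\<close> is the total angular momentum.
\<close>

definition Lam :: "real => complex \<times> real => real" where
 "Lam w y = w / sqrt (1 - (snd y)\<^sup>2)"

definition ecc :: "real => complex \<times> real => complex" where
 "ecc u y = fst y * cis (- u)"

text \<open>The equation of a conic with semi-latus rectum \<open>Lam^2\<close>;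
  \<open>Re ecc\<close> is the eccentricity times the cosine of the true anomaly.\<close>

definition rad :: "real => real => complex \<times> real => real" where
 "rad w u y = (Lam w y)\<^sup>2 / (1 + Re (ecc u y))"

definition vel :: "real => real => complex \<times> real => real" where
 "vel w u y = - Im (ecc u y) / Lam w y"

definition lat :: "real => complex \<times> real => real" where
 "lat u y = snd y * sin u"

text \<open>\<open>X\<close> is a box containing the pairs (distance, sine of latitude) when the
  elements run through \<open>K\<close>: the radial bounds come from the extreme values of
  \<open>Lam^2\<close> and of \<open>1 + Re ecc\<close>. In the gradient of the potential
  \<open>1/r^3 + e E\<close> is the coefficient common to the three coordinates, and
  \<open>e D\<close> is added to the vertical one; \<open>D0\<close> and \<open>E0\<close> are the
  values of a quadrupole of strength \<open>c\<close>.\<close>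

locale perturbed =
 fixes w e1 c :: real and D E :: "real => real \<times> real => real" and K X
 defines "K \<equiv> cball (0::complex) e1 \<times> {- e1..e1}"
  and "X \<equiv> {w\<^sup>2 / (1 + e1)..w\<^sup>2 / ((1 - e1^2) * (1 - e1))} \<times> {- e1..e1}"
 assumes w: "w > 0" and e1: "0 < e1" "e1 < 1" and c: "c > 0"
  and D: "expands 1 (UNIV :: unit set) X (%e _. D e)" and E: "expands 1 (UNIV :: unit set) X (%e _. E e)"
  and D0: "x \<in> X ==> D 0 x = 6 * c / fst x ^ 5"
  and E0: "x \<in> X ==> E 0 x = c * (3 - 15 * (snd x)\<^sup>2) / fst x ^ 5"
begin

definition \<Delta> :: "real => real => complex \<times> real => real" where
 "\<Delta> e u y = D e (rad w u y, lat u y)"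

definition \<Xi> :: "real => real => complex \<times> real => real" where
 "\<Xi> e u y = E e (rad w u y, lat u y)"

text \<open>The angular speed \<open>du/dt\<close>.\<close>

definition Ups :: "real => real => complex \<times> real => real" where
 "Ups e u y = Lam w y / (rad w u y)\<^sup>2 + e * ((rad w u y)\<^sup>2 * \<Delta> e u y * (sin u)\<^sup>2 * w^2 / (Lam w y) ^ 3)"

text \<open>Gauss's variational equations with \<open>u\<close> as independent variable.
  Differentiating \<open>p = cis u * ecc\<close> leaves three contributions: the part of
  \<open>Ups\<close> beyond the Kepler rate, the torque that changes the total angular momentum, and
  the radial perturbing force. Each carries a factor \<open>e\<close>, which has been taken
  out.\<close>

definition Gp :: "real => real => complex \<times> real => complex" where
 "Gp e u y = cis u *
   (\<i> * ecc u y * of_real ((rad w u y)\<^sup>2 * \<Delta> e u y * (sin u)\<^sup>2 * w^2 / (Lam w y) ^ 3)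
   - (of_real (2 * Lam w y / rad w u y) - \<i> * of_real (vel w u y)) *
     of_real ((rad w u y)\<^sup>2 * (snd y)\<^sup>2 * sin u * cos u * \<Delta> e u y)
   + \<i> * of_real (Lam w y * rad w u y * (\<Xi> e u y + (lat u y)\<^sup>2 * \<Delta> e u y)))
   / of_real (Ups e u y)"

definition GS :: "real => real => complex \<times> real => real" where
 "GS e u y = - (w^2 / (Lam w y) ^ 3 * (rad w u y)\<^sup>2 * snd y * sin u * cos u * \<Delta> e u y) / Ups e u y"

lemma K_bounds:
 assumes "norm p <= e1" "\<bar>S\<bar> <= e1"
 shows "1 - e1^2 <= 1 - S^2" "0 < 1 - e1^2" "0 < 1 - S^2"
  "w <= Lam w (p, S)" "(Lam w (p, S))\<^sup>2 = w^2 / (1 - S^2)" "Lam w (p, S) > 0"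
  "norm (ecc u (p, S)) <= e1" "1 - e1 <= 1 + Re (ecc u (p, S))" "1 + Re (ecc u (p, S)) > 0"
  "(rad w u (p, S), lat u (p, S)) \<in> X" "rad w u (p, S) > 0" "w^2 / (1 + e1) <= rad w u (p, S)"
proof -
 show S: "1 - e1^2 <= 1 - S^2" using assms(2) e1 by (simp add: abs_le_square_iff[symmetric])
 show e: "0 < 1 - e1^2" using e1 by (simp add: abs_square_less_1)
 then show S0: "0 < 1 - S^2" using S by linarith
 then have s1: "sqrt (1 - S^2) <= 1" "sqrt (1 - S^2) > 0" by auto
 then show wL: "w <= Lam w (p, S)" using w by (simp add: Lam_def field_simps)
 show L2: "(Lam w (p, S))\<^sup>2 = w^2 / (1 - S^2)" using S0 by (simp add: Lam_def power_divide)
 show L: "Lam w (p, S) > 0" using wL w by linarith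
 show q: "norm (ecc u (p, S)) <= e1" using assms(1) by (simp add: ecc_def norm_mult)
 then have r: "\<bar>Re (ecc u (p, S))\<bar> <= e1" using abs_Re_le_cmod order_trans by blast
 then show r1: "1 - e1 <= 1 + Re (ecc u (p, S))" by linarith
 then show r2: "1 + Re (ecc u (p, S)) > 0" using e1 by linarith
 have "w^2 / (1 + e1) <= (Lam w (p, S))\<^sup>2 / (1 + Re (ecc u (p, S)))"
  using wL w r r2 by (intro frac_le power_mono) auto
 then show lo: "w^2 / (1 + e1) <= rad w u (p, S)" by (simp add: rad_def)
 have "(Lam w (p, S))\<^sup>2 <= w^2 / (1 - e1^2)" unfolding L2 using S e S0 w by (intro divide_left_mono) auto
 then have hi: "rad w u (p, S) <= w^2 / ((1 - e1^2) * (1 - e1))"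
  unfolding rad_def divide_divide_eq_left[symmetric] using r1 r2 e1 e w
  by (intro frac_le) auto
 have "\<bar>S * sin u\<bar> <= e1 * 1" unfolding abs_mult using assms(2) e1 by (intro mult_mono) auto
 then show "(rad w u (p, S), lat u (p, S)) \<in> X" using lo hi by (auto simp: X_def lat_def)
 have "w^2 / (1 + e1) > 0" using w e1 by simp
 then show "rad w u (p, S) > 0" using lo by linarith
qed

lemma K_iff: "y \<in> K \<longleftrightarrow> norm (fst y) <= e1 \<and> \<bar>snd y\<bar> <= e1"
 by (cases y) (auto simp: K_def)

lemmas K_facts = K_bounds[where p = "fst y" and S = "snd y" for y, unfolded prod.collapse]

text \<open>The expansions are made along a family of states \<open>(P, S)\<close> because they
  serve twice: with the coordinates themselves for Lipschitz bounds of the field, and with the flow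
  for the expansion over one turn.\<close>

context
 fixes W :: "'w set" and Y :: "'y::metric_space set" and uu :: "'w => real"
  and P :: "real => 'w => 'y => complex" and S :: "real => 'w => 'y => real"
 assumes P: "expands 1 W Y P" and S: "expands 1 W Y S"
  and PS: "\<forall>\<^sub>F e in nhds 0. \<forall>v\<in>W. \<forall>y\<in>Y. norm (P e v y) <= e1 \<and> \<bar>S e v y\<bar> <= e1"
begin

abbreviation "st e v y \<equiv> (P e v y, S e v y)"

lemma PS0: "v \<in> W ==> y \<in> Y ==> norm (P 0 v y) <= e1 \<and> \<bar>S 0 v y\<bar> <= e1"
 using eventually_nhds_x_imp_x[OF PS] by blast

lemma ex_sin: "expands 1 W Y (%_ v _. sin (uu v))" and ex_cos: "expands 1 W Y (%_ v _. cos (uu v))"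
 and ex_cis: "expands 1 W Y (%_ v _. cis (uu v))" and ex_cis': "expands 1 W Y (%_ v _. cis (- uu v))"
 by (rule expands_const_fun[where M = 1], simp)+

lemma ex_Lam: "expands 1 W Y (%e v y. Lam w (st e v y))"
proof -
 have sq: "expands 1 W Y (%e v y. sqrt (1 - (S e v y)\<^sup>2))"
 proof (rule expands_sqrt[where m = "1 - e1^2"])
  show "\<forall>\<^sub>F e in nhds 0. \<forall>v\<in>W. \<forall>y\<in>Y. 1 - e1^2 <= 1 - (S e v y)\<^sup>2"
   using PS by eventually_elim (use K_bounds(1) in blast)
  show "expands 1 W Y (%e v y. 1 - (S e v y)\<^sup>2)"
   by (intro expands_diff expands_power S expands_const)
 qed (use K_bounds(2)[of 0 0] e1 in auto)
 have "expands 1 W Y (%e v y. w / sqrt (1 - (S e v y)\<^sup>2))"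
 proof (rule expands_divide[OF expands_const sq, where m = "sqrt (1 - e1^2)"])
  show "\<forall>\<^sub>F e in nhds 0. \<forall>v\<in>W. \<forall>y\<in>Y. sqrt (1 - e1^2) <= norm (sqrt (1 - (S e v y)\<^sup>2))"
   using PS
  proof eventually_elim
   case (elim e)
   show ?case
   proof (intro ballI)
    fix v y assume "v \<in> W" "y \<in> Y"
    then have "1 - e1^2 <= 1 - (S e v y)\<^sup>2" using elim K_bounds(1) by blast
    then have "sqrt (1 - e1^2) <= sqrt (1 - (S e v y)\<^sup>2)" by simp
     then show "sqrt (1 - e1^2) <= norm (sqrt (1 - (S e v y)\<^sup>2))"
     unfolding real_norm_def by linarith
   qed
  qed
 qed (use K_bounds(2)[of 0 0] e1 in auto)
 then show ?thesis by (simp add: Lam_def)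
qed

lemma ex_ecc: "expands 1 W Y (%e v y. ecc (uu v) (st e v y))"
 by (simp only: ecc_def fst_conv) (intro expands_mult P ex_cis')

lemma ex_rad: "expands 1 W Y (%e v y. rad w (uu v) (st e v y))"
 unfolding rad_def
proof (rule expands_divide[where m = "1 - e1"])
 show "expands 1 W Y (%e v y. 1 + Re (ecc (uu v) (st e v y)))"
  by (intro expands_add expands_const expands_bounded_linear[OF bounded_linear_Re] ex_ecc)
 show "\<forall>\<^sub>F e in nhds 0. \<forall>v\<in>W. \<forall>y\<in>Y. 1 - e1 <= norm (1 + Re (ecc (uu v) (st e v y)))"
  using PS
 proof eventually_elim
  case (elim e)
  show ?case
  proof (intro ballI)
   fix v y assume "v \<in> W" "y \<in> Y"
   then have "norm (P e v y) <= e1" "\<bar>S e v y\<bar> <= e1" using elim by auto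
   from K_bounds(8)[OF this, of "uu v"] show "1 - e1 <= norm (1 + Re (ecc (uu v) (st e v y)))" by simp
  qed
 qed
qed (use e1 in \<open>simp_all add: expands_power ex_Lam del: One_nat_def\<close>)

lemma ex_lat: "expands 1 W Y (%e v y. lat (uu v) (st e v y))"
 by (simp only: lat_def snd_conv) (intro expands_mult S ex_sin)

lemma ex_inv_rad: "expands 1 W Y (%e v y. inverse (rad w (uu v) (st e v y)))"
proof (rule expands_inverse[OF _ _ ex_rad])
 show "w^2 / (1 + e1) > 0" using w e1 by simp
 show "\<forall>\<^sub>F e in nhds 0. \<forall>v\<in>W. \<forall>y\<in>Y. w\<^sup>2 / (1 + e1) <= norm (rad w (uu v) (st e v y))"
  using PS
 proof eventually_elim
  case (elim e)
  show ?case
  proof (intro ballI)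
   fix v y assume "v \<in> W" "y \<in> Y"
   then have "norm (P e v y) <= e1" "\<bar>S e v y\<bar> <= e1" using elim by auto
   from K_bounds(12)[OF this, of "uu v"] show "w^2 / (1 + e1) <= norm (rad w (uu v) (st e v y))" by simp
  qed
 qed
qed

lemma ex_inv_Lam: "expands 1 W Y (%e v y. inverse (Lam w (st e v y)))"
proof (rule expands_inverse[OF w _ ex_Lam])
 show "\<forall>\<^sub>F e in nhds 0. \<forall>v\<in>W. \<forall>y\<in>Y. w <= norm (Lam w (st e v y))"
  using PS
 proof eventually_elim
  case (elim e)
  show ?case
  proof (intro ballI)
   fix v y assume "v \<in> W" "y \<in> Y"
   then have "norm (P e v y) <= e1" "\<bar>S e v y\<bar> <= e1" using elim by auto
   from K_bounds(4)[OF this] show "w <= norm (Lam w (st e v y))" by simp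
  qed
 qed
qed

text \<open>\<open>D\<close> and \<open>E\<close> are known only through an expansion of order one
  on \<open>X\<close>. Their explicit values at \<open>e = 0\<close> are expanded along the family
  by algebra; the remainder is composed as a Lipschitz function and multiplied by
  \<open>e\<close>.\<close>

lemma ex_coefficient:
 assumes F: "expands 1 (UNIV :: unit set) X (%e _. F e)"
  and F0: "\<And>x. x \<in> X ==> F 0 x = lead (fst x) (snd x)"
  and lead: "expands 1 W Y (%e v y. lead (rad w (uu v) (st e v y)) (lat (uu v) (st e v y)))"
 shows "expands 1 W Y (%e v y. F e (rad w (uu v) (st e v y), lat (uu v) (st e v y)))"
proof -
 let ?x = "%e v y. (rad w (uu v) (st e v y), lat (uu v) (st e v y))"
 obtain g where g: "expands 0 (UNIV :: unit set) X g"
  "\<forall>\<^sub>F e in nhds 0. \<forall>w\<in>UNIV. \<forall>x\<in>X. F e x = F 0 x + e *\<^sub>R g e w x"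
  by (rule expandsE[OF F[unfolded One_nat_def]])
 have xX: "\<forall>\<^sub>F e in nhds 0. \<forall>v\<in>W. \<forall>y\<in>Y. ?x e v y \<in> X"
  using PS by eventually_elim (use K_bounds(10) in blast)
 have "ulip W Y ?x" using ulip_Pair[OF expands_ulip[OF ex_rad] expands_ulip[OF ex_lat]] by simp
 from ulip_compose[OF _ this xX, of g] g(1) have "expands 0 W Y (%e v y. g e () (?x e v y))"
  by (simp add: expands.simps(1))
 from expands_add[OF lead expands_scale[OF this, folded One_nat_def]] show ?thesis
 proof (rule expands_cong)
  show "\<forall>\<^sub>F e in nhds 0. \<forall>v\<in>W. \<forall>y\<in>Y. lead (rad w (uu v) (st e v y)) (lat (uu v) (st e v y)) +
    e *\<^sub>R g e () (?x e v y) = F e (?x e v y)"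
   using g(2) xX
  proof eventually_elim
   case (elim e)
   show ?case
   proof (intro ballI)
    fix v y assume "v \<in> W" "y \<in> Y"
    then have "?x e v y \<in> X" using elim by blast
    then show "lead (rad w (uu v) (st e v y)) (lat (uu v) (st e v y)) + e *\<^sub>R g e () (?x e v y) = F e (?x e v y)"
     using elim(1) F0[of "?x e v y"] by simp
   qed
  qed
 qed
qed

lemma ex_Delta: "expands 1 W Y (%e v y. \<Delta> e (uu v) (st e v y))"
 unfolding \<Delta>_def
proof (rule ex_coefficient[OF D, where lead = "%r z. 6 * c * inverse r ^ 5"])
 show "D 0 x = 6 * c * inverse (fst x) ^ 5" if "x \<in> X" for x
  using D0[OF that] by (simp add: divide_inverse power_inverse)
qed (intro expands_mult expands_const expands_power ex_inv_rad)

lemma ex_Xi: "expands 1 W Y (%e v y. \<Xi> e (uu v) (st e v y))"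
 unfolding \<Xi>_def
proof (rule ex_coefficient[OF E, where lead = "%r z. c * (3 - 15 * z^2) * inverse r ^ 5"])
 show "E 0 x = c * (3 - 15 * (snd x)\<^sup>2) * inverse (fst x) ^ 5" if "x \<in> X" for x
  using E0[OF that] by (simp add: divide_inverse power_inverse)
qed (intro expands_mult expands_const expands_power expands_diff ex_inv_rad ex_lat)

lemma ex_Ups: "expands 1 W Y (%e v y. Ups e (uu v) (st e v y))"
proof -
 have "expands 1 W Y (%e v y. Lam w (st e v y) * (inverse (rad w (uu v) (st e v y)))\<^sup>2
   + e * ((rad w (uu v) (st e v y))\<^sup>2 * \<Delta> e (uu v) (st e v y) * (sin (uu v))\<^sup>2 * w^2 * (inverse (Lam w (st e v y))) ^ 3))"
  by (intro expands_add expands_mult expands_power expands_param expands_const ex_Lam ex_inv_rad ex_rad ex_Delta ex_sin ex_inv_Lam)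
 then show ?thesis by (simp add: Ups_def divide_inverse power_inverse)
qed

text \<open>At \<open>e = 0\<close> the speed is \<open>Lam / rad^2\<close>, which is at least
  \<open>w\<close> over the square of the largest radius in \<open>X\<close>; half of this survives
  for small \<open>e\<close>.\<close>

lemma Ups_ge:
 assumes "w / (w^2 / ((1 - e1^2) * (1 - e1)))\<^sup>2 = 2 * m"
 shows "m > 0" "\<forall>\<^sub>F e in nhds 0. \<forall>v\<in>W. \<forall>y\<in>Y. m <= Ups e (uu v) (st e v y)"
proof -
 have e: "0 < 1 - e1^2" using K_bounds(2)[of 0 0] e1 by simp
 have "w / (w^2 / ((1 - e1^2) * (1 - e1)))\<^sup>2 > 0" using w e1 e by simp
 with assms show m: "m > 0" by simp
 have "\<forall>\<^sub>F e in nhds 0. \<forall>v\<in>W. \<forall>y\<in>Y. 2 * m / 2 <= Ups e (uu v) (st e v y)"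
 proof (rule expands_eventually_ge[of 0])
  fix v y assume "v \<in> W" "y \<in> Y"
  then have s: "norm (P 0 v y) <= e1" "\<bar>S 0 v y\<bar> <= e1" using PS0 by auto
  have "w / (w^2 / ((1 - e1^2) * (1 - e1)))\<^sup>2 <= Lam w (st 0 v y) / (rad w (uu v) (st 0 v y))\<^sup>2"
   using K_bounds(4)[OF s] K_bounds(10,11)[OF s, of "uu v"] w by (intro frac_le power_mono) (auto simp: X_def)
  then show "2 * m <= Ups 0 (uu v) (st 0 v y)" using assms by (simp add: Ups_def)
 qed (use m ex_Ups in auto)
 then show "\<forall>\<^sub>F e in nhds 0. \<forall>v\<in>W. \<forall>y\<in>Y. m <= Ups e (uu v) (st e v y)" by simp
qed

lemma ex_inv_Ups: "expands 1 W Y (%e v y. inverse (Ups e (uu v) (st e v y)))"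
proof -
 define m where "m = w / (w^2 / ((1 - e1^2) * (1 - e1)))\<^sup>2 / 2"
 have m: "w / (w^2 / ((1 - e1^2) * (1 - e1)))\<^sup>2 = 2 * m" by (simp add: m_def)
 show ?thesis
 proof (rule expands_inverse[OF _ _ ex_Ups])
  show "m > 0" by (rule Ups_ge[OF m])
  show "\<forall>\<^sub>F e in nhds 0. \<forall>v\<in>W. \<forall>y\<in>Y. m <= norm (Ups e (uu v) (st e v y))"
   using Ups_ge(2)[OF m] by eventually_elim force
 qed
qed

lemma ex_GS: "expands 1 W Y (%e v y. GS e (uu v) (st e v y))"
proof -
 have "expands 1 W Y (%e v y. - (w^2 * (inverse (Lam w (st e v y))) ^ 3 * (rad w (uu v) (st e v y))\<^sup>2 * S e v y *
   sin (uu v) * cos (uu v) * \<Delta> e (uu v) (st e v y)) * inverse (Ups e (uu v) (st e v y)))"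
  by (intro expands_minus expands_mult expands_power expands_const ex_rad ex_Delta ex_sin ex_cos ex_inv_Lam ex_inv_Ups S)
 then show ?thesis by (simp add: GS_def divide_inverse power_inverse)
qed

lemma ex_of_real: "expands 1 W Y f ==> expands 1 W Y (%e v y. complex_of_real (f e v y))"
 by (rule expands_bounded_linear[OF bounded_linear_of_real])

lemma ex_vel: "expands 1 W Y (%e v y. vel w (uu v) (st e v y))"
proof -
 have "expands 1 W Y (%e v y. - Im (ecc (uu v) (st e v y)) * inverse (Lam w (st e v y)))"
  by (intro expands_minus expands_mult expands_bounded_linear[OF bounded_linear_Im] ex_ecc ex_inv_Lam)
 then show ?thesis by (simp add: vel_def divide_inverse)
qed

lemma ex_Gp: "expands 1 W Y (%e v y. Gp e (uu v) (st e v y))"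
proof -
 have "expands 1 W Y (%e v y. cis (uu v) *
   (\<i> * ecc (uu v) (st e v y) * of_real ((rad w (uu v) (st e v y))\<^sup>2 * \<Delta> e (uu v) (st e v y) * (sin (uu v))\<^sup>2 * w^2 * (inverse (Lam w (st e v y))) ^ 3)
   - (of_real (2 * Lam w (st e v y) * inverse (rad w (uu v) (st e v y))) - \<i> * of_real (vel w (uu v) (st e v y))) *
     of_real ((rad w (uu v) (st e v y))\<^sup>2 * (S e v y)\<^sup>2 * sin (uu v) * cos (uu v) * \<Delta> e (uu v) (st e v y))
   + \<i> * of_real (Lam w (st e v y) * rad w (uu v) (st e v y) * (\<Xi> e (uu v) (st e v y) + (lat (uu v) (st e v y))\<^sup>2 * \<Delta> e (uu v) (st e v y))))
   * of_real (inverse (Ups e (uu v) (st e v y))))"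
  by (intro expands_add expands_diff expands_mult expands_power expands_const ex_of_real ex_rad ex_Lam ex_ecc ex_Delta
    ex_Xi ex_sin ex_cos ex_cis ex_inv_Lam ex_inv_rad ex_inv_Ups ex_vel ex_lat S)
 then show ?thesis by (simp add: Gp_def divide_inverse power_inverse)
qed

end
end

section \<open>Averages of the leading terms over one turn\<close>

lemma has_integral_cis_pow:
 assumes "n > 0"
 shows "((%u. cis u ^ n) has_integral 0) {0..2 * pi}" "((%u. cis (- u) ^ n) has_integral 0) {0..2 * pi}"
proof -
 have main: "((%u. cis (k * u)) has_integral 0) {0..2 * pi}" if "k = real n \<or> k = - real n" for k
 proof -
  have k: "k ~= 0" using that assms by auto
  have e: "cis (k * (2 * pi)) = 1" using that cis_multiple_2pi[of k] by (auto simp: mult.commute)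
  have "((%u. cis (k * u)) has_integral (cis (k * (2 * pi)) / (\<i> * of_real k) - cis (k * 0) / (\<i> * of_real k))) {0..2 * pi}"
  proof (rule fundamental_theorem_of_calculus)
   fix u
   have "((%u. 1 / (\<i> * of_real k) * exp (u *\<^sub>R (\<i> * of_real k))) has_vector_derivative
     1 / (\<i> * of_real k) * (exp (u *\<^sub>R (\<i> * of_real k)) * (\<i> * of_real k))) (at u within {0..2 * pi})"
    by (intro has_vector_derivative_mult_right exp_scaleR_has_vector_derivative_right)
   moreover have "exp (v *\<^sub>R (\<i> * of_real k)) = cis (k * v)" for v
    by (simp add: cis_conv_exp scaleR_conv_of_real mult.commute mult.left_commute)
   ultimately show "((%u. cis (k * u) / (\<i> * of_real k)) has_vector_derivative cis (k * u)) (at u within {0..2 * pi})"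
    using k by simp
 qed simp
  then show ?thesis using e by simp
 qed
 show "((%u. cis u ^ n) has_integral 0) {0..2 * pi}" using main[of "real n", OF disjI1[OF refl]] by (simp only: Complex.DeMoivre)
 show "((%u. cis (- u) ^ n) has_integral 0) {0..2 * pi}" using main[of "- real n", OF disjI2[OF refl]] by (simp only: Complex.DeMoivre) simp
qed

text \<open>The Fourier coefficients of the leading term of \<open>Gp\<close>, with \<open>X = cis u\<close>, \<open>Y = cis (-u)\<close>, \<open>s = S\<^sup>2\<close>.\<close>

lemma Gp_fourier:
 fixes X Y p r s :: complex
 assumes XY: "X * Y = 1"
 shows "(1 + (p * Y + r * X) / 2) * X *
  (\<i> * (p * Y) * (1 - s) * ((2 - X^2 - Y^2) / 4)
   - (2 + 3 / 2 * (p * Y) + 1 / 2 * (r * X)) * s * (- \<i> * (X^2 - Y^2) / 4)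
   + \<i> * (1 + (p * Y + r * X) / 2) * (1 / 2 - 3 / 8 * s * (2 - X^2 - Y^2)))
  = \<i> * p * (1 - 5 / 4 * s)
   + \<i> * p^2 * (s / 32 - 1 / 8) * Y ^ 3 - \<i> * p / 4 * Y ^ 2
   + \<i> * (- s / 8 - p * r / 8 + p * r * s / 16 + 3 / 8 * p^2 - 7 / 16 * p^2 * s) * Y ^ 1
   + \<i> * (1 / 2 - 3 / 4 * s + r^2 * s / 32 + p * r / 2 - 5 / 8 * p * r * s - p^2 / 8 + 13 / 32 * p^2 * s) * X ^ 1
   + \<i> * (r / 2 - 3 / 4 * r * s - p / 4 + 5 / 4 * p * s) * X ^ 2
   + \<i> * (7 / 8 * s + r^2 / 8 - 3 / 16 * r^2 * s - p * r / 8 + 9 / 16 * p * r * s) * X ^ 3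
   + \<i> * (3 / 4 * r * s) * X ^ 4 + \<i> * (5 / 32 * r^2 * s) * X ^ 5"
proof -
 have "X ~= 0" using XY by auto
 then have X: "X ~= 0" "Y = 1 / X" using XY by (simp_all add: nonzero_eq_divide_eq mult.commute)
 show ?thesis unfolding X(2) using X(1)
  by (simp add: field_simps power2_eq_square power3_eq_cube) (simp add: algebra_simps power_numeral_reduce numeral_eq_Suc)
qed

text \<open>No constant term occurs, which is why the inclination has no drift of first
  order.\<close>

lemma GS_fourier:
 fixes X Y p r :: complex
 assumes XY: "X * Y = 1"
 shows "(1 + (p * Y + r * X) / 2) * (X^2 - Y^2) = X ^ 2 - Y ^ 2 + p / 2 * X ^ 1 - p / 2 * Y ^ 3 + r / 2 * X ^ 3 - r / 2 * Y ^ 1"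
proof -
 have "X ~= 0" using XY by auto
 then have X: "X ~= 0" "Y = 1 / X" using XY by (simp_all add: nonzero_eq_divide_eq mult.commute)
 show ?thesis unfolding X(2) using X(1)
  by (simp add: field_simps power2_eq_square power3_eq_cube)
qed

lemma ecc_trig:
 shows "complex_of_real (sin u) = (cis u - cis (- u)) / (2 * \<i>)" "complex_of_real (cos u) = (cis u + cis (- u)) / 2"
  "complex_of_real (Re (p * cis (- u))) = (p * cis (- u) + cnj p * cis u) / 2"
  "\<i> * complex_of_real (Im (p * cis (- u))) = (p * cis (- u) - cnj p * cis u) / 2"
 proof -
 have "cis u - cis (- u) = 2 * \<i> * complex_of_real (sin u)" by (simp add: complex_eq_iff)
 then show "complex_of_real (sin u) = (cis u - cis (- u)) / (2 * \<i>)" by simp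
qed (auto simp: complex_eq_iff algebra_simps)

context perturbed
begin

text \<open>Dividing by \<open>Ups 0 = Lam / rad^2\<close> and inserting
  \<open>rad = Lam^2 / (1 + a)\<close> cancels every denominator except the constant
  \<open>Lam^4\<close>. With \<open>u\<close> as independent variable the averages are therefore
  those of trigonometric polynomials.\<close>

lemma leading_coefficients:
 fixes u :: real
 assumes "y \<in> K"
 defines "a \<equiv> Re (ecc u y)" and "b \<equiv> Im (ecc u y)" and "\<kappa> \<equiv> 6 * c / (Lam w y) ^ 4" and "s \<equiv> (snd y)\<^sup>2"
 shows "(rad w u y)\<^sup>2 * \<Delta> 0 u y * (sin u)\<^sup>2 * w^2 / (Lam w y) ^ 3 / Ups 0 u y = \<kappa> * (1 + a) * (1 - s) * (sin u)\<^sup>2"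
  "2 * Lam w y / rad w u y * ((rad w u y)\<^sup>2 * \<Delta> 0 u y) / Ups 0 u y = \<kappa> * (1 + a) * (2 * (1 + a))"
  "vel w u y * ((rad w u y)\<^sup>2 * \<Delta> 0 u y) / Ups 0 u y = - \<kappa> * (1 + a) * b"
  "Lam w y * rad w u y * (\<Xi> 0 u y + (lat u y)\<^sup>2 * \<Delta> 0 u y) / Ups 0 u y = \<kappa> * (1 + a) * (1 + a) * (1 / 2 - 3 / 2 * s * (sin u)\<^sup>2)"
  "w^2 / (Lam w y) ^ 3 * (rad w u y)\<^sup>2 * snd y * sin u * cos u * \<Delta> 0 u y / Ups 0 u y = \<kappa> * (1 - s) * snd y * (1 + a) * (sin u * cos u)"
proof -
 have yK: "norm (fst y) <= e1" "\<bar>snd y\<bar> <= e1" using assms(1) K_iff by auto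
 note f = K_facts[OF yK]
 define L where "L = Lam w y"
 define \<rho> where "\<rho> = rad w u y"
 have L: "L > 0" "w^2 = L^2 * (1 - s)" using f(3,5,6) by (auto simp: L_def s_def field_simps)
 have a: "1 + a > 0" using f(9)[of u] by (simp add: a_def)
 have rho: "\<rho> > 0" "\<rho> = L^2 / (1 + a)" using f(11)[of u] by (auto simp: \<rho>_def L_def a_def rad_def)
 have X: "(\<rho>, lat u y) \<in> X" using f(10) by (simp add: \<rho>_def)
 have D: "\<Delta> 0 u y = 6 * c / \<rho> ^ 5" using D0[OF X] by (simp add: \<Delta>_def \<rho>_def)
 have E: "\<Xi> 0 u y = c * (3 - 15 * (lat u y)\<^sup>2) / \<rho> ^ 5" using E0[OF X] by (simp add: \<Xi>_def \<rho>_def)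
 have U: "Ups 0 u y = L / \<rho>^2" by (simp add: Ups_def \<rho>_def L_def)
 have v: "vel w u y = - b / L" by (simp add: vel_def b_def L_def)
 have z: "(lat u y)\<^sup>2 = s * (sin u)\<^sup>2" by (simp add: lat_def s_def power_mult_distrib)
 have base: "\<rho>^2 * (6 * c / \<rho> ^ 5) / (L / \<rho>^2) = 6 * c * (1 + a) / L ^ 3"
 proof -
  have "\<rho>^2 * (6 * c / \<rho> ^ 5) / (L / \<rho>^2) = 6 * c / (L * \<rho>)"
   using rho(1) L(1) by (simp add: field_simps power2_eq_square) (simp add: numeral_eq_Suc)
  also have "\<dots> = 6 * c * (1 + a) / L ^ 3" using L(1) a by (simp add: rho(2) field_simps power2_eq_square power3_eq_cube)
  finally show ?thesis .
 qed
 have "(rad w u y)\<^sup>2 * \<Delta> 0 u y * (sin u)\<^sup>2 * w^2 / (Lam w y) ^ 3 / Ups 0 u y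
   = (\<rho>^2 * (6 * c / \<rho> ^ 5) / (L / \<rho>^2)) * ((sin u)\<^sup>2 * (L^2 * (1 - s)) / L ^ 3)"
  unfolding D U L(2) L_def[symmetric] \<rho>_def[symmetric] by (simp add: ac_simps)
 also have "\<dots> = \<kappa> * (1 + a) * (1 - s) * (sin u)\<^sup>2"
  unfolding base \<kappa>_def L_def[symmetric] using L(1) by (simp add: field_simps power2_eq_square) (simp add: numeral_eq_Suc)
 finally show "(rad w u y)\<^sup>2 * \<Delta> 0 u y * (sin u)\<^sup>2 * w^2 / (Lam w y) ^ 3 / Ups 0 u y = \<kappa> * (1 + a) * (1 - s) * (sin u)\<^sup>2" .
 have "2 * Lam w y / rad w u y * ((rad w u y)\<^sup>2 * \<Delta> 0 u y) / Ups 0 u y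
   = (\<rho>^2 * (6 * c / \<rho> ^ 5) / (L / \<rho>^2)) * (2 * L / \<rho>)"
  unfolding D U L_def[symmetric] \<rho>_def[symmetric] by simp
 also have "\<dots> = \<kappa> * (1 + a) * (2 * (1 + a))"
  unfolding base \<kappa>_def L_def[symmetric] using L(1) a by (simp add: rho(2) field_simps power2_eq_square) (simp add: numeral_eq_Suc)
 finally show "2 * Lam w y / rad w u y * ((rad w u y)\<^sup>2 * \<Delta> 0 u y) / Ups 0 u y = \<kappa> * (1 + a) * (2 * (1 + a))" .
 have "vel w u y * ((rad w u y)\<^sup>2 * \<Delta> 0 u y) / Ups 0 u y
   = (\<rho>^2 * (6 * c / \<rho> ^ 5) / (L / \<rho>^2)) * (- b / L)"
  unfolding D U v L_def[symmetric] \<rho>_def[symmetric] by (simp add: ac_simps)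
 also have "\<dots> = - \<kappa> * (1 + a) * b"
  unfolding base \<kappa>_def L_def[symmetric] using L(1) by (simp add: field_simps) (simp add: numeral_eq_Suc)
 finally show "vel w u y * ((rad w u y)\<^sup>2 * \<Delta> 0 u y) / Ups 0 u y = - \<kappa> * (1 + a) * b" .
 have "Lam w y * rad w u y * (\<Xi> 0 u y + (lat u y)\<^sup>2 * \<Delta> 0 u y) / Ups 0 u y
   = (\<rho>^2 * (6 * c / \<rho> ^ 5) / (L / \<rho>^2)) * (L / \<rho> * (1 / 2 - 3 / 2 * s * (sin u)\<^sup>2))"
  unfolding D E U L_def[symmetric] \<rho>_def[symmetric] z using rho(1) L(1)
  by (simp add: field_simps power2_eq_square)
 also have "\<dots> = \<kappa> * (1 + a) * (1 + a) * (1 / 2 - 3 / 2 * s * (sin u)\<^sup>2)"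
 proof -
  have "6 * c * (1 + a) / L ^ 3 * (L / \<rho>) = \<kappa> * (1 + a) * (1 + a)"
   unfolding \<kappa>_def L_def[symmetric] using L(1) a by (simp add: rho(2) field_simps power2_eq_square) (simp add: numeral_eq_Suc)
  then show ?thesis unfolding base by (metis mult.assoc)
 qed
 finally show "Lam w y * rad w u y * (\<Xi> 0 u y + (lat u y)\<^sup>2 * \<Delta> 0 u y) / Ups 0 u y = \<kappa> * (1 + a) * (1 + a) * (1 / 2 - 3 / 2 * s * (sin u)\<^sup>2)" .
 have "w^2 / (Lam w y) ^ 3 * (rad w u y)\<^sup>2 * snd y * sin u * cos u * \<Delta> 0 u y / Ups 0 u y
   = (\<rho>^2 * (6 * c / \<rho> ^ 5) / (L / \<rho>^2)) * ((L^2 * (1 - s)) / L ^ 3 * snd y * (sin u * cos u))"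
  unfolding D U L(2) L_def[symmetric] \<rho>_def[symmetric] by (simp add: ac_simps)
 also have "\<dots> = \<kappa> * (1 - s) * snd y * (1 + a) * (sin u * cos u)"
  unfolding base \<kappa>_def L_def[symmetric] using L(1) by (simp add: field_simps power2_eq_square) (simp add: numeral_eq_Suc)
 finally show "w^2 / (Lam w y) ^ 3 * (rad w u y)\<^sup>2 * snd y * sin u * cos u * \<Delta> 0 u y / Ups 0 u y = \<kappa> * (1 - s) * snd y * (1 + a) * (sin u * cos u)" .
qed

text \<open>The classical mean rate of the argument of perigee per radian of \<open>u\<close>, in
  units of \<open>e\<close>; the last factor vanishes at the critical inclination
  \<open>S^2 = 4/5\<close>.\<close>

definition rot :: "real => real" where
 "rot S = 6 * c / w ^ 4 * (1 - S^2)\<^sup>2 * (1 - 5 / 4 * S^2)"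

lemma average_Gp:
 assumes "y \<in> K"
 shows "((%u. Gp 0 u y) has_integral 2 * pi * \<i> * rot (snd y) * fst y) {0..2 * pi}"
proof -
 define s where "s = (snd y)\<^sup>2"
 define \<kappa> where "\<kappa> = 6 * c / (Lam w y) ^ 4"
 define p where "p = fst y"
 define X Y where "X u = cis u" and "Y u = cis (- u)" for u
 have yK: "norm (fst y) <= e1" "\<bar>snd y\<bar> <= e1" using assms(1) K_iff by auto
 have eq: "Gp 0 u y = of_real \<kappa> * (\<i> * p * (1 - 5 / 4 * s)
   + \<i> * p^2 * (s / 32 - 1 / 8) * Y u ^ 3 - \<i> * p / 4 * Y u ^ 2
   + \<i> * (- s / 8 - p * cnj p / 8 + p * cnj p * s / 16 + 3 / 8 * p^2 - 7 / 16 * p^2 * s) * Y u ^ 1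
   + \<i> * (1 / 2 - 3 / 4 * s + (cnj p)\<^sup>2 * s / 32 + p * cnj p / 2 - 5 / 8 * p * cnj p * s - p^2 / 8 + 13 / 32 * p^2 * s) * X u ^ 1
   + \<i> * (cnj p / 2 - 3 / 4 * cnj p * s - p / 4 + 5 / 4 * p * s) * X u ^ 2
   + \<i> * (7 / 8 * s + (cnj p)\<^sup>2 / 8 - 3 / 16 * (cnj p)\<^sup>2 * s - p * cnj p / 8 + 9 / 16 * p * cnj p * s) * X u ^ 3
   + \<i> * (3 / 4 * cnj p * s) * X u ^ 4 + \<i> * (5 / 32 * (cnj p)\<^sup>2 * s) * X u ^ 5)" for u
 proof -
  define a where "a = Re (ecc u y)"
  define b where "b = Im (ecc u y)"
  note lc = leading_coefficients[OF assms, of u, folded a_def b_def s_def \<kappa>_def]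
  have "Gp 0 u y = cis u *
    (\<i> * ecc u y * of_real ((rad w u y)\<^sup>2 * \<Delta> 0 u y * (sin u)\<^sup>2 * w^2 / (Lam w y) ^ 3 / Ups 0 u y)
    - (of_real (2 * Lam w y / rad w u y * ((rad w u y)\<^sup>2 * \<Delta> 0 u y) / Ups 0 u y)
     - \<i> * of_real (vel w u y * ((rad w u y)\<^sup>2 * \<Delta> 0 u y) / Ups 0 u y)) * of_real (s * (sin u * cos u))
    + \<i> * of_real (Lam w y * rad w u y * (\<Xi> 0 u y + (lat u y)\<^sup>2 * \<Delta> 0 u y) / Ups 0 u y))"
   by (simp add: Gp_def s_def divide_inverse algebra_simps)
  also have "\<dots> = of_real \<kappa> * ((1 + of_real a) * cis u *
    (\<i> * ecc u y * (1 - of_real s) * of_real (sin u) ^ 2 - (2 * (1 + of_real a) + \<i> * of_real b) * of_real s * (of_real (sin u) * of_real (cos u))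
    + \<i> * (1 + of_real a) * (1 / 2 - 3 / 2 * of_real s * of_real (sin u) ^ 2)))"
   unfolding lc by (simp add: field_simps)
  also have "ecc u y = p * Y u" by (simp add: ecc_def p_def Y_def)
  also have "cis u = X u" by (simp add: X_def)
  also have "complex_of_real a = (p * Y u + cnj p * X u) / 2"
   unfolding a_def ecc_def p_def X_def Y_def by (rule ecc_trig(3))
  also have "\<i> * complex_of_real b = (p * Y u - cnj p * X u) / 2"
   unfolding b_def ecc_def p_def X_def Y_def by (rule ecc_trig(4))
  also have "complex_of_real (sin u) = (X u - Y u) / (2 * \<i>)" by (simp add: ecc_trig X_def Y_def)
  also have "complex_of_real (cos u) = (X u + Y u) / 2" by (simp add: ecc_trig X_def Y_def)
  also have "((X u - Y u) / (2 * \<i>))\<^sup>2 = (2 - (X u)\<^sup>2 - (Y u)\<^sup>2) / 4"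
  proof -
   have "X u * Y u = 1" by (simp add: X_def Y_def cis_mult)
   then have "(X u - Y u)\<^sup>2 = (X u)\<^sup>2 + (Y u)\<^sup>2 - 2" by (simp add: power2_diff)
   then show ?thesis by (simp add: power_divide power_mult_distrib field_simps)
  qed
  also have "(X u - Y u) / (2 * \<i>) * ((X u + Y u) / 2) = - \<i> * ((X u)\<^sup>2 - (Y u)\<^sup>2) / 4"
   by (simp add: field_simps power2_eq_square)
  also have "2 * (1 + (p * Y u + cnj p * X u) / 2) + (p * Y u - cnj p * X u) / 2 = 2 + 3 / 2 * (p * Y u) + 1 / 2 * (cnj p * X u)"
   by (simp add: field_simps)
  also have "1 / 2 - 3 / 2 * complex_of_real s * ((2 - (X u)\<^sup>2 - (Y u)\<^sup>2) / 4) = 1 / 2 - 3 / 8 * of_real s * (2 - (X u)\<^sup>2 - (Y u)\<^sup>2)"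
   by (simp add: field_simps)
  finally show ?thesis
   using Gp_fourier[of "X u" "Y u" p "cnj p" "of_real s"] by (simp add: X_def Y_def cis_mult)
 qed
 \<comment> \<open>The zeros are the integrals of the harmonics; only the constant Fourier
   coefficient contributes.\<close>
 have "((%u. Gp 0 u y) has_integral of_real \<kappa> * (measure lborel {0..2 * pi} *\<^sub>R (\<i> * p * (1 - 5 / 4 * s))
   + \<i> * p^2 * (s / 32 - 1 / 8) * 0 - \<i> * p / 4 * 0
   + \<i> * (- s / 8 - p * cnj p / 8 + p * cnj p * s / 16 + 3 / 8 * p^2 - 7 / 16 * p^2 * s) * 0
   + \<i> * (1 / 2 - 3 / 4 * s + (cnj p)\<^sup>2 * s / 32 + p * cnj p / 2 - 5 / 8 * p * cnj p * s - p^2 / 8 + 13 / 32 * p^2 * s) * 0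
   + \<i> * (cnj p / 2 - 3 / 4 * cnj p * s - p / 4 + 5 / 4 * p * s) * 0
   + \<i> * (7 / 8 * s + (cnj p)\<^sup>2 / 8 - 3 / 16 * (cnj p)\<^sup>2 * s - p * cnj p / 8 + 9 / 16 * p * cnj p * s) * 0
   + \<i> * (3 / 4 * cnj p * s) * 0 + \<i> * (5 / 32 * (cnj p)\<^sup>2 * s) * 0)) {0..2 * pi}"
  unfolding eq X_def Y_def
  by (intro has_integral_mult_right has_integral_add has_integral_diff has_integral_cis_pow has_integral_const_real) auto
 then have "((%u. Gp 0 u y) has_integral 2 * pi * \<i> * of_real (\<kappa> * (1 - 5 / 4 * s)) * p) {0..2 * pi}"
  by (simp add: scaleR_conv_of_real algebra_simps)
 moreover have "\<kappa> = 6 * c / w ^ 4 * (1 - s)\<^sup>2"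
 proof -
  have "(Lam w y) ^ 4 = ((Lam w y)\<^sup>2)\<^sup>2" by simp
  also have "\<dots> = (w^2 / (1 - s))\<^sup>2" using K_facts(5)[OF yK] by (simp add: s_def)
  finally show ?thesis by (simp add: \<kappa>_def power_divide)
 qed
 then have "\<kappa> * (1 - 5 / 4 * s) = rot (snd y)" by (simp add: rot_def s_def)
 ultimately show ?thesis by (simp only: p_def)
qed

lemma average_GS:
 assumes "y \<in> K"
 shows "((%u. GS 0 u y) has_integral 0) {0..2 * pi}"
proof -
 define s where "s = (snd y)\<^sup>2"
 define \<kappa> where "\<kappa> = 6 * c / (Lam w y) ^ 4"
 define m where "m = \<kappa> * (1 - s) * snd y"
 define p where "p = fst y"
 define X Y where "X u = cis u" and "Y u = cis (- u)" for u
 have eq: "complex_of_real (GS 0 u y) = (\<i> * of_real m / 4) * (X u ^ 2 - Y u ^ 2 + p / 2 * X u ^ 1 - p / 2 * Y u ^ 3 + cnj p / 2 * X u ^ 3 - cnj p / 2 * Y u ^ 1)" for u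
 proof -
  define a where "a = Re (ecc u y)"
  note lc = leading_coefficients(5)[OF assms, of u, folded a_def s_def \<kappa>_def]
  have "GS 0 u y = - (m * (1 + a) * (sin u * cos u))" proof -
   have "GS 0 u y = - (w^2 / (Lam w y) ^ 3 * (rad w u y)\<^sup>2 * snd y * sin u * cos u * \<Delta> 0 u y / Ups 0 u y)"
    by (simp add: GS_def)
   then show ?thesis unfolding lc m_def .
  qed
  also have "complex_of_real \<dots> = - (of_real m * (1 + of_real a) * (of_real (sin u) * of_real (cos u)))" by simp
  also have "complex_of_real a = (p * Y u + cnj p * X u) / 2"
   unfolding a_def ecc_def p_def X_def Y_def by (rule ecc_trig(3))
  also have "complex_of_real (sin u) = (X u - Y u) / (2 * \<i>)" by (simp add: ecc_trig X_def Y_def)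
  also have "complex_of_real (cos u) = (X u + Y u) / 2" by (simp add: ecc_trig X_def Y_def)
  also have "(X u - Y u) / (2 * \<i>) * ((X u + Y u) / 2) = - \<i> * ((X u)\<^sup>2 - (Y u)\<^sup>2) / 4"
   by (simp add: field_simps power2_eq_square)
  also have "- (of_real m * (1 + (p * Y u + cnj p * X u) / 2) * (- \<i> * ((X u)\<^sup>2 - (Y u)\<^sup>2) / 4))
    = (\<i> * of_real m / 4) * ((1 + (p * Y u + cnj p * X u) / 2) * ((X u)\<^sup>2 - (Y u)\<^sup>2))" by simp
  finally show ?thesis using GS_fourier[of "X u" "Y u" p "cnj p"] by (simp add: X_def Y_def cis_mult)
 qed
 have "((%u. complex_of_real (GS 0 u y)) has_integral
   (\<i> * of_real m / 4) * (0 - 0 + p / 2 * 0 - p / 2 * 0 + cnj p / 2 * 0 - cnj p / 2 * 0)) {0..2 * pi}"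
  unfolding eq X_def Y_def
  by (intro has_integral_mult_right has_integral_add has_integral_diff has_integral_cis_pow) auto
 from has_integral_linear[OF this bounded_linear_Re] show ?thesis by (simp add: o_def)
qed

end

section \<open>The flow of the elements and its expansion over one turn\<close>

context perturbed
begin

definition G :: "real => real => complex \<times> real => complex \<times> real" where
 "G e u y = (Gp e u y, GS e u y)"

lemma K_convex_compact: "convex K" "compact K" "closed K" "K ~= {}" "0 \<in> K"
proof -
 show "convex K" unfolding K_def by (intro convex_Times) auto
 show "compact K" unfolding K_def by (intro compact_Times) auto
 then show "closed K" by (rule compact_imp_closed)
 show "0 \<in> K" using e1 by (simp add: K_iff)
 then show "K ~= {}" by auto
qed

lemma norm_fst_snd: "norm (fst z) <= norm z" "norm (snd z) <= norm z"
 using norm_fst_le[of "fst z" "snd z"] norm_snd_le[of "snd z" "fst z"] by (simp_all del: norm_fst_le norm_snd_le)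

lemma ulip_components: "ulip W K (%_ _ y. fst y)" "ulip W K (%_ _ y. snd y)"
proof -
 have d: "norm (fst y - fst y') <= 1 * dist y y'" "norm (snd y - snd y') <= 1 * dist y y'" for y y' :: "complex \<times> real"
  using norm_fst_snd[of "y - y'"] by (simp_all add: dist_norm)
 have n: "norm (fst y) <= 1" "norm (snd y) <= 1" if "y \<in> K" for y
  using that e1 by (simp_all add: K_iff)
 show "ulip W K (%_ _ y. fst y)" "ulip W K (%_ _ y. snd y)"
  unfolding ulip_def by (intro exI[of _ 1] always_eventually allI ballI conjI n d; assumption)+
qed

lemma ex_G:
 assumes "expands 1 W Y P" "expands 1 W Y S"
  "\<forall>\<^sub>F e in nhds 0. \<forall>v\<in>W. \<forall>y\<in>Y. norm (P e v y) <= e1 \<and> \<bar>S e v y\<bar> <= e1"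
 shows "expands 1 W Y (%e v y. G e (uu v) (P e v y, S e v y))"
proof -
 have "bounded_linear (%x::complex. (x, 0::real))" "bounded_linear (%x::real. (0::complex, x))"
  by (auto intro!: bounded_linear_Pair bounded_linear_zero bounded_linear_ident)
 from expands_add[OF expands_bounded_linear[OF this(1) ex_Gp[OF assms]] expands_bounded_linear[OF this(2) ex_GS[OF assms]]]
 show ?thesis by (simp add: G_def)
qed

lemma G_lipschitz:
 obtains C where "C > 0" "\<forall>\<^sub>F e in nhds 0. \<forall>u. \<forall>y\<in>K. norm (G e u y) <= C \<and> (\<forall>y'\<in>K. norm (G e u y - G e u y') <= C * norm (y - y'))"
proof -
 have "expands 1 (UNIV :: real set) K (%e u y. G e u (fst y, snd y))"
  by (rule ex_G) (use ulip_components in \<open>auto intro!: ulip_imp_expands_const always_eventually simp: K_iff\<close>)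
 from ulipE[OF expands_ulip[OF this]] obtain C where "C > 0"
  "\<forall>\<^sub>F e in nhds 0. \<forall>u\<in>UNIV. \<forall>y\<in>K. norm (G e u (fst y, snd y)) <= C \<and> (\<forall>y'\<in>K. norm (G e u (fst y, snd y) - G e u (fst y', snd y')) <= C * dist y y')"
  by blast
 then show thesis by (intro that[of C]) (auto simp: dist_norm)
qed

lemma Ups_pos: "\<forall>\<^sub>F e in nhds 0. \<forall>u. \<forall>y\<in>K. w / (w^2 / ((1 - e1^2) * (1 - e1)))\<^sup>2 / 2 <= Ups e u y"
proof -
 have "expands 1 (UNIV :: real set) K (%_ _ y. fst y)" "expands 1 (UNIV :: real set) K (%_ _ y. snd y)"
  "\<forall>\<^sub>F e in nhds (0::real). \<forall>v\<in>(UNIV :: real set). \<forall>y\<in>K. norm (fst y) <= e1 \<and> \<bar>snd y\<bar> <= e1"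
  using ulip_components by (auto intro!: ulip_imp_expands_const always_eventually simp: K_iff)
 from Ups_ge(2)[OF this, where uu = "%u. u" and m = "w / (w^2 / ((1 - e1^2) * (1 - e1)))\<^sup>2 / 2"]
 show ?thesis by simp
qed

lemma lipschitz_family_continuous:
 assumes "ulip (UNIV :: unit set) X (%e _. (F e :: real \<times> real => real))"
 shows "\<forall>\<^sub>F e in nhds 0. continuous_on X (F e)"
proof -
 obtain C where C: "C > 0" "\<forall>\<^sub>F e in nhds 0. \<forall>w\<in>(UNIV :: unit set). \<forall>y\<in>X. norm (F e y) <= C \<and> (\<forall>y'\<in>X. norm (F e y - F e y') <= C * dist y y')"
  using ulipE[OF assms] .
 from C(2) show ?thesis
 proof eventually_elim
  case (elim e)
  have "C-lipschitz_on X (F e)" by (rule lipschitz_onI) (use elim C(1) in \<open>auto simp: dist_norm\<close>)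
  then show ?case by (rule lipschitz_on_continuous_on)
 qed
qed

lemma G_continuous: "\<forall>\<^sub>F e in nhds 0. continuous_on (UNIV \<times> K) (%(u, y). G e u y) \<and> continuous_on (UNIV \<times> K) (%(u, y). Ups e u y)"
 using lipschitz_family_continuous[OF expands_ulip[OF D]] lipschitz_family_continuous[OF expands_ulip[OF E]] Ups_pos
proof eventually_elim
 case (elim e)
 let ?N = "UNIV \<times> K :: (real \<times> complex \<times> real) set"
 have "w / (w^2 / ((1 - e1^2) * (1 - e1)))\<^sup>2 / 2 > 0" using K_bounds(2)[of 0 0] e1 w by simp
 then have U: "Ups e u y ~= 0" if "y \<in> K" for u y using elim(3) that by (smt (verit))
 have k: "1 - (snd y)\<^sup>2 > 0" "Lam w y > 0" "1 + Re (ecc u y) > 0" "rad w u y > 0" "(rad w u y, lat u y) \<in> X" if "y \<in> K" for u y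
  using K_facts(3,6,9,10,11)[of y] that K_iff by auto
 have nz: "\<forall>z\<in>?N. sqrt (1 - (snd (snd z))\<^sup>2) ~= 0" "\<forall>z\<in>?N. Lam w (snd z) ~= 0" "\<forall>z\<in>?N. (Lam w (snd z)) ^ 3 ~= 0"
  "\<forall>z\<in>?N. 1 + Re (ecc (fst z) (snd z)) ~= 0" "\<forall>z\<in>?N. rad w (fst z) (snd z) ~= 0" "\<forall>z\<in>?N. (rad w (fst z) (snd z))\<^sup>2 ~= 0"
  "\<forall>z\<in>?N. Ups e (fst z) (snd z) ~= 0" "\<forall>z\<in>?N. complex_of_real (Ups e (fst z) (snd z)) ~= 0"
  "(%z. (rad w (fst z) (snd z), lat (fst z) (snd z))) ` ?N \<subseteq> X"
  using k U by (simp_all add: mem_Times_iff less_imp_neq[THEN not_sym] image_subset_iff)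
 have cL: "continuous_on ?N (%z. Lam w (snd z))" unfolding Lam_def
  by (intro continuous_intros nz)
 have cq: "continuous_on ?N (%z. ecc (fst z) (snd z))" unfolding ecc_def
  by (intro continuous_intros)
 have cr: "continuous_on ?N (%z. rad w (fst z) (snd z))" unfolding rad_def
  by (intro continuous_intros cL cq nz)
 have cl: "continuous_on ?N (%z. lat (fst z) (snd z))" unfolding lat_def by (intro continuous_intros)
 have cv: "continuous_on ?N (%z. vel w (fst z) (snd z))" unfolding vel_def
  by (intro continuous_intros cL cq nz)
 have cD: "continuous_on ?N (%z. \<Delta> e (fst z) (snd z))" unfolding \<Delta>_def
  by (rule continuous_on_compose2[OF elim(1) _ nz(9)]) (intro continuous_intros cr cl)
 have cE: "continuous_on ?N (%z. \<Xi> e (fst z) (snd z))" unfolding \<Xi>_def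
  by (rule continuous_on_compose2[OF elim(2) _ nz(9)]) (intro continuous_intros cr cl)
 have cU: "continuous_on ?N (%z. Ups e (fst z) (snd z))" unfolding Ups_def
  by (intro continuous_intros cL cr cD nz)
 have "continuous_on ?N (%z. G e (fst z) (snd z))" unfolding G_def Gp_def GS_def
  by (intro continuous_intros cL cr cD cE cU cl cv cq nz)
 then show ?case using cU by (simp add: case_prod_unfold)
qed

text \<open>The field is controlled on \<open>K\<close> only. Composing it with the nearest-point
  map of the convex set \<open>K\<close>, which is 1-Lipschitz, makes it bounded and Lipschitz
  everywhere. Energy conservation shows later that orbits of energy \<open>h\<close> starting in
  \<open>K\<close> never feel the projection.\<close>

definition flow :: "real => complex \<times> real => real => complex \<times> real" where
 "flow e y0 = (SOME y. y 0 = y0 \<and> (\<forall>u. (y has_vector_derivative e *\<^sub>R G e u (closest_point K (y u))) (at u)))"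

text \<open>By the last estimate the displacement, and not only the position, is Lipschitz in the
  initial state with a constant \<open>O(e)\<close> on bounded ranges of \<open>u\<close>. Dividing
  the displacement by \<open>e\<close> thus still leaves a Lipschitz family.\<close>

lemma flow_estimates:
 obtains C where "C > 0" "\<forall>\<^sub>F e in nhds 0.
  (\<forall>y. flow e y 0 = y) \<and> (\<forall>y u. (flow e y has_vector_derivative e *\<^sub>R G e u (closest_point K (flow e y u))) (at u)) \<and>
  (\<forall>y u. norm (flow e y u - y) <= C * \<bar>e\<bar> * \<bar>u\<bar>) \<and>
  (\<forall>y y' u. norm ((flow e y u - y) - (flow e y' u - y')) <= norm (y - y') * (exp (C * \<bar>e\<bar> * \<bar>u\<bar>) - 1))"
proof -
 obtain C where C: "C > 0" "\<forall>\<^sub>F e in nhds 0. \<forall>u. \<forall>y\<in>K. norm (G e u y) <= C \<and> (\<forall>y'\<in>K. norm (G e u y - G e u y') <= C * norm (y - y'))"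
  using G_lipschitz .
 have "\<forall>\<^sub>F e in nhds 0.
  (\<forall>y. flow e y 0 = y) \<and> (\<forall>y u. (flow e y has_vector_derivative e *\<^sub>R G e u (closest_point K (flow e y u))) (at u)) \<and>
  (\<forall>y u. norm (flow e y u - y) <= C * \<bar>e\<bar> * \<bar>u\<bar>) \<and>
  (\<forall>y y' u. norm ((flow e y u - y) - (flow e y' u - y')) <= norm (y - y') * (exp (C * \<bar>e\<bar> * \<bar>u\<bar>) - 1))"
  using C(2) G_continuous
 proof eventually_elim
  case (elim e)
  let ?c = "closest_point K"
  have cK: "?c y \<in> K" for y using K_convex_compact by (intro closest_point_in_set)
  have cl: "norm (?c y - ?c y') <= norm (y - y')" for y y'
   using closest_point_lipschitz[OF K_convex_compact(1,3,4), of y y'] by (simp add: dist_norm)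
  have cc: "continuous_on UNIV ?c"
   using K_convex_compact by (intro continuous_on_closest_point)
  have cont: "continuous_on UNIV (%(u, y). e *\<^sub>R G e u (?c y))"
  proof -
   have "continuous_on UNIV (%z::real \<times> complex \<times> real. (fst z, ?c (snd z)))"
    by (intro continuous_intros continuous_on_compose2[OF cc]) auto
   from continuous_on_compose2[OF conjunct1[OF elim(2)] this] cK
   have "continuous_on UNIV (%z::real \<times> complex \<times> real. G e (fst z) (?c (snd z)))"
    by (simp add: image_subset_iff)
   then show ?thesis by (auto simp: case_prod_unfold intro!: continuous_intros)
  qed
  have bnd: "norm (e *\<^sub>R G e u (?c y)) <= \<bar>e\<bar> * C" for u y
   using elim(1) cK[of y] by (auto intro!: mult_left_mono)
  have lip: "norm (e *\<^sub>R G e u (?c y) - e *\<^sub>R G e u (?c y')) <= \<bar>e\<bar> * C * norm (y - y')" for u y y'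
  proof -
   have "norm (G e u (?c y) - G e u (?c y')) <= C * norm (?c y - ?c y')" using elim(1) cK by blast
   also have "\<dots> <= C * norm (y - y')" using C(1) cl by simp
   finally have "\<bar>e\<bar> * norm (G e u (?c y) - G e u (?c y')) <= \<bar>e\<bar> * (C * norm (y - y'))" by (intro mult_left_mono) auto
   then show ?thesis by (simp add: scaleR_diff_right[symmetric] mult.assoc)
  qed
  have "\<exists>y. y 0 = y0 \<and> (\<forall>u. (y has_vector_derivative e *\<^sub>R G e u (?c (y u))) (at u))" for y0
   using global_solution_exists[OF cont bnd lip, of y0] by metis
  then have fl: "flow e y0 0 = y0 \<and> (\<forall>u. (flow e y0 has_vector_derivative e *\<^sub>R G e u (?c (flow e y0 u))) (at u))" for y0
   unfolding flow_def by (rule someI_ex)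
  have near: "norm (flow e y u - y) <= C * \<bar>e\<bar> * \<bar>u\<bar>" for y u
  proof -
   have "norm (flow e y u - flow e y 0) <= \<bar>e\<bar> * C * norm (u - 0)"
   proof (rule differentiable_bound[of UNIV])
    show "(flow e y has_derivative (%h. h *\<^sub>R (e *\<^sub>R G e v (?c (flow e y v))))) (at v within UNIV)" for v
     using fl by (auto simp: has_vector_derivative_def)
    show "onorm (%h. h *\<^sub>R (e *\<^sub>R G e v (?c (flow e y v)))) <= \<bar>e\<bar> * C" for v
    proof (rule onorm_le)
     fix x :: real
     show "norm (x *\<^sub>R (e *\<^sub>R G e v (?c (flow e y v)))) <= \<bar>e\<bar> * C * norm x"
     using mult_left_mono[OF bnd[of v "flow e y v"], of "norm x"] by (simp add: abs_mult mult_ac)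
    qed
   qed auto
   then show ?thesis using fl by (simp add: mult_ac)
  qed
  have diff: "norm (flow e y u - flow e y' u) <= exp (\<bar>e\<bar> * C * \<bar>u - 0\<bar>) * norm (flow e y 0 - flow e y' 0)" for y y' u
   by (rule norm_growth[where z' = "%u. e *\<^sub>R G e u (?c (flow e y u)) - e *\<^sub>R G e u (?c (flow e y' u))"])
    (intro has_vector_derivative_diff conjunct2[OF fl, rule_format] lip)+
  have "norm ((flow e y u - y) - (flow e y' u - y')) <= norm (y - y') * (exp (C * \<bar>e\<bar> * \<bar>u\<bar>) - 1)" for y y' u
  proof (cases "e = 0")
   case True
   then show ?thesis using near[of y u] near[of y' u] by simp
  next
   case False
   have "norm ((flow e y u - flow e y' u) - (flow e y 0 - flow e y' 0)) <= (\<bar>e\<bar> * C * norm (y - y')) / (\<bar>e\<bar> * C) * (exp (\<bar>e\<bar> * C * \<bar>u\<bar>) - 1)"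
   proof (rule norm_diff_le_exp)
    fix v
    show "((%u. flow e y u - flow e y' u) has_vector_derivative (e *\<^sub>R G e v (?c (flow e y v)) - e *\<^sub>R G e v (?c (flow e y' v)))) (at v)"
     using fl by (intro has_vector_derivative_diff) auto
    have "norm (e *\<^sub>R G e v (?c (flow e y v)) - e *\<^sub>R G e v (?c (flow e y' v))) <= \<bar>e\<bar> * C * norm (flow e y v - flow e y' v)" by (rule lip)
    also have "\<dots> <= \<bar>e\<bar> * C * (exp (\<bar>e\<bar> * C * \<bar>v\<bar>) * norm (y - y'))"
     using diff[of y v y'] fl C(1) by (intro mult_left_mono) auto
    finally show "norm (e *\<^sub>R G e v (?c (flow e y v)) - e *\<^sub>R G e v (?c (flow e y' v))) <= \<bar>e\<bar> * C * norm (y - y') * exp (\<bar>e\<bar> * C * \<bar>v\<bar>)"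
     by (simp add: mult_ac)
   qed (use C(1) False in auto)
   also have "(\<bar>e\<bar> * C * norm (y - y')) / (\<bar>e\<bar> * C) = norm (y - y')" using False C(1) by simp
   finally show ?thesis using fl by (simp add: algebra_simps)
  qed
  then show ?case using fl near by blast
 qed
 then show thesis using that[of C] C(1) by blast
qed

lemma exp_minus_one_le: "(x::real) \<ge> 0 ==> exp x - 1 <= x * exp x"
 using exp_ge_add_one_self[of "- x"] by (simp add: exp_minus field_simps)

text \<open>
 One turn of the flow to second order. The remainder is Lipschitz with a constant of order
 \<open>e\<^sup>2\<close>, so the rotation of one orbit about a nearby one is controlled uniformly.
\<close>

theorem turn_expansion:
 assumes "0 < e2" "e2 < e1"
 obtains C where "C > 0" "\<forall>\<^sub>F e in nhds 0. \<forall>y\<in>cball 0 e2 \<times> {- e2..e2}. \<forall>y'\<in>cball 0 e2 \<times> {- e2..e2}.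
   norm ((flow e y (2 * pi) - y - (e * (2 * pi * rot (snd y))) *\<^sub>R (\<i> * fst y, 0))
    - (flow e y' (2 * pi) - y' - (e * (2 * pi * rot (snd y'))) *\<^sub>R (\<i> * fst y', 0))) <= C * e^2 * norm (y - y')"
proof -
 define Y where "Y = cball (0::complex) e2 \<times> {- e2..e2}"
 have YK: "Y \<subseteq> K" using assms by (auto simp: Y_def K_def)
 let ?W = "{0..2 * pi}"
 obtain B where B: "B > 0" "\<forall>\<^sub>F e in nhds 0.
  (\<forall>y. flow e y 0 = y) \<and> (\<forall>y u. (flow e y has_vector_derivative e *\<^sub>R G e u (closest_point K (flow e y u))) (at u)) \<and>
  (\<forall>y u. norm (flow e y u - y) <= B * \<bar>e\<bar> * \<bar>u\<bar>) \<and>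
  (\<forall>y y' u. norm ((flow e y u - y) - (flow e y' u - y')) <= norm (y - y') * (exp (B * \<bar>e\<bar> * \<bar>u\<bar>) - 1))"
  using flow_estimates .
 \<comment> \<open>The displacement divided by \<open>e\<close>. The value at \<open>e = 0\<close>
   is a convention; \<eta> enters multiplied by \<open>e\<close>.\<close>
 define \<eta> where "\<eta> e u y = (if e = 0 then 0 else (1 / e) *\<^sub>R (flow e y u - y))" for e u y
 define M where "M = max (B * (2 * pi)) (B * (2 * pi) * exp (B * (2 * pi)))"
 \<comment> \<open>The displacement during one turn, at most \<open>B |e| 2 pi\<close>, has to fit
   between \<open>e2\<close> and \<open>e1\<close>; the bound \<open>1\<close> keeps the exponential
   in \<open>M\<close> uniform.\<close>
 have small: "\<forall>\<^sub>F e in nhds (0::real). \<bar>e\<bar> < min 1 ((e1 - e2) / (B * (2 * pi)))"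
  using assms B(1) by (auto simp: eventually_nhds_metric intro!: exI[of _ "min 1 ((e1 - e2) / (B * (2 * pi)))"])
 have eta: "ulip ?W Y \<eta>" unfolding ulip_def
 proof (intro exI[of _ M])
  show "\<forall>\<^sub>F e in nhds 0. \<forall>u\<in>?W. \<forall>y\<in>Y. norm (\<eta> e u y) <= M \<and> (\<forall>y'\<in>Y. norm (\<eta> e u y - \<eta> e u y') <= M * dist y y')"
   using B(2) small
  proof eventually_elim
   case (elim e)
   have near: "norm (flow e y u - y) <= B * \<bar>e\<bar> * \<bar>u\<bar>" for y u using elim(1) by blast
   have lip: "norm ((flow e y u - y) - (flow e y' u - y')) <= norm (y - y') * (exp (B * \<bar>e\<bar> * \<bar>u\<bar>) - 1)" for y y' u
    using elim(1) by blast
   have M0: "M \<ge> 0" using B(1) by (simp add: M_def le_max_iff_disj)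
   show ?case
   proof (cases "e = 0")
    case False
    show ?thesis
    proof (intro ballI conjI)
     fix u y assume u: "u \<in> ?W"
     have uB: "B * \<bar>u\<bar> <= B * (2 * pi)" using u B(1) by (intro mult_left_mono) auto
     have "norm (\<eta> e u y) = norm (flow e y u - y) / \<bar>e\<bar>" using False by (simp add: \<eta>_def)
     also have "\<dots> <= (B * \<bar>e\<bar> * \<bar>u\<bar>) / \<bar>e\<bar>" by (intro divide_right_mono near) auto
     also have "\<dots> = B * \<bar>u\<bar>" using False by simp
     also have "\<dots> <= M" using uB by (simp add: M_def)
     finally show "norm (\<eta> e u y) <= M" .
     fix y'
     have "\<eta> e u y - \<eta> e u y' = (1 / e) *\<^sub>R ((flow e y u - y) - (flow e y' u - y'))"
     using False by (simp add: \<eta>_def scaleR_diff_right)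
     then have "norm (\<eta> e u y - \<eta> e u y') = norm ((flow e y u - y) - (flow e y' u - y')) / \<bar>e\<bar>" by simp
     also have "\<dots> <= norm (y - y') * (exp (B * \<bar>e\<bar> * \<bar>u\<bar>) - 1) / \<bar>e\<bar>"
     by (intro divide_right_mono lip) auto
     also have "\<dots> <= norm (y - y') * ((B * \<bar>e\<bar> * \<bar>u\<bar>) * exp (B * \<bar>e\<bar> * \<bar>u\<bar>)) / \<bar>e\<bar>"
     using B(1) by (intro divide_right_mono mult_left_mono exp_minus_one_le) auto
     also have "\<dots> = norm (y - y') * (B * \<bar>u\<bar> * exp (\<bar>e\<bar> * (B * \<bar>u\<bar>)))" using False by (simp add: mult_ac)
     also have "\<dots> <= norm (y - y') * (B * (2 * pi) * exp (1 * (B * (2 * pi))))"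
     using uB B(1) elim(2) by (intro mult_left_mono mult_mono iffD2[OF exp_le_cancel_iff]) auto
     also have "\<dots> <= norm (y - y') * M" by (intro mult_left_mono) (auto simp: M_def)
     finally show "norm (\<eta> e u y - \<eta> e u y') <= M * dist y y'" by (simp add: dist_norm mult.commute)
    qed
   qed (use M0 in \<open>auto simp: \<eta>_def\<close>)
  qed
 qed
 have fl0: "flow 0 y u = y" for y u
 proof -
  have "norm (flow 0 y u - y) <= B * \<bar>0\<bar> * \<bar>u\<bar>" using eventually_nhds_x_imp_x[OF B(2)] by blast
  then show ?thesis by simp
 qed
 have fleq: "flow e y u = y + e *\<^sub>R \<eta> e u y" for e y u by (cases "e = 0") (auto simp: \<eta>_def fl0)
 have sub: "ulip W Y f" if "ulip W K f" for W :: "real set" and f :: "real => real => complex \<times> real => 'z::real_normed_vector"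
 proof -
  from that obtain C where "\<forall>\<^sub>F e in nhds 0. \<forall>w\<in>W. \<forall>y\<in>K. norm (f e w y) <= C \<and> (\<forall>y'\<in>K. norm (f e w y - f e w y') <= C * dist y y')"
   unfolding ulip_def by blast
  then have "\<forall>\<^sub>F e in nhds 0. \<forall>w\<in>W. \<forall>y\<in>Y. norm (f e w y) <= C \<and> (\<forall>y'\<in>Y. norm (f e w y - f e w y') <= C * dist y y')"
   by eventually_elim (use YK in blast)
  then show ?thesis unfolding ulip_def by blast
 qed
 have e0: "expands 0 ?W Y f" if "ulip ?W Y f" for f :: "real => real => complex \<times> real => 'z::real_normed_vector"
  using that by (simp add: expands.simps)
 have P: "expands 1 ?W Y (%e u y. fst (flow e y u))"
  unfolding One_nat_def
  by (rule expands_step[where g = "%e u y. fst (\<eta> e u y)"])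
   (use sub[OF ulip_components(1)] in \<open>auto simp: fl0 fleq intro!: e0 ulip_bounded_linear[OF bounded_linear_fst eta]\<close>)
 have S: "expands 1 ?W Y (%e u y. snd (flow e y u))"
  unfolding One_nat_def
  by (rule expands_step[where g = "%e u y. snd (\<eta> e u y)"])
   (use sub[OF ulip_components(2)] in \<open>auto simp: fl0 fleq intro!: e0 ulip_bounded_linear[OF bounded_linear_snd eta]\<close>)
 have stay: "\<forall>\<^sub>F e in nhds 0. \<forall>u\<in>?W. \<forall>y\<in>Y. norm (fst (flow e y u)) <= e1 \<and> \<bar>snd (flow e y u)\<bar> <= e1"
  using B(2) small
 proof eventually_elim
  case (elim e)
  show ?case
  proof (intro ballI)
   fix u y assume u: "u \<in> ?W" and y: "y \<in> Y"
   have "norm (flow e y u - y) <= B * \<bar>e\<bar> * \<bar>u\<bar>" using elim by blast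
   also have "\<dots> <= B * ((e1 - e2) / (B * (2 * pi))) * (2 * pi)"
    using u B(1) elim(2) assms by (intro mult_mono) auto
   also have "\<dots> = e1 - e2" using B(1) by simp
   finally have d: "norm (flow e y u - y) <= e1 - e2" .
   have "norm (fst (flow e y u) - fst y) <= e1 - e2" "norm (snd (flow e y u) - snd y) <= e1 - e2"
    using norm_fst_snd[of "flow e y u - y"] d by simp_all
   moreover have "norm (fst y) <= e2" "\<bar>snd y\<bar> <= e2" using y by (auto simp: Y_def)
   moreover have "norm (fst (flow e y u)) <= norm (fst y) + norm (fst (flow e y u) - fst y)"
    by (metis norm_triangle_sub)
   ultimately show "norm (fst (flow e y u)) <= e1 \<and> \<bar>snd (flow e y u)\<bar> <= e1" by auto
  qed
 qed
 from ex_G[OF P S stay, of "%u. u"] have "expands 1 ?W Y (%e u y. G e u (flow e y u))" by simp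
 then obtain g where g: "ulip ?W Y g" "\<forall>\<^sub>F e in nhds 0. \<forall>u\<in>?W. \<forall>y\<in>Y. G e u (flow e y u) = G 0 u (flow 0 y u) + e *\<^sub>R g e u y"
  by (auto simp: expands.simps)
 obtain C where C: "C > 0" "\<forall>\<^sub>F e in nhds 0. \<forall>u\<in>?W. \<forall>y\<in>Y. norm (g e u y) <= C \<and> (\<forall>y'\<in>Y. norm (g e u y - g e u y') <= C * dist y y')"
  using ulipE[OF g(1)] .
 show thesis
 proof (rule that[of "C * (2 * pi)"])
  show "\<forall>\<^sub>F e in nhds 0. \<forall>y\<in>cball 0 e2 \<times> {- e2..e2}. \<forall>y'\<in>cball 0 e2 \<times> {- e2..e2}.
   norm ((flow e y (2 * pi) - y - (e * (2 * pi * rot (snd y))) *\<^sub>R (\<i> * fst y, 0))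
    - (flow e y' (2 * pi) - y' - (e * (2 * pi * rot (snd y'))) *\<^sub>R (\<i> * fst y', 0))) <= C * (2 * pi) * e^2 * norm (y - y')"
   using B(2) stay g(2) C(2)
  proof eventually_elim
   case (elim e)
   have int: "((%u. e\<^sup>2 *\<^sub>R g e u y) has_integral (flow e y (2 * pi) - y - (e * (2 * pi * rot (snd y))) *\<^sub>R (\<i> * fst y, 0))) ?W"
    if y: "y \<in> Y" for y
   proof -
    have cK: "closest_point K (flow e y u) = flow e y u" if "u \<in> ?W" for u
     using elim(2) that y by (intro closest_point_self) (auto simp: K_iff)
    have 1: "((%u. e *\<^sub>R G e u (flow e y u)) has_integral (flow e y (2 * pi) - flow e y 0)) ?W"
    proof (rule fundamental_theorem_of_calculus)
     fix u assume u: "u \<in> ?W"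
     have "(flow e y has_vector_derivative e *\<^sub>R G e u (closest_point K (flow e y u))) (at u within ?W)"
     using elim(1) by (blast intro: has_vector_derivative_at_within)
     then show "(flow e y has_vector_derivative e *\<^sub>R G e u (flow e y u)) (at u within ?W)" by (simp add: cK[OF u])
    qed simp
    have yK: "y \<in> K" using y YK by blast
    have "bounded_linear (%x::complex. (x, 0::real))" "bounded_linear (%x::real. (0::complex, x))"
     by (auto intro!: bounded_linear_Pair bounded_linear_zero bounded_linear_ident)
    from has_integral_add[OF has_integral_linear[OF average_Gp[OF yK] this(1)] has_integral_linear[OF average_GS[OF yK] this(2)]]
    have "((%u. G 0 u y) has_integral (2 * pi * \<i> * rot (snd y) * fst y, 0)) ?W"
     by (simp add: G_def o_def)
    from has_integral_diff[OF 1 has_integral_cmul[OF this, of e]]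
    have A: "((%u. e *\<^sub>R G e u (flow e y u) - e *\<^sub>R G 0 u y) has_integral (flow e y (2 * pi) - y - e *\<^sub>R (2 * pi * \<i> * rot (snd y) * fst y, 0))) ?W"
     using conjunct1[OF elim(1)] by simp
    have A': "e *\<^sub>R (2 * pi * \<i> * rot (snd y) * fst y, 0::real) = (e * (2 * pi * rot (snd y))) *\<^sub>R (\<i> * fst y, 0)"
     by (simp add: scaleR_conv_of_real mult_ac)
    have eq: "e *\<^sub>R G e u (flow e y u) - e *\<^sub>R G 0 u y = e^2 *\<^sub>R g e u y" if "u \<in> ?W" for u
    proof -
     have "G e u (flow e y u) = G 0 u y + e *\<^sub>R g e u y" using elim(3) that y by (simp add: fl0)
     then show ?thesis by (simp add: power2_eq_square scaleR_add_right)
    qed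
    show ?thesis by (rule has_integral_eq[OF eq A[unfolded A']])
   qed
   show ?case
   proof (intro ballI)
    fix y y' :: "complex \<times> real" assume "y \<in> cball 0 e2 \<times> {- e2..e2}" "y' \<in> cball 0 e2 \<times> {- e2..e2}"
    then have y: "y \<in> Y" "y' \<in> Y" by (auto simp: Y_def)
    from has_integral_diff[OF int[OF y(1)] int[OF y(2)]]
    have i: "((%u. e\<^sup>2 *\<^sub>R g e u y - e^2 *\<^sub>R g e u y') has_integral
     ((flow e y (2 * pi) - y - (e * (2 * pi * rot (snd y))) *\<^sub>R (\<i> * fst y, 0))
    - (flow e y' (2 * pi) - y' - (e * (2 * pi * rot (snd y'))) *\<^sub>R (\<i> * fst y', 0)))) ?W" .
    have "norm ((flow e y (2 * pi) - y - (e * (2 * pi * rot (snd y))) *\<^sub>R (\<i> * fst y, 0))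
    - (flow e y' (2 * pi) - y' - (e * (2 * pi * rot (snd y'))) *\<^sub>R (\<i> * fst y', 0))) <= (e^2 * (C * norm (y - y'))) * measure lborel ?W"
    proof (rule has_integral_bound_real[OF _ _ i])
     fix u assume u: "u \<in> ?W - {}"
     have "norm (e^2 *\<^sub>R (g e u y - g e u y')) = e^2 * norm (g e u y - g e u y')" by simp
     also have "\<dots> <= e^2 * (C * norm (y - y'))" using elim(4) u y by (intro mult_left_mono) (auto simp: dist_norm)
     finally show "norm (e^2 *\<^sub>R g e u y - e^2 *\<^sub>R g e u y') <= e^2 * (C * norm (y - y'))" by (simp add: scaleR_diff_right)
    qed (use C(1) in auto)
    then show "norm ((flow e y (2 * pi) - y - (e * (2 * pi * rot (snd y))) *\<^sub>R (\<i> * fst y, 0))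
    - (flow e y' (2 * pi) - y' - (e * (2 * pi * rot (snd y'))) *\<^sub>R (\<i> * fst y', 0))) <= C * (2 * pi) * e^2 * norm (y - y')"
     by (simp add: mult_ac)
   qed
  qed
 qed (use C(1) in auto)
qed

end

section \<open>Newton's theorem and the first moment of the ball\<close>

lemma compact_integrable:
 fixes f :: "'a::euclidean_space => 'b::euclidean_space"
 assumes "compact S" "continuous_on S f"
 shows "f integrable_on S" "f absolutely_integrable_on S" "(LINT x : S | lborel. f x) = integral S f"
proof -
 have *: "set_integrable lborel S h" if "continuous_on S h" for h :: "'a => 'c::euclidean_space"
  using borel_integrable_compact[OF assms(1) that] by (simp add: set_integrable_def)
 have "continuous_on S (%x. norm (f x))" using assms(2) by (intro continuous_intros)
 then show "f absolutely_integrable_on S"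
  using set_borel_integral_eq_integral(1)[OF *[OF assms(2)]] set_borel_integral_eq_integral(1)[OF *, of "%x. norm (f x)"]
  by (simp add: absolutely_integrable_on_def)
 show "f integrable_on S" "(LINT x : S | lborel. f x) = integral S f"
  using set_borel_integral_eq_integral[OF *[OF assms(2)]] by auto
qed

text \<open>The scalar integrand is placed on the first coordinate axis so that the change of
  variables for maps from \<open>real^3\<close> to \<open>real^3\<close> applies; the first
  component is read off at the end.\<close>

lemma integral_linear_image:
 fixes f :: "real^3 => real"
 assumes "linear T" "compact S" "continuous_on (T ` S) f"
 shows "integral (T ` S) f = \<bar>det (matrix T)\<bar> * integral S (%x. f (T x))"
proof -
 let ?h = "%x. f x *\<^sub>R (axis 1 1 :: real^3)"
 have cT: "compact (T ` S)"
  using assms by (intro compact_continuous_image linear_continuous_on linear_conv_bounded_linear[THEN iffD1]) auto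
 have ch: "continuous_on (T ` S) ?h" using assms(3) by (intro continuous_intros)
 have cf: "continuous_on S (%x. f (T x))"
  using continuous_on_compose2[OF assms(3), of S T] assms(1) by (simp add: linear_continuous_on linear_conv_bounded_linear)
 have bl: "bounded_linear (%v::real^3. v $ 1)" by (rule bounded_linear_vec_nth)
 have "integral (T ` S) ?h = \<bar>det (matrix T)\<bar> *\<^sub>R integral S (?h \<circ> T)"
  by (rule integral_change_of_variables_linear[OF assms(1)]) (use compact_integrable(2)[OF cT ch] in auto)
 then have "integral (T ` S) ?h $ 1 = \<bar>det (matrix T)\<bar> * integral S (?h \<circ> T) $ 1" by simp
 moreover have "integral (T ` S) ?h $ 1 = integral (T ` S) f"
  using integral_linear[OF compact_integrable(1)[OF cT ch] bl] by (simp add: o_def)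
 moreover have "integral S (?h \<circ> T) $ 1 = integral S (%x. f (T x))"
 proof -
  have "continuous_on S (?h \<circ> T)" unfolding o_def using cf by (intro continuous_intros)
  from integral_linear[OF compact_integrable(1)[OF assms(2) this] bl] show ?thesis by (simp add: o_def)
 qed
 ultimately show ?thesis by simp
qed

text \<open>Uniform continuity of \<open>g\<close> on a compact neighbourhood times \<open>S\<close>
  bounds the linearisation error by \<eta> times the displacement, uniformly in \<open>w\<close>.
  Here \<eta> is \<epsilon> over the volume of \<open>S\<close> plus one, the one guarding against
  volume zero.\<close>

lemma GDERIV_integral:
 fixes f :: "'a::euclidean_space => 'b::euclidean_space => real"
 assumes "compact S" "open U" "x0 \<in> U"
  and f: "\<And>x w. x \<in> U ==> w \<in> S ==> GDERIV (%x. f x w) x :> g x w"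
  and g: "continuous_on (U \<times> S) (%(x, w). g x w)"
  and fc: "\<And>x. x \<in> U ==> continuous_on S (f x)"
 shows "GDERIV (%x. integral S (f x)) x0 :> integral S (g x0)"
 unfolding gderiv_def has_derivative_at_alt
proof (intro conjI allI impI)
 show "bounded_linear (%h. h \<bullet> integral S (g x0))" by (rule bounded_linear_inner_left)
 fix \<epsilon> :: real assume \<epsilon>: "\<epsilon> > 0"
 have S: "S \<in> lmeasurable" using assms(1) by (rule lmeasurable_compact)
 define \<eta> where "\<eta> = \<epsilon> / (measure lebesgue S + 1)"
 have \<eta>: "\<eta> > 0" using \<epsilon> by (simp add: \<eta>_def add_nonneg_pos)
 obtain r where r: "r > 0" "cball x0 r \<subseteq> U" using assms(2,3) open_contains_cball by blast
 have "uniformly_continuous_on (cball x0 r \<times> S) (%(x, w). g x w)"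
  using r assms(1) by (intro compact_uniformly_continuous continuous_on_subset[OF g] compact_Times) auto
 then obtain d where d: "d > 0" "\<And>p q. p \<in> cball x0 r \<times> S ==> q \<in> cball x0 r \<times> S ==> dist q p < d ==>
   dist (case q of (x, w) => g x w) (case p of (x, w) => g x w) < \<eta>"
  using \<eta> unfolding uniformly_continuous_on_def by metis
 show "\<exists>\<delta>>0. \<forall>y. norm (y - x0) < \<delta> -->
   norm (integral S (f y) - integral S (f x0) - (y - x0) \<bullet> integral S (g x0)) <= \<epsilon> * norm (y - x0)"
 proof (intro exI[of _ "min r d"] conjI allI impI)
  fix y assume y: "norm (y - x0) < min r d"
  have yU: "y \<in> U" using y r by (auto simp: dist_norm norm_minus_commute)
  have gc: "continuous_on S (g x0)"
   using continuous_on_compose2[OF g, of S "%w. (x0, w)"] assms(3) by (simp add: image_subset_iff continuous_on_Pair continuous_on_const continuous_on_id)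
  have i1: "f y integrable_on S" "f x0 integrable_on S" "g x0 integrable_on S"
   using compact_integrable(1)[OF assms(1)] fc yU assms(3) gc by auto
  have gi: "((%w. (y - x0) \<bullet> g x0 w) has_integral ((y - x0) \<bullet> integral S (g x0))) S"
   using has_integral_linear[OF integrable_integral[OF i1(3)] bounded_linear_inner_right[of "y - x0"]] by (simp add: o_def)
  have int: "((%w. f y w - f x0 w - (y - x0) \<bullet> g x0 w) has_integral (integral S (f y) - integral S (f x0) - (y - x0) \<bullet> integral S (g x0))) S"
   by (intro has_integral_diff integrable_integral i1 gi)
  have pt: "norm (f y w - f x0 w - (y - x0) \<bullet> g x0 w) <= norm (y - x0) * \<eta>" if w: "w \<in> S" for w
  proof -
   let ?B = "cball x0 (norm (y - x0))"
   have sub: "?B \<subseteq> cball x0 r" "?B \<subseteq> ball x0 d" using y by auto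
   show ?thesis
   proof (rule differentiable_bound_linearization[where S = ?B and f' = "%x h. h \<bullet> g x w"])
    fix t :: real assume "t \<in> {0..1}"
    then have "\<bar>t\<bar> * norm (y - x0) <= 1 * norm (y - x0)" by (intro mult_right_mono) auto
    then show "x0 + t *\<^sub>R (y - x0) \<in> ?B" by (simp add: dist_norm)
   next
    fix x assume x: "x \<in> ?B"
    then have "x \<in> U" using sub r by blast
    from f[OF this w] show "((%x. f x w) has_derivative (%h. h \<bullet> g x w)) (at x within ?B)"
     by (auto simp: gderiv_def intro: has_derivative_at_withinI)
   next
    fix x assume x: "x \<in> ?B"
    have "dist (x, w) (x0, w) < d" using x y by (simp add: dist_Pair_Pair dist_commute)
    then have "dist (g x w) (g x0 w) < \<eta>"
     using d(2)[of "(x0, w)" "(x, w)"] x sub w r(1) by auto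
    then have n: "norm (g x w - g x0 w) <= \<eta>" by (simp add: dist_norm)
    show "onorm ((%h. h \<bullet> g x w) - (%h. h \<bullet> g x0 w)) <= \<eta>"
     unfolding fun_diff_def
    proof (rule onorm_le)
     fix h
     have "norm (h \<bullet> (g x w - g x0 w)) <= norm h * norm (g x w - g x0 w)" by (simp add: Cauchy_Schwarz_ineq2)
     also have "\<dots> <= norm h * \<eta>" using n by (intro mult_left_mono) auto
     finally show "norm (h \<bullet> g x w - h \<bullet> g x0 w) <= \<eta> * norm h" by (simp add: inner_diff_right mult.commute)
    qed
   qed simp
  qed
  have "norm (integral S (f y) - integral S (f x0) - (y - x0) \<bullet> integral S (g x0)) <= integral S (%w. norm (y - x0) * \<eta>)"
   using integral_norm_bound_integral[OF has_integral_integrable[OF int] integrable_on_const[OF S] pt] integral_unique[OF int] by simp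
  also have "\<dots> = measure lebesgue S * (norm (y - x0) * \<eta>)"
   using lmeasure_integral[OF S] integral_mult_right[of S "norm (y - x0) * \<eta>" "%_. 1"] by (simp add: mult.commute)
  also have "\<dots> = (measure lebesgue S / (measure lebesgue S + 1)) * (\<epsilon> * norm (y - x0))" by (simp add: \<eta>_def)
  also have "\<dots> <= 1 * (\<epsilon> * norm (y - x0))"
   using \<epsilon> by (intro mult_right_mono) (auto simp: divide_le_eq_1 add_nonneg_pos)
  finally show "norm (integral S (f y) - integral S (f x0) - (y - x0) \<bullet> integral S (g x0)) <= \<epsilon> * norm (y - x0)" by simp
 qed (use r d in auto)
qed

definition newton :: "'a::real_inner => 'a" where
 "newton v = (1 / norm v ^ 3) *\<^sub>R v"

lemma has_derivative_norm_diff: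
 fixes x w :: "'a::euclidean_space"
 assumes "x ~= w"
 shows "((%x. norm (x - w)) has_derivative (%h. h \<bullet> sgn (x - w))) (at x)"
proof -
 have "((%x. x - w) has_derivative (%h. h)) (at x)" by (auto intro!: derivative_eq_intros)
 from has_derivative_compose[OF this GDERIV_norm[unfolded gderiv_def]] assms show ?thesis by simp
qed

lemma GDERIV_inverse_dist:
 fixes x w :: "'a::euclidean_space"
 assumes "x ~= w"
 shows "GDERIV (%x. 1 / norm (x - w)) x :> - newton (x - w)"
proof -
 have n: "norm (x - w) ~= 0" using assms by simp
 have "((%x. 1 / norm (x - w)) has_derivative (%h. - (h \<bullet> sgn (x - w)) / (norm (x - w))\<^sup>2)) (at x)"
  using n by (auto intro!: derivative_eq_intros has_derivative_norm_diff[OF assms] simp: power2_eq_square divide_simps)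
 moreover have "(%h. - (h \<bullet> sgn (x - w)) / (norm (x - w))\<^sup>2) = (%h. h \<bullet> (- newton (x - w)))"
  using n by (auto simp: newton_def sgn_div_norm power2_eq_square power3_eq_cube divide_simps)
 ultimately show ?thesis by (simp add: gderiv_def)
qed

lemma GDERIV_newton:
 fixes x w :: "'a::euclidean_space"
 assumes "x ~= w"
 shows "GDERIV (%x. newton (x - w) \<bullet> a) x :>
  (1 / norm (x - w) ^ 3) *\<^sub>R a - (3 * ((x - w) \<bullet> a) / norm (x - w) ^ 5) *\<^sub>R (x - w)"
proof -
 have n: "norm (x - w) ~= 0" using assms by simp
 have "((%x. ((x - w) \<bullet> a) / norm (x - w) ^ 3) has_derivative
   (%h. (h \<bullet> a) / norm (x - w) ^ 3 - ((x - w) \<bullet> a) * (3 * (norm (x - w))\<^sup>2 * (h \<bullet> sgn (x - w))) / (norm (x - w) ^ 3)\<^sup>2)) (at x)"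
  proof -
  have 1: "((%x. (x - w) \<bullet> a) has_derivative (%h. h \<bullet> a)) (at x)" by (auto intro!: derivative_eq_intros)
  have 2: "((%x. norm (x - w) ^ 3) has_derivative (%h. 3 * (norm (x - w))\<^sup>2 * (h \<bullet> sgn (x - w)))) (at x)"
   using has_derivative_power[OF has_derivative_norm_diff[OF assms], of 3] by (simp add: mult_ac)
  show ?thesis
   using has_derivative_divide[OF 1 2] n by (simp add: field_simps power2_eq_square)
 qed
 moreover have "(%h. (h \<bullet> a) / norm (x - w) ^ 3 - ((x - w) \<bullet> a) * (3 * (norm (x - w))\<^sup>2 * (h \<bullet> sgn (x - w))) / (norm (x - w) ^ 3)\<^sup>2) =
   (%h. h \<bullet> ((1 / norm (x - w) ^ 3) *\<^sub>R a - (3 * ((x - w) \<bullet> a) / norm (x - w) ^ 5) *\<^sub>R (x - w)))"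
 proof
  fix h
  have "norm (x - w) ^ 3 * norm (x - w) ^ 3 = (norm (x - w))\<^sup>2 * (norm (x - w) * norm (x - w) ^ 3)" 
   "norm (x - w) ^ 5 = norm (x - w) * norm (x - w) * norm (x - w) ^ 3" by (simp_all add: numeral_eq_Suc)
  then show "(h \<bullet> a) / norm (x - w) ^ 3 - ((x - w) \<bullet> a) * (3 * (norm (x - w))\<^sup>2 * (h \<bullet> sgn (x - w))) / (norm (x - w) ^ 3)\<^sup>2 =
   h \<bullet> ((1 / norm (x - w) ^ 3) *\<^sub>R a - (3 * ((x - w) \<bullet> a) / norm (x - w) ^ 5) *\<^sub>R (x - w))"
   using n by (simp add: inner_diff_right sgn_div_norm power2_eq_square divide_simps)
 qed
 ultimately show ?thesis by (simp add: gderiv_def newton_def)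
qed

lemma GDERIV_along:
 fixes f :: "'a::euclidean_space => real"
 assumes "GDERIV f (x + t *\<^sub>R v) :> d"
 shows "((%t. f (x + t *\<^sub>R v)) has_real_derivative v \<bullet> d) (at t)"
proof -
 have "((%t. x + t *\<^sub>R v) has_derivative (%h. h *\<^sub>R v)) (at t)"
  by (auto intro!: derivative_eq_intros)
 from has_derivative_compose[OF this assms[unfolded gderiv_def]]
 show ?thesis by (simp add: has_field_derivative_def mult_commute_abs mult.commute)
qed

text \<open>Equivariance under the half turn about the line through \<open>x\<close> forces
  \<open>g x\<close> to be radial, and equivariance under the other rotations makes the factor a
  function \<psi> of the radius. The divergence is then \<open>3 \<psi> + \<rho> \<psi>'\<close>, so
  \<open>\<rho>^3 \<psi>\<close> is constant.\<close>

lemma radial_divergence_free: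
 fixes g :: "real^3 => real^3"
 assumes R: "R \<ge> 0"
  and eqv: "\<And>T x. orthogonal_transformation T ==> norm x > R ==> g (T x) = T (g x)"
  and der: "\<And>x i. norm x > R ==> GDERIV (%x. g x \<bullet> axis i 1) x :> dg x i"
  and dv: "\<And>x. norm x > R ==> (\<Sum>i\<in>UNIV. dg x i $ i) = 0"
 obtains c where "\<And>x. norm x > R ==> g x = (c / norm x ^ 3) *\<^sub>R x"
proof -
 define e where "e = (axis 1 1 :: real^3)"
 have e: "norm e = 1" "e \<bullet> e = 1" by (simp_all add: e_def inner_axis)
 have par: "g x = ((g x \<bullet> x) / (x \<bullet> x)) *\<^sub>R x" if x: "norm x > R" for x
 proof -
  have nx: "x \<bullet> x ~= 0" using x R by auto
  \<comment> \<open>The half turn about the line through \<open>x\<close>.\<close>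
  define T where "T v = (2 * (v \<bullet> x) / (x \<bullet> x)) *\<^sub>R x - v" for v
  have "orthogonal_transformation T"
   unfolding orthogonal_transformation_def
  proof (intro conjI allI)
   show "linear T" unfolding T_def
    by (auto simp: linear_iff inner_add_left algebra_simps add_divide_distrib)
   show "T v \<bullet> T u = v \<bullet> u" for v u
    using nx by (simp add: T_def inner_diff_left inner_diff_right inner_commute field_simps)
  qed
  from eqv[OF this x] have "g (T x) = T (g x)" .
  moreover have "T x = x" using nx by (simp add: T_def algebra_simps scaleR_2)
  ultimately have "g x + g x = (2 * (g x \<bullet> x) / (x \<bullet> x)) *\<^sub>R x"
   unfolding T_def by (simp add: algebra_simps)
  then have "(1/2) *\<^sub>R (g x + g x) = (1/2) *\<^sub>R ((2 * (g x \<bullet> x) / (x \<bullet> x)) *\<^sub>R x)" by simp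
  then show ?thesis by (simp add: scaleR_2[symmetric])
 qed
 define \<psi> where "\<psi> \<rho> = (g (\<rho> *\<^sub>R e) \<bullet> e) / \<rho>" for \<rho>
 have \<psi>: "g x = \<psi> (norm x) *\<^sub>R x" if x: "norm x > R" for x
 proof -
  have ne: "norm (norm x *\<^sub>R e) = norm x" using e by simp
  obtain T where T: "orthogonal_transformation T" "T (norm x *\<^sub>R e) = x"
   using orthogonal_transformation_exists[OF ne] .
  have "g x = T (g (norm x *\<^sub>R e))" using eqv[OF T(1), of "norm x *\<^sub>R e"] T(2) x ne by (simp del: norm_scaleR)
  also have "g (norm x *\<^sub>R e) = \<psi> (norm x) *\<^sub>R (norm x *\<^sub>R e)"
   proof -
   have "x ~= 0" using x R by auto
   then show ?thesis using par[of "norm x *\<^sub>R e"] x e by (simp add: \<psi>_def)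
  qed
  also have "T \<dots> = \<psi> (norm x) *\<^sub>R T (norm x *\<^sub>R e)"
   using T(1) by (simp add: orthogonal_transformation_def linear_cmul)
  finally show ?thesis by (simp add: T(2))
 qed
 have d\<psi>: "((%\<rho>. \<rho> ^ 3 * \<psi> \<rho>) has_real_derivative 0) (at \<rho>)" if \<rho>: "\<rho> > R" for \<rho>
 proof -
  have \<rho>0: "\<rho> > 0" and n: "norm (\<rho> *\<^sub>R e) = \<rho>" using \<rho> R e by auto
  have "((%t. g (0 + t *\<^sub>R e) \<bullet> axis 1 1) has_real_derivative e \<bullet> dg (\<rho> *\<^sub>R e) 1) (at \<rho>)"
   by (rule GDERIV_along) (use der[of "\<rho> *\<^sub>R e" 1] n \<rho> in simp)
  then have g1: "((%t. g (t *\<^sub>R e) \<bullet> e) has_real_derivative dg (\<rho> *\<^sub>R e) 1 $ 1) (at \<rho>)"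
   by (simp add: e_def inner_axis')
  define k where "k = (dg (\<rho> *\<^sub>R e) 1 $ 1 * \<rho> - (g (\<rho> *\<^sub>R e) \<bullet> e) * 1) / (\<rho> * \<rho>)"
  have k: "(\<psi> has_real_derivative k) (at \<rho>)"
   unfolding \<psi>_def[abs_def] k_def using \<rho>0 by (intro DERIV_divide g1 DERIV_ident) auto
  have d1: "dg (\<rho> *\<^sub>R e) 1 $ 1 = \<rho> * k + \<psi> \<rho>"
   using \<rho>0 by (simp add: k_def \<psi>_def field_simps)
  \<comment> \<open>Across the radial direction the component is
    \<open>\<psi> (sqrt (\<rho>^2 + t^2)) * t\<close>; its derivative at \<open>t = 0\<close> is
    obtained from the continuity of \<psi>.\<close>
  have di: "dg (\<rho> *\<^sub>R e) i $ i = \<psi> \<rho>" if i: "i ~= 1" for i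
  proof -
   define v where "v = (axis i 1 :: real^3)"
   have ev: "e \<bullet> v = 0" "v \<bullet> v = 1" using i by (auto simp: e_def v_def inner_axis_axis)
   have "((%t. g (\<rho> *\<^sub>R e + t *\<^sub>R v) \<bullet> axis i 1) has_real_derivative v \<bullet> dg (\<rho> *\<^sub>R e) i) (at 0)"
    by (rule GDERIV_along) (use der[of "\<rho> *\<^sub>R e" i] n \<rho> in simp)
   then have a: "((%t. g (\<rho> *\<^sub>R e + t *\<^sub>R v) \<bullet> v) has_real_derivative dg (\<rho> *\<^sub>R e) i $ i) (at 0)"
    by (simp add: v_def inner_axis')
   have nrm: "norm (\<rho> *\<^sub>R e + t *\<^sub>R v) = sqrt (\<rho>^2 + t^2)" for t
    by (simp add: norm_eq_sqrt_inner inner_add_left inner_add_right ev e inner_commute[of v e] power2_eq_square)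
   have eq: "g (\<rho> *\<^sub>R e + t *\<^sub>R v) \<bullet> v = \<psi> (sqrt (\<rho>^2 + t^2)) * t" for t
   proof -
    have "\<rho> = sqrt (\<rho>^2)" using \<rho>0 by simp
    also have "\<dots> <= sqrt (\<rho>^2 + t^2)" by simp
    finally have "norm (\<rho> *\<^sub>R e + t *\<^sub>R v) > R" unfolding nrm using \<rho> by linarith
    from \<psi>[OF this] show ?thesis by (simp add: nrm inner_add_left ev)
   qed
   have "isCont (%t. \<psi> (sqrt (\<rho>^2 + t^2))) 0"
   proof -
    have "isCont \<psi> (sqrt (\<rho>^2 + 0\<^sup>2))" using DERIV_isCont[OF k] \<rho>0 by simp
    then show ?thesis by (rule isCont_o2[rotated, where f = "%t. sqrt (\<rho>^2 + t^2)"]) (intro continuous_intros)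
   qed
   then have "((%t. \<psi> (sqrt (\<rho>^2 + t^2)) * t) has_real_derivative \<psi> \<rho>) (at 0)"
    unfolding CARAT_DERIV using \<rho>0 by (intro exI[of _ "%t. \<psi> (sqrt (\<rho>^2 + t^2))"]) simp
   with a[unfolded eq] show ?thesis by (rule DERIV_unique)
  qed
  have "3 * \<psi> \<rho> + \<rho> * k = 0"
   proof -
   have "norm (\<rho> *\<^sub>R e) > R" using n \<rho> by (simp only:)
   from dv[OF this] have "dg (\<rho> *\<^sub>R e) 1 $ 1 + dg (\<rho> *\<^sub>R e) 2 $ 2 + dg (\<rho> *\<^sub>R e) 3 $ 3 = 0"
    by (simp only: sum_3)
   moreover have "dg (\<rho> *\<^sub>R e) 2 $ 2 = \<psi> \<rho>" "dg (\<rho> *\<^sub>R e) 3 $ 3 = \<psi> \<rho>" by (rule di, simp)+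
   ultimately show ?thesis using d1 by linarith
  qed
  then have "\<rho>^2 * (3 * \<psi> \<rho> + \<rho> * k) = 0" by simp
  then have "3 * \<rho>^2 * \<psi> \<rho> + k * \<rho> ^ 3 = 0" by (simp add: algebra_simps power2_eq_square power3_eq_cube)
  moreover have "((%\<rho>. \<rho> ^ 3 * \<psi> \<rho>) has_real_derivative (3 * \<rho>^2 * \<psi> \<rho> + k * \<rho> ^ 3)) (at \<rho>)"
   by (auto intro!: derivative_eq_intros k)
  ultimately show ?thesis by simp
 qed
 have "\<exists>c. \<forall>\<rho>\<in>{R<..}. \<rho> ^ 3 * \<psi> \<rho> = c"
  by (rule has_field_derivative_zero_constant) (use d\<psi> in \<open>auto intro: has_field_derivative_at_within\<close>)
 then obtain c where c: "\<And>\<rho>. \<rho> > R ==> \<rho> ^ 3 * \<psi> \<rho> = c" by auto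
 show thesis
 proof (rule that[of c])
  fix x :: "real^3" assume x: "norm x > R"
  then have "norm x ~= 0" using R by auto
  then have "\<psi> (norm x) = c / norm x ^ 3" using c[OF x] by (simp add: field_simps)
  then show "g x = (c / norm x ^ 3) *\<^sub>R x" using \<psi>[OF x] by simp
 qed
qed

lemma integral_cball_orthogonal:
 fixes f T :: "real^3 => real^3"
 assumes T: "orthogonal_transformation T" and f: "continuous_on (cball 0 R) f"
 shows "integral (cball 0 R) (%w. f (T w)) = integral (cball 0 R) f"
proof -
 have i: "T ` cball 0 R = cball 0 R" using image_orthogonal_transformation_cball[OF T, of 0 R] T
  by (simp add: linear_0 orthogonal_transformation_linear)
 have "integral (T ` cball 0 R) f = \<bar>det (matrix T)\<bar> *\<^sub>R integral (cball 0 R) (f \<circ> T)"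
  by (rule integral_change_of_variables_linear)
   (use T f i compact_integrable(2)[of "cball 0 R" f] in \<open>auto simp: orthogonal_transformation_linear\<close>)
 then show ?thesis using T by (simp add: i o_def)
qed

text \<open>The Hessian of \<open>- 1 / norm v\<close>, applied to the vector
  \<open>a\<close>.\<close>

definition hess :: "'a::real_inner => 'a => 'a" where
 "hess a v = (1 / norm v ^ 3) *\<^sub>R a - (3 * (v \<bullet> a) / norm v ^ 5) *\<^sub>R v"

lemma GDERIV_newton': "x ~= w ==> GDERIV (%x. newton (x - w) \<bullet> a) x :> hess a (x - w)"
 for x w :: "'a::euclidean_space"
 unfolding hess_def by (rule GDERIV_newton)

lemma GDERIV_transform_open:
 assumes "GDERIV f x :> d" "open U" "x \<in> U" "\<And>y. y \<in> U ==> f y = g y"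
 shows "GDERIV g x :> d"
 using has_derivative_transform_within_open[of f "%h. h \<bullet> d" x UNIV U g] assms by (simp add: gderiv_def)

lemma continuous_on_newton [continuous_intros]:
 fixes f :: "'a::topological_space => 'b::real_inner"
 assumes "continuous_on S f" "\<And>x. x \<in> S ==> f x ~= 0"
 shows "continuous_on S (%x. newton (f x))" "continuous_on S (%x. hess a (f x))" "continuous_on S (%x. 1 / norm (f x))"
proof -
 have n: "\<forall>x\<in>S. norm (f x) ~= 0" "\<forall>x\<in>S. norm (f x) ^ 3 ~= 0" "\<forall>x\<in>S. norm (f x) ^ 5 ~= 0" using assms(2) by auto
 show "continuous_on S (%x. newton (f x))" "continuous_on S (%x. hess a (f x))" "continuous_on S (%x. 1 / norm (f x))"
  unfolding newton_def hess_def by (intro continuous_intros assms(1) n)+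
qed

lemma outside_open: "open {x :: 'a::euclidean_space. norm x > R}"
 by (intro open_Collect_less continuous_intros)

section \<open>Potential, field and first moment of the homogeneous ball\<close>

locale homogeneous_ball =
 fixes R :: real
 assumes R: "R > 0"
begin

definition B :: "(real^3) set" where "B = cball 0 R"
definition \<mu> :: real where "\<mu> = measure lebesgue B"

lemma B: "compact B" "B \<in> lmeasurable" "\<mu> > 0" and in_B: "w \<in> B \<longleftrightarrow> norm w <= R"
proof -
 show c: "compact B" by (simp add: B_def)
 then show "B \<in> lmeasurable" by (rule lmeasurable_compact)
 show "\<mu> > 0" using R by (simp add: \<mu>_def B_def content_cball_pos)
 show "w \<in> B \<longleftrightarrow> norm w <= R" by (simp add: B_def)
qed

lemma outside_ne: "norm x > R ==> w \<in> B ==> x - w ~= 0"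
 by (auto simp: in_B)

lemma dist_ge: "norm x > R ==> w \<in> B ==> norm x - R <= norm (x - w)" "w \<in> B ==> norm (x - w) <= norm x + R"
 using norm_triangle_ineq2[of x w] norm_triangle_ineq4[of x w] by (auto simp: in_B)

lemma integral_const_B: "integral B (%_. c::real) = c * \<mu>"
 using lmeasure_integral[OF B(2)] integral_mult_right[of B c "%_. 1"] by (simp add: \<mu>_def)

lemma GDERIV_weighted:
 assumes x: "norm x > R" and \<omega>: "continuous_on B \<omega>"
  and f: "\<And>v. v ~= 0 ==> GDERIV f v :> g v" and g: "continuous_on (- {0}) g"
 shows "GDERIV (%x. integral B (%w. \<omega> w * f (x - w))) x :> integral B (%w. \<omega> w *\<^sub>R g (x - w))"
proof (rule GDERIV_integral[OF B(1) outside_open[of R]])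
 show "x \<in> {x. norm x > R}" using x by simp
 fix x :: "real^3" and w :: "real^3" assume xw: "x \<in> {x. norm x > R}" "w \<in> B"
 have "((%x. x - w) has_derivative (%h. h)) (at x)" by (auto intro!: derivative_eq_intros)
 from has_derivative_compose[OF this f[OF outside_ne, of x w, unfolded gderiv_def]] xw
 have "((%x. f (x - w)) has_derivative (%h. h \<bullet> g (x - w))) (at x)" by simp
 from has_derivative_mult_right[OF this, of "\<omega> w"]
 show "GDERIV (%x. \<omega> w * f (x - w)) x :> \<omega> w *\<^sub>R g (x - w)" by (simp add: gderiv_def)
next
 have "continuous_on ({x. norm x > R} \<times> B) (%p. \<omega> (snd p) *\<^sub>R g (fst p - snd p))"
  by (intro continuous_intros continuous_on_compose2[OF \<omega>] continuous_on_compose2[OF g]) (auto simp: in_B)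
 then show "continuous_on ({x. norm x > R} \<times> B) (%(x, w). \<omega> w *\<^sub>R g (x - w))" by (simp add: case_prod_unfold)
next
 fix x :: "real^3" assume x: "x \<in> {x. norm x > R}"
 have "continuous_on (- {0}) f"
  using f by (intro continuous_at_imp_continuous_on ballI) (auto simp: gderiv_def intro: has_derivative_continuous)
 then show "continuous_on B (%w. \<omega> w * f (x - w))" using x
  by (intro continuous_intros \<omega> continuous_on_compose2[of "- {0}" f B "%w. x - w"]) (auto simp: in_B)
qed

lemma newton_int: "norm x > R ==> (%w. newton (x - w)) integrable_on B" "norm x > R ==> (%w. 1 / norm (x - w)) integrable_on B"
 "norm x > R ==> (%w. (1 / norm (x - w)) *\<^sub>R w) integrable_on B" "norm x > R ==> (%w. hess a (x - w)) integrable_on B"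
 "norm x > R ==> (%w. (w \<bullet> b) *\<^sub>R newton (x - w)) integrable_on B"
 using outside_ne[of x] by (auto intro!: compact_integrable(1)[OF B(1)] continuous_intros)

definition pot0 :: "real^3 => real" where "pot0 x = integral B (%w. 1 / norm (x - w))"
definition field0 :: "real^3 => real^3" where "field0 x = integral B (%w. newton (x - w))"
text \<open>The Newtonian integral of the vector density \<open>w\<close>. The change of the
  attraction of the ball under a linear displacement of its mass is expressed through the
  derivatives of this field.\<close>

definition moment :: "real^3 => real^3" where "moment x = integral B (%w. (1 / norm (x - w)) *\<^sub>R w)"

lemma field0_inner: "norm x > R ==> field0 x \<bullet> a = integral B (%w. newton (x - w) \<bullet> a)"
 using integral_linear[OF newton_int(1) bounded_linear_inner_left[of a], of x] by (simp add: field0_def o_def)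

lemma moment_inner: "norm x > R ==> moment x \<bullet> a = integral B (%w. (w \<bullet> a) * (1 / norm (x - w)))"
 using integral_linear[OF newton_int(3) bounded_linear_inner_left[of a], of x] by (simp add: moment_def o_def)

lemma pot0_derivative:
 assumes x: "norm x > R" shows "GDERIV pot0 x :> - field0 x"
proof -
 have "GDERIV (%x. integral B (%w. 1 * (1 / norm (x - w)))) x :> integral B (%w. 1 *\<^sub>R (- newton (x - w)))"
 proof (rule GDERIV_weighted[OF x, where f = "%v. 1 / norm v" and g = "%v. - newton v"])
  show "GDERIV (%v. 1 / norm v) v :> - newton v" if "v ~= 0" for v :: "real^3"
   using GDERIV_inverse_dist[of v 0] that by simp
 qed (auto intro!: continuous_intros)
 then show ?thesis by (simp add: pot0_def[abs_def] field0_def)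
qed

lemma field0_derivative:
 assumes x: "norm x > R" shows "GDERIV (%x. field0 x \<bullet> a) x :> integral B (%w. hess a (x - w))"
proof -
 have "GDERIV (%x. integral B (%w. 1 * (newton (x - w) \<bullet> a))) x :> integral B (%w. 1 *\<^sub>R hess a (x - w))"
 proof (rule GDERIV_weighted[OF x, where f = "%v. newton v \<bullet> a" and g = "hess a"])
  show "GDERIV (%v. newton v \<bullet> a) v :> hess a v" if "v ~= 0" for v :: "real^3"
   using GDERIV_newton'[of v 0 a] that by simp
 qed (auto intro!: continuous_intros)
 then have "GDERIV (%x. integral B (%w. newton (x - w) \<bullet> a)) x :> integral B (%w. hess a (x - w))" by simp
 then show ?thesis
  by (rule GDERIV_transform_open[OF _ outside_open[of R]]) (use x in \<open>auto simp: field0_inner\<close>)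
qed

lemma moment_derivative:
 assumes x: "norm x > R" shows "GDERIV (%x. moment x \<bullet> a) x :> - integral B (%w. (w \<bullet> a) *\<^sub>R newton (x - w))"
proof -
 have "GDERIV (%x. integral B (%w. (w \<bullet> a) * (1 / norm (x - w)))) x :> integral B (%w. (w \<bullet> a) *\<^sub>R (- newton (x - w)))"
 proof (rule GDERIV_weighted[OF x, where f = "%v. 1 / norm v" and g = "%v. - newton v"])
  show "GDERIV (%v. 1 / norm v) v :> - newton v" if "v ~= 0" for v :: "real^3"
   using GDERIV_inverse_dist[of v 0] that by simp
 qed (auto intro!: continuous_intros)
 then have "GDERIV (%x. integral B (%w. (w \<bullet> a) * (1 / norm (x - w)))) x :> - integral B (%w. (w \<bullet> a) *\<^sub>R newton (x - w))"
  by simp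
 then show ?thesis
  by (rule GDERIV_transform_open[OF _ outside_open[of R]]) (use x in \<open>auto simp: moment_inner\<close>)
qed

lemma orth_newton: "orthogonal_transformation T ==> newton (T v) = T (newton v)" for v :: "real^3" and T :: "real^3 => real^3"
 by (simp add: newton_def orthogonal_transformation linear_cmul)

lemma field0_equivariant:
 fixes T :: "real^3 => real^3"
 assumes T: "orthogonal_transformation T" and x: "norm x > R"
 shows "field0 (T x) = T (field0 x)" "moment (T x) = T (moment x)"
proof -
 have lT: "linear T" "\<And>v. norm (T v) = norm v" using T by (auto simp: orthogonal_transformation)
 have bT: "bounded_linear T" using lT(1) by (simp add: linear_conv_bounded_linear)
 have Tx: "norm (T x) > R" using x lT by simp
 have c: "continuous_on (cball 0 R) (%w. newton (T x - w))" "continuous_on (cball 0 R) (%w. (1 / norm (T x - w)) *\<^sub>R w)"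
  using outside_ne[OF Tx] by (auto simp: B_def intro!: continuous_intros)
 have "field0 (T x) = integral B (%w. newton (T x - T w))"
  using integral_cball_orthogonal[OF T c(1)] by (simp add: field0_def B_def)
 also have "\<dots> = integral B (T \<circ> (%w. newton (x - w)))"
  by (simp add: o_def linear_diff[OF lT(1), symmetric] orth_newton[OF T])
 also have "\<dots> = T (field0 x)" unfolding field0_def by (rule integral_linear[OF newton_int(1)[OF x] bT])
 finally show "field0 (T x) = T (field0 x)" .
 have "moment (T x) = integral B (%w. (1 / norm (T x - T w)) *\<^sub>R T w)"
  using integral_cball_orthogonal[OF T c(2)] by (simp add: moment_def B_def)
 also have "\<dots> = integral B (T \<circ> (%w. (1 / norm (x - w)) *\<^sub>R w))"
  by (simp add: o_def linear_diff[OF lT(1), symmetric] lT linear_cmul[OF lT(1)])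
 also have "\<dots> = T (moment x)" unfolding moment_def by (rule integral_linear[OF newton_int(3)[OF x] bT])
 finally show "moment (T x) = T (moment x)" .
qed

lemma hess_trace:
 fixes v :: "real^3"
 assumes v: "v ~= 0"
 shows "(\<Sum>i\<in>UNIV. hess (axis i 1) v $ i) = 0"
proof -
 have h: "hess (axis i 1) v $ i = 1 / norm v ^ 3 - (3 / norm v ^ 5) * (v $ i * v $ i)" for i
  proof -
  have "v \<bullet> axis i 1 = v $ i" "(axis i 1 :: real^3) $ i = 1" by (simp add: inner_axis) (simp add: axis_def)
  then show ?thesis by (simp add: hess_def)
 qed
 have "(\<Sum>i\<in>UNIV. hess (axis i 1) v $ i) = 3 * (1 / norm v ^ 3) - (3 / norm v ^ 5) * (\<Sum>i\<in>UNIV. v $ i * v $ i)"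
  unfolding h sum_subtractf sum_distrib_left[symmetric] by simp
 also have "(\<Sum>i\<in>UNIV. v $ i * v $ i) = (norm v)\<^sup>2"
  by (simp add: power2_norm_eq_inner inner_vec_def)
 also have "3 * (1 / norm v ^ 3) - (3 / norm v ^ 5) * (norm v)\<^sup>2 = 0"
 proof -
  have "norm v ^ 5 = norm v ^ 3 * (norm v)\<^sup>2" by (simp only: power_add[symmetric]) simp
  then have "(3 / norm v ^ 5) * (norm v)\<^sup>2 = 3 / (norm v ^ 3 * (norm v)\<^sup>2) * (norm v)\<^sup>2" by (simp only:)
  also have "\<dots> = 3 * (1 / norm v ^ 3)" proof -
   have "3 / (a * b) * b = 3 * (1 / a)" if "b ~= 0" for a b :: real using that by simp
   then show ?thesis using v by (meson norm_eq_zero power_eq_0_iff)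
  qed
  finally show ?thesis by simp
 qed
 finally show ?thesis .
qed

lemma pot0_bounds:
 assumes x: "norm x > R" shows "\<mu> / (norm x + R) <= pot0 x" "pot0 x <= \<mu> / (norm x - R)"
proof -
 have "integral B (%_. 1 / (norm x + R)) <= pot0 x" unfolding pot0_def
  using x R dist_ge(1)[OF x] dist_ge(2)[where x = x] outside_ne[OF x]
  by (intro integral_le newton_int integrable_on_const B) (auto intro!: divide_left_mono mult_pos_pos)
 then show "\<mu> / (norm x + R) <= pot0 x" by (simp add: integral_const_B)
 have "pot0 x <= integral B (%_. 1 / (norm x - R))" unfolding pot0_def
  using x R dist_ge(1)[OF x] dist_ge(2)[where x = x] outside_ne[OF x]
  by (intro integral_le newton_int integrable_on_const B) (auto intro!: divide_left_mono mult_pos_pos)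
 then show "pot0 x <= \<mu> / (norm x - R)" by (simp add: integral_const_B)
qed

text \<open>The field is rotation-equivariant and, as \<open>hess\<close> has trace zero, free of
  divergence, hence \<open>c x / |x|^3\<close>. Along a ray the potential is then
  \<open>c / t + k\<close>, and squeezing it between \<open>\<mu> / (t + R)\<close> and
  \<open>\<mu> / (t - R)\<close> at infinity yields \<open>k = 0\<close> and
  \<open>c = \<mu>\<close>.\<close>

theorem newton_theorem:
 assumes x: "norm x > R"
 shows "field0 x = (\<mu> / norm x ^ 3) *\<^sub>R x" "pot0 x = \<mu> / norm x"
proof -
 obtain c where c: "\<And>x. norm x > R ==> field0 x = (c / norm x ^ 3) *\<^sub>R x"
 proof (rule radial_divergence_free[of R field0 "%x i. integral B (%w. hess (axis i 1) (x - w))"])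
  fix x :: "real^3" assume x: "norm x > R"
  have "(\<Sum>i\<in>UNIV. integral B (%w. hess (axis i 1) (x - w)) $ i) = (\<Sum>i\<in>UNIV. integral B (%w. hess (axis i 1) (x - w) $ i))"
   using integral_linear[OF newton_int(4)[OF x] bounded_linear_vec_nth] by (simp add: o_def)
  also have "\<dots> = integral B (%w. \<Sum>i\<in>UNIV. hess (axis i 1) (x - w) $ i)"
   using integrable_linear[OF newton_int(4)[OF x] bounded_linear_vec_nth] by (intro integral_sum[symmetric]) (auto simp: o_def)
  also have "\<dots> = integral B (%w. 0)" by (rule integral_cong) (use hess_trace outside_ne[OF x] in blast)
  finally show "(\<Sum>i\<in>UNIV. integral B (%w. hess (axis i 1) (x - w)) $ i) = 0" by simp
 qed (use R field0_equivariant field0_derivative in auto)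
 have const: "pot0 (t *\<^sub>R axis 1 1) = \<mu> / t \<and> c = \<mu>" if t: "t > R" for t
 proof -
  define f where "f t = pot0 (t *\<^sub>R axis 1 1) - c / t" for t
  have d: "(f has_real_derivative 0) (at t)" if t: "t > R" for t
  proof -
   have n: "norm (t *\<^sub>R axis 1 1 :: real^3) = t" using t R by simp
   have "((%t. pot0 (0 + t *\<^sub>R axis 1 1)) has_real_derivative axis 1 1 \<bullet> - field0 (t *\<^sub>R axis 1 1)) (at t)"
    by (rule GDERIV_along) (use pot0_derivative[of "t *\<^sub>R axis 1 1"] n t in simp)
   moreover have "axis 1 1 \<bullet> - field0 (t *\<^sub>R axis 1 1) = - (c / t^2)"
    using c[of "t *\<^sub>R axis 1 1"] n t R by (simp add: inner_axis_axis power3_eq_cube power2_eq_square)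
   ultimately have "((%t. pot0 (t *\<^sub>R axis 1 1)) has_real_derivative - (c / t^2)) (at t)" by simp
   moreover have "((%t. c / t) has_real_derivative - (c / t^2)) (at t)"
    using t R by (auto intro!: derivative_eq_intros simp: power2_eq_square)
   ultimately have "((%t. pot0 (t *\<^sub>R axis 1 1) - c / t) has_real_derivative - (c / t^2) - - (c / t^2)) (at t)"
    by (rule DERIV_diff)
   then show ?thesis by (simp add: f_def[abs_def])
  qed
  have "\<exists>k. \<forall>t\<in>{R<..}. f t = k"
   by (rule has_field_derivative_zero_constant) (use d in \<open>auto intro: has_field_derivative_at_within\<close>)
  then obtain k where k: "\<And>t. t > R ==> pot0 (t *\<^sub>R axis 1 1) = c / t + k" by (auto simp: f_def algebra_simps)
  have b: "\<mu> / (t + R) <= c / t + k" "c / t + k <= \<mu> / (t - R)" if t: "t > R" for t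
   using pot0_bounds[of "t *\<^sub>R axis 1 1"] k[OF t] t R by auto
  have lim: "((%t::real. a / (t + s)) \<longlongrightarrow> 0) at_top" for a s
   proof (rule tendsto_divide_0[OF tendsto_const], rule filterlim_at_top_imp_at_infinity)
   show "filterlim (%t. t + s) at_top at_top"
    using filterlim_tendsto_add_at_top[OF tendsto_const filterlim_ident, of s] by (simp add: add.commute)
  qed
  have ev: "eventually (%t. t > R) at_top" by (rule eventually_gt_at_top)
  have "((%t. c / t + k) \<longlongrightarrow> 0) at_top"
   by (rule tendsto_sandwich[OF _ _ lim[of \<mu> R] lim[of \<mu> "- R"]])
    (use b in \<open>auto intro: eventually_mono[OF ev]\<close>)
  moreover have "((%t. c / t + k) \<longlongrightarrow> 0 + k) at_top"
   using lim[of c 0] by (intro tendsto_intros) simp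
  ultimately have k0: "k = 0" using tendsto_unique trivial_limit_at_top_linorder by fastforce
  have lim1: "((%t::real. \<mu> * (t / (t + s))) \<longlongrightarrow> \<mu> * 1) at_top" for s
  proof (intro tendsto_mult tendsto_const)
   have "((%t::real. 1 - s / (t + s)) \<longlongrightarrow> 1 - 0) at_top" by (intro tendsto_diff tendsto_const lim)
   moreover have "eventually (%t::real. 1 - s / (t + s) = t / (t + s)) at_top"
    using eventually_gt_at_top[of "- s"] by eventually_elim (simp add: field_simps)
   ultimately show "((%t::real. t / (t + s)) \<longlongrightarrow> 1) at_top" using tendsto_cong by fastforce
  qed
  have "((%t::real. c) \<longlongrightarrow> \<mu> * 1) at_top"
  proof (rule tendsto_sandwich[OF _ _ lim1[of R] lim1[of "- R"]])
   show "eventually (%t. \<mu> * (t / (t + R)) <= c) at_top" "eventually (%t. c <= \<mu> * (t / (t + - R))) at_top"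
    using b k0 R by (auto intro!: eventually_mono[OF ev] simp: field_simps)
  qed
  then have "c = \<mu>" by (simp add: tendsto_const_iff)
  then show ?thesis using k[OF t] k0 by simp
 qed
 from const[of "R + 1"] have "c = \<mu>" by simp
 then show f: "field0 x = (\<mu> / norm x ^ 3) *\<^sub>R x" using c[OF x] by simp
 have ne: "norm (norm x *\<^sub>R axis 1 1 :: real^3) = norm x" by simp
 obtain T :: "real^3 => real^3" where T: "orthogonal_transformation T" "T (norm x *\<^sub>R axis 1 1) = x"
  using orthogonal_transformation_exists[OF ne] .
 have lT: "linear T" "\<And>v. norm (T v) = norm v" using T by (auto simp: orthogonal_transformation)
 let ?y = "norm x *\<^sub>R axis 1 1 :: real^3"
 have "pot0 (T ?y) = pot0 ?y"
 proof -
  have cc: "continuous_on B (%w. 1 / norm (T ?y - w))"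
   using outside_ne[of "T ?y"] x T(2) by (auto intro!: continuous_intros)
  have im: "T ` B = B" using image_orthogonal_transformation_cball[OF T(1), of 0 R] lT by (simp add: B_def linear_0)
  have "pot0 (T ?y) = integral (T ` B) (%w. 1 / norm (T ?y - w))" by (simp add: pot0_def im)
  also have "\<dots> = integral B (%w. 1 / norm (T ?y - T w))"
   using integral_linear_image[OF lT(1) B(1), of "%w. 1 / norm (T ?y - w)"] cc im T(1) by simp
  also have "\<dots> = pot0 ?y" by (simp add: pot0_def linear_diff[OF lT(1), symmetric] lT)
  finally show ?thesis .
 qed
 then show "pot0 x = \<mu> / norm x" using const[of "norm x"] x T(2) by simp
qed

text \<open>The divergence of \<open>moment\<close> is \<open>pot0 x - field0 x \<bullet> x\<close>,
  which vanishes by Newton's theorem, so the classification of radial fields applies again. It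
  leaves the sign of \<open>c\<close> open; this is settled by an estimate at a point at distance
  \<open>2 R\<close>.\<close>

theorem first_moment:
 obtains c where "c > 0" "\<And>x. norm x > R ==> moment x = (c / norm x ^ 3) *\<^sub>R x"
proof -
 obtain c where c: "\<And>x. norm x > R ==> moment x = (c / norm x ^ 3) *\<^sub>R x"
 proof (rule radial_divergence_free[of R moment "%x i. - integral B (%w. (w \<bullet> axis i 1) *\<^sub>R newton (x - w))"])
  fix x :: "real^3" assume x: "norm x > R"
  have "(\<Sum>i\<in>UNIV. (- integral B (%w. (w \<bullet> axis i 1) *\<^sub>R newton (x - w))) $ i)
    = - (\<Sum>i\<in>UNIV. integral B (%w. ((w \<bullet> axis i 1) *\<^sub>R newton (x - w)) $ i))"
   using integral_linear[OF newton_int(5)[OF x] bounded_linear_vec_nth] by (simp add: o_def sum_negf)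
  also have "(\<Sum>i\<in>UNIV. integral B (%w. ((w \<bullet> axis i 1) *\<^sub>R newton (x - w)) $ i)) = integral B (%w. \<Sum>i\<in>UNIV. ((w \<bullet> axis i 1) *\<^sub>R newton (x - w)) $ i)"
   using integrable_linear[OF newton_int(5)[OF x] bounded_linear_vec_nth] by (intro integral_sum[symmetric]) (auto simp: o_def)
  also have "\<dots> = integral B (%w. newton (x - w) \<bullet> x - 1 / norm (x - w))"
  proof (rule integral_cong)
   fix w assume "w \<in> B"
   then have n: "norm (x - w) ~= 0" using outside_ne[OF x] by auto
   have "(\<Sum>i\<in>UNIV. ((w \<bullet> axis i 1) *\<^sub>R newton (x - w)) $ i) = newton (x - w) \<bullet> w"
    proof -
    have "w \<bullet> axis i 1 = w $ i" for i by (simp add: inner_axis)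
    then show ?thesis by (simp only: vector_scaleR_component) (simp add: inner_vec_def mult.commute)
   qed
   also have "\<dots> = newton (x - w) \<bullet> x - newton (x - w) \<bullet> (x - w)" by (simp add: inner_diff_right)
   also have "newton (x - w) \<bullet> (x - w) = 1 / norm (x - w)"
    using n by (simp add: newton_def power2_norm_eq_inner[symmetric] power2_eq_square power3_eq_cube)
   finally show "(\<Sum>i\<in>UNIV. ((w \<bullet> axis i 1) *\<^sub>R newton (x - w)) $ i) = newton (x - w) \<bullet> x - 1 / norm (x - w)" .
  qed
  also have "\<dots> = field0 x \<bullet> x - pot0 x"
   using integrable_linear[OF newton_int(1)[OF x] bounded_linear_inner_left[of x]] newton_int(2)[OF x]
   by (simp add: field0_inner[OF x] pot0_def o_def integral_diff)
  also have "\<dots> = 0"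
  proof -
   have "norm x ~= 0" using x R by auto
   then show ?thesis by (simp add: newton_theorem[OF x] power2_norm_eq_inner[symmetric] power2_eq_square power3_eq_cube)
  qed
  finally show "(\<Sum>i\<in>UNIV. (- integral B (%w. (w \<bullet> axis i 1) *\<^sub>R newton (x - w))) $ i) = 0" by simp
 qed (use R field0_equivariant moment_derivative in auto)
 define x where "x = ((2 * R) *\<^sub>R axis 1 1 :: real^3)"
 have x: "norm x > R" "norm x = 2 * R" using R by (auto simp: x_def)
 let ?f = "%w. (w \<bullet> x) * (1 / norm (x - w))"
 \<comment> \<open>The integrand combined with its image under \<open>w \<mapsto> - w\<close>. This
   sum is nonnegative, because whichever of \<open>w\<close> and \<open>- w\<close> lies on the side
   of \<open>x\<close> is also the nearer one.\<close>
 let ?h = "%w. (w \<bullet> x) * (1 / norm (x - w) - 1 / norm (x + w))"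
 have xw: "x + w ~= 0" if "w \<in> B" for w
  using outside_ne[OF x(1), of "- w"] that by (simp add: in_B)
 have cf: "continuous_on B ?f" "continuous_on B ?h" "continuous_on B (%w. (w \<bullet> x) * (1 / norm (x + w)))"
  using outside_ne[OF x(1)] xw by (auto intro!: continuous_intros)
 have refl: "integral B ?f = - integral B (%w. (w \<bullet> x) * (1 / norm (x + w)))"
 proof -
  have T: "orthogonal_transformation (uminus :: real^3 => _)" by (simp add: orthogonal_transformation_def linear_iff)
  have im: "uminus ` B = B" using image_orthogonal_transformation_cball[OF T, of 0 R] by (simp add: B_def)
  have "integral B ?f = integral (uminus ` B) ?f" by (simp add: im)
  also have "\<dots> = integral B (%w. ?f (- w))"
   using integral_linear_image[OF orthogonal_transformation_linear[OF T] B(1), of ?f] cf(1) im T by simp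
  finally show ?thesis by simp
 qed
 have "integral B ?h = integral B (%w. ?f w - (w \<bullet> x) * (1 / norm (x + w)))" by (simp add: right_diff_distrib)
 also have "\<dots> = integral B ?f - integral B (%w. (w \<bullet> x) * (1 / norm (x + w)))"
  using cf B(1) by (intro integral_diff compact_integrable(1))
 also have "\<dots> = 2 * (moment x \<bullet> x)" using refl by (simp add: moment_inner[OF x(1)])
 finally have mh: "2 * (moment x \<bullet> x) = integral B ?h" by simp
 have eq: "?h w = 4 * (w \<bullet> x)\<^sup>2 / (norm (x - w) * norm (x + w) * (norm (x - w) + norm (x + w)))" if w: "w \<in> B" for w
 proof -
  have n: "norm (x - w) > 0" "norm (x + w) > 0" using outside_ne[OF x(1) w] xw[OF w] by auto
  have "(norm (x + w))\<^sup>2 - (norm (x - w))\<^sup>2 = 4 * (w \<bullet> x)"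
   by (simp add: power2_norm_eq_inner inner_add_left inner_add_right inner_diff_left inner_diff_right inner_commute)
  then have "(norm (x + w) - norm (x - w)) * (norm (x - w) + norm (x + w)) = 4 * (w \<bullet> x)"
   by (simp add: algebra_simps power2_eq_square)
  with n have "norm (x + w) - norm (x - w) = 4 * (w \<bullet> x) / (norm (x - w) + norm (x + w))"
   by (intro nonzero_eq_divide_eq[THEN iffD2]) linarith+
  moreover have "1 / norm (x - w) - 1 / norm (x + w) = (norm (x + w) - norm (x - w)) / (norm (x - w) * norm (x + w))"
   using n by (simp add: field_simps)
  ultimately show ?thesis using n by (simp add: power2_eq_square mult_ac)
 qed
 have h0: "?h w \<ge> 0" if "w \<in> B" for w unfolding eq[OF that] by simp
 \<comment> \<open>A smaller ball on the side of \<open>x\<close>. On it \<open>w $ 1\<close> is at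
   least \<open>R / 4\<close> and both distances are at most \<open>3 R\<close>, which gives the
   positive lower bound \<open>m\<close>.\<close>
 define C where "C = cball ((R / 2) *\<^sub>R axis 1 1 :: real^3) (R / 4)"
 have CB: "C \<subseteq> B" unfolding C_def B_def using R by (simp add: cball_subset_cball_iff dist_norm)
 define m where "m = 4 * (R^2 / 2)\<^sup>2 / (3 * R * (3 * R) * (3 * R + 3 * R))"
 have hm: "m <= ?h w" if w: "w \<in> C" for w
 proof -
  have wB: "w \<in> B" using w CB by auto
  have n: "norm (x - w) > 0" "norm (x + w) > 0" using outside_ne[OF x(1) wB] xw[OF wB] by auto
  have "norm ((R / 2) *\<^sub>R axis 1 1 - w) <= R / 4" using w by (simp add: C_def dist_norm)
  then have "\<bar>((R / 2) *\<^sub>R axis 1 1 - w) $ 1\<bar> <= R / 4" using component_le_norm_cart order_trans by blast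
  then have "w $ 1 \<ge> R / 4" unfolding abs_le_iff vector_minus_component vector_scaleR_component by (simp add: axis_def)
  then have "R / 4 * (2 * R) <= w $ 1 * (2 * R)" using R by (intro mult_right_mono) auto
  then have "R^2 / 2 <= w \<bullet> x" by (simp add: x_def inner_axis power2_eq_square mult.commute)
  moreover have "norm (x - w) <= 3 * R" "norm (x + w) <= 3 * R"
   using dist_ge(2)[of w x] dist_ge(2)[of "- w" x] wB x by (auto simp: in_B)
  ultimately show ?thesis unfolding eq[OF wB] m_def using n R
   by (intro frac_le mult_left_mono power_mono mult_mono add_mono mult_nonneg_nonneg mult_pos_pos add_pos_pos) auto
 qed
 have "m > 0" using R by (simp add: m_def)
 have C: "C \<in> lmeasurable" "measure lebesgue C > 0" using R by (auto simp: C_def content_cball_pos lmeasurable_cball)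
 have "0 < m * measure lebesgue C" using C \<open>m > 0\<close> by simp
 also have "\<dots> = integral C (%_. m)" using lmeasure_integral[OF C(1)] integral_mult_right[of C m "%_. 1"] by simp
 also have "\<dots> <= integral C ?h"
  using hm C by (intro integral_le integrable_on_const compact_integrable(1) continuous_on_subset[OF cf(2) CB]) (auto simp: C_def)
 also have "\<dots> <= integral B ?h"
  using h0 by (intro integral_subset_le CB compact_integrable(1) continuous_on_subset[OF cf(2) CB] cf B) (auto simp: C_def)
 finally have "0 < moment x \<bullet> x" using mh by simp
 also have "moment x \<bullet> x = c / norm x" using c[OF x(1)] x R by (simp add: power2_norm_eq_inner[symmetric] power2_eq_square power3_eq_cube)
 finally have "c > 0" using x R by (simp add: zero_less_divide_iff)
 then show thesis using c that by blast
qed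

end

section \<open>Averages over the body\<close>


text \<open>The semiaxes are those of the body: \<open>1 - 2/3 e P2 (sin \<phi>)\<close> equals
  \<open>1 + e/3\<close> on the equator and \<open>1 - 2e/3\<close> at the poles.\<close>

definition stretch :: "real => real^3 => real^3" where
 "stretch e w = vector [(1 + e / 3) * w $ 1, (1 + e / 3) * w $ 2, (1 - 2 * e / 3) * w $ 3]"

lemma norm_vec3: "(norm (x :: real^3))\<^sup>2 = (x $ 1)\<^sup>2 + (x $ 2)\<^sup>2 + (x $ 3)\<^sup>2"
 unfolding power2_norm_eq_inner by (simp add: inner_vec_def sum_3 power2_eq_square)

lemma stretch_nth [simp]: "stretch e w $ 1 = (1 + e / 3) * w $ 1" "stretch e w $ 2 = (1 + e / 3) * w $ 2"
 "stretch e w $ 3 = (1 - 2 * e / 3) * w $ 3"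
 by (simp_all add: stretch_def)

lemma stretch_linear: "linear (stretch e)"
 by (rule linearI) (simp_all add: vec_eq_iff forall_3 algebra_simps)

lemma stretch_0: "stretch 0 = (%w. w)"
 by (simp add: fun_eq_iff vec_eq_iff forall_3)

lemma det_stretch: "det (matrix (stretch e)) = (1 + e / 3)\<^sup>2 * (1 - 2 * e / 3)"
 by (simp add: det_3 matrix_def axis_def power2_eq_square)

lemma norm_stretch_le: "norm (stretch e w) <= (1 + \<bar>e\<bar>) * norm w"
proof (rule power2_le_imp_le)
 have a: "(1 + e / 3)\<^sup>2 <= (1 + \<bar>e\<bar>)\<^sup>2" "(1 - 2 * e / 3)\<^sup>2 <= (1 + \<bar>e\<bar>)\<^sup>2"
  by (auto simp: abs_le_square_iff[symmetric] abs_if)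
 have "(norm (stretch e w))\<^sup>2 = (1 + e / 3)\<^sup>2 * (w $ 1)\<^sup>2 + (1 + e / 3)\<^sup>2 * (w $ 2)\<^sup>2 + (1 - 2 * e / 3)\<^sup>2 * (w $ 3)\<^sup>2"
  by (simp add: norm_vec3 power_mult_distrib)
 also have "\<dots> <= (1 + \<bar>e\<bar>)\<^sup>2 * (w $ 1)\<^sup>2 + (1 + \<bar>e\<bar>)\<^sup>2 * (w $ 2)\<^sup>2 + (1 + \<bar>e\<bar>)\<^sup>2 * (w $ 3)\<^sup>2"
  using a by (intro add_mono mult_right_mono) auto
 also have "\<dots> = ((1 + \<bar>e\<bar>) * norm w)\<^sup>2" by (simp add: power_mult_distrib norm_vec3 distrib_left)
 finally show "(norm (stretch e w))\<^sup>2 <= ((1 + \<bar>e\<bar>) * norm w)\<^sup>2" .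
qed simp

lemma norm_spherical:
 assumes "\<rho> \<ge> 0" shows "norm (spherical \<rho> \<theta> \<phi>) = \<rho>"
proof -
 have "(norm (spherical \<rho> \<theta> \<phi>))\<^sup>2 = \<rho>^2 * ((cos \<phi>)\<^sup>2 * ((cos \<theta>)\<^sup>2 + (sin \<theta>)\<^sup>2) + (sin \<phi>)\<^sup>2)"
  by (simp add: norm_vec3 spherical_def algebra_simps power_mult_distrib del: sin_cos_squared_add sin_cos_squared_add2)
 also have "\<dots> = \<rho>^2" by simp
 finally show ?thesis using assms by simp
qed

text \<open>Multiplying the bound on the radius by \<open>\<rho>^2\<close> removes the angles. The
  bound on \<open>e\<close> keeps the radius nonnegative at latitude zero, so that the origin, which
  satisfies the polynomial inequality trivially, belongs to the body.\<close>

lemma ellipsoid_iff: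
 assumes R: "R > 0" and e: "\<bar>e\<bar> <= 1 / 2"
 shows "y \<in> ellipsoid R e \<longleftrightarrow> norm y ^ 3 <= R * ((1 + e / 3) * (norm y)\<^sup>2 - e * (y $ 3)\<^sup>2)"
proof
 assume "y \<in> ellipsoid R e"
 then obtain \<rho> \<theta> \<phi> where y: "y = spherical \<rho> \<theta> \<phi>" "0 <= \<rho>" "\<rho> <= R * (1 - 2 / 3 * e * P2 (sin \<phi>))"
  unfolding ellipsoid_def by blast
 have n: "norm y = \<rho>" "y $ 3 = \<rho> * sin \<phi>" using y norm_spherical by (auto simp: spherical_def)
 have "\<rho>^2 * \<rho> <= \<rho>^2 * (R * (1 - 2 / 3 * e * P2 (sin \<phi>)))" using y(3) by (intro mult_left_mono) auto
 then show "norm y ^ 3 <= R * ((1 + e / 3) * (norm y)\<^sup>2 - e * (y $ 3)\<^sup>2)"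
  unfolding n P2_def by (simp add: field_simps power2_eq_square power3_eq_cube)
next
 assume h: "norm y ^ 3 <= R * ((1 + e / 3) * (norm y)\<^sup>2 - e * (y $ 3)\<^sup>2)"
 show "y \<in> ellipsoid R e"
 proof (cases "y = 0")
  case True
  have "y = spherical 0 0 0" using True by (simp add: spherical_def vec_eq_iff forall_3)
  moreover have "0 <= R * (1 - 2 / 3 * e * P2 (sin 0))" using R e by (simp add: P2_def)
  ultimately show ?thesis unfolding ellipsoid_def by (intro CollectI exI[of _ 0]) auto
 next
  case False
  define \<rho> where "\<rho> = norm y"
  define \<phi> where "\<phi> = arcsin (y $ 3 / \<rho>)"
  define z where "z = Complex (y $ 1) (y $ 2)"
  have \<rho>: "\<rho> > 0" using False by (simp add: \<rho>_def)
  have "\<bar>y $ 3\<bar> <= \<rho>" unfolding \<rho>_def by (rule component_le_norm_cart)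
  then have b: "- 1 <= y $ 3 / \<rho>" "y $ 3 / \<rho> <= 1" using \<rho> by (auto simp: field_simps)
  have s: "sin \<phi> = y $ 3 / \<rho>" using b by (simp add: \<phi>_def)
  have phi: "- pi / 2 <= \<phi>" "\<phi> <= pi / 2" using arcsin_bounded[OF b] by (auto simp: \<phi>_def)
  have "\<rho> * cos \<phi> = cmod z"
  proof -
   have "cos \<phi> \<ge> 0" using phi by (intro cos_ge_zero) auto
   moreover have "(\<rho> * cos \<phi>)\<^sup>2 = (cmod z)\<^sup>2"
   proof -
    have "(\<rho> * cos \<phi>)\<^sup>2 = \<rho>^2 - (\<rho> * sin \<phi>)\<^sup>2" by (simp add: power_mult_distrib cos_squared_eq algebra_simps)
    also have "\<dots> = (y $ 1)\<^sup>2 + (y $ 2)\<^sup>2" using \<rho> unfolding s by (simp add: \<rho>_def norm_vec3)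
    finally show ?thesis by (simp add: z_def cmod_power2)
   qed
   ultimately show ?thesis using \<rho> by (metis abs_norm_cancel abs_of_nonneg mult_nonneg_nonneg less_imp_le norm_ge_zero power2_eq_iff_nonneg)
  qed
  moreover have "rcis (cmod z) (Arg z) = z" by (rule rcis_cmod_Arg)
  ultimately have "rcis (\<rho> * cos \<phi>) (Arg z) = z" by simp
  then have "\<rho> * cos \<phi> * cos (Arg z) = y $ 1" "\<rho> * cos \<phi> * sin (Arg z) = y $ 2"
   by (auto simp: complex_eq_iff z_def)
  then have y: "y = spherical \<rho> (Arg z) \<phi>"
   using s \<rho> by (simp add: spherical_def vec_eq_iff forall_3 mult_ac)
  have "\<rho>^2 * \<rho> <= \<rho>^2 * (R * (1 - 2 / 3 * e * P2 (sin \<phi>)))"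
   proof -
   have "\<rho>^2 * (R * (1 - 2 / 3 * e * ((3 * (y $ 3 / \<rho>)\<^sup>2 - 1) / 2))) = R * ((1 + e / 3) * \<rho>^2 - e * (y $ 3)\<^sup>2)"
    using \<rho> by (simp add: field_simps power2_eq_square)
   then show ?thesis
    using h unfolding P2_def s \<rho>_def[symmetric] by (simp only:) (simp add: power2_eq_square power3_eq_cube)
  qed
  then have "\<rho> <= R * (1 - 2 / 3 * e * P2 (sin \<phi>))" using \<rho> by (simp add: mult_le_cancel_left_pos)
  then show ?thesis unfolding ellipsoid_def using y phi \<rho> by fastforce
 qed
qed

text \<open>
 Up to second order in \<open>e\<close>, the body is the linear image of the ball under \<open>stretch e\<close>: with
 \<open>\<alpha> = 1 + e/3\<close> and \<open>\<beta> = 1 - 2e/3\<close> the defining inequality becomes a comparison of weighted power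
 means of \<open>\<alpha>\<close> and \<open>\<beta>\<close>, which differ by \<open>O((\<alpha> - \<beta>)\<^sup>2)\<close>.
\<close>

lemma power_mean_identity:
 fixes a b \<alpha> \<beta> :: real
 shows "(a + b) * (\<alpha> ^ 3 * a + \<beta> ^ 3 * b)\<^sup>2 = (\<alpha>\<^sup>2 * a + \<beta>\<^sup>2 * b) ^ 3
  + (\<alpha> - \<beta>)\<^sup>2 * (a^2 * b * \<alpha> ^ 3 * (\<alpha> + 2 * \<beta>) + a * b^2 * \<beta> ^ 3 * (\<beta> + 2 * \<alpha>))"
 by algebra

text \<open>Squaring the cubic inequality leaves even powers of the coordinates only, in the shape
  to which \<open>power_mean_identity\<close> applies.\<close>

lemma stretch_in_ellipsoid_iff:
 assumes R: "R > 0" and e: "\<bar>e\<bar> <= 1 / 2"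
 defines "a w \<equiv> (w $ 1)\<^sup>2 + (w $ 2)\<^sup>2" and "b w \<equiv> (w $ 3)\<^sup>2"
 shows "stretch e w \<in> ellipsoid R e \<longleftrightarrow>
  ((1 + e / 3)\<^sup>2 * a w + (1 - 2 * e / 3)\<^sup>2 * b w) ^ 3 <= (R * ((1 + e / 3) ^ 3 * a w + (1 - 2 * e / 3) ^ 3 * b w))\<^sup>2"
proof -
 define \<alpha> \<beta> where "\<alpha> = 1 + e / 3" and "\<beta> = 1 - 2 * e / 3"
 have ab: "\<alpha> > 0" "\<beta> > 0" "e = \<alpha> - \<beta>" "a w \<ge> 0" "b w \<ge> 0" using e by (auto simp: \<alpha>_def \<beta>_def a_def b_def)
 have n2: "(norm (stretch e w))\<^sup>2 = \<alpha>\<^sup>2 * a w + \<beta>\<^sup>2 * b w"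
  by (simp add: norm_vec3 a_def b_def \<alpha>_def \<beta>_def power_mult_distrib distrib_left)
 have rhs: "R * ((1 + e / 3) * (norm (stretch e w))\<^sup>2 - e * (stretch e w $ 3)\<^sup>2) = R * (\<alpha> ^ 3 * a w + \<beta> ^ 3 * b w)"
 proof -
  have "(1 + e / 3) * (norm (stretch e w))\<^sup>2 - e * (stretch e w $ 3)\<^sup>2 = \<alpha> * (\<alpha>\<^sup>2 * a w + \<beta>\<^sup>2 * b w) - (\<alpha> - \<beta>) * (\<beta>\<^sup>2 * b w)"
   proof -
   have z: "(stretch e w $ 3)\<^sup>2 = \<beta>\<^sup>2 * b w" by (simp add: b_def \<beta>_def power_mult_distrib)
   have e1: "1 + e / 3 = \<alpha>" by (simp add: \<alpha>_def)
   show ?thesis unfolding n2 z e1 ab(3)[symmetric] ..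
  qed
  also have "\<dots> = \<alpha> ^ 3 * a w + \<beta> ^ 3 * b w" by (simp add: algebra_simps power2_eq_square power3_eq_cube)
  finally show ?thesis by simp
 qed
 have "stretch e w \<in> ellipsoid R e \<longleftrightarrow> norm (stretch e w) ^ 3 <= R * (\<alpha> ^ 3 * a w + \<beta> ^ 3 * b w)"
  unfolding ellipsoid_iff[OF R e] rhs ..
 also have "\<dots> \<longleftrightarrow> (norm (stretch e w) ^ 3)\<^sup>2 <= (R * (\<alpha> ^ 3 * a w + \<beta> ^ 3 * b w))\<^sup>2"
  using abs_le_square_iff[of "norm (stretch e w) ^ 3" "R * (\<alpha> ^ 3 * a w + \<beta> ^ 3 * b w)"] ab(1,2,4,5) R by simp
 also have "(norm (stretch e w) ^ 3)\<^sup>2 = ((norm (stretch e w))\<^sup>2) ^ 3" by (simp only: power_mult[symmetric] mult.commute)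
 finally show ?thesis by (simp only: n2 \<alpha>_def \<beta>_def)
qed

text \<open>The correction term in \<open>power_mean_identity\<close> is nonnegative for either sign
  of \<open>e\<close>.\<close>

lemma ellipsoid_inner:
 assumes R: "R > 0" and e: "\<bar>e\<bar> <= 1 / 2"
 shows "stretch e ` cball 0 R \<subseteq> ellipsoid R e"
proof
 fix y assume "y \<in> stretch e ` cball 0 R"
 then obtain w where w: "y = stretch e w" "norm w <= R" by auto
 define \<alpha> \<beta> a b where "\<alpha> = 1 + e / 3" and "\<beta> = 1 - 2 * e / 3" and "a = (w $ 1)\<^sup>2 + (w $ 2)\<^sup>2" and "b = (w $ 3)\<^sup>2"
 have ab: "\<alpha> > 0" "\<beta> > 0" "a \<ge> 0" "b \<ge> 0" using e by (auto simp: \<alpha>_def \<beta>_def a_def b_def)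
 have r: "a + b <= R^2" using w(2) power_mono[OF w(2), of 2] by (simp add: norm_vec3 a_def b_def)
 have "(\<alpha>\<^sup>2 * a + \<beta>\<^sup>2 * b) ^ 3 <= (a + b) * (\<alpha> ^ 3 * a + \<beta> ^ 3 * b)\<^sup>2"
  unfolding power_mean_identity using ab by simp
 also have "\<dots> <= R^2 * (\<alpha> ^ 3 * a + \<beta> ^ 3 * b)\<^sup>2" using r by (intro mult_right_mono) auto
 finally show "y \<in> ellipsoid R e"
  unfolding w(1) stretch_in_ellipsoid_iff[OF R e] by (simp add: \<alpha>_def \<beta>_def a_def b_def power_mult_distrib)
qed

text \<open>The correction term in \<open>power_mean_identity\<close> is at most
  \<open>120 e^2 (a + b) M^2\<close>, whence \<open>|w|^2 (1 - 120 e^2) <= R^2\<close>; for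
  \<open>|e| <= 1/16\<close> the inverse of \<open>1 - 120 e^2\<close> is at most
  \<open>1 + 240 e^2\<close>. The factor 120 is 10 times 12, from \<open>x^3 (x + 2 z) <= 10\<close>
  and \<open>(a + b)^2 <= 12 M^2\<close>.\<close>

lemma ellipsoid_outer:
 assumes R: "R > 0" and e: "\<bar>e\<bar> <= 1 / 16"
 shows "ellipsoid R e \<subseteq> stretch e ` cball 0 (R * (1 + 240 * e^2))"
proof
 fix y assume y: "y \<in> ellipsoid R e"
 define \<alpha> \<beta> where "\<alpha> = 1 + e / 3" and "\<beta> = 1 - 2 * e / 3"
 define w :: "real^3" where "w = vector [y $ 1 / \<alpha>, y $ 2 / \<alpha>, y $ 3 / \<beta>]"
 define a b where "a = (w $ 1)\<^sup>2 + (w $ 2)\<^sup>2" and "b = (w $ 3)\<^sup>2"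
 have ab: "2 / 3 <= \<alpha>" "\<alpha> <= 4 / 3" "2 / 3 <= \<beta>" "\<beta> <= 4 / 3" "a \<ge> 0" "b \<ge> 0" "\<alpha> - \<beta> = e"
  using e by (auto simp: \<alpha>_def \<beta>_def a_def b_def abs_le_iff)
 have yw: "y = stretch e w"
  using ab by (simp add: w_def vec_eq_iff forall_3 \<alpha>_def[symmetric] \<beta>_def[symmetric])
 have e2: "240 * e^2 <= 1" "\<bar>e\<bar> <= 1 / 2"
 proof -
  have "e^2 <= (1 / 16)\<^sup>2" using e by (simp add: abs_le_square_iff[symmetric])
  then show "240 * e^2 <= 1" by (simp add: power2_eq_square)
 qed (use e in auto)
 have n: "(norm w)\<^sup>2 = a + b" by (simp add: norm_vec3 a_def b_def)
 show "y \<in> stretch e ` cball 0 (R * (1 + 240 * e^2))"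
 proof (cases "w = 0")
  case True
  then show ?thesis using yw R by (auto intro!: image_eqI[of _ _ w])
 next
  case False
  define M where "M = \<alpha> ^ 3 * a + \<beta> ^ 3 * b"
  have s: "a + b > 0" using n False by (metis zero_less_norm_iff zero_less_power)
  have cube: "x ^ 3 \<ge> 8 / 27" if "2 / 3 <= x" for x :: real
   using power_mono[OF that, of 3] by (simp add: power3_eq_cube)
  have M: "8 / 27 * (a + b) <= M"
   unfolding M_def distrib_left using cube ab by (intro add_mono mult_right_mono) auto
  then have "(8 / 27 * (a + b))\<^sup>2 <= M^2" using s by (intro power_mono) auto
  moreover have "(8 / 27 * (a + b))\<^sup>2 = 64 / 729 * (a + b)\<^sup>2" by (subst power_mult_distrib) (simp add: power_divide)
  ultimately have M2: "(a + b)\<^sup>2 <= 12 * M^2" using zero_le_power2[of M] by linarith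
  have "0 < 8 / 27 * (a + b)" using s by simp
  then have "M > 0" using M by (rule less_le_trans)
  have q: "x ^ 3 * (x + 2 * z) <= 10" if "2 / 3 <= x" "x <= 4 / 3" "2 / 3 <= z" "z <= 4 / 3" for x z :: real
  proof -
   have "x ^ 3 * (x + 2 * z) <= (4 / 3) ^ 3 * (4 / 3 + 2 * (4 / 3))" using that by (intro mult_mono power_mono add_mono) auto
   then show ?thesis by (simp add: power3_eq_cube)
  qed
  have y3: "(\<alpha>\<^sup>2 * a + \<beta>\<^sup>2 * b) ^ 3 <= R^2 * M^2"
   using y unfolding yw stretch_in_ellipsoid_iff[OF R e2(2)] by (simp add: \<alpha>_def \<beta>_def a_def b_def M_def power_mult_distrib)
  have "a^2 * b * \<alpha> ^ 3 * (\<alpha> + 2 * \<beta>) + a * b^2 * \<beta> ^ 3 * (\<beta> + 2 * \<alpha>)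
    = a^2 * b * (\<alpha> ^ 3 * (\<alpha> + 2 * \<beta>)) + a * b^2 * (\<beta> ^ 3 * (\<beta> + 2 * \<alpha>))" by (simp add: mult_ac)
  also have "\<dots> <= a^2 * b * 10 + a * b^2 * 10" using ab q by (intro add_mono mult_left_mono) auto
  also have "\<dots> <= 10 * (a + b) ^ 3"
  proof -
   have "10 * (a + b) ^ 3 - (a^2 * b * 10 + a * b^2 * 10) = 10 * a ^ 3 + 20 * a^2 * b + 20 * a * b^2 + 10 * b ^ 3"
    by (simp add: power2_eq_square power3_eq_cube algebra_simps)
   also have "\<dots> \<ge> 0" using ab by simp
   finally show ?thesis by simp
  qed
  also have "\<dots> = 10 * ((a + b) * (a + b)\<^sup>2)" by (simp add: power2_eq_square power3_eq_cube)
  also have "\<dots> <= 10 * ((a + b) * (12 * M^2))" using M2 s by (intro mult_left_mono) auto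
  finally have rem: "a^2 * b * \<alpha> ^ 3 * (\<alpha> + 2 * \<beta>) + a * b^2 * \<beta> ^ 3 * (\<beta> + 2 * \<alpha>) <= 10 * ((a + b) * (12 * M^2))" .
  have "(a + b) * M^2 <= R^2 * M^2 + e^2 * (10 * ((a + b) * (12 * M^2)))"
   using power_mean_identity[of a b \<alpha> \<beta>] y3 mult_left_mono[OF rem, of "e^2"] by (simp add: M_def ab(7))
  then have "((a + b) * (1 - 120 * e^2)) * M^2 <= R^2 * M^2" by (simp add: algebra_simps)
  then have r: "(a + b) * (1 - 120 * e^2) <= R^2" using \<open>M > 0\<close> by (simp add: mult_le_cancel_right)
  have "1 <= (1 - 120 * e^2) * (1 + 240 * e^2)"
  proof -
   have "(1 - 120 * e^2) * (1 + 240 * e^2) - 1 = 120 * e^2 * (1 - 240 * e^2)" by (simp add: algebra_simps)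
   also have "\<dots> \<ge> 0" using e2 by simp
   finally show ?thesis by simp
  qed
  then have "(a + b) * 1 <= (a + b) * ((1 - 120 * e^2) * (1 + 240 * e^2))" using s by (intro mult_left_mono) auto
  also have "\<dots> <= R^2 * (1 + 240 * e^2)" using r mult_right_mono[OF r, of "1 + 240 * e^2"] by (simp add: mult.assoc)
  also have "\<dots> <= R^2 * ((1 + 240 * e^2) * (1 + 240 * e^2))" by (intro mult_left_mono) (auto simp: algebra_simps)
  also have "\<dots> = (R * (1 + 240 * e^2))\<^sup>2"
   by (simp only: power_mult_distrib power2_eq_square[of "1 + 240 * e^2"])
  finally have "(norm w)\<^sup>2 <= (R * (1 + 240 * e^2))\<^sup>2" using n by simp
  then have "norm w <= R * (1 + 240 * e^2)"
   by (rule power2_le_imp_le) (intro mult_nonneg_nonneg add_nonneg_nonneg, use R in simp_all)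
  then show ?thesis unfolding yw by (intro imageI) simp
 qed
qed

lemma ellipsoid_0: "R > 0 ==> ellipsoid R 0 = cball 0 R"
 using ellipsoid_inner[of R 0] ellipsoid_outer[of R 0] by (simp add: stretch_0)

lemma ellipsoid_norm_le:
 assumes R: "R > 0" and e: "\<bar>e\<bar> <= 1 / 16" and y: "y \<in> ellipsoid R e"
 shows "norm y <= (1 + \<bar>e\<bar>) * (R * (1 + 240 * e^2))"
proof -
 obtain w where w: "y = stretch e w" "norm w <= R * (1 + 240 * e^2)" using ellipsoid_outer[OF R e] y by auto
 have "norm y <= (1 + \<bar>e\<bar>) * norm w" using norm_stretch_le w by simp
 also have "\<dots> <= (1 + \<bar>e\<bar>) * (R * (1 + 240 * e^2))" using w by (intro mult_left_mono) auto
 finally show ?thesis .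
qed

lemma ellipsoid_compact:
 assumes R: "R > 0" and e: "\<bar>e\<bar> <= 1 / 16" shows "compact (ellipsoid R e)"
proof -
 have "ellipsoid R e = {y. norm y ^ 3 <= R * ((1 + e / 3) * (norm y)\<^sup>2 - e * (y $ 3)\<^sup>2)}"
  using ellipsoid_iff[OF R, of e] e by auto
 moreover have "closed {y :: real^3. norm y ^ 3 <= R * ((1 + e / 3) * (norm y)\<^sup>2 - e * (y $ 3)\<^sup>2)}"
  by (intro closed_Collect_le continuous_intros)
 moreover have "bounded (ellipsoid R e)"
  unfolding bounded_iff using ellipsoid_norm_le[OF R e] by blast
 ultimately show ?thesis by (simp add: compact_eq_bounded_closed)
qed

section \<open>Means over the body compared with means over the stretched ball\<close>

context homogeneous_ball
begin

definition avg :: "real => (real^3 => real) => real" where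
 "avg e f = integral (ellipsoid R e) f / measure lebesgue (ellipsoid R e)"

lemma measure_stretch:
 assumes e: "\<bar>e\<bar> <= 1 / 2" and k: "k \<ge> 0"
 shows "measure lebesgue (stretch e ` cball 0 (R * k)) = det (matrix (stretch e)) * (k ^ 3 * \<mu>)" "det (matrix (stretch e)) > 0"
proof -
 show d: "det (matrix (stretch e)) > 0" unfolding det_stretch using e by (intro mult_pos_pos zero_less_power) auto
 have "measure lebesgue (stretch e ` cball 0 (R * k)) = \<bar>det (matrix (stretch e))\<bar> * measure lebesgue (cball 0 (R * k) :: (real^3) set)"
  by (rule measure_linear_image[OF stretch_linear]) auto
 also have "measure lebesgue (cball 0 (R * k) :: (real^3) set) = k ^ 3 * \<mu>"
  using R k by (simp add: \<mu>_def B_def content_cball power_mult_distrib)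
 finally show "measure lebesgue (stretch e ` cball 0 (R * k)) = det (matrix (stretch e)) * (k ^ 3 * \<mu>)" using d by simp
qed

text \<open>Stretched ball and body are nested, and their volumes differ by a relative amount of at
  most 7 times \<open>240 e^2\<close>, since \<open>(1 + x)^3 - 1 <= 7 x\<close> on the unit
  interval. Numerator and denominator of the mean each contribute once, whence 3360. The error is
  linear in the bound \<open>M\<close>, which makes the estimate useful for differences of
  integrands as well.\<close>

lemma avg_stretch:
 assumes e: "\<bar>e\<bar> <= 1 / 16" and f: "continuous_on (cball 0 R2) f" and M: "\<And>v. norm v <= R2 ==> \<bar>f v\<bar> <= M"
  and R2: "(1 + \<bar>e\<bar>) * (R * (1 + 240 * e^2)) <= R2"
 shows "\<bar>avg e f - integral B (%w. f (stretch e w)) / \<mu>\<bar> <= 3360 * e^2 * M"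
proof -
 define Q where "Q = ellipsoid R e"
 define S where "S = stretch e ` B"
 define d where "d = det (matrix (stretch e))"
 define x where "x = 240 * e^2"
 have e2: "\<bar>e\<bar> <= 1 / 2" using e by simp
 have x: "0 <= x" "x <= 1"
 proof -
  have "e^2 <= (1 / 16)\<^sup>2" using e by (simp add: abs_le_square_iff[symmetric])
  then show "x <= 1" by (simp add: x_def power2_eq_square)
 qed (simp add: x_def)
 have Qc: "compact Q" unfolding Q_def using R e by (rule ellipsoid_compact)
 have Sc: "compact S" unfolding S_def
  using stretch_linear B(1) by (intro compact_continuous_image linear_continuous_on linear_conv_bounded_linear[THEN iffD1])
 have SQ: "S \<subseteq> Q" unfolding S_def Q_def using ellipsoid_inner[OF R e2] by (simp add: B_def)
 have QR: "Q \<subseteq> cball 0 R2" unfolding Q_def using ellipsoid_norm_le[OF R e] R2 by fastforce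
 have fQ: "continuous_on Q f" "continuous_on S f" using f QR SQ by (meson continuous_on_subset order_trans)+
 have mS: "measure lebesgue S = d * \<mu>" using measure_stretch(1)[OF e2, of 1] by (simp add: S_def B_def d_def)
 have d: "d > 0" using measure_stretch(2)[OF e2, of 1] by (simp add: d_def)
 have mQ: "measure lebesgue Q <= d * ((1 + x) ^ 3 * \<mu>)"
 proof -
  have "Q \<subseteq> stretch e ` cball 0 (R * (1 + x))" unfolding Q_def x_def by (rule ellipsoid_outer[OF R e])
  moreover have "stretch e ` cball 0 (R * (1 + x)) \<in> lmeasurable"
   by (intro lmeasurable_compact compact_continuous_image linear_continuous_on linear_conv_bounded_linear[THEN iffD1] stretch_linear) auto
  ultimately have "measure lebesgue Q <= measure lebesgue (stretch e ` cball 0 (R * (1 + x)))"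
   using Qc by (intro measure_mono_fmeasurable) (auto intro: lmeasurable_compact fmeasurableD)
  then show ?thesis using measure_stretch(1)[OF e2, of "1 + x"] x by (simp add: d_def)
 qed
 have SQm: "measure lebesgue S <= measure lebesgue Q"
  using SQ Qc Sc by (intro measure_mono_fmeasurable) (auto intro: lmeasurable_compact fmeasurableD)
 define \<delta> where "\<delta> = measure lebesgue Q - measure lebesgue S"
 have \<delta>: "0 <= \<delta>" "\<delta> <= (d * \<mu>) * (7 * x)"
 proof -
  have "(1 + x) ^ 3 - 1 <= 7 * x"
  proof -
   have "7 * x - ((1 + x) ^ 3 - 1) = x * (4 - 3 * x - x^2)" by (simp add: power3_eq_cube power2_eq_square algebra_simps)
   moreover have "x^2 <= 1" using x by (simp add: power_le_one)
   ultimately show ?thesis using x by (smt (verit) mult_nonneg_nonneg)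
  qed
  then have "(d * \<mu>) * ((1 + x) ^ 3 - 1) <= (d * \<mu>) * (7 * x)" using d B(3) by (intro mult_left_mono) auto
  then show "\<delta> <= (d * \<mu>) * (7 * x)" using mQ mS by (simp add: \<delta>_def algebra_simps)
 qed (use SQm in \<open>simp add: \<delta>_def\<close>)
 have M0: "M \<ge> 0"
 proof -
  have "0 \<in> B" using R by (simp add: in_B)
  then have "stretch e 0 \<in> Q" using SQ unfolding S_def by blast
  then have "norm (stretch e 0) <= R2" using QR by auto
  from M[OF this] show ?thesis by linarith
 qed
 have i: "f integrable_on Q" "f integrable_on S" using compact_integrable(1) Qc Sc fQ by auto
 have c: "(%_. M) integrable_on Q" "(%_. M) integrable_on S"
  using Qc Sc by (auto intro: integrable_on_const lmeasurable_compact)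
 have cm: "integral T (%_. M) = M * measure lebesgue T" if "compact T" for T :: "(real^3) set"
  using lmeasure_integral[OF lmeasurable_compact[OF that]] integral_mult_right[of T M "%_. 1"] by simp
 have bd: "\<bar>f v\<bar> <= M" if "v \<in> Q" for v using M[of v] QR that by auto
 have bd': "0 <= f v + M" "0 <= M - f v" if "v \<in> Q" for v using bd[OF that] by linarith+
 \<comment> \<open>\<open>f + M\<close> and \<open>M - f\<close> are nonnegative on
   \<open>Q\<close>, so their integrals grow with the domain; together they control the contribution
   of the shell between \<open>S\<close> and \<open>Q\<close>.\<close>
 have "integral S (%v. f v + M) <= integral Q (%v. f v + M)"
  using i c SQ bd' by (intro integral_subset_le integrable_add) auto
 then have lo: "integral S f - integral Q f <= M * \<delta>"
  using i c cm[OF Qc] cm[OF Sc] by (simp add: integral_add \<delta>_def algebra_simps)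
 have "integral S (%v. M - f v) <= integral Q (%v. M - f v)"
  using i c SQ bd' by (intro integral_subset_le integrable_diff) auto
 then have hi: "integral Q f - integral S f <= M * \<delta>"
  using i c cm[OF Qc] cm[OF Sc] by (simp add: integral_diff \<delta>_def algebra_simps)
 have v: "d * \<mu> > 0" "d * \<mu> + \<delta> > 0" using d B(3) \<delta>(1) by (auto intro: add_pos_nonneg)
 have IS: "\<bar>integral S f\<bar> <= M * (d * \<mu>)"
 proof -
  have "norm (integral S f) <= integral S (%_. M)"
   using i c bd SQ by (intro integral_norm_bound_integral) auto
  then show ?thesis using cm[OF Sc] mS by simp
 qed
 have avg: "avg e f = integral Q f / (d * \<mu> + \<delta>)" using mS by (simp add: avg_def Q_def[symmetric] \<delta>_def)
 have sub: "integral B (%w. f (stretch e w)) / \<mu> = integral S f / (d * \<mu>)"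
  using integral_linear_image[OF stretch_linear B(1), of e f] fQ(2) d by (simp add: S_def d_def)
 have "avg e f - integral B (%w. f (stretch e w)) / \<mu> = (integral Q f - integral S f) / (d * \<mu> + \<delta>) - integral S f * \<delta> / ((d * \<mu>) * (d * \<mu> + \<delta>))"
  proof -
  have "q / (t + \<delta>) - s / t = (q - s) / (t + \<delta>) - s * \<delta> / (t * (t + \<delta>))" if "t > 0" "t + \<delta> > 0" for q s t
   using that by (simp add: divide_simps) (simp add: algebra_simps)
  then show ?thesis unfolding avg sub using v by blast
 qed
 also have "\<bar>\<dots>\<bar> <= M * \<delta> / (d * \<mu>) + (M * (d * \<mu>)) * \<delta> / ((d * \<mu>) * (d * \<mu>))"
 proof (rule order_trans[OF abs_triangle_ineq4], rule add_mono)
  have "\<bar>integral Q f - integral S f\<bar> <= M * \<delta>" using lo hi by (simp add: abs_le_iff)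
  then show "\<bar>(integral Q f - integral S f) / (d * \<mu> + \<delta>)\<bar> <= M * \<delta> / (d * \<mu>)"
   unfolding abs_divide using v \<delta>(1) M0 by (intro frac_le) auto
  show "\<bar>integral S f * \<delta> / ((d * \<mu>) * (d * \<mu> + \<delta>))\<bar> <= (M * (d * \<mu>)) * \<delta> / ((d * \<mu>) * (d * \<mu>))"
   unfolding abs_divide abs_mult using v \<delta>(1) M0 IS d B(3) by (intro frac_le mult_mono mult_nonneg_nonneg) auto
 qed
 also have "\<dots> = 2 * M * (\<delta> / (d * \<mu>))" using v by (simp add: field_simps)
 also have "\<dots> <= 2 * M * (7 * x)"
 proof -
  have "\<delta> / (d * \<mu>) <= 7 * x" using \<delta>(2) v(1) by (simp add: divide_le_eq mult.commute)
  then show ?thesis using M0 by (intro mult_left_mono) auto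
 qed
 finally show ?thesis by (simp add: x_def mult_ac)
qed

lemma ulip_integral:
 fixes f :: "real => real^3 => 'y::metric_space => real"
 assumes "ulip B Y f" "\<forall>\<^sub>F e in nhds 0. \<forall>y\<in>Y. continuous_on B (%w. f e w y)"
 shows "ulip (UNIV :: unit set) Y (%e _ y. integral B (%w. f e w y))"
proof -
 obtain C where C: "C > 0" "\<forall>\<^sub>F e in nhds 0. \<forall>w\<in>B. \<forall>y\<in>Y. norm (f e w y) <= C \<and> (\<forall>y'\<in>Y. norm (f e w y - f e w y') <= C * dist y y')"
  using ulipE[OF assms(1)] .
 show ?thesis unfolding ulip_def
 proof (intro exI[of _ "C * \<mu>"])
  show "\<forall>\<^sub>F e in nhds 0. \<forall>w\<in>(UNIV :: unit set). \<forall>y\<in>Y. norm (integral B (%w. f e w y)) <= C * \<mu> \<and>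
    (\<forall>y'\<in>Y. norm (integral B (%w. f e w y) - integral B (%w. f e w y')) <= C * \<mu> * dist y y')"
   using C(2) assms(2)
  proof eventually_elim
   case (elim e)
   have i: "(%w. f e w y) integrable_on B" if "y \<in> Y" for y using compact_integrable(1)[OF B(1)] elim(2) that by blast
   show ?case
   proof (intro ballI conjI)
    fix y assume y: "y \<in> Y"
    have "norm (integral B (%w. f e w y)) <= integral B (%_. C)"
     using elim(1) y by (intro integral_norm_bound_integral i integrable_on_const B) auto
    then show "norm (integral B (%w. f e w y)) <= C * \<mu>" by (simp add: integral_const_B)
    fix y' assume y': "y' \<in> Y"
    have "norm (integral B (%w. f e w y - f e w y')) <= integral B (%_. C * dist y y')"
     using elim(1) y y' by (intro integral_norm_bound_integral integrable_diff i integrable_on_const B) auto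
    then show "norm (integral B (%w. f e w y) - integral B (%w. f e w y')) <= C * \<mu> * dist y y'"
     using i y y' by (simp add: integral_const_B integral_diff mult_ac)
   qed
  qed
 qed
qed

text \<open>The definition of \<open>expands\<close> does not say that its coefficients can be
  integrated. For \<open>e ~= 0\<close> they are difference quotients of continuous functions, and
  the one at \<open>e = 0\<close> is a uniform limit of these. The last remainder is reset to zero
  at \<open>e = 0\<close>, where it is multiplied by zero.\<close>

lemma expands_integral:
 fixes f :: "real => real^3 => 'y::metric_space => real"
 assumes f: "expands 2 B Y f" and c: "\<forall>\<^sub>F e in nhds 0. \<forall>y\<in>Y. continuous_on B (%w. f e w y)"
 shows "expands 2 (UNIV :: unit set) Y (%e _ y. integral B (%w. f e w y))"
proof -
 have two: "2 = Suc (Suc 0)" by simp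
 obtain g where g: "ulip B Y (%_. f 0)" "expands (Suc 0) B Y g"
  "\<forall>\<^sub>F e in nhds 0. \<forall>w\<in>B. \<forall>y\<in>Y. f e w y = f 0 w y + e *\<^sub>R g e w y"
  using f[unfolded two] by (rule expandsE)
 obtain h where h: "ulip B Y (%_. g 0)" "expands 0 B Y h"
  "\<forall>\<^sub>F e in nhds 0. \<forall>w\<in>B. \<forall>y\<in>Y. g e w y = g 0 w y + e *\<^sub>R h e w y"
  using g(2) by (rule expandsE)
 obtain C where C: "C > 0" "\<forall>\<^sub>F e in nhds 0. \<forall>w\<in>B. \<forall>y\<in>Y. norm (h e w y) <= C \<and> (\<forall>y'\<in>Y. norm (h e w y - h e w y') <= C * dist y y')"
  using ulipE[OF h(2)[unfolded expands.simps]] .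
 have c0: "continuous_on B (%w. f 0 w y)" if "y \<in> Y" for y using eventually_nhds_x_imp_x[OF c] that by blast
 have cg: "\<forall>\<^sub>F e in nhds 0. e ~= 0 --> (\<forall>y\<in>Y. continuous_on B (%w. g e w y))"
  using c g(3)
 proof eventually_elim
  case (elim e)
  show ?case
  proof (intro impI ballI)
   fix y assume e: "e ~= 0" and y: "y \<in> Y"
   have "continuous_on B (%w. (f e w y - f 0 w y) / e)" using elim(1) c0 y e by (intro continuous_intros) auto
   then show "continuous_on B (%w. g e w y)"
    by (rule continuous_on_eq) (use elim(2) y e in auto)
  qed
 qed
 have cg0: "continuous_on B (%w. g 0 w y)" if y: "y \<in> Y" for y
 proof (rule uniform_limit_theorem[where F = "at (0::real)"])
  show "\<forall>\<^sub>F e in at 0. continuous_on B (%w. g e w y)"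
   using cg y by (auto simp: eventually_at_filter elim: eventually_mono)
  show "uniform_limit B (%e w. g e w y) (%w. g 0 w y) (at 0)"
   unfolding uniform_limit_iff
  proof (intro allI impI)
   fix \<epsilon> :: real assume "\<epsilon> > 0"
   have "\<forall>\<^sub>F e in nhds (0::real). \<bar>e\<bar> < \<epsilon> / C"
    using \<open>\<epsilon> > 0\<close> C(1) by (auto simp: eventually_nhds_metric intro!: exI[of _ "\<epsilon> / C"])
   then have "\<forall>\<^sub>F e in nhds 0. \<forall>w\<in>B. dist (g e w y) (g 0 w y) < \<epsilon>"
    using C(2) h(3)
   proof eventually_elim
    case (elim e)
    show ?case
    proof
     fix w assume w: "w \<in> B"
     have "dist (g e w y) (g 0 w y) = \<bar>e\<bar> * \<bar>h e w y\<bar>" using elim(3) w y by (simp add: dist_norm abs_mult)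
     also have "\<dots> <= \<bar>e\<bar> * C" using elim(2) w y by (intro mult_left_mono) auto
     also have "\<dots> < \<epsilon>" using elim(1) C(1) by (simp add: pos_less_divide_eq)
     finally show "dist (g e w y) (g 0 w y) < \<epsilon>" .
    qed
   qed
   then show "\<forall>\<^sub>F e in at 0. \<forall>w\<in>B. dist (g e w y) (g 0 w y) < \<epsilon>"
    by (auto simp: eventually_at_filter elim: eventually_mono)
  qed
 qed simp
 define h' where "h' e w y = (if e = 0 then 0 else h e w y)" for e w y
 have ch: "\<forall>\<^sub>F e in nhds 0. \<forall>y\<in>Y. continuous_on B (%w. h' e w y)"
  using cg h(3)
 proof eventually_elim
  case (elim e)
  show ?case
  proof (cases "e = 0")
   case False
   show ?thesis
   proof
    fix y assume y: "y \<in> Y"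
    have "continuous_on B (%w. (g e w y - g 0 w y) / e)" using elim(1) cg0[OF y] y False by (intro continuous_intros) auto
    then show "continuous_on B (%w. h' e w y)"
     by (rule continuous_on_eq) (use elim(2) y False in \<open>auto simp: h'_def\<close>)
   qed
  qed (simp add: h'_def)
 qed
 have uh: "ulip B Y h'" unfolding ulip_def
 proof (intro exI[of _ C])
  show "\<forall>\<^sub>F e in nhds 0. \<forall>w\<in>B. \<forall>y\<in>Y. norm (h' e w y) <= C \<and> (\<forall>y'\<in>Y. norm (h' e w y - h' e w y') <= C * dist y y')"
   using C(2) by eventually_elim (use C(1) in \<open>auto simp: h'_def\<close>)
 qed
 have eqg: "\<forall>\<^sub>F e in nhds 0. \<forall>w\<in>B. \<forall>y\<in>Y. g e w y = g 0 w y + e * h' e w y"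
  using h(3) by eventually_elim (auto simp: h'_def)
 have ig: "expands (Suc 0) (UNIV :: unit set) Y (%e _ y. integral B (%w. g 0 w y) + e *\<^sub>R integral B (%w. h' e w y))"
 proof (rule expands_step[where g = "%e _ y. integral B (%w. h' e w y)"])
  show "ulip (UNIV :: unit set) Y (%_ _ y. integral B (%w. g 0 w y) + 0 *\<^sub>R integral B (%w. h' 0 w y))"
   using ulip_integral[OF h(1)] cg0 by simp
  show "expands 0 (UNIV :: unit set) Y (%e _ y. integral B (%w. h' e w y))"
   unfolding expands.simps by (rule ulip_integral[OF uh ch])
 qed simp
 have "expands (Suc (Suc 0)) (UNIV :: unit set) Y (%e _ y. integral B (%w. f e w y))"
 proof (rule expands_step[OF _ ig])
  show "ulip (UNIV :: unit set) Y (%_ _ y. integral B (%w. f 0 w y))"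
   using ulip_integral[OF g(1)] c0 by simp
  show "\<forall>\<^sub>F e in nhds 0. \<forall>w\<in>(UNIV :: unit set). \<forall>y\<in>Y. integral B (%w. f e w y) = integral B (%w. f 0 w y) +
    e *\<^sub>R (integral B (%w. g 0 w y) + e *\<^sub>R integral B (%w. h' e w y))"
   using g(3) eqg ch
  proof eventually_elim
   case (elim e)
   show ?case
   proof (intro ballI)
    fix y assume y: "y \<in> Y"
    have "integral B (%w. f e w y) = integral B (%w. f 0 w y + e * (g 0 w y + e * h' e w y))"
     by (rule integral_cong) (use elim y in auto)
    also have "\<dots> = integral B (%w. f 0 w y) + integral B (%w. e * (g 0 w y + e * h' e w y))"
     using y c0 cg0 elim(3) by (intro integral_add compact_integrable(1)[OF B(1)] continuous_intros) auto
    also have "integral B (%w. e * (g 0 w y + e * h' e w y)) = e * integral B (%w. g 0 w y + e * h' e w y)" by simp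
    also have "integral B (%w. g 0 w y + e * h' e w y) = integral B (%w. g 0 w y) + integral B (%w. e * h' e w y)"
     using y cg0 elim(3) by (intro integral_add compact_integrable(1)[OF B(1)] continuous_intros) auto
    finally show "integral B (%w. f e w y) = integral B (%w. f 0 w y) +
     e *\<^sub>R (integral B (%w. g 0 w y) + e *\<^sub>R integral B (%w. h' e w y))" by simp
   qed
  qed
 qed
 then show ?thesis by (simp only: two)
qed

text \<open>The mean over the body is the mean over the stretched ball plus \<open>e^2 T\<close>.
  Applied to \<open>\<kappa> y\<close> the estimate \<open>avg_stretch\<close> bounds
  \<open>T\<close>; applied to the difference of \<open>\<kappa> y\<close> and
  \<open>\<kappa> y'\<close> it makes \<open>T\<close> Lipschitz. An error of this size changes
  neither the value nor the derivative at \<open>e = 0\<close>.\<close>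

theorem expands_avg:
 fixes \<kappa> :: "'y::metric_space => real^3 => real"
 assumes R2: "R2 > R"
  and st: "expands 2 B Y (%e w y. \<kappa> y (stretch e w))"
  and lip: "ulip (cball 0 R2) Y (%_ v y. \<kappa> y v)"
  and cont: "\<And>y. y \<in> Y ==> continuous_on (cball 0 R2) (\<kappa> y)"
 shows "expands 2 (UNIV :: unit set) Y (%e _ y. avg e (\<kappa> y))"
  "\<And>y. y \<in> Y ==> avg 0 (\<kappa> y) = integral B (\<kappa> y) / \<mu>"
  "\<And>y d. y \<in> Y ==> ((%e. integral B (%w. \<kappa> y (stretch e w)) / \<mu>) has_real_derivative d) (at 0) ==>
    ((%e. avg e (\<kappa> y)) has_real_derivative d) (at 0)"
proof -
 define H where "H e y = integral B (%w. \<kappa> y (stretch e w)) / \<mu>" for e y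
 obtain C where C: "C > 0" "\<forall>\<^sub>F e in nhds (0::real). \<forall>v\<in>cball 0 R2. \<forall>y\<in>Y. norm (\<kappa> y v) <= C \<and> (\<forall>y'\<in>Y. norm (\<kappa> y v - \<kappa> y' v) <= C * dist y y')"
  using ulipE[OF lip] .
 have \<kappa>: "norm (\<kappa> y v) <= C" "y' \<in> Y ==> norm (\<kappa> y v - \<kappa> y' v) <= C * dist y y'" if "norm v <= R2" "y \<in> Y" for v y y'
  using eventually_nhds_x_imp_x[OF C(2)] that by auto
 have "((%e. (1 + \<bar>e\<bar>) * (R * (1 + 240 * e^2))) \<longlongrightarrow> (1 + \<bar>0\<bar>) * (R * (1 + 240 * 0\<^sup>2))) (nhds (0::real))"
  by (intro tendsto_intros filterlim_ident)
 then have "\<forall>\<^sub>F e in nhds 0. (1 + \<bar>e\<bar>) * (R * (1 + 240 * e^2)) < R2" using R2 by (intro order_tendstoD(2)) auto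
 moreover have "\<forall>\<^sub>F e in nhds (0::real). \<bar>e\<bar> <= 1 / 16" by (auto simp: eventually_nhds_metric intro!: exI[of _ "1 / 16"])
 ultimately have small: "\<forall>\<^sub>F e in nhds 0. (1 + \<bar>e\<bar>) * (R * (1 + 240 * e^2)) <= R2 \<and> \<bar>e\<bar> <= 1 / 16"
  by eventually_elim auto
 have cs: "continuous_on B (%w. \<kappa> y (stretch e w))" "stretch e ` B \<subseteq> cball 0 R2" if "y \<in> Y" "(1 + \<bar>e\<bar>) * (R * (1 + 240 * e^2)) <= R2" for e y
 proof -
  have "norm (stretch e w) <= R2" if "w \<in> B" for w
  proof -
   have "norm (stretch e w) <= (1 + \<bar>e\<bar>) * norm w" by (rule norm_stretch_le)
   also have "\<dots> <= (1 + \<bar>e\<bar>) * (R * (1 + 240 * e^2))"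
    using that R by (intro mult_left_mono) (auto simp: in_B algebra_simps intro: order_trans)
   finally show ?thesis using \<open>(1 + \<bar>e\<bar>) * (R * (1 + 240 * e^2)) <= R2\<close> by linarith
  qed
  then show *: "stretch e ` B \<subseteq> cball 0 R2" by auto
  show "continuous_on B (%w. \<kappa> y (stretch e w))"
   by (rule continuous_on_compose2[OF cont[OF that(1)] _ *])
    (intro linear_continuous_on linear_conv_bounded_linear[THEN iffD1] stretch_linear)
 qed
 have bound: "\<bar>avg e (\<kappa> y) - H e y\<bar> <= 3360 * e^2 * C"
  if "y \<in> Y" "(1 + \<bar>e\<bar>) * (R * (1 + 240 * e^2)) <= R2 \<and> \<bar>e\<bar> <= 1 / 16" for e y
  unfolding H_def using avg_stretch[OF _ cont[OF that(1)], of e C] that \<kappa>(1) by simp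
 have av0: "avg 0 (\<kappa> y) = integral B (\<kappa> y) / \<mu>" for y
  using R by (simp add: avg_def ellipsoid_0 \<mu>_def B_def)
 define T where "T e y = (if e = 0 then 0 else (avg e (\<kappa> y) - H e y) / e^2)" for e y
 have T: "ulip (UNIV :: unit set) Y (%e _ y. T e y)" unfolding ulip_def
 proof (intro exI[of _ "3360 * C"])
  show "\<forall>\<^sub>F e in nhds 0. \<forall>w\<in>(UNIV :: unit set). \<forall>y\<in>Y. norm (T e y) <= 3360 * C \<and> (\<forall>y'\<in>Y. norm (T e y - T e y') <= 3360 * C * dist y y')"
   using small
  proof eventually_elim
   case (elim e)
   show ?case
   proof (cases "e = 0")
    case False
    then have e2: "e\<^sup>2 > 0" by simp
    show ?thesis
    proof (intro ballI conjI)
     fix y assume y: "y \<in> Y"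
     have "\<bar>avg e (\<kappa> y) - H e y\<bar> / e^2 <= 3360 * e^2 * C / e^2" using bound[OF y elim] e2 by (intro divide_right_mono) auto
     then show "norm (T e y) <= 3360 * C" using False by (simp add: T_def abs_divide)
     fix y' assume y': "y' \<in> Y"
     let ?f = "%v. \<kappa> y v - \<kappa> y' v"
     have cc: "compact (ellipsoid R e)" "ellipsoid R e \<subseteq> cball 0 R2"
     using ellipsoid_compact[OF R, of e] ellipsoid_norm_le[OF R, of e] elim by force+
     have "\<bar>avg e ?f - integral B (%w. ?f (stretch e w)) / \<mu>\<bar> <= 3360 * e^2 * (C * dist y y')"
     by (rule avg_stretch[where ?R2.0 = R2]) (use elim y y' \<kappa>(2) cont in \<open>auto intro!: continuous_intros\<close>)
     moreover have "avg e ?f = avg e (\<kappa> y) - avg e (\<kappa> y')"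
     proof -
     have "integral (ellipsoid R e) ?f = integral (ellipsoid R e) (\<kappa> y) - integral (ellipsoid R e) (\<kappa> y')"
     using cc cont y y' by (intro integral_diff compact_integrable(1)) (auto intro: continuous_on_subset)
     then show ?thesis by (simp add: avg_def diff_divide_distrib)
     qed
     moreover have "integral B (%w. ?f (stretch e w)) / \<mu> = H e y - H e y'"
     proof -
     have "integral B (%w. ?f (stretch e w)) = integral B (%w. \<kappa> y (stretch e w)) - integral B (%w. \<kappa> y' (stretch e w))"
     using cs(1) y y' elim by (intro integral_diff compact_integrable(1) B(1)) auto
     then show ?thesis by (simp add: H_def diff_divide_distrib)
     qed
     ultimately have "\<bar>(avg e (\<kappa> y) - H e y) - (avg e (\<kappa> y') - H e y')\<bar> <= 3360 * e^2 * (C * dist y y')" by (simp add: algebra_simps)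
     then have "\<bar>(avg e (\<kappa> y) - H e y) - (avg e (\<kappa> y') - H e y')\<bar> / e^2 <= 3360 * e^2 * (C * dist y y') / e^2"
     by (intro divide_right_mono) auto
     then show "norm (T e y - T e y') <= 3360 * C * dist y y'"
     using False by (simp add: T_def diff_divide_distrib[symmetric] abs_divide mult_ac)
    qed
   qed (use C(1) in \<open>simp add: T_def\<close>)
  qed
 qed
 have T1: "expands 2 (UNIV :: unit set) Y (%e _ y. e *\<^sub>R (e *\<^sub>R T e y))"
  using expands_scale[OF expands_scale[of 0 "UNIV :: unit set" Y "%e _ y. T e y"]] T
  by (simp add: expands.simps(1) numeral_2_eq_2)
 have H: "expands 2 (UNIV :: unit set) Y (%e _ y. H e y)"
 proof -
  have "expands 2 (UNIV :: unit set) Y (%e _ y. integral B (%w. \<kappa> y (stretch e w)))"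
   by (rule expands_integral[OF st]) (use small in eventually_elim, use cs in auto)
  from expands_mult[OF this expands_const[of 2 "UNIV :: unit set" Y "1 / \<mu>"]] show ?thesis by (simp add: H_def)
 qed
 have H0: "H 0 y = avg 0 (\<kappa> y)" for y by (simp add: H_def av0 stretch_0)
 have eq: "avg e (\<kappa> y) = H e y + e *\<^sub>R (e *\<^sub>R T e y)" for e y
  by (cases "e = 0") (auto simp: T_def H0 power2_eq_square)
 show "expands 2 (UNIV :: unit set) Y (%e _ y. avg e (\<kappa> y))"
  unfolding eq by (rule expands_add[OF H T1])
 show "avg 0 (\<kappa> y) = integral B (\<kappa> y) / \<mu>" if "y \<in> Y" for y by (rule av0)
 fix y d assume y: "y \<in> Y" and d: "((%e. integral B (%w. \<kappa> y (stretch e w)) / \<mu>) has_real_derivative d) (at 0)"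
 have "((%e. avg e (\<kappa> y) - H e y) has_real_derivative 0) (at 0)"
  unfolding DERIV_def
 proof (rule Lim_null_comparison)
  show "\<forall>\<^sub>F h in at 0. norm ((avg (0 + h) (\<kappa> y) - H (0 + h) y - (avg 0 (\<kappa> y) - H 0 y)) / h) <= 3360 * C * \<bar>h\<bar>"
   unfolding eventually_at_filter using small
  proof eventually_elim
   case (elim h)
   show ?case
   proof (intro impI)
    assume h: "h ~= 0"
    have "\<bar>avg h (\<kappa> y) - H h y\<bar> / \<bar>h\<bar> <= 3360 * h^2 * C / \<bar>h\<bar>" using bound[OF y elim] by (intro divide_right_mono) auto
    also have "\<dots> = 3360 * C * \<bar>h\<bar>" using h by (simp add: power2_eq_square abs_if)
    finally show "norm ((avg (0 + h) (\<kappa> y) - H (0 + h) y - (avg 0 (\<kappa> y) - H 0 y)) / h) <= 3360 * C * \<bar>h\<bar>" by (simp add: H0 abs_divide)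
   qed
  qed
  show "((%h. 3360 * C * \<bar>h\<bar>) \<longlongrightarrow> 0) (at 0)" by (auto intro!: tendsto_eq_intros)
 qed
 from DERIV_add[OF this d[folded H_def]] show "((%e. avg e (\<kappa> y)) has_real_derivative d) (at 0)" by simp
qed

end

section \<open>The potential near the round body\<close>

text \<open>The second parameter is the sine of the latitude rather than the latitude, since it
  equals \<open>S * sin u\<close> in the orbital elements.\<close>

definition meridian :: "real \<times> real => real^3" where
 "meridian y = vector [fst y * sqrt (1 - (snd y)\<^sup>2), 0, fst y * snd y]"

definition refl3 :: "real^3 => real^3" where
 "refl3 v = vector [v $ 1, v $ 2, - (v $ 3)]"

definition ker0 :: "real \<times> real => real^3 => real" where
 "ker0 y v = 1 / norm (meridian y - v)"

text \<open>The first component of the attraction divided by the first coordinate of the point,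
  which stays away from zero as long as the latitude stays away from the poles.\<close>

definition kerB :: "real \<times> real => real^3 => real" where
 "kerB y v = (1 - v $ 1 / (fst y * sqrt (1 - (snd y)\<^sup>2))) * (1 / norm (meridian y - v) ^ 3)"

text \<open>
 Symmetrising the third component of the attraction in \<open>v $ 3\<close> makes it divisible by the height
 of the point; \<open>kerA\<close> is the quotient.
\<close>

definition kerA :: "real \<times> real => real^3 => real" where
 "kerA y v = (let a = norm (meridian y - v); b = norm (meridian y - refl3 v) in
   1 / 2 * ((1 / a ^ 3 + 1 / b ^ 3) - 4 * (v $ 3)\<^sup>2 * (a^2 + a * b + b^2) / ((a + b) * (a ^ 3 * b ^ 3))))"

lemma meridian_nth [simp]: "meridian y $ 1 = fst y * sqrt (1 - (snd y)\<^sup>2)" "meridian y $ 2 = 0" "meridian y $ 3 = fst y * snd y"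
 by (simp_all add: meridian_def)

lemma refl3_nth [simp]: "refl3 v $ 1 = v $ 1" "refl3 v $ 2 = v $ 2" "refl3 v $ 3 = - (v $ 3)"
 by (simp_all add: refl3_def)

lemma norm_refl3 [simp]: "norm (refl3 v) = norm v"
 by (rule power2_eq_imp_eq) (simp_all add: norm_vec3)

lemma orthogonal3:
 fixes T :: "real^3 => real^3"
 assumes "linear T" "\<And>v. norm (T v) = norm v" shows "orthogonal_transformation T"
 using assms by (simp add: orthogonal_transformation)

lemma refl3_orthogonal: "orthogonal_transformation refl3"
 by (rule orthogonal3) (auto intro!: linearI simp: vec_eq_iff forall_3)

lemma meridian_dist:
 assumes "\<bar>snd y\<bar> <= 1"
 shows "norm (meridian y - v) = sqrt ((fst y)\<^sup>2 + ((v $ 1)\<^sup>2 + (v $ 2)\<^sup>2 + (v $ 3)\<^sup>2)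
   - 2 * (fst y * sqrt (1 - (snd y)\<^sup>2) * v $ 1 + fst y * snd y * v $ 3))"
proof -
 have "(snd y)\<^sup>2 <= 1" using assms by (simp add: abs_square_le_1)
 then have s: "(sqrt (1 - (snd y)\<^sup>2))\<^sup>2 = 1 - (snd y)\<^sup>2" by simp
 have "(norm (meridian y - v))\<^sup>2 = (fst y)\<^sup>2 * (sqrt (1 - (snd y)\<^sup>2))\<^sup>2 + (fst y)\<^sup>2 * (snd y)\<^sup>2 + ((v $ 1)\<^sup>2 + (v $ 2)\<^sup>2 + (v $ 3)\<^sup>2)
   - 2 * (fst y * sqrt (1 - (snd y)\<^sup>2) * v $ 1 + fst y * snd y * v $ 3)"
  by (simp add: norm_vec3 power2_diff power_mult_distrib)
 also have "\<dots> = (fst y)\<^sup>2 + ((v $ 1)\<^sup>2 + (v $ 2)\<^sup>2 + (v $ 3)\<^sup>2)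
   - 2 * (fst y * sqrt (1 - (snd y)\<^sup>2) * v $ 1 + fst y * snd y * v $ 3)" unfolding s by (simp add: algebra_simps)
 finally show ?thesis by (metis norm_ge_zero real_sqrt_unique)
qed

lemma norm_meridian:
 assumes "\<bar>snd y\<bar> <= 1" "fst y \<ge> 0" shows "norm (meridian y) = fst y"
 using meridian_dist[OF assms(1), of 0] assms(2) by simp

text \<open>The coefficient \<open>g\<close> is a difference quotient for \<open>e ~= 0\<close>; as
  its own remainder is bounded, \<open>g 0\<close> is the derivative at
  \<open>e = 0\<close>.\<close>

lemma expands_first_coefficient:
 fixes F :: "real => 'y::metric_space => real"
 assumes "expands 2 (UNIV :: unit set) Y (%e _. F e)"
 obtains g where "expands 1 (UNIV :: unit set) Y (%e _. g e)" "\<forall>\<^sub>F e in nhds 0. \<forall>y\<in>Y. F e y = F 0 y + e * g e y"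
  "\<And>y. y \<in> Y ==> ((%e. F e y) has_real_derivative g 0 y) (at 0)" "continuous_on Y (F 0)" "continuous_on Y (g 0)"
proof -
 have cont: "continuous_on Y f" if f: "ulip (UNIV :: unit set) Y (%_ _. f)" for f :: "'y => real"
 proof -
  obtain C where C: "C > 0" "\<forall>\<^sub>F e in nhds (0::real). \<forall>w\<in>(UNIV :: unit set). \<forall>y\<in>Y. norm (f y) <= C \<and> (\<forall>y'\<in>Y. norm (f y - f y') <= C * dist y y')"
   using ulipE[OF f] .
  have "C-lipschitz_on Y f"
   using eventually_nhds_x_imp_x[OF C(2)] C(1) by (intro lipschitz_onI) (auto simp: dist_norm)
  then show ?thesis by (rule lipschitz_on_continuous_on)
 qed
 obtain g' where g': "ulip (UNIV :: unit set) Y (%_ _. F 0)" "expands (Suc 0) (UNIV :: unit set) Y g'"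
  "\<forall>\<^sub>F e in nhds 0. \<forall>w\<in>(UNIV :: unit set). \<forall>y\<in>Y. F e y = F 0 y + e *\<^sub>R g' e w y"
  using assms[unfolded numeral_2_eq_2] by (rule expandsE)
 define g where "g e = g' e ()" for e
 have gg: "g' = (%e _. g e)" by (auto simp: g_def fun_eq_iff)
 obtain h where h: "ulip (UNIV :: unit set) Y (%_ _. g 0)" "expands 0 (UNIV :: unit set) Y h"
  "\<forall>\<^sub>F e in nhds 0. \<forall>w\<in>(UNIV :: unit set). \<forall>y\<in>Y. g e y = g 0 y + e *\<^sub>R h e w y"
  using g'(2)[unfolded gg] by (rule expandsE)
 obtain C where C: "C > 0" "\<forall>\<^sub>F e in nhds 0. \<forall>w\<in>(UNIV :: unit set). \<forall>y\<in>Y. norm (h e w y) <= C \<and> (\<forall>y'\<in>Y. norm (h e w y - h e w y') <= C * dist y y')"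
  using ulipE[OF h(2)[unfolded expands.simps]] .
 have Fg: "\<forall>\<^sub>F e in nhds 0. \<forall>y\<in>Y. F e y = F 0 y + e * g e y"
  using g'(3) by eventually_elim (simp add: gg)
 show thesis
 proof (rule that[of g])
  show "expands 1 (UNIV :: unit set) Y (%e _. g e)" using g'(2) by (simp add: gg)
  show "continuous_on Y (F 0)" "continuous_on Y (g 0)" using cont g'(1) h(1) by auto
  fix y assume y: "y \<in> Y"
  have "((%k. (F (0 + k) y - F 0 y) / k - g 0 y) \<longlongrightarrow> 0) (at 0)"
  proof (rule Lim_null_comparison)
   show "\<forall>\<^sub>F k in at 0. norm ((F (0 + k) y - F 0 y) / k - g 0 y) <= C * \<bar>k\<bar>"
    unfolding eventually_at_filter using Fg h(3) C(2)
   proof eventually_elim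
    case (elim k)
    show ?case
    proof (intro impI)
     assume k: "k ~= 0"
     have "(F (0 + k) y - F 0 y) / k - g 0 y = k * h k () y" using elim(1,2) y k by simp
     moreover have "\<bar>k\<bar> * \<bar>h k () y\<bar> <= \<bar>k\<bar> * C" using elim(3) y by (intro mult_left_mono) auto
     ultimately show "norm ((F (0 + k) y - F 0 y) / k - g 0 y) <= C * \<bar>k\<bar>" by (simp add: abs_mult mult.commute)
    qed
   qed
   show "((%k. C * \<bar>k\<bar>) \<longlongrightarrow> 0) (at 0)" by (auto intro!: tendsto_eq_intros)
  qed
  then show "((%e. F e y) has_real_derivative g 0 y) (at 0)" unfolding DERIV_def by (simp add: LIM_zero_iff)
 qed (rule Fg)
qed

lemma GDERIV_unique: "GDERIV f x :> a ==> GDERIV f x :> b ==> a = b" for x :: "'a::euclidean_space"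
proof -
 assume "GDERIV f x :> a" "GDERIV f x :> b"
 then have "(%h. h \<bullet> a) = (%h. h \<bullet> b)" unfolding gderiv_def by (rule has_derivative_unique)
 then show "a = b" by (metis vector_eq_ldot)
qed

lemma hess_symmetric: "hess a v \<bullet> b = hess b v \<bullet> a"
proof -
 have "hess a v \<bullet> b = (a \<bullet> b) / norm v ^ 3 - 3 * (v \<bullet> a) * (v \<bullet> b) / norm v ^ 5" for a b
  by (simp add: hess_def inner_diff_left)
 from this[of a b] this[of b a] show ?thesis by (simp add: inner_commute[of a b] mult_ac)
qed

definition stretch' :: "real^3 => real^3" where
 "stretch' w = vector [w $ 1 / 3, w $ 2 / 3, - (2 * w $ 3 / 3)]"

lemma stretch'_nth [simp]: "stretch' w $ 1 = w $ 1 / 3" "stretch' w $ 2 = w $ 2 / 3" "stretch' w $ 3 = - (2 * w $ 3 / 3)"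
 by (simp_all add: stretch'_def)

lemma stretch_eq: "stretch e w = w + e *\<^sub>R stretch' w"
 by (simp add: vec_eq_iff forall_3 algebra_simps)

lemma stretch'_linear: "linear stretch'"
 by (rule linearI) (simp_all add: vec_eq_iff forall_3 field_simps)

lemma continuous_on_stretch' [continuous_intros]: "continuous_on S f ==> continuous_on S (%x. stretch' (f x))"
 using linear_continuous_on[of stretch' UNIV] stretch'_linear continuous_on_compose2[of UNIV stretch' S f]
 by (simp add: linear_conv_bounded_linear)

lemma continuous_on_refl3 [continuous_intros]: "continuous_on S f ==> continuous_on S (%x. refl3 (f x))"
 using linear_continuous_on[of refl3 UNIV] orthogonal_transformation_linear[OF refl3_orthogonal] continuous_on_compose2[of UNIV refl3 S f]
 by (simp add: linear_conv_bounded_linear)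

lemma continuous_on_hess2:
 fixes f h :: "'a::topological_space => 'b::real_inner"
 assumes "continuous_on S f" "continuous_on S h" "\<And>x. x \<in> S ==> f x ~= 0"
 shows "continuous_on S (%x. hess (h x) (f x))"
proof -
 have n: "\<forall>x\<in>S. norm (f x) ^ 3 ~= 0" "\<forall>x\<in>S. norm (f x) ^ 5 ~= 0" using assms(3) by auto
 show ?thesis unfolding hess_def by (intro continuous_intros assms n)
qed

context homogeneous_ball
begin

text \<open>The first variation of the potential of the ball under \<open>stretch\<close>.\<close>

lemma first_variation:
 obtains c where "c > 0" "\<And>x a. norm x > R ==>
  ((%e. integral B (%w. newton (x - stretch e w) \<bullet> a) / \<mu>) has_real_derivative
   - c * (a \<bullet> ((1 / norm x ^ 5) *\<^sub>R vector [2 * x $ 1, 2 * x $ 2, - (4 * x $ 3)]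
    - (5 * ((x $ 1)\<^sup>2 + (x $ 2)\<^sup>2 - 2 * (x $ 3)\<^sup>2) / norm x ^ 7) *\<^sub>R x))) (at 0)"
proof -
 obtain c where c: "c > 0" "\<And>x. norm x > R ==> moment x = (c / norm x ^ 3) *\<^sub>R x" using first_moment by blast
 \<comment> \<open>Both expressions for \<open>moment\<close>, the integral and the explicit one,
   are differentiated and the gradients compared.\<close>
 have M: "integral B (%w. (w \<bullet> a) *\<^sub>R newton (x - w)) = - c *\<^sub>R hess a x" if x: "norm x > R" for x a
 proof -
  have "x ~= 0" using x R by auto
  then have "GDERIV (%x. newton x \<bullet> a) x :> hess a x" using GDERIV_newton'[of x 0 a] by simp
  then have "((%x. c * (newton x \<bullet> a)) has_derivative (%h. c * (h \<bullet> hess a x))) (at x)"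
   unfolding gderiv_def by (rule has_derivative_mult_right)
  then have "GDERIV (%x. c * (newton x \<bullet> a)) x :> c *\<^sub>R hess a x" by (simp add: gderiv_def)
  then have "GDERIV (%x. moment x \<bullet> a) x :> c *\<^sub>R hess a x"
   by (rule GDERIV_transform_open[OF _ outside_open[of R]]) (use x in \<open>auto simp: c newton_def\<close>)
  from GDERIV_unique[OF this moment_derivative[OF x]] show ?thesis by (simp add: minus_equation_iff)
 qed
 \<comment> \<open>As \<open>hess\<close> is symmetric, the gradient of \<open>N\<close> is minus
   the integrated first variation of the attraction. \<open>N\<close> turns out to be a multiple of
   the quadrupole potential.\<close>
 define N where "N x = integral B (%w. newton (x - w) \<bullet> stretch' w)" for x
 have N: "N x = c * (((x $ 1)\<^sup>2 + (x $ 2)\<^sup>2 - 2 * (x $ 3)\<^sup>2) / norm x ^ 5)" if x: "norm x > R" for x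
 proof -
  have x0: "norm x ~= 0" using x R by auto
  define I where "I i = integral B (%w. (w $ i) * (newton (x - w) $ i))" for i :: 3
  have Iint: "(%w. (w $ i) * (newton (x - w) $ i)) integrable_on B" for i :: 3
   using outside_ne[OF x] by (intro compact_integrable(1)[OF B(1)] continuous_intros) auto
  have I: "I i = - c * (1 / norm x ^ 3 - 3 * (x $ i)\<^sup>2 / norm x ^ 5)" for i
  proof -
   have wi: "w \<bullet> axis i 1 = w $ i" for w :: "real^3" by (simp add: inner_axis)
   have "I i = integral B (%w. ((w \<bullet> axis i 1) *\<^sub>R newton (x - w)) $ i)" by (simp add: I_def wi)
   also have "\<dots> = integral B (%w. (w \<bullet> axis i 1) *\<^sub>R newton (x - w)) $ i"
    using integral_linear[OF newton_int(5)[OF x] bounded_linear_vec_nth[of i]] by (simp add: o_def)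
   also have "\<dots> = - c * (hess (axis i 1) x $ i)" by (simp add: M[OF x])
   also have "hess (axis i 1) x $ i = 1 / norm x ^ 3 - 3 * (x $ i)\<^sup>2 / norm x ^ 5"
   proof -
    have "(axis i 1 :: real^3) $ i = 1" by (simp add: axis_def)
    then show ?thesis by (simp add: hess_def wi power2_eq_square)
   qed
   finally show ?thesis .
  qed
  have "N x = integral B (%w. (1/3) * ((w $ 1) * (newton (x - w) $ 1)) + (1/3) * ((w $ 2) * (newton (x - w) $ 2)) - (2/3) * ((w $ 3) * (newton (x - w) $ 3)))"
   unfolding N_def by (rule integral_cong) (simp add: inner_vec_def sum_3 field_simps)
  also have "\<dots> = (1/3) * I 1 + (1/3) * I 2 - (2/3) * I 3"
   unfolding I_def by (intro integral_unique has_integral_diff has_integral_add has_integral_mult_right integrable_integral Iint)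
  also have "\<dots> = c * (((x $ 1)\<^sup>2 + (x $ 2)\<^sup>2 - 2 * (x $ 3)\<^sup>2) / norm x ^ 5)"
   unfolding I by (simp add: algebra_simps add_divide_distrib diff_divide_distrib)
  finally show ?thesis .
 qed
 define gN where "gN x = (1 / norm x ^ 5) *\<^sub>R vector [2 * x $ 1, 2 * x $ 2, - (4 * x $ 3)]
    - (5 * ((x $ 1)\<^sup>2 + (x $ 2)\<^sup>2 - 2 * (x $ 3)\<^sup>2) / norm x ^ 7) *\<^sub>R x" for x :: "real^3"
 have gradN: "integral B (%w. hess (stretch' w) (x - w)) = c *\<^sub>R gN x" if x: "norm x > R" for x
 proof (rule GDERIV_unique)
  have x0: "x ~= 0" "norm x ~= 0" using x R by auto
  show "GDERIV N x :> integral B (%w. hess (stretch' w) (x - w))"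
   unfolding N_def[abs_def]
  proof (rule GDERIV_integral[OF B(1) outside_open[of R]])
   show "x \<in> {x. R < norm x}" using x by simp
   show "GDERIV (%x. newton (x - w) \<bullet> stretch' w) x :> hess (stretch' w) (x - w)" if "x \<in> {x. R < norm x}" "w \<in> B" for x w
    using that outside_ne[of x w] by (intro GDERIV_newton') auto
   have "continuous_on ({x. R < norm x} \<times> B) (%p. hess (stretch' (snd p)) (fst p - snd p))"
    by (intro continuous_on_hess2 continuous_intros) (auto simp: in_B)
   then show "continuous_on ({x. R < norm x} \<times> B) (%(x, w). hess (stretch' w) (x - w))" by (simp add: case_prod_unfold)
   show "continuous_on B (%w. newton (x - w) \<bullet> stretch' w)" if "x \<in> {x. R < norm x}" for x
    using that outside_ne[of x] by (intro continuous_intros) auto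
  qed
  have n: "(norm has_derivative (%h. h \<bullet> sgn x)) (at x)" using GDERIV_norm[OF x0(1)] by (simp add: gderiv_def)
  have cmp: "((%x. x $ i) has_derivative (%h. h $ i)) (at x)" for i :: 3
   by (rule bounded_linear_imp_has_derivative[OF bounded_linear_vec_nth])
  have d1: "((%x. (x $ 1)\<^sup>2 + (x $ 2)\<^sup>2 - 2 * (x $ 3)\<^sup>2) has_derivative (%h. 2 * x $ 1 * h $ 1 + 2 * x $ 2 * h $ 2 - 4 * x $ 3 * h $ 3)) (at x)"
   by (auto intro!: derivative_eq_intros cmp simp: power2_eq_square algebra_simps)
  have d2: "((%x. norm x ^ 5) has_derivative (%h. 5 * norm x ^ 4 * (h \<bullet> sgn x))) (at x)"
   using has_derivative_power[OF n, of 5] by (simp add: mult_ac)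
  have "((%x. c * (((x $ 1)\<^sup>2 + (x $ 2)\<^sup>2 - 2 * (x $ 3)\<^sup>2) / norm x ^ 5)) has_derivative
   (%h. c * (((2 * x $ 1 * h $ 1 + 2 * x $ 2 * h $ 2 - 4 * x $ 3 * h $ 3) * norm x ^ 5
     - ((x $ 1)\<^sup>2 + (x $ 2)\<^sup>2 - 2 * (x $ 3)\<^sup>2) * (5 * norm x ^ 4 * (h \<bullet> sgn x))) / (norm x ^ 5 * norm x ^ 5)))) (at x)"
   using x0 by (intro has_derivative_mult_right has_derivative_divide' d1 d2) auto
  moreover have "(%h. c * (((2 * x $ 1 * h $ 1 + 2 * x $ 2 * h $ 2 - 4 * x $ 3 * h $ 3) * norm x ^ 5
     - ((x $ 1)\<^sup>2 + (x $ 2)\<^sup>2 - 2 * (x $ 3)\<^sup>2) * (5 * norm x ^ 4 * (h \<bullet> sgn x))) / (norm x ^ 5 * norm x ^ 5))) = (%h. h \<bullet> (c *\<^sub>R gN x))"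
  proof
   fix h :: "real^3"
   define r q t where "r = norm x" and "q = (x $ 1)\<^sup>2 + (x $ 2)\<^sup>2 - 2 * (x $ 3)\<^sup>2" and "t = 2 * x $ 1 * h $ 1 + 2 * x $ 2 * h $ 2 - 4 * x $ 3 * h $ 3"
   have r: "r ~= 0" using x0 by (simp add: r_def)
   have p: "r ^ 7 = r ^ 5 * r^2" "r ^ 5 = r ^ 4 * r" by (simp_all add: numeral_eq_Suc)
   have "h \<bullet> vector [2 * x $ 1, 2 * x $ 2, - (4 * x $ 3)] = t" by (simp add: inner_vec_def sum_3 t_def)
   then have "h \<bullet> (c *\<^sub>R gN x) = c * (1 / r ^ 5 * t - 5 * q / r ^ 7 * (h \<bullet> x))"
    by (simp add: gN_def inner_diff_right r_def q_def)
   also have "\<dots> = c * ((t * r ^ 5 - q * (5 * r ^ 4 * ((h \<bullet> x) / r))) / (r ^ 5 * r ^ 5))"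
    unfolding p using r by (simp add: field_simps power2_eq_square)
   also have "(h \<bullet> x) / r = h \<bullet> sgn x" by (simp add: sgn_div_norm r_def divide_inverse mult.commute)
   finally show "c * (((2 * x $ 1 * h $ 1 + 2 * x $ 2 * h $ 2 - 4 * x $ 3 * h $ 3) * norm x ^ 5
     - ((x $ 1)\<^sup>2 + (x $ 2)\<^sup>2 - 2 * (x $ 3)\<^sup>2) * (5 * norm x ^ 4 * (h \<bullet> sgn x))) / (norm x ^ 5 * norm x ^ 5)) = h \<bullet> (c *\<^sub>R gN x)"
    by (simp add: r_def q_def t_def)
  qed
  ultimately have "GDERIV (%x. c * (((x $ 1)\<^sup>2 + (x $ 2)\<^sup>2 - 2 * (x $ 3)\<^sup>2) / norm x ^ 5)) x :> c *\<^sub>R gN x"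
   by (simp only: gderiv_def)
  then show "GDERIV N x :> c *\<^sub>R gN x"
   by (rule GDERIV_transform_open[OF _ outside_open[of R]]) (use x N in auto)
 qed
 show thesis
 proof (rule that[of "c / \<mu>"])
  show "c / \<mu> > 0" using c B(3) by simp
  fix x a :: "real^3" assume x: "norm x > R"
  let ?U = "{e::real. (1 + \<bar>e\<bar>) * R < norm x}"
  have ne: "x - stretch e w ~= 0" if "e \<in> ?U" "w \<in> B" for e w
  proof -
   have "norm (stretch e w) <= (1 + \<bar>e\<bar>) * norm w" by (rule norm_stretch_le)
   also have "\<dots> <= (1 + \<bar>e\<bar>) * R" using that by (intro mult_left_mono) (auto simp: in_B)
   finally show ?thesis using that by auto
  qed
  have "GDERIV (%e. integral B (%w. newton (x - stretch e w) \<bullet> a)) 0 :> integral B (%w. - (stretch' w \<bullet> hess a (x - stretch 0 w)))"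
  proof (rule GDERIV_integral[OF B(1)])
   show "open ?U" by (intro open_Collect_less continuous_intros)
   show "0 \<in> ?U" using x by simp
   show "GDERIV (%e. newton (x - stretch e w) \<bullet> a) e :> - (stretch' w \<bullet> hess a (x - stretch e w))" if ew: "e \<in> ?U" "w \<in> B" for e w
   proof -
    have "((%e. x - stretch e w) has_derivative (%h. - (h *\<^sub>R stretch' w))) (at e)"
     unfolding stretch_eq by (auto intro!: derivative_eq_intros)
    moreover have "((%v. newton v \<bullet> a) has_derivative (%h. h \<bullet> hess a (x - stretch e w))) (at (x - stretch e w))"
     using GDERIV_newton'[of "x - stretch e w" 0 a] ne[OF ew] by (simp add: gderiv_def)
    ultimately have "((%e. newton (x - stretch e w) \<bullet> a) has_derivative (%h. - (h *\<^sub>R stretch' w) \<bullet> hess a (x - stretch e w))) (at e)"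
     by (rule has_derivative_compose)
    then show ?thesis unfolding gderiv_def by simp
   qed
   have "continuous_on (?U \<times> B) (%p. - (stretch' (snd p) \<bullet> hess a (x - stretch (fst p) (snd p))))"
    proof (intro continuous_intros ballI)
    fix p assume "p \<in> ?U \<times> B"
    then have "x ~= stretch (fst p) (snd p)" using ne[of "fst p" "snd p"] by auto
    then show "x - stretch (fst p) (snd p) ~= 0" by simp
   qed (simp_all add: stretch_eq, intro continuous_intros)
   then show "continuous_on (?U \<times> B) (%(e, w). - (stretch' w \<bullet> hess a (x - stretch e w)))" by (simp add: case_prod_unfold)
   show "continuous_on B (%w. newton (x - stretch e w) \<bullet> a)" if "e \<in> ?U" for e
    unfolding stretch_eq by (intro continuous_intros) (use ne[OF that] in \<open>auto simp: stretch_eq\<close>)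
  qed
  moreover have "integral B (%w. - (stretch' w \<bullet> hess a (x - stretch 0 w))) = - (a \<bullet> (c *\<^sub>R gN x))"
  proof -
   have "(%w. hess (stretch' w) (x - w)) integrable_on B"
    using outside_ne[OF x] by (intro compact_integrable(1)[OF B(1)] continuous_on_hess2 continuous_intros) auto
   from integral_linear[OF this bounded_linear_inner_right[of a]]
   have "integral B (%w. a \<bullet> hess (stretch' w) (x - w)) = a \<bullet> (c *\<^sub>R gN x)" by (simp add: o_def gradN[OF x])
   moreover have "a \<bullet> hess (stretch' w) (x - w) = stretch' w \<bullet> hess a (x - w)" for w
    using hess_symmetric[of "stretch' w" "x - w" a] by (simp add: inner_commute)
   ultimately show ?thesis by (simp add: stretch_0)
  qed
  ultimately have "((%e. integral B (%w. newton (x - stretch e w) \<bullet> a)) has_real_derivative - (a \<bullet> (c *\<^sub>R gN x))) (at 0)" by simp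
  from DERIV_cdivide[OF this, of \<mu>] show "((%e. integral B (%w. newton (x - stretch e w) \<bullet> a) / \<mu>) has_real_derivative
   - (c / \<mu>) * (a \<bullet> ((1 / norm x ^ 5) *\<^sub>R vector [2 * x $ 1, 2 * x $ 2, - (4 * x $ 3)]
    - (5 * ((x $ 1)\<^sup>2 + (x $ 2)\<^sup>2 - 2 * (x $ 3)\<^sup>2) / norm x ^ 7) *\<^sub>R x))) (at 0)"
   by (simp add: gN_def)
 qed
qed

text \<open>Since \<open>b^2 - a^2 = 4 z t\<close>, the difference \<open>b^3 - a^3\<close> contains
  the height \<open>z\<close> as a factor; this is the divisibility behind
  \<open>kerA\<close>.\<close>

lemma kerA_pointwise:
 assumes y: "\<bar>snd y\<bar> <= 1" and ne: "meridian y ~= v" "meridian y ~= refl3 v"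
 shows "fst y * snd y * kerA y v = 1 / 2 * (newton (meridian y - v) $ 3 + newton (meridian y - refl3 v) $ 3)"
proof -
 define a b z t where "a = norm (meridian y - v)" and "b = norm (meridian y - refl3 v)" and "z = fst y * snd y" and "t = v $ 3"
 have ab: "a > 0" "b > 0" using ne by (auto simp: a_def b_def)
 have "b^2 - a^2 = 4 * z * t"
  unfolding a_def b_def norm_vec3 by (simp add: z_def t_def power2_eq_square algebra_simps)
 then have "(b - a) * (a + b) = 4 * z * t" by (simp add: power2_eq_square algebra_simps)
 then have zt: "4 * z * t / (a + b) = b - a" using ab by (simp add: field_simps)
 have "z * (1 / 2 * ((1 / a ^ 3 + 1 / b ^ 3) - 4 * t^2 * (a^2 + a * b + b^2) / ((a + b) * (a ^ 3 * b ^ 3))))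
   = 1 / 2 * (z * (1 / a ^ 3 + 1 / b ^ 3) - t * (4 * z * t / (a + b)) * (a^2 + a * b + b^2) / (a ^ 3 * b ^ 3))"
  by (simp add: power2_eq_square algebra_simps)
 also have "\<dots> = 1 / 2 * (z * (1 / a ^ 3 + 1 / b ^ 3) - t * (b ^ 3 - a ^ 3) / (a ^ 3 * b ^ 3))"
  unfolding zt by (simp add: power2_eq_square power3_eq_cube algebra_simps)
 also have "\<dots> = 1 / 2 * ((z - t) / a ^ 3 + (z + t) / b ^ 3)"
  using ab by (simp add: field_simps)
 finally show ?thesis
  by (simp add: kerA_def Let_def a_def[symmetric] b_def[symmetric] newton_def z_def t_def)
qed

lemma kerB_pointwise:
 assumes "\<bar>snd y\<bar> < 1" "fst y > 0"
 shows "fst y * sqrt (1 - (snd y)\<^sup>2) * kerB y v = newton (meridian y - v) $ 1"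
proof -
 have "1 - (snd y)\<^sup>2 > 0" using assms by (simp add: abs_square_less_1)
 then have k: "fst y * sqrt (1 - (snd y)\<^sup>2) ~= 0" using assms(2) by simp
 have "k * ((1 - a / k) * (1 / n)) = (1 / n) * (k - a)" if "k ~= 0" for k a n :: real
 proof -
  have "k * (1 - a / k) = k - a" using that by (simp add: right_diff_distrib)
  then show ?thesis by (metis mult.assoc mult.commute)
 qed
 from this[OF k] have "fst y * sqrt (1 - (snd y)\<^sup>2) * kerB y v = 1 / norm (meridian y - v) ^ 3 * (fst y * sqrt (1 - (snd y)\<^sup>2) - v $ 1)"
  unfolding kerB_def .
 then show ?thesis by (simp add: newton_def)
qed

text \<open>On a domain invariant under \<open>refl3\<close> the integrand and its mirror image have
  the same integral, so averaging the two changes nothing. In the applications \<open>m\<close> is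
  the stretch on the ball or the identity on the body.\<close>

lemma kerA_integral:
 assumes y: "\<bar>snd y\<bar> <= 1" and S: "compact S" "refl3 ` S = S" and m: "continuous_on S m" "\<And>w. m (refl3 w) = refl3 (m w)"
  and ne: "\<And>w. w \<in> S ==> meridian y ~= m w"
 shows "fst y * snd y * integral S (%w. kerA y (m w)) = integral S (%w. newton (meridian y - m w) $ 3)"
proof -
 have ne': "meridian y ~= refl3 (m w)" if "w \<in> S" for w
  using ne[of "refl3 w"] that S(2) m(2) by (metis imageI)
 have c: "continuous_on S (%w. newton (meridian y - m w) $ 3)" "continuous_on S (%w. newton (meridian y - refl3 (m w)) $ 3)"
  using ne ne' m(1) by (auto intro!: continuous_intros)
 have "integral S (%w. newton (meridian y - m w) $ 3) = integral (refl3 ` S) (%w. newton (meridian y - m w) $ 3)" by (simp add: S)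
 also have "\<dots> = integral S (%w. newton (meridian y - refl3 (m w)) $ 3)"
  using integral_linear_image[OF orthogonal_transformation_linear[OF refl3_orthogonal] S(1), of "%w. newton (meridian y - m w) $ 3"] c(1) S(2) refl3_orthogonal
  by (simp add: m(2))
 finally have sw: "integral S (%w. newton (meridian y - refl3 (m w)) $ 3) = integral S (%w. newton (meridian y - m w) $ 3)" by simp
 have "fst y * snd y * integral S (%w. kerA y (m w)) = integral S (%w. fst y * snd y * kerA y (m w))" by simp
 also have "\<dots> = integral S (%w. 1 / 2 * (newton (meridian y - m w) $ 3 + newton (meridian y - refl3 (m w)) $ 3))"
  by (rule integral_cong) (use kerA_pointwise[OF y] ne ne' in blast)
 also have "\<dots> = 1 / 2 * (integral S (%w. newton (meridian y - m w) $ 3) + integral S (%w. newton (meridian y - refl3 (m w)) $ 3))"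
  using c S(1) by (simp add: integral_add compact_integrable(1))
 finally show ?thesis using sw by simp
qed

end

text \<open>The distances are square roots of expressions polynomial in the coordinates, bounded
  below by the gap \<open>r1 - R'\<close>; the closure properties of \<open>expands\<close> do the
  rest. \<open>V\<close> is the moving point of the stretched ball or a fixed point.\<close>

lemma kernels_expand:
 fixes V :: "real => 'w => real^3" and r1 r2 z1 R' :: real
 defines "X \<equiv> {r1..r2} \<times> {- z1..z1}"
 assumes r: "R' < r1" "0 < R'" "r1 <= r2" and z1: "0 < z1" "z1 < 1"
  and V: "\<And>i. expands k W X (%e w _. V e w $ i)" and Vn: "\<forall>\<^sub>F e in nhds 0. \<forall>w\<in>W. norm (V e w) <= R'"
 shows "expands k W X (%e w y. ker0 y (V e w))" "expands k W X (%e w y. kerB y (V e w))" "expands k W X (%e w y. kerA y (V e w))"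
proof -
 have lip: "dist (fst y) (fst y') <= dist y y'" "dist (snd y) (snd y') <= dist y y'" for y y' :: "real \<times> real"
  by (rule dist_fst_le, rule dist_snd_le)
 have X: "r1 <= fst y" "fst y <= r2" "\<bar>snd y\<bar> <= z1" "\<bar>snd y\<bar> <= 1" "0 < fst y" if "y \<in> X" for y
  using that r z1 by (auto simp: X_def)
 have f1: "expands k W X (%_ _ y. fst y)"
 proof (rule ulip_imp_expands_const)
  have "norm (fst y) <= max r2 1" "norm (fst y - fst y') <= max r2 1 * dist y y'" if "y \<in> X" for y y'
  proof -
   show "norm (fst y) <= max r2 1" using X[OF that] by simp
   have "norm (fst y - fst y') <= 1 * dist y y'" using lip(1)[of y y'] by (simp add: dist_real_def)
   also have "\<dots> <= max r2 1 * dist y y'" by (intro mult_right_mono) auto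
   finally show "norm (fst y - fst y') <= max r2 1 * dist y y'" .
  qed
  then show "ulip W X (%_ _ y. fst y)" unfolding ulip_def by (intro exI[of _ "max r2 1"] always_eventually) blast
 qed
 have f2: "expands k W X (%_ _ y. snd y)"
 proof (rule ulip_imp_expands_const)
  have "norm (snd y) <= 1" "norm (snd y - snd y') <= 1 * dist y y'" if "y \<in> X" for y y'
   using X[OF that] lip(2)[of y y'] by (simp_all add: dist_real_def)
  then show "ulip W X (%_ _ y. snd y)" unfolding ulip_def by (intro exI[of _ 1] always_eventually) blast
 qed
 have zz: "1 - z1\<^sup>2 > 0" using z1 by (simp add: abs_square_less_1)
 have sq: "1 - z1^2 <= 1 - (snd y)\<^sup>2" if "y \<in> X" for y
  using X(3)[OF that] z1 by (simp add: abs_le_square_iff[symmetric])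
 have f3: "expands k W X (%_ _ y. sqrt (1 - (snd y)\<^sup>2))"
  by (rule expands_sqrt[OF zz]) (use sq in \<open>auto intro!: expands_diff expands_power f2\<close>)
 define q where "q e w y = (fst y)\<^sup>2 + ((V e w $ 1)\<^sup>2 + (V e w $ 2)\<^sup>2 + (V e w $ 3)\<^sup>2)
   - 2 * (fst y * sqrt (1 - (snd y)\<^sup>2) * V e w $ 1 + fst y * snd y * V e w $ 3)" for e w y
 define q' where "q' e w y = (fst y)\<^sup>2 + ((V e w $ 1)\<^sup>2 + (V e w $ 2)\<^sup>2 + (V e w $ 3)\<^sup>2)
   - 2 * (fst y * sqrt (1 - (snd y)\<^sup>2) * V e w $ 1 + fst y * snd y * (- (V e w $ 3)))" for e w y
 have q: "expands k W X q" "expands k W X q'"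
  unfolding q_def[abs_def] q'_def[abs_def]
  by (intro expands_add expands_diff expands_mult expands_power expands_minus expands_const f1 f2 f3 V)+
 have nq: "norm (meridian y - V e w) = sqrt (q e w y)" "norm (meridian y - refl3 (V e w)) = sqrt (q' e w y)" if "y \<in> X" for e w y
  using meridian_dist[OF X(4)[OF that]] by (simp_all add: q_def q'_def)
 have low: "\<forall>\<^sub>F e in nhds 0. \<forall>w\<in>W. \<forall>y\<in>X. r1 - R' <= sqrt (q e w y) \<and> r1 - R' <= sqrt (q' e w y)"
  using Vn
 proof eventually_elim
  case (elim e)
  show ?case
  proof (intro ballI)
   fix w y assume w: "w \<in> W" and y: "y \<in> X"
   have m: "norm (meridian y) = fst y" using norm_meridian X(4,5)[OF y] by simp
   have "norm (meridian y) - norm (V e w) <= norm (meridian y - V e w)" by (rule norm_triangle_ineq2)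
   moreover have "norm (meridian y) - norm (refl3 (V e w)) <= norm (meridian y - refl3 (V e w))" by (rule norm_triangle_ineq2)
   ultimately show "r1 - R' <= sqrt (q e w y) \<and> r1 - R' <= sqrt (q' e w y)"
    using elim w m X(1)[OF y] nq[OF y, of e w] by force
  qed
 qed
 define d where "d = r1 - R'"
 have d: "d > 0" using r by (simp add: d_def)
 have low2: "\<forall>\<^sub>F e in nhds 0. \<forall>w\<in>W. \<forall>y\<in>X. d\<^sup>2 <= q e w y" "\<forall>\<^sub>F e in nhds 0. \<forall>w\<in>W. \<forall>y\<in>X. d\<^sup>2 <= q' e w y"
 proof -
  have "d^2 <= t" if "d <= sqrt t" for t using that d by (simp add: real_le_rsqrt real_le_lsqrt sqrt_ge_absD)
  then show "\<forall>\<^sub>F e in nhds 0. \<forall>w\<in>W. \<forall>y\<in>X. d\<^sup>2 <= q e w y" "\<forall>\<^sub>F e in nhds 0. \<forall>w\<in>W. \<forall>y\<in>X. d\<^sup>2 <= q' e w y"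
   using low by (auto simp: d_def elim!: eventually_mono)
 qed
 have a: "expands k W X (%e w y. sqrt (q e w y))" "expands k W X (%e w y. sqrt (q' e w y))"
  by (rule expands_sqrt[where m = "d^2"]; use d low2 q in simp)+
 have ia: "expands k W X (%e w y. inverse (sqrt (q e w y)))" "expands k W X (%e w y. inverse (sqrt (q' e w y)))"
  by (rule expands_inverse[OF d _ a(1)] expands_inverse[OF d _ a(2)], use low in \<open>eventually_elim\<close>, force simp: d_def)+
 have isum: "expands k W X (%e w y. inverse (sqrt (q e w y) + sqrt (q' e w y)))"
  by (rule expands_inverse[OF d _ expands_add[OF a]]) (use low d in \<open>auto simp: d_def elim!: eventually_mono\<close>, force)
 show "expands k W X (%e w y. ker0 y (V e w))"
  by (rule expands_cong[OF ia(1)]) (auto simp: ker0_def nq inverse_eq_divide)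
 have i1: "expands k W X (%_ _ y. inverse (fst y * sqrt (1 - (snd y)\<^sup>2)))"
 proof (rule expands_inverse[where m = "r1 * sqrt (1 - z1^2)"])
  show "r1 * sqrt (1 - z1^2) > 0" using r zz by simp
  have "r1 * sqrt (1 - z1^2) <= norm (fst y * sqrt (1 - (snd y)\<^sup>2))" if "y \<in> X" for y
  proof -
   have "r1 * sqrt (1 - z1^2) <= fst y * sqrt (1 - (snd y)\<^sup>2)"
    using X[OF that] sq[OF that] r zz by (intro mult_mono) auto
   then show ?thesis unfolding real_norm_def by linarith
  qed
  then show "\<forall>\<^sub>F e in nhds (0::real). \<forall>w\<in>W. \<forall>y\<in>X. r1 * sqrt (1 - z1^2) <= norm (fst y * sqrt (1 - (snd y)\<^sup>2))"
   by (auto intro: always_eventually)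
 qed (intro expands_mult f1 f3)
 have "expands k W X (%e w y. (1 - V e w $ 1 * inverse (fst y * sqrt (1 - (snd y)\<^sup>2))) * (inverse (sqrt (q e w y))) ^ 3)"
  by (intro expands_mult expands_diff expands_power expands_const V i1 ia)
 then show "expands k W X (%e w y. kerB y (V e w))"
  by (rule expands_cong) (auto simp: kerB_def nq divide_inverse power_inverse)
 have "expands k W X (%e w y. 1 / 2 * (((inverse (sqrt (q e w y))) ^ 3 + (inverse (sqrt (q' e w y))) ^ 3)
   - 4 * (V e w $ 3)\<^sup>2 * ((sqrt (q e w y))\<^sup>2 + sqrt (q e w y) * sqrt (q' e w y) + (sqrt (q' e w y))\<^sup>2) *
    (inverse (sqrt (q e w y) + sqrt (q' e w y)) * ((inverse (sqrt (q e w y))) ^ 3 * (inverse (sqrt (q' e w y))) ^ 3))))"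
  by (rule expands_mult[OF expands_const expands_diff[OF expands_add[OF expands_power[OF ia(1)] expands_power[OF ia(2)]]
    expands_mult[OF expands_mult[OF expands_mult[OF expands_const expands_power[OF V]]
     expands_add[OF expands_add[OF expands_power[OF a(1)] expands_mult[OF a]] expands_power[OF a(2)]]]
     expands_mult[OF isum expands_mult[OF expands_power[OF ia(1)] expands_power[OF ia(2)]]]]]])
 moreover have "1 / 2 * ((inverse a ^ 3 + inverse b ^ 3) - 4 * z * t * (inverse (a + b) * (inverse a ^ 3 * inverse b ^ 3)))
   = 1 / 2 * ((1 / a ^ 3 + 1 / b ^ 3) - 4 * z * t / ((a + b) * (a ^ 3 * b ^ 3)))" for a b z t :: real
  by (simp only: divide_inverse power_inverse inverse_mult_distrib mult_1_left mult.assoc)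
 ultimately show "expands k W X (%e w y. kerA y (V e w))"
  by (elim expands_cong) (intro always_eventually allI ballI, simp only: kerA_def Let_def nq)
qed

section \<open>Symmetries of the body and the attraction it exerts\<close>

definition rotz :: "real => real^3 => real^3" where
 "rotz t v = vector [cos t * v $ 1 - sin t * v $ 2, sin t * v $ 1 + cos t * v $ 2, v $ 3]"

lemma rotz_nth [simp]: "rotz t v $ 1 = cos t * v $ 1 - sin t * v $ 2" "rotz t v $ 2 = sin t * v $ 1 + cos t * v $ 2" "rotz t v $ 3 = v $ 3"
 by (simp_all add: rotz_def)

lemma rotz_orthogonal: "orthogonal_transformation (rotz t)"
proof (rule orthogonal3)
 show "linear (rotz t)" by (rule linearI) (simp_all add: vec_eq_iff forall_3 algebra_simps)
 fix v
 have "(norm (rotz t v))\<^sup>2 = ((cos t)\<^sup>2 + (sin t)\<^sup>2) * ((v $ 1)\<^sup>2 + (v $ 2)\<^sup>2) + (v $ 3)\<^sup>2"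
  unfolding norm_vec3 rotz_nth by algebra
 then have "(norm (rotz t v))\<^sup>2 = (norm v)\<^sup>2" by (simp add: norm_vec3 del: rotz_nth)
 then show "norm (rotz t v) = norm v" by (simp add: power2_eq_iff_nonneg)
qed

definition refl2 :: "real^3 => real^3" where
 "refl2 v = vector [v $ 1, - (v $ 2), v $ 3]"

lemma refl2_nth [simp]: "refl2 v $ 1 = v $ 1" "refl2 v $ 2 = - (v $ 2)" "refl2 v $ 3 = v $ 3"
 by (simp_all add: refl2_def)

lemma refl2_orthogonal: "orthogonal_transformation refl2"
proof (rule orthogonal3)
 show "linear refl2" by (rule linearI) (simp_all add: vec_eq_iff forall_3)
 show "norm (refl2 v) = norm v" for v by (rule power2_eq_imp_eq) (simp_all add: norm_vec3)
qed

context homogeneous_ball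
begin

lemma ellipsoid_symmetric:
 assumes e: "\<bar>e\<bar> <= 1 / 16" and T: "orthogonal_transformation T" "\<And>v. (T v $ 3)\<^sup>2 = (v $ 3)\<^sup>2"
 shows "T ` ellipsoid R e = ellipsoid R e"
proof -
 have iff: "T v \<in> ellipsoid R e \<longleftrightarrow> v \<in> ellipsoid R e" for v
  using ellipsoid_iff[OF R, of e] e T by (simp add: orthogonal_transformation)
 show ?thesis
 proof (intro equalityI subsetI)
  fix y assume y: "y \<in> ellipsoid R e"
  obtain v where "y = T v" using orthogonal_transformation_surj[OF T(1)] by (metis surjD)
  then show "y \<in> T ` ellipsoid R e" using y iff by blast
 qed (use iff in auto)
qed

definition force :: "real => real^3 => real^3" where
 "force e x = (1 / measure lebesgue (ellipsoid R e)) *\<^sub>R integral (ellipsoid R e) (%v. newton (x - v))"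

lemma newton_int_ellipsoid:
 assumes "\<bar>e\<bar> <= 1 / 16" "x \<notin> ellipsoid R e"
 shows "continuous_on (ellipsoid R e) (%v. newton (x - v))" "(%v. newton (x - v)) integrable_on ellipsoid R e"
proof -
 show c: "continuous_on (ellipsoid R e) (%v. newton (x - v))" using assms(2) by (intro continuous_intros) auto
 show "(%v. newton (x - v)) integrable_on ellipsoid R e" by (rule compact_integrable(1)[OF ellipsoid_compact[OF R assms(1)] c])
qed

lemma force_equivariant:
 assumes e: "\<bar>e\<bar> <= 1 / 16" and T: "orthogonal_transformation T" "\<And>v. (T v $ 3)\<^sup>2 = (v $ 3)\<^sup>2" and x: "x \<notin> ellipsoid R e"
 shows "T x \<notin> ellipsoid R e" "force e (T x) = T (force e x)"
proof -
 let ?Q = "ellipsoid R e"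
 have lT: "linear T" using T(1) by (rule orthogonal_transformation_linear)
 have bT: "bounded_linear T" using lT by (simp add: linear_conv_bounded_linear)
 have im: "T ` ?Q = ?Q" by (rule ellipsoid_symmetric[OF e T])
 show Tx: "T x \<notin> ?Q" using x im T(1) by (metis imageE orthogonal_transformation_inj injD)
 have "integral (T ` ?Q) (%v. newton (T x - v)) = \<bar>det (matrix T)\<bar> *\<^sub>R integral ?Q ((%v. newton (T x - v)) \<circ> T)"
  by (rule integral_change_of_variables_linear[OF lT])
   (use compact_integrable(2)[OF ellipsoid_compact[OF R e] newton_int_ellipsoid(1)[OF e Tx]] im in auto)
 then have "integral ?Q (%v. newton (T x - v)) = integral ?Q (%v. newton (T x - T v))"
  using T(1) by (simp add: im o_def)
 also have "\<dots> = integral ?Q (T \<circ> (%v. newton (x - v)))"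
  by (simp add: o_def linear_diff[OF lT, symmetric] orth_newton[OF T(1)])
 also have "\<dots> = T (integral ?Q (%v. newton (x - v)))" by (rule integral_linear[OF newton_int_ellipsoid(2)[OF e x] bT])
 finally show "force e (T x) = T (force e x)" by (simp add: force_def linear_cmul[OF lT])
qed

lemma potential_eq:
 assumes e: "\<bar>e\<bar> <= 1 / 16" and x: "x \<notin> ellipsoid R e"
 shows "potential R e x = - avg e (%v. 1 / norm (x - v))"
proof -
 have c: "continuous_on (ellipsoid R e) (%v. 1 / norm (x - v))" using x by (intro continuous_intros) auto
 have "(LINT y:ellipsoid R e|lborel. 1 / dist x y) = integral (ellipsoid R e) (%v. 1 / norm (x - v))"
  using compact_integrable(3)[OF ellipsoid_compact[OF R e] c] by (simp add: dist_norm)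
 moreover have "measure lborel (ellipsoid R e) = measure lebesgue (ellipsoid R e)"
  using ellipsoid_compact[OF R e] by (simp add: borel_compact)
 ultimately show ?thesis by (simp add: potential_def avg_def)
qed

lemma potential_derivative:
 assumes e: "\<bar>e\<bar> <= 1 / 16" and x: "x \<notin> ellipsoid R e"
 shows "GDERIV (potential R e) x :> force e x"
proof -
 let ?Q = "ellipsoid R e" and ?m = "measure lebesgue (ellipsoid R e)"
 have Q: "compact ?Q" by (rule ellipsoid_compact[OF R e])
 have op: "open (- ?Q)" using Q by (simp add: compact_imp_closed open_Compl)
 have "GDERIV (%x. integral ?Q (%v. 1 / norm (x - v))) x :> integral ?Q (%v. - newton (x - v))"
 proof (rule GDERIV_integral[OF Q op])
  show "x \<in> - ?Q" using x by simp
  show "GDERIV (%x. 1 / norm (x - v)) x :> - newton (x - v)" if "x \<in> - ?Q" "v \<in> ?Q" for x v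
   using that by (intro GDERIV_inverse_dist) auto
  have "continuous_on ((- ?Q) \<times> ?Q) (%p. - newton (fst p - snd p))" by (intro continuous_intros) auto
  then show "continuous_on ((- ?Q) \<times> ?Q) (%(x, v). - newton (x - v))" by (simp add: case_prod_unfold)
  show "continuous_on ?Q (%v. 1 / norm (x - v))" if "x \<in> - ?Q" for x
   using that by (intro continuous_intros) auto
 qed
 then have "((%x. (- 1 / ?m) * integral ?Q (%v. 1 / norm (x - v))) has_derivative (%h. (- 1 / ?m) * (h \<bullet> integral ?Q (%v. - newton (x - v))))) (at x)"
  unfolding gderiv_def by (rule has_derivative_mult_right)
 then have "GDERIV (%x. (- 1 / ?m) * integral ?Q (%v. 1 / norm (x - v))) x :> force e x"
  by (simp add: gderiv_def force_def)
 then show ?thesis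
  by (rule GDERIV_transform_open[OF _ op]) (use x potential_eq[OF e] in \<open>auto simp: avg_def\<close>)
qed

text \<open>Reflecting the point in the equatorial plane reflects the force, and where the
  coordinate in question is nonzero the force determines the coefficient. The evenness is what makes
  the element equations reversible.\<close>

lemma gradient_even:
 assumes e: "\<bar>e\<bar> <= 1 / 16" and x: "x \<notin> ellipsoid R e"
  and g: "GDERIV (potential R e) x :> vector [x $ 1 * b, x $ 2 * b, x $ 3 * a]"
   "GDERIV (potential R e) (refl3 x) :> vector [refl3 x $ 1 * b', refl3 x $ 2 * b', refl3 x $ 3 * a']"
 shows "x $ 1 ~= 0 ==> b' = b" "x $ 3 ~= 0 ==> a' = a"
proof -
 have sq: "(refl3 v $ 3)\<^sup>2 = (v $ 3)\<^sup>2" for v by simp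
 note r = force_equivariant[OF e refl3_orthogonal sq x]
 have "refl3 (force e x) = vector [refl3 x $ 1 * b', refl3 x $ 2 * b', refl3 x $ 3 * a']"
  using GDERIV_unique[OF potential_derivative[OF e r(1)] g(2)] r(2) by simp
 moreover have "force e x = vector [x $ 1 * b, x $ 2 * b, x $ 3 * a]"
  by (rule GDERIV_unique[OF potential_derivative[OF e x] g(1)])
 ultimately show "x $ 1 ~= 0 ==> b' = b" "x $ 3 ~= 0 ==> a' = a" by (simp_all add: vec_eq_iff forall_3)
qed

lemma potential_round:
 assumes "norm x > R" shows "potential R 0 x = - (1 / norm x)"
proof -
 have "x \<notin> ellipsoid R 0" using assms R by (simp add: ellipsoid_0)
 then have "potential R 0 x = - avg 0 (%v. 1 / norm (x - v))" by (intro potential_eq) auto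
 also have "avg 0 (%v. 1 / norm (x - v)) = pot0 x / \<mu>" using R by (simp add: avg_def ellipsoid_0 pot0_def \<mu>_def B_def)
 also have "\<dots> = 1 / norm x" using newton_theorem(2)[OF assms] B(3) by simp
 finally show ?thesis .
qed

text \<open>\<open>E\<close> is the first-order coefficient of the mean of \<open>kerB\<close>, and
  \<open>D\<close> the difference of those of \<open>kerA\<close> and \<open>kerB\<close>. At
  \<open>e = 0\<close> they follow from the gradient of the quadrupole: \<open>9 - 15 z^2\<close>
  for the vertical and \<open>3 - 15 z^2\<close> for the horizontal coefficient, hence
  \<open>6\<close> for the difference.\<close>

theorem potential_expansion:
 fixes r1 r2 z1 :: real
 defines "X \<equiv> {r1..r2} \<times> {- z1..z1}"
 assumes r: "R < r1" "r1 <= r2" and z1: "0 < z1" "z1 < 1"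
 obtains c C D E where "c > 0" "C > 0"
  "expands 1 (UNIV :: unit set) X (%e _. D e)" "expands 1 (UNIV :: unit set) X (%e _. E e)"
  "\<And>y. y \<in> X ==> D 0 y = 6 * c / fst y ^ 5"
  "\<And>y. y \<in> X ==> E 0 y = c * (3 - 15 * (snd y)\<^sup>2) / fst y ^ 5"
  "\<forall>\<^sub>F e in nhds 0. \<forall>y\<in>X. \<forall>t. rotz t (meridian y) \<notin> ellipsoid R e \<and>
    GDERIV (potential R e) (rotz t (meridian y)) :> (let b = 1 / fst y ^ 3 + e * E e y; x = rotz t (meridian y) in
     vector [x $ 1 * b, x $ 2 * b, x $ 3 * (b + e * D e y)])"
  "\<forall>\<^sub>F e in nhds 0. \<forall>y\<in>X. \<bar>potential R e (meridian y) + 1 / fst y\<bar> <= C * \<bar>e\<bar>"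
proof -
 \<comment> \<open>A sphere between the ball and the points of \<open>X\<close>: for small
   \<open>e\<close> it encloses the body and the stretched ball.\<close>
 define R' where "R' = (R + r1) / 2"
 have R': "R < R'" "R' < r1" "0 < R'" using r R by (auto simp: R'_def)
 have X: "r1 <= fst y" "fst y <= r2" "\<bar>snd y\<bar> <= z1" "\<bar>snd y\<bar> < 1" "\<bar>snd y\<bar> <= 1" "0 < fst y" "norm (meridian y) = fst y" "norm (meridian y) > R" if "y \<in> X" for y
  using that r z1 R norm_meridian[of y] by (auto simp: X_def)
 have st: "expands 2 B X (%e w _. stretch e w $ i)" for i
 proof -
  have w: "expands 2 B X (%e w _. w $ j)" for j
   by (rule expands_const_fun[where M = R]) (simp add: in_B order_trans[OF component_le_norm_cart])
  have "expands 2 B X (%e w _. (1 + e / 3) * w $ j)" "expands 2 B X (%e w _. (1 - 2 * e / 3) * w $ j)" for j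
   using expands_mult[OF expands_add[OF expands_const[of 2 B X 1] expands_mult[OF expands_param expands_const[of 2 B X "1/3"]]] w[of j]]
    expands_mult[OF expands_diff[OF expands_const[of 2 B X 1] expands_mult[OF expands_param expands_const[of 2 B X "2/3"]]] w[of j]]
   by (simp_all add: mult.commute)
  then show ?thesis using exhaust_3[of i] by auto
 qed
 have stn: "\<forall>\<^sub>F e in nhds 0. \<forall>w\<in>B. norm (stretch e w) <= R'"
 proof -
  have "((%e. (1 + \<bar>e\<bar>) * R) \<longlongrightarrow> (1 + \<bar>0\<bar>) * R) (nhds (0::real))" by (intro tendsto_intros filterlim_ident)
  then have "\<forall>\<^sub>F e in nhds (0::real). (1 + \<bar>e\<bar>) * R < R'" using R' by (intro order_tendstoD(2)) auto
  then show ?thesis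
  proof eventually_elim
   case (elim e)
   show ?case
   proof
    fix w assume "w \<in> B"
    then have "(1 + \<bar>e\<bar>) * norm w <= (1 + \<bar>e\<bar>) * R" by (intro mult_left_mono) (auto simp: in_B)
    then show "norm (stretch e w) <= R'" using norm_stretch_le[of e w] elim by linarith
   qed
  qed
 qed
 have cv: "expands 2 (cball (0::real^3) R') X (%_ v _. v $ i)" for i :: 3
  by (rule expands_const_fun[where M = R']) (simp add: order_trans[OF component_le_norm_cart])
 have k1: "expands 2 B X (%e w y. ker0 y (stretch e w))" "expands 2 B X (%e w y. kerB y (stretch e w))" "expands 2 B X (%e w y. kerA y (stretch e w))"
  using kernels_expand[OF R'(2,3) r(2) z1, of 2 B stretch] st stn unfolding X_def by blast+
 have cvn: "\<forall>\<^sub>F e in nhds (0::real). \<forall>v\<in>cball (0::real^3) R'. norm v <= R'" by simp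
 have k2: "ulip (cball 0 R') X (%_ v y. ker0 y v)" "ulip (cball 0 R') X (%_ v y. kerB y v)" "ulip (cball 0 R') X (%_ v y. kerA y v)"
  by (rule expands_ulip, use kernels_expand[OF R'(2,3) r(2) z1, of 2 "cball 0 R'" "%_ v. v"] cv cvn in \<open>unfold X_def, blast\<close>)+
 have ne: "meridian y - v ~= 0" "meridian y - refl3 v ~= 0" if "y \<in> X" "norm v <= R'" for y v
 proof -
  have "norm v < norm (meridian y)" using X(1,7)[OF that(1)] that(2) R' by linarith
  then show "meridian y - v ~= 0" by auto
  have "norm (refl3 v) < norm (meridian y)" using \<open>norm v < norm (meridian y)\<close> by simp
  then show "meridian y - refl3 v ~= 0" by auto
 qed
 have c0: "continuous_on (cball 0 R') (ker0 y)" if y: "y \<in> X" for y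
  unfolding ker0_def[abs_def] by (intro continuous_intros) (use ne[OF y] in auto)
 have cB: "continuous_on (cball 0 R') (kerB y)" if y: "y \<in> X" for y
 proof -
  have "1 - (snd y)\<^sup>2 > 0" using X(4)[OF y] by (simp add: abs_square_less_1)
  then have "\<forall>v\<in>cball (0::real^3) R'. fst y * sqrt (1 - (snd y)\<^sup>2) ~= 0" "\<forall>v\<in>cball 0 R'. norm (meridian y - v) ^ 3 ~= 0"
   using ne[OF y] X(6)[OF y] by auto
  then show ?thesis unfolding kerB_def[abs_def] by (intro continuous_intros) auto
 qed
 have cA: "continuous_on (cball 0 R') (kerA y)" if y: "y \<in> X" for y
 proof -
  have p: "norm (meridian y - v) > 0" "norm (meridian y - refl3 v) > 0" if "v \<in> cball 0 R'" for v
   using ne[OF y, of v] that by auto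
  then have "\<forall>v\<in>cball 0 R'. norm (meridian y - v) ^ 3 ~= 0" "\<forall>v\<in>cball 0 R'. norm (meridian y - refl3 v) ^ 3 ~= 0"
   "\<forall>v\<in>cball 0 R'. (norm (meridian y - v) + norm (meridian y - refl3 v)) * (norm (meridian y - v) ^ 3 * norm (meridian y - refl3 v) ^ 3) ~= 0"
   by (force, force, smt (verit) mult_eq_0_iff power_eq_0_iff)
  then show ?thesis unfolding kerA_def[abs_def] Let_def by (intro continuous_intros) auto
 qed
 note a0 = expands_avg[where \<kappa> = ker0, OF R'(1) k1(1) k2(1) c0]
 note aB = expands_avg[where \<kappa> = kerB, OF R'(1) k1(2) k2(2) cB]
 note aA = expands_avg[where \<kappa> = kerA, OF R'(1) k1(3) k2(3) cA]
 have a02: "avg 0 (ker0 y) = integral B (ker0 y) / \<mu>" and aB2: "avg 0 (kerB y) = integral B (kerB y) / \<mu>"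
  and aA2: "avg 0 (kerA y) = integral B (kerA y) / \<mu>" if "y \<in> X" for y
  using a0(2) aB(2) aA(2) that by blast+
 have aB3: "((%e. avg e (kerB y)) has_real_derivative d) (at 0)"
  if "y \<in> X" "((%e. integral B (%w. kerB y (stretch e w)) / \<mu>) has_real_derivative d) (at 0)" for y d
  using aB(3) that by blast
 have aA3: "((%e. avg e (kerA y)) has_real_derivative d) (at 0)"
  if "y \<in> X" "((%e. integral B (%w. kerA y (stretch e w)) / \<mu>) has_real_derivative d) (at 0)" for y d
  using aA(3) that by blast
 obtain g0 where g0: "expands 1 (UNIV :: unit set) X (%e _. g0 e)" "\<forall>\<^sub>F e in nhds 0. \<forall>y\<in>X. avg e (ker0 y) = avg 0 (ker0 y) + e * g0 e y"
  using expands_first_coefficient[OF a0(1)] by blast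
 obtain gB where gB: "expands 1 (UNIV :: unit set) X (%e _. gB e)" "\<forall>\<^sub>F e in nhds 0. \<forall>y\<in>X. avg e (kerB y) = avg 0 (kerB y) + e * gB e y"
  "\<And>y. y \<in> X ==> ((%e. avg e (kerB y)) has_real_derivative gB 0 y) (at 0)"
  using expands_first_coefficient[OF aB(1)] by blast
 obtain gA where gA: "expands 1 (UNIV :: unit set) X (%e _. gA e)" "\<forall>\<^sub>F e in nhds 0. \<forall>y\<in>X. avg e (kerA y) = avg 0 (kerA y) + e * gA e y"
  "\<And>y. y \<in> X ==> ((%e. avg e (kerA y)) has_real_derivative gA 0 y) (at 0)"
  "continuous_on X (%y. avg 0 (kerA y))" "continuous_on X (gA 0)"
  using expands_first_coefficient[OF aA(1)] by blast
 obtain c where c: "c > 0" "\<And>x a. norm x > R ==>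
  ((%e. integral B (%w. newton (x - stretch e w) \<bullet> a) / \<mu>) has_real_derivative
   - c * (a \<bullet> ((1 / norm x ^ 5) *\<^sub>R vector [2 * x $ 1, 2 * x $ 2, - (4 * x $ 3)]
    - (5 * ((x $ 1)\<^sup>2 + (x $ 2)\<^sup>2 - 2 * (x $ 3)\<^sup>2) / norm x ^ 7) *\<^sub>R x))) (at 0)"
  using first_variation by blast
 have axis_in: "v \<bullet> axis i 1 = v $ i" "axis i 1 \<bullet> v = v $ i" for v :: "real^3" and i by (simp_all add: inner_axis inner_axis')
 have mer: "(meridian y $ 1)\<^sup>2 + (meridian y $ 2)\<^sup>2 - 2 * (meridian y $ 3)\<^sup>2 = (fst y)\<^sup>2 * (1 - 3 * (snd y)\<^sup>2)" if "y \<in> X" for y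
 proof -
  have "(snd y)\<^sup>2 <= 1" using X(5)[OF that] by (simp add: abs_square_le_1)
  then have sq: "(sqrt (1 - (snd y)\<^sup>2))\<^sup>2 = 1 - (snd y)\<^sup>2" by simp
  show ?thesis unfolding meridian_nth power_mult_distrib sq by (simp add: algebra_simps)
 qed
 have d1: "((%e. integral B (%w. newton (meridian y - stretch e w) $ 1) / \<mu>) has_real_derivative
   meridian y $ 1 * (c * (3 - 15 * (snd y)\<^sup>2) / fst y ^ 5)) (at 0)"
  and d3: "((%e. integral B (%w. newton (meridian y - stretch e w) $ 3) / \<mu>) has_real_derivative
   meridian y $ 3 * (c * (9 - 15 * (snd y)\<^sup>2) / fst y ^ 5)) (at 0)" if y: "y \<in> X" for y
 proof -
  have n: "norm (meridian y) = fst y" "fst y ~= 0" using X(6,7)[OF y] by auto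
  
  have q: "5 * ((fst y)\<^sup>2 * t) / fst y ^ 7 = 5 * t / fst y ^ 5" for t using n(2) by (simp add: divide_simps power_numeral_reduce)
  show "((%e. integral B (%w. newton (meridian y - stretch e w) $ 1) / \<mu>) has_real_derivative
   meridian y $ 1 * (c * (3 - 15 * (snd y)\<^sup>2) / fst y ^ 5)) (at 0)"
   using c(2)[OF X(8)[OF y], of "axis 1 1"] unfolding axis_in n(1) mer[OF y] q
   by (rule DERIV_cong) (use n(2) in \<open>simp add: field_simps\<close>)
  show "((%e. integral B (%w. newton (meridian y - stretch e w) $ 3) / \<mu>) has_real_derivative
   meridian y $ 3 * (c * (9 - 15 * (snd y)\<^sup>2) / fst y ^ 5)) (at 0)"
   using c(2)[OF X(8)[OF y], of "axis 3 1"] unfolding axis_in n(1) mer[OF y] q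
   by (rule DERIV_cong) (use n(2) in \<open>simp add: field_simps\<close>)
 qed
 have s0: "meridian y $ 1 ~= 0" if "y \<in> X" for y
 proof -
  have "1 - (snd y)\<^sup>2 > 0" using X(4)[OF that] by (simp add: abs_square_less_1)
  then show ?thesis using X(6)[OF that] by simp
 qed
 have Bint: "meridian y $ 1 * integral B (%w. kerB y (stretch e w)) = integral B (%w. newton (meridian y - stretch e w) $ 1)" if y: "y \<in> X" for e y
 proof -
  have "meridian y $ 1 * integral B (%w. kerB y (stretch e w)) = integral B (%w. meridian y $ 1 * kerB y (stretch e w))" by simp
  also have "\<dots> = integral B (%w. newton (meridian y - stretch e w) $ 1)"
   using kerB_pointwise[OF X(4)[OF y] X(6)[OF y]] by simp
  finally show ?thesis .
 qed
 have B0: "avg 0 (kerB y) = 1 / fst y ^ 3" and gB0: "gB 0 y = c * (3 - 15 * (snd y)\<^sup>2) / fst y ^ 5" if y: "y \<in> X" for y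
 proof -
  have "field0 (meridian y) $ 1 = integral B (%w. newton (meridian y - w) $ 1)"
   using field0_inner[OF X(8)[OF y], of "axis 1 1"] by (simp only: axis_in)
  then have "meridian y $ 1 * integral B (kerB y) = \<mu> / fst y ^ 3 * meridian y $ 1"
   using Bint[OF y, of 0] newton_theorem(1)[OF X(8)[OF y]] X(7)[OF y] by (simp add: stretch_0)
  then have "meridian y $ 1 * integral B (kerB y) = meridian y $ 1 * (\<mu> / fst y ^ 3)" by (simp only: mult.commute[of "\<mu> / fst y ^ 3"])
  then have "integral B (kerB y) = \<mu> / fst y ^ 3" by (rule iffD1[OF mult_left_cancel[OF s0[OF y]]])
  then show "avg 0 (kerB y) = 1 / fst y ^ 3" using aB2[OF y] B(3) by simp
  have "((%e. 1 / meridian y $ 1 * (integral B (%w. newton (meridian y - stretch e w) $ 1) / \<mu>)) has_real_derivative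
   1 / meridian y $ 1 * (meridian y $ 1 * (c * (3 - 15 * (snd y)\<^sup>2) / fst y ^ 5))) (at 0)"
   by (rule DERIV_cmult[OF d1[OF y]])
  moreover have "1 / meridian y $ 1 * (integral B (%w. newton (meridian y - stretch e w) $ 1) / \<mu>) = integral B (%w. kerB y (stretch e w)) / \<mu>" for e
   unfolding Bint[OF y, symmetric] using s0[OF y] by simp
  ultimately have "((%e. integral B (%w. kerB y (stretch e w)) / \<mu>) has_real_derivative c * (3 - 15 * (snd y)\<^sup>2) / fst y ^ 5) (at 0)"
   using s0[OF y] by simp
  from DERIV_unique[OF gB(3)[OF y] aB3[OF y this]] show "gB 0 y = c * (3 - 15 * (snd y)\<^sup>2) / fst y ^ 5" .
 qed
 have Aint: "meridian y $ 3 * integral B (%w. kerA y (stretch e w)) = integral B (%w. newton (meridian y - stretch e w) $ 3)"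
  if y: "y \<in> X" and e: "\<And>w. w \<in> B ==> norm (stretch e w) <= R'" for e y
  unfolding meridian_nth
 proof (rule kerA_integral[OF X(5)[OF y] B(1)])
  show "refl3 ` B = B" using image_orthogonal_transformation_cball[OF refl3_orthogonal, of 0 R]
   by (simp add: B_def linear_0[OF orthogonal_transformation_linear[OF refl3_orthogonal]])
  show "continuous_on B (stretch e)" unfolding stretch_eq[abs_def] by (intro continuous_intros)
  show "stretch e (refl3 w) = refl3 (stretch e w)" for w by (simp add: vec_eq_iff forall_3)
  show "meridian y ~= stretch e w" if "w \<in> B" for w using ne(1)[OF y e[OF that]] by auto
 qed
 \<comment> \<open>The values come from dividing by the height, which fails on the equator;
   \<open>fill\<close> extends them there by continuity.\<close>
 have A0': "avg 0 (kerA y) = 1 / fst y ^ 3" and gA0': "gA 0 y = c * (9 - 15 * (snd y)\<^sup>2) / fst y ^ 5" if y: "y \<in> X" and z: "snd y ~= 0" for y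
 proof -
  have z0: "meridian y $ 3 ~= 0" using z X(6)[OF y] by simp
  have "field0 (meridian y) $ 3 = integral B (%w. newton (meridian y - w) $ 3)"
   using field0_inner[OF X(8)[OF y], of "axis 3 1"] by (simp only: axis_in)
  then have "meridian y $ 3 * integral B (kerA y) = \<mu> / fst y ^ 3 * meridian y $ 3"
   using Aint[OF y, of 0] newton_theorem(1)[OF X(8)[OF y]] X(7)[OF y] R' by (simp add: stretch_0 in_B)
  then have "meridian y $ 3 * integral B (kerA y) = meridian y $ 3 * (\<mu> / fst y ^ 3)" by (simp only: mult.commute[of "\<mu> / fst y ^ 3"])
  then have "integral B (kerA y) = \<mu> / fst y ^ 3" by (rule iffD1[OF mult_left_cancel[OF z0]])
  then show "avg 0 (kerA y) = 1 / fst y ^ 3" using aA2[OF y] B(3) by simp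
  have "((%e. 1 / meridian y $ 3 * (integral B (%w. newton (meridian y - stretch e w) $ 3) / \<mu>)) has_real_derivative
   1 / meridian y $ 3 * (meridian y $ 3 * (c * (9 - 15 * (snd y)\<^sup>2) / fst y ^ 5))) (at 0)"
   by (rule DERIV_cmult[OF d3[OF y]])
  then have "((%e. 1 / meridian y $ 3 * (integral B (%w. newton (meridian y - stretch e w) $ 3) / \<mu>)) has_real_derivative
   c * (9 - 15 * (snd y)\<^sup>2) / fst y ^ 5) (at 0)" using z0 by simp
  then have "((%e. integral B (%w. kerA y (stretch e w)) / \<mu>) has_real_derivative c * (9 - 15 * (snd y)\<^sup>2) / fst y ^ 5) (at 0)"
  proof (rule DERIV_cong_ev[OF refl _ refl, THEN iffD1, rotated])
   show "\<forall>\<^sub>F e in nhds 0. 1 / meridian y $ 3 * (integral B (%w. newton (meridian y - stretch e w) $ 3) / \<mu>) = integral B (%w. kerA y (stretch e w)) / \<mu>"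
    using stn
   proof eventually_elim
    case (elim e)
    then have "meridian y $ 3 * integral B (%w. kerA y (stretch e w)) = integral B (%w. newton (meridian y - stretch e w) $ 3)"
     by (intro Aint[OF y]) auto
    from this[symmetric] show ?case using z0 by simp
   qed
  qed
  from DERIV_unique[OF gA(3)[OF y] aA3[OF y this]] show "gA 0 y = c * (9 - 15 * (snd y)\<^sup>2) / fst y ^ 5" .
 qed
 have fill: "f y = h y" if y: "y \<in> X" and f: "continuous_on X f" and h: "continuous_on X h" and fh: "\<And>y. y \<in> X ==> snd y ~= 0 ==> f y = h y"
  for f h :: "real \<times> real => real" and y
 proof (cases "snd y = 0")
  case True
  define s where "s n = (fst y, z1 / real (Suc n))" for n
  have sX: "s n \<in> X" "snd (s n) ~= 0" for n
  proof -
   have "z1 / real (Suc n) <= z1 / 1" using z1 by (intro divide_left_mono) auto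
   then show "s n \<in> X" using y z1 unfolding X_def s_def by (auto simp: mem_Times_iff) (smt (verit) divide_nonneg_nonneg of_nat_0_le_iff)
   show "snd (s n) ~= 0" using z1 by (simp add: s_def)
  qed
  have "(%n. z1 / real (Suc n)) \<longlonglongrightarrow> 0"
   using LIMSEQ_inverse_real_of_nat[THEN tendsto_mult_right[of _ _ _ z1]] by (simp add: divide_inverse mult.commute)
  then have "s \<longlonglongrightarrow> (fst y, 0)" unfolding s_def by (intro tendsto_Pair tendsto_const)
  then have s: "s \<longlonglongrightarrow> y" using True by (metis prod.collapse)
  have "(%n. f (s n)) \<longlonglongrightarrow> f y" "(%n. h (s n)) \<longlonglongrightarrow> h y"
   using continuous_on_tendsto_compose[OF f s y] continuous_on_tendsto_compose[OF h s y] sX by auto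
  moreover have "f (s n) = h (s n)" for n by (rule fh[OF sX])
  ultimately show ?thesis by (simp add: LIMSEQ_unique)
 qed (use fh y in blast)
 have nzX: "\<forall>y\<in>X. fst y ^ 3 ~= 0" "\<forall>y\<in>X. fst y ^ 5 ~= 0" using X(6) by force+
 have A0: "avg 0 (kerA y) = 1 / fst y ^ 3" and gA0: "gA 0 y = c * (9 - 15 * (snd y)\<^sup>2) / fst y ^ 5" if y: "y \<in> X" for y
 proof -
  have h: "continuous_on X (%y. 1 / fst y ^ 3)" "continuous_on X (%y. c * (9 - 15 * (snd y)\<^sup>2) / fst y ^ 5)"
   by (intro continuous_intros nzX)+
  show "avg 0 (kerA y) = 1 / fst y ^ 3" by (rule fill[OF y gA(4) h(1) A0'])
  show "gA 0 y = c * (9 - 15 * (snd y)\<^sup>2) / fst y ^ 5" by (rule fill[OF y gA(5) h(2) gA0'])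
 qed
 have small: "\<forall>\<^sub>F e in nhds 0. \<bar>e\<bar> <= 1 / 16 \<and> (\<forall>v\<in>ellipsoid R e. norm v <= R')"
 proof -
  have "((%e. (1 + \<bar>e\<bar>) * (R * (1 + 240 * e^2))) \<longlongrightarrow> (1 + \<bar>0\<bar>) * (R * (1 + 240 * 0\<^sup>2))) (nhds (0::real))"
   by (intro tendsto_intros filterlim_ident)
  then have "\<forall>\<^sub>F e in nhds 0. (1 + \<bar>e\<bar>) * (R * (1 + 240 * e^2)) < R'" using R' by (intro order_tendstoD(2)) auto
  moreover have "\<forall>\<^sub>F e in nhds (0::real). \<bar>e\<bar> <= 1 / 16" by (auto simp: eventually_nhds_metric intro!: exI[of _ "1 / 16"])
  ultimately show ?thesis
   by eventually_elim (use ellipsoid_norm_le[OF R] in force)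
 qed
 obtain C where C: "C > 0" "\<forall>\<^sub>F e in nhds 0. \<forall>w\<in>(UNIV :: unit set). \<forall>y\<in>X. norm (g0 e y) <= C \<and> (\<forall>y'\<in>X. norm (g0 e y - g0 e y') <= C * dist y y')"
  using ulipE[OF expands_ulip[OF g0(1)]] .
 show thesis
 proof (rule that[of c C "%e y. gA e y - gB e y" gB])
  show "expands 1 (UNIV :: unit set) X (%e _ y. gA e y - gB e y)" by (rule expands_diff[OF gA(1) gB(1)])
  show "gA 0 y - gB 0 y = 6 * c / fst y ^ 5" if "y \<in> X" for y
   unfolding gA0[OF that] gB0[OF that] by (simp add: diff_divide_distrib[symmetric] algebra_simps)
  show "\<forall>\<^sub>F e in nhds 0. \<forall>y\<in>X. \<bar>potential R e (meridian y) + 1 / fst y\<bar> <= C * \<bar>e\<bar>"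
   using g0(2) C(2) small
  proof eventually_elim
   case (elim e)
   show ?case
   proof
    fix y assume y: "y \<in> X"
    have "meridian y \<notin> ellipsoid R e" using elim(3) ne(1)[OF y, of "meridian y"] by auto
    then have "potential R e (meridian y) = - avg e (ker0 y)" using elim(3) by (simp add: potential_eq ker0_def[abs_def])
    moreover have "avg 0 (ker0 y) = 1 / fst y"
     using a02[OF y] newton_theorem(2)[OF X(8)[OF y]] X(7)[OF y] B(3) by (simp add: pot0_def ker0_def[abs_def])
    ultimately have "potential R e (meridian y) + 1 / fst y = - (e * g0 e y)" using elim(1) y by simp
    moreover have "\<bar>e\<bar> * \<bar>g0 e y\<bar> <= \<bar>e\<bar> * C" using elim(2) y by (intro mult_left_mono) auto
    ultimately show "\<bar>potential R e (meridian y) + 1 / fst y\<bar> <= C * \<bar>e\<bar>" by (simp add: abs_mult mult.commute)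
   qed
  qed
  show "\<forall>\<^sub>F e in nhds 0. \<forall>y\<in>X. \<forall>t. rotz t (meridian y) \<notin> ellipsoid R e \<and>
    GDERIV (potential R e) (rotz t (meridian y)) :> (let b = 1 / fst y ^ 3 + e * gB e y; x = rotz t (meridian y) in
     vector [x $ 1 * b, x $ 2 * b, x $ 3 * (b + e * (gA e y - gB e y))])"
   using gA(2) gB(2) small
  proof eventually_elim
   case (elim e)
   show ?case
   proof (intro ballI allI)
    fix y t assume y: "y \<in> X"
    let ?Q = "ellipsoid R e" and ?x = "meridian y" and ?m = "measure lebesgue (ellipsoid R e)"
    have e: "\<bar>e\<bar> <= 1 / 16" using elim(3) by simp
    have x: "?x \<notin> ?Q" using elim(3) ne(1)[OF y, of ?x] by auto
    note rot = force_equivariant[OF e rotz_orthogonal _ x, of t]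
    have comp: "force e ?x $ i = integral ?Q (%v. newton (?x - v) $ i) / ?m" for i
     using integral_linear[OF newton_int_ellipsoid(2)[OF e x] bounded_linear_vec_nth[of i]] by (simp add: force_def o_def)
    have "force e ?x $ 2 = 0"
    proof -
     have "refl2 ?x = ?x" by (simp add: vec_eq_iff forall_3)
     then have "force e ?x = refl2 (force e ?x)" using force_equivariant(2)[OF e refl2_orthogonal _ x] by simp
     then have "force e ?x $ 2 = refl2 (force e ?x) $ 2" by (rule arg_cong)
     then show ?thesis by simp
    qed
    moreover have "force e ?x $ 1 = ?x $ 1 * avg e (kerB y)"
    proof -
     have "?x $ 1 * integral ?Q (kerB y) = integral ?Q (%v. ?x $ 1 * kerB y v)" by simp
     also have "\<dots> = integral ?Q (%v. newton (?x - v) $ 1)" using kerB_pointwise[OF X(4)[OF y] X(6)[OF y]] by simp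
     finally show ?thesis by (simp add: comp avg_def)
    qed
    moreover have "force e ?x $ 3 = ?x $ 3 * avg e (kerA y)"
    proof -
     have "fst y * snd y * integral ?Q (%v. kerA y v) = integral ?Q (%v. newton (?x - v) $ 3)"
     by (rule kerA_integral[OF X(5)[OF y] ellipsoid_compact[OF R e] ellipsoid_symmetric[OF e refl3_orthogonal], where m = "%v. v"])
     (use x in \<open>auto intro: continuous_on_id\<close>)
     then show ?thesis by (simp add: comp avg_def)
    qed
    ultimately have F: "force e ?x = vector [?x $ 1 * avg e (kerB y), 0, ?x $ 3 * avg e (kerA y)]"
     by (simp add: vec_eq_iff forall_3)
    have b: "avg e (kerB y) = 1 / fst y ^ 3 + e * gB e y" using elim(2) y B0[OF y] by simp
    have a: "avg e (kerA y) = 1 / fst y ^ 3 + e * gB e y + e * (gA e y - gB e y)"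
     using elim(1) y A0[OF y] by (simp add: algebra_simps)
    have "force e (rotz t ?x) = rotz t (force e ?x)" using rot(2) by simp
    also have "\<dots> = (let b = 1 / fst y ^ 3 + e * gB e y; x = rotz t (meridian y) in
     vector [x $ 1 * b, x $ 2 * b, x $ 3 * (b + e * (gA e y - gB e y))])"
     unfolding F a b Let_def by (simp add: vec_eq_iff forall_3)
    finally have "force e (rotz t ?x) = \<dots>" .
    moreover have nq: "rotz t ?x \<notin> ?Q" using rot(1) by simp
    ultimately show "rotz t (meridian y) \<notin> ellipsoid R e \<and>
     GDERIV (potential R e) (rotz t (meridian y)) :> (let b = 1 / fst y ^ 3 + e * gB e y; x = rotz t (meridian y) in
     vector [x $ 1 * b, x $ 2 * b, x $ 3 * (b + e * (gA e y - gB e y))])"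
     using potential_derivative[OF e nq] by simp
   qed
  qed
 qed (use c C gB gB0 in auto)
qed

end

section \<open>Solutions in the orbital elements\<close>

lemma GDERIV_compose:
 fixes f :: "'a::real_inner => real"
 assumes "GDERIV f (x t) :> g" "(x has_vector_derivative v) (at t)"
 shows "((%t. f (x t)) has_real_derivative v \<bullet> g) (at t)"
proof -
 have "((%t. f (x t)) has_derivative (%h. (h *\<^sub>R v) \<bullet> g)) (at t)"
  using has_derivative_compose[of x "%h. h *\<^sub>R v" t UNIV f "%h. h \<bullet> g"] assms
  by (simp add: gderiv_def has_vector_derivative_def)
 then show ?thesis by (simp add: has_field_derivative_def mult_commute_abs)
qed

lemma has_vector_derivative_vector3:
 fixes f g h :: "real => real"
 assumes "(f has_real_derivative f') (at t)" "(g has_real_derivative g') (at t)" "(h has_real_derivative h') (at t)"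
 shows "((%t. vector [f t, g t, h t] :: real^3) has_vector_derivative vector [f', g', h']) (at t)"
proof -
 have eq: "(vector [a, b, c] :: real^3) = a *\<^sub>R axis 1 1 + b *\<^sub>R axis 2 1 + c *\<^sub>R axis 3 1" for a b c :: real
  by (simp add: vec_eq_iff forall_3 axis_def)
 have "(f has_vector_derivative f') (at t)" "(g has_vector_derivative g') (at t)" "(h has_vector_derivative h') (at t)"
  using assms by (simp_all add: has_real_derivative_iff_has_vector_derivative)
 then show ?thesis unfolding eq
  by (intro has_vector_derivative_add bounded_linear.has_vector_derivative[OF bounded_linear_scaleR_left])
qed

text \<open>From here on \<open>e\<close> is fixed, small enough for the eventual statements made so
  far. At \<open>e = 0\<close> the squared eccentricity of an orbit of energy \<open>h\<close> is at
  most \<open>1 + 2 h w^2\<close>; \<open>gap\<close> leaves room for the error \<open>C0\<close> of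
  the potential between this number and \<open>e2^2\<close>.\<close>

locale orbit = perturbed +
 fixes e h e2 M M' m C0 :: real and R :: real
 assumes grad: "x \<in> X ==> GDERIV (potential R e) (rotz t (meridian x)) :>
   (let b = 1 / fst x ^ 3 + e * E e x; v = rotz t (meridian x) in vector [v $ 1 * b, v $ 2 * b, v $ 3 * (b + e * D e x)])"
  and outside: "x \<in> X ==> rotz t (meridian x) \<notin> ellipsoid R e"
  and near: "x \<in> X ==> \<bar>potential R e (meridian x) + 1 / fst x\<bar> <= C0"
  and even: "x \<in> X ==> D e (fst x, - snd x) = D e x" "x \<in> X ==> E e (fst x, - snd x) = E e x"
  and m: "m > 0" "y \<in> K ==> m <= Ups e u y" "y \<in> K ==> Ups e u y <= M'"
  and cont: "continuous_on (UNIV \<times> K) (%(u, y). Ups e u y)"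
  and lip: "y \<in> K ==> y' \<in> K ==> norm (G e u y - G e u y') <= M * norm (y - y')"
  and e2: "0 < e2" "e2 < e1" and gap: "2 * w^2 * C0 < e2^2 - (1 + 2 * h * w^2)"
  and fl: "flow e y 0 = y" "(flow e y has_vector_derivative e *\<^sub>R G e u (closest_point K (flow e y u))) (at u)"
begin

text \<open>The term \<open>Lam^2 / (2 rad^2)\<close> contains the rotation about the axis as well,
  since \<open>Lam\<close> is the total angular momentum.\<close>

definition energy :: "real => complex \<times> real => real" where
 "energy u y = (vel w u y)\<^sup>2 / 2 + (Lam w y)\<^sup>2 / (2 * (rad w u y)\<^sup>2) + potential R e (meridian (rad w u y, lat u y))"

definition K2 where "K2 = cball (0::complex) e2 \<times> {- e2..e2}"

lemma K2_iff: "y \<in> K2 \<longleftrightarrow> norm (fst y) <= e2 \<and> \<bar>snd y\<bar> <= e2"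
 by (cases y) (auto simp: K2_def)

lemma K2_K: "y \<in> K2 ==> y \<in> K"
 using e2 by (simp add: K2_iff K_iff)

text \<open>The coefficients of the gradient of the potential: \<open>(x B, y B, z (B + F))\<close>.\<close>

definition B where "B u y = 1 / (rad w u y) ^ 3 + e * \<Xi> e u y"
definition F where "F u y = e * \<Delta> e u y"

text \<open>The link between the elements and mechanics: after multiplication by the angular speed
  \<upsilon> these are the time derivatives of radius, radial velocity, sine of latitude and angular
  momentum under an attraction with coefficients \<open>b\<close> and \<open>b + f\<close>.\<close>

lemma element_derivatives:
 fixes y :: "real => complex \<times> real"
 assumes y: "(y has_vector_derivative e *\<^sub>R G e u (y u)) (at u)" and yK: "y u \<in> K"
 defines "r \<equiv> rad w u (y u)" and "L \<equiv> Lam w (y u)" and "z \<equiv> lat u (y u)" and "v \<equiv> vel w u (y u)" and "S \<equiv> snd (y u)"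
  and "\<upsilon> \<equiv> Ups e u (y u)" and "b \<equiv> B u (y u)" and "f \<equiv> F u (y u)"
 shows "((%u. rad w u (y u)) has_real_derivative v / \<upsilon>) (at u)"
  "((%u. vel w u (y u)) has_real_derivative (L^2 / r ^ 3 - r * (b + z^2 * f)) / \<upsilon>) (at u)"
  "((%u. lat u (y u)) has_real_derivative (S * cos u * L / r^2) / \<upsilon>) (at u)"
  "((%u. Lam w (y u)) has_real_derivative (- (r^2 * S^2 * sin u * cos u * f)) / \<upsilon>) (at u)"
  "((%u. snd (y u)) has_real_derivative (- (w^2 / L ^ 3 * r^2 * S * sin u * cos u * f)) / \<upsilon>) (at u)"
  "\<upsilon> = L / r^2 + r^2 * f * (sin u)\<^sup>2 * w^2 / L ^ 3"
proof -
 define q where "q = ecc u (y u)"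
 have pos: "L > 0" "r > 0" "1 + Re q > 0" "\<upsilon> > 0" "1 - S\<^sup>2 > 0" "L^2 = w^2 / (1 - S^2)"
  using K_facts(3,5,6,9,11)[of "y u"] yK m(1) m(2)[OF yK, of u] unfolding L_def r_def q_def S_def \<upsilon>_def K_iff by auto
 show ups: "\<upsilon> = L / r^2 + r^2 * f * (sin u)\<^sup>2 * w^2 / L ^ 3"
  by (simp add: \<upsilon>_def Ups_def L_def r_def f_def F_def mult_ac)
 have rq: "r = L^2 / (1 + Re q)" and vq: "v = - Im q / L" by (simp_all add: r_def rad_def L_def q_def v_def vel_def)
 have Req: "Re q = L^2 / r - 1" and Imq: "Im q = - (v * L)" using pos(1,2,3) by (simp_all add: rq vq)
 have dp: "((%u. fst (y u)) has_vector_derivative e *\<^sub>R Gp e u (y u)) (at u)"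
  using bounded_linear.has_vector_derivative[OF bounded_linear_fst y] by (simp add: G_def)
 have dS: "((%u. snd (y u)) has_real_derivative e * GS e u (y u)) (at u)"
  using bounded_linear.has_vector_derivative[OF bounded_linear_snd y] by (simp add: G_def has_real_derivative_iff_has_vector_derivative)
 define S1 where "S1 = - (w^2 / L ^ 3 * r^2 * S * sin u * cos u * f)"
 have S1: "e * GS e u (y u) = S1 / \<upsilon>"
  by (simp add: GS_def S1_def f_def F_def L_def r_def S_def \<upsilon>_def mult_ac)
 show dS': "((%u. snd (y u)) has_real_derivative (- (w^2 / L ^ 3 * r^2 * S * sin u * cos u * f)) / \<upsilon>) (at u)"
  using dS unfolding S1 S1_def .
 have "((%u. lat u (y u)) has_real_derivative S1 / \<upsilon> * sin u + S * cos u) (at u)"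
  unfolding lat_def S_def by (rule derivative_eq_intros dS[unfolded S1] refl | simp add: S_def)+
 moreover have "S1 / \<upsilon> * sin u + S * cos u = (S * cos u * L / r^2) / \<upsilon>"
 proof -
  have "S1 * sin u + S * cos u * \<upsilon> = S * cos u * L / r^2"
   unfolding ups S1_def by (simp add: power2_eq_square algebra_simps)
  then show ?thesis using pos(4) by (simp add: field_simps)
 qed
 ultimately show "((%u. lat u (y u)) has_real_derivative (S * cos u * L / r^2) / \<upsilon>) (at u)" by simp
 define L1 where "L1 = - (r^2 * S^2 * sin u * cos u * f)"
 have dL: "((%u. Lam w (y u)) has_real_derivative L1 / \<upsilon>) (at u)"
 proof -
  have s: "sqrt (1 - S^2) > 0" "L = w / sqrt (1 - S^2)" using pos by (simp_all add: L_def Lam_def S_def)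
  have "((%u. w / sqrt (1 - (snd (y u))\<^sup>2)) has_real_derivative
    - (w * (inverse (sqrt (1 - S^2)) / 2 * (- (2 * S * (S1 / \<upsilon>))))) / (sqrt (1 - S^2))\<^sup>2) (at u)"
   using pos(5) s(1) unfolding S_def
   by (auto intro!: derivative_eq_intros dS[unfolded S1] simp: S_def power2_eq_square)
  moreover have "- (w * (inverse (sqrt (1 - S^2)) / 2 * (- (2 * S * (S1 / \<upsilon>))))) / (sqrt (1 - S^2))\<^sup>2
   = L ^ 3 / w^2 * S * S1 / \<upsilon>"
   unfolding s(2) using s(1) w by (simp add: power2_eq_square power3_eq_cube divide_simps)
  moreover have "L ^ 3 / w^2 * S * S1 = L1" unfolding S1_def L1_def using pos(1) w by (simp add: power2_eq_square)
  ultimately show ?thesis unfolding Lam_def[abs_def] by (simp only:)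
 qed
 then show "((%u. Lam w (y u)) has_real_derivative (- (r^2 * S^2 * sin u * cos u * f)) / \<upsilon>) (at u)" unfolding L1_def .
 have dcis: "((%u. cis (- u)) has_vector_derivative - \<i> * cis (- u)) (at u)"
  unfolding cis_conv_exp by (auto intro!: derivative_eq_intros has_vector_derivative_real_field simp: has_field_derivative_def)
 define q1 where "q1 = - \<i> * q * of_real (L / r^2) + of_real (2 * L / r) * of_real L1 - \<i> * of_real (v * L1)
   + \<i> * of_real (L * r * (b - 1 / r ^ 3 + z^2 * f))"
 have dq: "((%u. ecc u (y u)) has_vector_derivative q1 / of_real \<upsilon>) (at u)"
 proof -
  have "((%u. ecc u (y u)) has_vector_derivative fst (y u) * (- \<i> * cis (- u)) + (e *\<^sub>R Gp e u (y u)) * cis (- u)) (at u)"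
   unfolding ecc_def by (rule has_vector_derivative_mult[OF dp dcis])
  moreover have "fst (y u) * (- \<i> * cis (- u)) + (e *\<^sub>R Gp e u (y u)) * cis (- u) = q1 / of_real \<upsilon>"
  proof -
   define P where "P = \<i> * q * of_real (r^2 * \<Delta> e u (y u) * (sin u)\<^sup>2 * w^2 / L ^ 3)
    - (of_real (2 * L / r) - \<i> * of_real v) * of_real (r^2 * S^2 * sin u * cos u * \<Delta> e u (y u))
    + \<i> * of_real (L * r * (\<Xi> e u (y u) + z^2 * \<Delta> e u (y u)))"
   have G: "Gp e u (y u) = cis u * P / of_real \<upsilon>"
    unfolding Gp_def P_def q_def r_def L_def v_def S_def z_def \<upsilon>_def ..
   have cc: "cis u * cis (- u) = 1" by (simp add: cis_mult)
   have v0: "complex_of_real \<upsilon> ~= 0" using pos(4) by simp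
   have "(e *\<^sub>R Gp e u (y u)) * cis (- u) = of_real e * P / of_real \<upsilon>"
    unfolding G using cc by (simp add: scaleR_conv_of_real mult_ac)
   moreover have "fst (y u) * (- \<i> * cis (- u)) = - \<i> * q" by (simp add: q_def ecc_def)
   moreover have "- \<i> * q * of_real \<upsilon> + of_real e * P = q1"
    unfolding ups P_def q1_def L1_def f_def F_def b_def B_def r_def[symmetric]
    by (simp add: algebra_simps)
   ultimately show ?thesis using v0 by (simp add: field_simps)
  qed
  ultimately show ?thesis by simp
 qed
 have Req1: "Re q1 = - (v * L^2 / r^2) + 2 * L * L1 / r"
  unfolding q1_def using Imq by (simp add: power2_eq_square)
 have Imq1: "Im q1 = - (L^2 / r - 1) * L / r^2 - v * L1 + L * r * (b - 1 / r ^ 3 + z^2 * f)"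
  unfolding q1_def using Req by (simp add: left_diff_distrib diff_divide_distrib)
 have dRe: "((%u. Re (ecc u (y u))) has_real_derivative Re q1 / \<upsilon>) (at u)"
  and dIm: "((%u. Im (ecc u (y u))) has_real_derivative Im q1 / \<upsilon>) (at u)"
  using bounded_linear.has_vector_derivative[OF bounded_linear_Re dq] bounded_linear.has_vector_derivative[OF bounded_linear_Im dq]
  by (simp_all add: has_real_derivative_iff_has_vector_derivative)
 have q0: "1 + Re (ecc u (y u)) ~= 0" using pos(3) by (simp add: q_def)
 have "((%u. (Lam w (y u))\<^sup>2 / (1 + Re (ecc u (y u)))) has_real_derivative
   (2 * L * (L1 / \<upsilon>) * (1 + Re q) - L^2 * (Re q1 / \<upsilon>)) / (1 + Re q)\<^sup>2) (at u)"
  by (rule DERIV_cong[OF DERIV_divide[OF DERIV_power[OF dL, where n = 2] DERIV_add[OF DERIV_const dRe] q0]])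
   (simp add: L_def q_def power2_eq_square mult_ac)
 moreover have "(2 * L * (L1 / \<upsilon>) * (1 + Re q) - L^2 * (Re q1 / \<upsilon>)) / (1 + Re q)\<^sup>2 = v / \<upsilon>"
 proof -
  have k: "1 + Re q = L^2 / r" using Req by simp
  have "(2 * L * L1 * (L^2 / r) - L^2 * Re q1) / (L^2 / r)\<^sup>2 = v"
   proof -
   have "2 * L * L1 * (L^2 / r) - L^2 * Re q1 = v * (L^2 / r)\<^sup>2"
    unfolding Req1 by (simp add: power2_eq_square algebra_simps)
   then show ?thesis using pos(1,2) by simp
  qed
  moreover have "(2 * L * (L1 / \<upsilon>) * (1 + Re q) - L^2 * (Re q1 / \<upsilon>)) / (1 + Re q)\<^sup>2
    = ((2 * L * L1 * (L^2 / r) - L^2 * Re q1) / (L^2 / r)\<^sup>2) / \<upsilon>"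
   unfolding k by (simp add: diff_divide_distrib mult_ac)
  ultimately show ?thesis by simp
 qed
 ultimately show "((%u. rad w u (y u)) has_real_derivative v / \<upsilon>) (at u)" by (simp add: rad_def[abs_def])
 have "((%u. - Im (ecc u (y u)) / Lam w (y u)) has_real_derivative ((- (Im q1 / \<upsilon>)) * L - (- Im q) * (L1 / \<upsilon>)) / (L * L)) (at u)"
  unfolding L_def q_def by (rule DERIV_divide[OF DERIV_minus[OF dIm] dL]) (use pos(1) in \<open>simp add: L_def\<close>)
 moreover have "((- (Im q1 / \<upsilon>)) * L - (- Im q) * (L1 / \<upsilon>)) / (L * L) = (L^2 / r ^ 3 - r * (b + z^2 * f)) / \<upsilon>"
 proof -
  have "(- Im q1 * L + Im q * L1) / (L * L) = L^2 / r ^ 3 - r * (b + z^2 * f)"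
   proof -
   \<comment> \<open>With \<open>r * t = 1\<close> every division by \<open>r\<close> becomes a
     product, and the claim a polynomial identity.\<close>
   define t where "t = 1 / r"
   have e: "x / r = x * t" "x / r^2 = x * t^2" "x / r ^ 3 = x * t ^ 3" for x by (simp_all add: t_def power_divide)
   have "r * t = 1" using pos(2) by (simp add: t_def)
   then have "- Im q1 * L + Im q * L1 = (L * L) * (L^2 / r ^ 3 - r * (b + z^2 * f))"
    unfolding Imq1 Imq e by algebra
   then show ?thesis using pos(1) by simp
  qed
  moreover have "((- (Im q1 / \<upsilon>)) * L - (- Im q) * (L1 / \<upsilon>)) / (L * L) = ((- Im q1 * L + Im q * L1) / (L * L)) / \<upsilon>"
   by (simp add: add_divide_distrib diff_divide_distrib mult_ac)
  ultimately show ?thesis by simp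
 qed
 ultimately show "((%u. vel w u (y u)) has_real_derivative (L^2 / r ^ 3 - r * (b + z^2 * f)) / \<upsilon>) (at u)"
  by (simp add: vel_def[abs_def])
qed

lemma lat_bound:
 assumes "y \<in> K" shows "\<bar>lat u y\<bar> <= e1" "1 - (lat u y)\<^sup>2 > 0" "\<bar>lat u y\<bar> < 1"
proof -
 have "\<bar>snd y * sin u\<bar> <= e1 * 1" unfolding abs_mult using assms e1 by (intro mult_mono) (auto simp: K_iff)
 then show "\<bar>lat u y\<bar> <= e1" by (simp add: lat_def)
 then show "\<bar>lat u y\<bar> < 1" using e1 by simp
 then show "1 - (lat u y)\<^sup>2 > 0" by (simp add: abs_square_less_1)
qed

lemma grad_meridian:
 assumes "y \<in> K"
 shows "GDERIV (potential R e) (meridian (rad w u y, lat u y)) :>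
  vector [rad w u y * sqrt (1 - (lat u y)\<^sup>2) * B u y, 0, rad w u y * lat u y * (B u y + F u y)]"
proof -
 have "(rad w u y, lat u y) \<in> X" using K_facts(10) assms K_iff by auto
 moreover have "rotz 0 v = v" for v by (simp add: vec_eq_iff forall_3)
 ultimately show ?thesis using grad[of "(rad w u y, lat u y)" 0] by (simp add: Let_def B_def F_def \<Xi>_def \<Delta>_def)
qed

lemma energy_derivative:
 assumes y: "(y has_vector_derivative e *\<^sub>R G e u (y u)) (at u)" and yK: "y u \<in> K"
 shows "((%u. energy u (y u)) has_real_derivative 0) (at u)"
proof -
 define r L z v S \<upsilon> b f where "r = rad w u (y u)" and "L = Lam w (y u)" and "z = lat u (y u)" and "v = vel w u (y u)" and "S = snd (y u)"
  and "\<upsilon> = Ups e u (y u)" and "b = B u (y u)" and "f = F u (y u)"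
 note d = element_derivatives[OF y yK, folded r_def L_def z_def v_def S_def \<upsilon>_def b_def f_def]
 have pos: "L > 0" "r > 0" "\<upsilon> > 0"
  using K_facts(6,11)[of "y u"] yK m(1) m(2)[OF yK, of u] unfolding L_def r_def \<upsilon>_def K_iff by auto
 have z: "1 - z\<^sup>2 > 0" using lat_bound(2)[OF yK] by (simp add: z_def)
 define s where "s = sqrt (1 - z^2)"
 have s: "s > 0" "s^2 = 1 - z^2" using z by (simp_all add: s_def)
 define z1 where "z1 = S * cos u * L / r^2"
 have ds: "((%u. sqrt (1 - (lat u (y u))\<^sup>2)) has_real_derivative - (z * (z1 / \<upsilon>)) / s) (at u)"
  proof -
  have "((%u. 1 - (lat u (y u))\<^sup>2) has_real_derivative - (2 * z * (z1 / \<upsilon>))) (at u)"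
   by (rule DERIV_cong[OF DERIV_diff[OF DERIV_const DERIV_power[OF d(3)[folded z1_def], where n = 2]]]) (simp add: z_def)
  note dr = DERIV_chain2[where f = sqrt and g = "%u. 1 - (lat u (y u))\<^sup>2", OF DERIV_real_sqrt[OF z[unfolded z_def]] this]
  have "inverse (sqrt (1 - (lat u (y u))\<^sup>2)) / 2 * - (2 * z * (z1 / \<upsilon>)) = - (z * (z1 / \<upsilon>)) / s"
   unfolding s_def z_def[symmetric] by (simp only: divide_inverse) simp
  then show ?thesis using dr by (simp only:)
 qed
 have dx: "((%u. meridian (rad w u (y u), lat u (y u))) has_vector_derivative
   vector [v / \<upsilon> * s + r * (- (z * (z1 / \<upsilon>)) / s), 0, v / \<upsilon> * z + r * (z1 / \<upsilon>)]) (at u)"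
  unfolding meridian_def fst_conv snd_conv
  by (rule has_vector_derivative_vector3[OF DERIV_cong[OF DERIV_mult[OF d(1) ds]] DERIV_const DERIV_cong[OF DERIV_mult[OF d(1) d(3)[folded z1_def]]]])
   (simp_all add: r_def s_def z_def mult.commute)
 have dU: "((%u. potential R e (meridian (rad w u (y u), lat u (y u)))) has_real_derivative
   (v / \<upsilon> * s + r * (- (z * (z1 / \<upsilon>)) / s)) * (r * s * b) + (v / \<upsilon> * z + r * (z1 / \<upsilon>)) * (r * z * (b + f))) (at u)"
  using GDERIV_compose[OF grad_meridian[OF yK] dx]
  by (simp add: inner_vec_def sum_3 r_def s_def z_def b_def f_def)
 have "((%u. energy u (y u)) has_real_derivative
   v * ((L^2 / r ^ 3 - r * (b + z^2 * f)) / \<upsilon>) + (L * ((- (r^2 * S^2 * sin u * cos u * f)) / \<upsilon>) / r^2 - L^2 * (v / \<upsilon>) / r ^ 3) +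
   ((v / \<upsilon> * s + r * (- (z * (z1 / \<upsilon>)) / s)) * (r * s * b) + (v / \<upsilon> * z + r * (z1 / \<upsilon>)) * (r * z * (b + f)))) (at u)"
  unfolding energy_def
 proof (intro DERIV_add dU)
  show "((%u. (vel w u (y u))\<^sup>2 / 2) has_real_derivative v * ((L^2 / r ^ 3 - r * (b + z^2 * f)) / \<upsilon>)) (at u)"
   by (rule DERIV_cong[OF DERIV_cdivide[OF DERIV_power[OF d(2), where n = 2]]]) (simp add: v_def)
  show "((%u. (Lam w (y u))\<^sup>2 / (2 * (rad w u (y u))\<^sup>2)) has_real_derivative
   L * ((- (r^2 * S^2 * sin u * cos u * f)) / \<upsilon>) / r^2 - L^2 * (v / \<upsilon>) / r ^ 3) (at u)"
  proof -
   have "((%u. (Lam w (y u))\<^sup>2 / (2 * (rad w u (y u))\<^sup>2)) has_real_derivative L * l / r^2 - L^2 * r' / r ^ 3) (at u)"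
    if l: "((%u. Lam w (y u)) has_real_derivative l) (at u)" "((%u. rad w u (y u)) has_real_derivative r') (at u)" for l r'
   proof -
    have n: "2 * (rad w u (y u))\<^sup>2 ~= 0" using pos(2) by (simp add: r_def)
    show ?thesis
     by (rule DERIV_cong[OF DERIV_divide[OF DERIV_power[OF l(1), where n = 2] DERIV_cmult[OF DERIV_power[OF l(2), where n = 2]] n]])
     (unfold L_def[symmetric] r_def[symmetric], use pos in \<open>simp add: field_simps power2_eq_square power3_eq_cube\<close>)
   qed
   from this[OF d(4) d(1)] show ?thesis .
  qed
 qed
 moreover have "v * ((L^2 / r ^ 3 - r * (b + z^2 * f)) / \<upsilon>) + (L * ((- (r^2 * S^2 * sin u * cos u * f)) / \<upsilon>) / r^2 - L^2 * (v / \<upsilon>) / r ^ 3) +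
   ((v / \<upsilon> * s + r * (- (z * (z1 / \<upsilon>)) / s)) * (r * s * b) + (v / \<upsilon> * z + r * (z1 / \<upsilon>)) * (r * z * (b + f))) = 0"
 proof -
  have zS: "z = S * sin u" by (simp add: z_def lat_def S_def)
  have "v * (L^2 / r ^ 3 - r * (b + z^2 * f)) + (L * (- (S^2 * sin u * cos u * f)) - L^2 * v / r ^ 3) +
   ((v * r * b * s^2 - r^2 * z * z1 * b) + (v * z + r * z1) * (r * z * (b + f))) = 0" (is "?A = 0")
  proof -
   have "r^2 * z1 = S * cos u * L" using pos by (simp add: z1_def)
   then have "?A = v * r * b * (s^2 + z^2 - 1) + f * (z * (S * cos u * L) - L * (S^2 * sin u * cos u))"
    by (simp add: algebra_simps power2_eq_square)
   also have "\<dots> = 0" using s(2) zS by (simp add: power2_eq_square)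
   finally show ?thesis .
  qed
  moreover have "v * ((L^2 / r ^ 3 - r * (b + z^2 * f)) / \<upsilon>) + (L * ((- (r^2 * S^2 * sin u * cos u * f)) / \<upsilon>) / r^2 - L^2 * (v / \<upsilon>) / r ^ 3) +
   ((v / \<upsilon> * s + r * (- (z * (z1 / \<upsilon>)) / s)) * (r * s * b) + (v / \<upsilon> * z + r * (z1 / \<upsilon>)) * (r * z * (b + f))) = ?A / \<upsilon>"
   proof -
   define i j k sn cs where "i = 1 / \<upsilon>" and "j = 1 / s" and "k = 1 / r" and "sn = sin u" and "cs = cos u"
   have d: "x / \<upsilon> = x * i" "x / s = x * j" "x / r^2 = x * k^2" "x / r ^ 3 = x * k ^ 3" for x
    by (simp_all add: i_def j_def k_def power_divide)
   have "r * k = 1" "s * j = 1" using pos s(1) by (simp_all add: j_def k_def)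
   then show ?thesis unfolding d sn_def[symmetric] cs_def[symmetric] by algebra
  qed
  ultimately show ?thesis by simp
 qed
 ultimately show ?thesis by simp
qed

text \<open>The Kepler part is \<open>- 1 / (2 a)\<close> with semimajor axis \<open>a\<close>,
  where \<open>Lam^2 = a (1 - |p|^2)\<close> and \<open>Lam^2 = w^2 / (1 - S^2)\<close>.\<close>

lemma energy_kepler:
 assumes "y \<in> K"
 shows "energy u y = - ((1 - (norm (fst y))\<^sup>2) * (1 - (snd y)\<^sup>2)) / (2 * w^2)
  + (potential R e (meridian (rad w u y, lat u y)) + 1 / rad w u y)"
proof -
 define q L r where "q = ecc u y" and "L = Lam w y" and "r = rad w u y"
 have pos: "L > 0" "r > 0" "1 + Re q > 0" "1 - (snd y)\<^sup>2 > 0" "L^2 = w^2 / (1 - (snd y)\<^sup>2)"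
  using K_facts(3,5,6,9,11)[of y] assms unfolding L_def r_def q_def K_iff by auto
 have nq: "(norm (fst y))\<^sup>2 = (Re q)\<^sup>2 + (Im q)\<^sup>2"
  proof -
  have "norm (fst y) = norm q" by (simp add: q_def ecc_def norm_mult)
  then show ?thesis by (simp only: cmod_power2)
 qed
 have rq: "1 / r = (1 + Re q) / L^2" by (simp add: r_def rad_def L_def q_def)
 have w2: "w^2 / L^2 = 1 - (snd y)\<^sup>2" "L\<^sup>2 ~= 0" using pos w by auto
 have "(vel w u y)\<^sup>2 / 2 + L^2 / (2 * r^2) - 1 / r = ((Im q)\<^sup>2 / L^2) / 2 + L^2 * (1 / r)\<^sup>2 / 2 - 1 / r"
  by (simp add: vel_def q_def L_def power_divide)
 also have "\<dots> = ((Re q)\<^sup>2 + (Im q)\<^sup>2 - 1) / (2 * L^2)"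
  unfolding rq using w2(2) by (simp add: field_simps power2_eq_square)
 also have "\<dots> = - ((1 - (norm (fst y))\<^sup>2) * (1 - (snd y)\<^sup>2)) / (2 * w^2)"
  unfolding w2(1)[symmetric] nq using w w2(2) by (simp add: field_simps)
 finally show ?thesis by (simp add: energy_def L_def r_def)
qed

text \<open>The product of \<open>1 - |p|^2\<close> and \<open>1 - S^2\<close> exceeds
  \<open>1 - e2^2\<close>; both factors are at most one, so each of them exceeds it too.\<close>

lemma energy_trap:
 assumes "y \<in> K" "energy u y = h"
 shows "\<bar>(1 - (norm (fst y))\<^sup>2) * (1 - (snd y)\<^sup>2) + 2 * h * w\<^sup>2\<bar> <= 2 * w^2 * C0" "y \<in> K2"
proof -
 define A where "A = (1 - (norm (fst y))\<^sup>2) * (1 - (snd y)\<^sup>2)"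
 define d where "d = potential R e (meridian (rad w u y, lat u y)) + 1 / rad w u y"
 have "(rad w u y, lat u y) \<in> X" using K_facts(10) assms K_iff by auto
 from near[OF this] have d: "\<bar>d\<bar> <= C0" by (simp add: d_def)
 have "h = - A / (2 * w^2) + d" using energy_kepler[OF assms(1), of u] assms(2) by (simp add: A_def d_def)
 then have "A + 2 * h * w^2 = 2 * w^2 * d" using w by (simp add: field_simps)
 then have "\<bar>A + 2 * h * w\<^sup>2\<bar> = 2 * w^2 * \<bar>d\<bar>" by (simp add: abs_mult)
 also have "\<dots> <= 2 * w^2 * C0" using d by (intro mult_left_mono) auto
 finally show *: "\<bar>A + 2 * h * w\<^sup>2\<bar> <= 2 * w^2 * C0" .
 then have A: "1 - e2^2 < A" using gap by linarith
 have n: "norm (fst y) <= e1" "\<bar>snd y\<bar> <= e1" using assms(1) by (simp_all add: K_iff)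
 have b: "0 <= 1 - (norm (fst y))\<^sup>2" "0 <= 1 - (snd y)\<^sup>2" using n e1 by (simp_all add: abs_square_le_1)
 have "A <= 1 - (norm (fst y))\<^sup>2" "A <= 1 - (snd y)\<^sup>2"
  unfolding A_def using b by (auto intro: mult_left_le mult_right_le_one_le mult_left_le_one_le)
 then have "(norm (fst y))\<^sup>2 <= e2^2" "(snd y)\<^sup>2 <= e2^2" using A by linarith+
 then show "y \<in> K2" using e2 by (auto simp: K2_iff abs_le_square_iff[symmetric])
qed

text \<open>While the flow stays in \<open>K\<close> the projection is the identity, the energy is
  conserved and \<open>energy_trap\<close> puts the state into the smaller set \<open>K2\<close>.
  \<open>trapped_forever\<close> closes this circle, once for each direction of
  \<open>u\<close>.\<close>

lemma flow_trapped:
 assumes y0: "y0 \<in> K" and h: "energy 0 y0 = h"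
 shows "flow e y0 u \<in> K2" "energy u (flow e y0 u) = h" "(flow e y0 has_vector_derivative e *\<^sub>R G e u (flow e y0 u)) (at u)"
proof -
 let ?y = "flow e y0"
 have c: "continuous_on UNIV ?y"
  by (intro continuous_at_imp_continuous_on ballI has_vector_derivative_continuous[OF fl(2)])
 have true: "(?y has_vector_derivative e *\<^sub>R G e v (?y v)) (at v)" if "?y v \<in> K" for v
  using fl(2)[of y0 v] closest_point_self[OF that] by simp
 have en: "energy v (?y v) = h" if "\<And>s. s \<in> {min 0 v..max 0 v} ==> ?y s \<in> K" for v
 proof -
  have "\<exists>k. \<forall>s\<in>{min 0 v..max 0 v}. energy s (?y s) = k"
  proof (rule has_field_derivative_zero_constant)
   fix s assume "s \<in> {min 0 v..max 0 v}"
   then have "?y s \<in> K" by (rule that)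
   from energy_derivative[OF true[OF this] this]
   show "((%s. energy s (?y s)) has_field_derivative 0) (at s within {min 0 v..max 0 v})"
    by (rule has_field_derivative_at_within)
  qed simp
  then obtain k where k: "\<And>s. s \<in> {min 0 v..max 0 v} ==> energy s (?y s) = k" by blast
  have "energy v (?y v) = energy 0 (?y 0)" using k[of v] k[of 0] by simp
  then show ?thesis using h fl(1) by simp
 qed
 have cl: "closed K2" unfolding K2_def by (intro closed_Times) auto
 
 have int: "K2 \<subseteq> interior K"
 proof -
  have "K2 \<subseteq> {p. norm p < e1} \<times> {- e1<..<e1}" using e2 by (auto simp: K2_def)
  moreover have "open ({p::complex. norm p < e1} \<times> {- e1<..<e1})"
   by (intro open_Times open_Collect_less continuous_intros open_greaterThanLessThan)
  then have "{p. norm p < e1} \<times> {- e1<..<e1} \<subseteq> interior K"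
   by (intro interior_maximal) (auto simp: K_def)
  ultimately show ?thesis by blast
 qed
 have y00: "?y 0 \<in> K2" using energy_trap(2)[OF y0 h] fl(1) by simp
 have stay: "?y v \<in> K2" for v
 proof (cases "v \<ge> 0")
  case True
  show ?thesis
  proof (rule trapped_forever[OF c cl int y00 _ True])
   fix t assume t: "t \<ge> 0" "\<And>s. s \<in> {0..t} ==> ?y s \<in> K"
   show "?y t \<in> K2" by (rule energy_trap(2)[OF t(2) en]) (use t in auto)
  qed
 next
  case False
  have c': "continuous_on UNIV (%s. ?y (- s))" by (rule continuous_on_compose2[OF c]) (auto intro!: continuous_intros)
  have "?y (- (- v)) \<in> K2"
  proof (rule trapped_forever[OF c' cl int])
   fix t assume t: "t \<ge> 0" "\<And>s. s \<in> {0..t} ==> ?y (- s) \<in> K"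
   have "?y s \<in> K" if "s \<in> {min 0 (- t)..max 0 (- t)}" for s using t(2)[of "- s"] that t(1) by auto
   then show "?y (- t) \<in> K2" using en[of "- t"] t by (intro energy_trap(2)[where u = "- t"]) auto
  qed (use y00 False in auto)
  then show ?thesis by simp
 qed
 then show "?y u \<in> K2" .
 show "energy u (?y u) = h" using en stay K2_K by blast
 show "(?y has_vector_derivative e *\<^sub>R G e u (?y u)) (at u)" using true stay K2_K by blast
qed

section \<open>Reversibility of the element equations\<close>

definition trajectory :: "(real => complex \<times> real) => bool" where
 "trajectory y \<longleftrightarrow> (\<forall>u. y u \<in> K \<and> energy u (y u) = h \<and> (y has_vector_derivative e *\<^sub>R G e u (y u)) (at u))"

lemma trajectory_flow: "y0 \<in> K ==> energy 0 y0 = h ==> trajectory (flow e y0)"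
 using flow_trapped K2_K by (simp add: trajectory_def)

lemma solutions_unique:
 assumes "\<And>u. y u \<in> K \<and> (y has_vector_derivative e *\<^sub>R G e u (y u)) (at u)"
  "\<And>u. y' u \<in> K \<and> (y' has_vector_derivative e *\<^sub>R G e u (y' u)) (at u)" "y a = y' a"
 shows "y u = y' u"
proof -
 have "norm (y u - y' u) <= exp (\<bar>e\<bar> * M * \<bar>u - a\<bar>) * norm (y a - y' a)"
 proof (rule norm_growth[where z = "%u. y u - y' u" and z' = "%u. e *\<^sub>R G e u (y u) - e *\<^sub>R G e u (y' u)"])
  fix v
  show "((%u. y u - y' u) has_vector_derivative e *\<^sub>R G e v (y v) - e *\<^sub>R G e v (y' v)) (at v)"
   using assms(1,2) by (intro has_vector_derivative_diff) auto
  have "norm (e *\<^sub>R G e v (y v) - e *\<^sub>R G e v (y' v)) = \<bar>e\<bar> * norm (G e v (y v) - G e v (y' v))"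
   by (simp add: scaleR_diff_right[symmetric])
  also have "\<dots> <= \<bar>e\<bar> * (M * norm (y v - y' v))" using assms(1,2) by (intro mult_left_mono lip) auto
  finally show "norm (e *\<^sub>R G e v (y v) - e *\<^sub>R G e v (y' v)) <= \<bar>e\<bar> * M * norm (y v - y' v)" by simp
 qed
 then show ?thesis using assms(3) by simp
qed

text \<open>The eccentricity vector is reflected in the line of the orbital plane with argument of
  latitude \<open>u0\<close>; the inclination is kept.\<close>

definition refl :: "real => complex \<times> real => complex \<times> real" where
 "refl u0 y = (cis (2 * u0) * cnj (fst y), snd y)"

lemma refl_K [simp]: "refl u0 y \<in> K \<longleftrightarrow> y \<in> K"
 by (simp add: K_iff refl_def norm_mult)

text \<open>The condition on \<open>u0\<close> selects the nodes and the points of extreme latitude.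
  The reflection there changes the sine of latitude at most by a sign, to which \<open>D\<close> and
  \<open>E\<close> are blind, and it reverses the radial velocity and
  \<open>sin u * cos u\<close>.\<close>

lemma G_refl:
 assumes u0: "sin (2 * u0) = 0" and y: "y \<in> K"
 shows "G e u (refl u0 y) = - refl u0 (G e (2 * u0 - u) y)"
proof -
 define u' where "u' = 2 * u0 - u"
 have c1: "(cos (2 * u0))\<^sup>2 = 1" using sin_cos_squared_add[of "2 * u0"] u0 by simp
 have sc: "sin u' = - cos (2 * u0) * sin u" "cos u' = cos (2 * u0) * cos u"
  using u0 by (simp_all add: u'_def sin_diff cos_diff)
 have sc2: "(sin u')\<^sup>2 = (sin u)\<^sup>2" "sin u' * cos u' = - (sin u * cos u)"
  unfolding sc power_mult_distrib using c1 by (simp_all add: power2_eq_square)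
 have q: "ecc u (refl u0 y) = cnj (ecc u' y)"
  by (simp add: ecc_def refl_def u'_def cis_cnj cis_mult mult_ac)
 have L: "Lam w (refl u0 y) = Lam w y" by (simp add: Lam_def refl_def)
 have r: "rad w u (refl u0 y) = rad w u' y" unfolding rad_def q L by simp
 have v: "vel w u (refl u0 y) = - vel w u' y" unfolding vel_def q L by simp
 have l: "lat u (refl u0 y) = lat u' y \<or> lat u (refl u0 y) = - lat u' y" "(lat u (refl u0 y))\<^sup>2 = (lat u' y)\<^sup>2"
 proof -
  have "cos (2 * u0) = 1 \<or> cos (2 * u0) = - 1" using c1 by (simp add: power2_eq_1_iff)
  then show "lat u (refl u0 y) = lat u' y \<or> lat u (refl u0 y) = - lat u' y" by (auto simp: lat_def refl_def sc)
  then show "(lat u (refl u0 y))\<^sup>2 = (lat u' y)\<^sup>2" by auto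
 qed
 have X: "(rad w u' y, lat u' y) \<in> X" using K_facts(10) y K_iff by auto
 have D: "\<Delta> e u (refl u0 y) = \<Delta> e u' y" "\<Xi> e u (refl u0 y) = \<Xi> e u' y"
  using l(1) even[OF X] by (auto simp: \<Delta>_def \<Xi>_def r)
 have U: "Ups e u (refl u0 y) = Ups e u' y" unfolding Ups_def L r D sc2 ..
 have cs: "x * sin u * cos u * d = - (x * sin u' * cos u' * d)" for x d :: real
  using sc2(2) by (simp add: mult.assoc)
 have cc: "cis u = cis (2 * u0) * cnj (cis u')" by (simp add: cis_cnj cis_mult u'_def)
 have S: "snd (refl u0 y) = snd y" by (simp add: refl_def)
 have conj: "k * (\<i> * cnj q * of_real a - (of_real l - \<i> * of_real (- v)) * of_real (- b) + \<i> * of_real d) / of_real n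
   = - (C * cnj (k' * (\<i> * q * of_real a - (of_real l - \<i> * of_real v) * of_real b + \<i> * of_real d) / of_real n))"
  if "k = C * cnj k'" for q k k' C :: complex and a l v b d n :: real
 proof -
  have "\<i> * cnj q * of_real a - (of_real l - \<i> * of_real (- v)) * of_real (- b) + \<i> * of_real d
   = - cnj (\<i> * q * of_real a - (of_real l - \<i> * of_real v) * of_real b + \<i> * of_real d)"
   by (simp add: complex_eq_iff)
  then show ?thesis by (simp only: that complex_cnj_mult complex_cnj_divide complex_cnj_complex_of_real mult.assoc mult_minus_right minus_divide_left times_divide_eq_right)
 qed
 have "Gp e u (refl u0 y) = - (cis (2 * u0) * cnj (Gp e u' y))"
  unfolding Gp_def q L r v D U l(2) S sc2(1)[symmetric] cs by (rule conj[OF cc])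
 moreover have "GS e u (refl u0 y) = - GS e u' y"
  unfolding GS_def L r D U S cs by simp
 ultimately show ?thesis by (simp add: G_def refl_def u'_def)
qed

lemma G_periodic: "G e (u + 2 * pi) y = G e u y"
proof -
 have "cis (u + 2 * pi) = cis u" "cis (- u - 2 * pi) = cis (- u)" by (simp_all add: complex_eq_iff cos_diff sin_diff)
 then show ?thesis by (simp add: G_def Gp_def GS_def Ups_def rad_def vel_def \<Delta>_def \<Xi>_def ecc_def lat_def)
qed

text \<open>The reflected curve run backwards solves the same equation and agrees with
  \<open>y\<close> at \<open>u0\<close>, so uniqueness identifies the two.\<close>

lemma trajectory_reflected:
 assumes y: "trajectory y" and u0: "sin (2 * u0) = 0" "refl u0 (y u0) = y u0"
 shows "y (2 * u0 - u) = refl u0 (y u)"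
proof -
 have lin: "bounded_linear (refl u0)"
  unfolding refl_def[abs_def]
  by (intro bounded_linear_Pair bounded_linear_compose[OF bounded_linear_mult_right] bounded_linear_compose[OF bounded_linear_cnj] bounded_linear_fst bounded_linear_snd)
 define y' where "y' u = refl u0 (y (2 * u0 - u))" for u
 have "y' u = y u" for u
 proof (rule solutions_unique[where a = u0])
  fix v
  have "((%u. y (2 * u0 - u)) has_vector_derivative (- 1) *\<^sub>R (e *\<^sub>R G e (2 * u0 - v) (y (2 * u0 - v)))) (at v)"
   by (rule vector_diff_chain_at[unfolded o_def]) (use y in \<open>auto simp: trajectory_def intro!: derivative_eq_intros\<close>)
  from bounded_linear.has_vector_derivative[OF lin this]
  have "(y' has_vector_derivative refl u0 ((- 1) *\<^sub>R (e *\<^sub>R G e (2 * u0 - v) (y (2 * u0 - v))))) (at v)"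
   by (simp add: y'_def[abs_def])
  moreover have "refl u0 ((- 1) *\<^sub>R (e *\<^sub>R G e (2 * u0 - v) (y (2 * u0 - v)))) = e *\<^sub>R G e v (y' v)"
  proof -
   have "y (2 * u0 - v) \<in> K" using y by (simp add: trajectory_def)
   from G_refl[OF u0(1) this, of v] show ?thesis
    unfolding y'_def by (simp only: scaleR_minus_right scaleR_minus_left scaleR_one linear_neg[OF bounded_linear.linear[OF lin]] linear_cmul[OF bounded_linear.linear[OF lin]])
  qed
  ultimately show "y' v \<in> K \<and> (y' has_vector_derivative e *\<^sub>R G e v (y' v)) (at v)"
   using y by (simp add: y'_def trajectory_def)
 qed (use y u0 in \<open>auto simp: trajectory_def y'_def\<close>)
 from this[of "2 * u0 - u"] show ?thesis by (simp add: y'_def)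
qed

text \<open>The composition of the reflections at \<open>0\<close> and at \<open>u1\<close> shifts
  \<open>u\<close> by \<open>2 * u1\<close> and rotates the eccentricity vector by the same
  angle.\<close>

lemma trajectory_symmetric_periodic:
 assumes y: "trajectory y" and "Im (fst (y 0)) = 0" "sin (2 * u1) = 0" "refl u1 (y u1) = y u1"
 shows "y (u + 2 * u1) = (cis (2 * u1) * fst (y u), snd (y u))"
proof -
 have "refl 0 (y 0) = y 0" using assms(2) by (simp add: refl_def complex_eq_iff prod_eq_iff)
 then have "y (- u) = refl 0 (y u)" for u using trajectory_reflected[OF y, of 0 u] by simp
 moreover have "y (2 * u1 - (- u)) = refl u1 (y (- u))" by (rule trajectory_reflected[OF y assms(3,4)])
 ultimately show ?thesis by (simp add: refl_def add.commute)
qed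

end

section \<open>Return to physical time\<close>

lemma antiderivative_exists:
 fixes f :: "real => real"
 assumes "continuous_on UNIV f"
 obtains F where "\<And>x. (F has_real_derivative f x) (at x)"
proof -
 have "\<exists>F. \<forall>x. -\<infinity> < ereal x --> ereal x < \<infinity> --> (F has_vector_derivative f x) (at x)"
  by (rule einterval_antiderivative) (use assms in \<open>auto simp: continuous_on_eq_continuous_at\<close>)
 then show thesis using that by (auto simp: has_real_derivative_iff_has_vector_derivative)
qed

text \<open>Time as a function of \<open>u\<close> is an antiderivative of \<open>1/f\<close>,
  increasing and onto because \<open>f\<close> lies between two positive bounds; \<open>U\<close> is
  its inverse. Periodicity of \<open>f\<close> makes the time for one period independent of the
  starting point.\<close>

lemma autonomous_reparametrization:
 fixes f :: "real => real"
 assumes f: "continuous_on UNIV f" "\<And>u. m <= f u" "\<And>u. f u <= M" and m: "m > 0"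
  and p: "p > 0" "\<And>u. f (u + p) = f u"
 obtains U T where "\<And>t. (U has_real_derivative f (U t)) (at t)" "surj U" "T > 0" "\<And>t. U (t + T) = U t + p"
proof -
 have pos: "f u > 0" for u using f(2)[of u] m by linarith
 have M: "M > 0" using pos[of 0] f(3)[of 0] by linarith
 have "continuous_on UNIV (%u. 1 / f u)" using pos by (intro continuous_intros f(1)) (auto simp: less_imp_neq[THEN not_sym])
 then obtain g where g: "\<And>x. (g has_real_derivative 1 / f x) (at x)" using antiderivative_exists by blast
 define \<tau> where "\<tau> x = g x - g 0" for x
 have d: "(\<tau> has_real_derivative 1 / f x) (at x)" for x
  unfolding \<tau>_def using g[of x] by (auto intro!: derivative_eq_intros)
 have c: "isCont \<tau> x" for x using d DERIV_isCont by blast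
 have mono: "\<tau> x < \<tau> x'" if "x < x'" for x x'
  by (rule DERIV_pos_imp_increasing[OF that]) (use d pos in force)
 have inj: "inj \<tau>" by (rule linorder_injI) (use mono in force)
 have diff: "\<tau> x' - \<tau> x \<ge> (x' - x) / M" if "x <= x'" for x x'
 proof -
  have "(%u. \<tau> u - u / M) x <= (%u. \<tau> u - u / M) x'"
  proof (rule DERIV_nonneg_imp_nondecreasing[OF that])
   fix u
   have "((%u. \<tau> u - u / M) has_real_derivative 1 / f u - 1 / M) (at u)"
    using M by (auto intro!: derivative_eq_intros d)
   moreover have "1 / f u - 1 / M \<ge> 0" using f(3)[of u] pos[of u] M by (simp add: frac_le)
   ultimately show "\<exists>D. ((%u. \<tau> u - u / M) has_real_derivative D) (at u) \<and> 0 <= D" by blast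
  qed
  then show ?thesis by (simp add: diff_divide_distrib)
 qed
 have t0: "\<tau> 0 = 0" by (simp add: \<tau>_def)
 have surj: "\<exists>x. \<tau> x = t" for t
 proof -
  have "\<tau> (- M * \<bar>t\<bar>) <= t" "t <= \<tau> (M * \<bar>t\<bar>)" "- M * \<bar>t\<bar> <= M * \<bar>t\<bar>"
   using diff[of "- M * \<bar>t\<bar>" 0] diff[of 0 "M * \<bar>t\<bar>"] M t0 by auto
  from IVT'[of \<tau>, OF this] show ?thesis using c by (auto intro: continuous_at_imp_continuous_on)
 qed
 define U where "U t = (SOME x. \<tau> x = t)" for t
 have tU: "\<tau> (U t) = t" for t unfolding U_def using surj by (rule someI_ex)
 have Ut: "U (\<tau> x) = x" for x by (rule injD[OF inj]) (rule tU)
 have Uc: "isCont U t" for t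
  using isCont_inverse_function[of 1 "U t" U \<tau>] Ut c tU by simp
 have dU: "(U has_real_derivative f (U t)) (at t)" for t
 proof -
  have "(U has_real_derivative inverse (1 / f (U t))) (at t)"
   by (rule DERIV_inverse_function[where a = "t - 1" and b = "t + 1", OF d]) (use pos tU Uc in \<open>auto simp: less_imp_neq[THEN not_sym]\<close>)
  then show ?thesis by simp
 qed
 have shift: "\<tau> (x + p) - \<tau> x = \<tau> (0 + p) - \<tau> 0" for x
 proof -
  have "\<forall>x. ((%x. \<tau> (x + p) - \<tau> x) has_real_derivative 0) (at x)"
  proof
   fix x
   have "((%x. \<tau> (x + p)) has_real_derivative 1 / f (x + p)) (at x)"
    using d[of "x + p"] by (simp add: DERIV_shift)
   from DERIV_diff[OF this d[of x]] show "((%x. \<tau> (x + p) - \<tau> x) has_real_derivative 0) (at x)" by (simp add: p(2))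
  qed
  then show ?thesis by (rule DERIV_isconst_all)
 qed
 show thesis
 proof (rule that[OF dU])
  show "surj U" using Ut by (rule surjI)
  show "\<tau> p > 0" using mono[OF p(1)] t0 by simp
  show "U (t + \<tau> p) = U t + p" for t
   using shift[of "U t"] Ut[of "U t + p"] tU[of t] t0 by (simp add: algebra_simps)
 qed
qed

text \<open>Newton's equation in cylindrical coordinates after elimination of the angle:
  \<open>s\<close> is the distance from the axis, \<omega> the conserved momentum about it, and
  \<open>\<omega>^2 / s^3\<close> the centrifugal force.\<close>

lemma newton_cylindrical:
 fixes s s1 z z1 \<theta> a b :: "real => real" and \<omega> :: real
 defines "v \<equiv> %t. vector [s1 t * cos (\<theta> t) - \<omega> / s t * sin (\<theta> t), s1 t * sin (\<theta> t) + \<omega> / s t * cos (\<theta> t), z1 t] :: real^3"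
 assumes s: "\<And>t. s t > 0" "\<And>t. (s has_real_derivative s1 t) (at t)" "\<And>t. (s1 has_real_derivative \<omega>\<^sup>2 / s t ^ 3 - s t * b t) (at t)"
  and z: "\<And>t. (z has_real_derivative z1 t) (at t)" "\<And>t. (z1 has_real_derivative - (z t * a t)) (at t)"
  and \<theta>: "\<And>t. (\<theta> has_real_derivative \<omega> / (s t)\<^sup>2) (at t)"
 shows "((%t. vector [s t * cos (\<theta> t), s t * sin (\<theta> t), z t]) has_vector_derivative v t) (at t)"
  "(v has_vector_derivative - vector [s t * cos (\<theta> t) * b t, s t * sin (\<theta> t) * b t, z t * a t]) (at t)"
proof -
 have s0: "s t ~= 0" using s(1)[of t] by simp
 show "((%t. vector [s t * cos (\<theta> t), s t * sin (\<theta> t), z t]) has_vector_derivative v t) (at t)"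
  unfolding v_def
 proof (rule has_vector_derivative_vector3)
  have "((%t. s t * cos (\<theta> t)) has_real_derivative s1 t * cos (\<theta> t) + (- sin (\<theta> t) * (\<omega> / (s t)\<^sup>2)) * s t) (at t)"
   "((%t. s t * sin (\<theta> t)) has_real_derivative s1 t * sin (\<theta> t) + (cos (\<theta> t) * (\<omega> / (s t)\<^sup>2)) * s t) (at t)"
   by (intro DERIV_mult s(2) DERIV_chain2[OF DERIV_cos \<theta>] DERIV_chain2[OF DERIV_sin \<theta>])+
  then show "((%t. s t * cos (\<theta> t)) has_real_derivative s1 t * cos (\<theta> t) - \<omega> / s t * sin (\<theta> t)) (at t)"
   "((%t. s t * sin (\<theta> t)) has_real_derivative s1 t * sin (\<theta> t) + \<omega> / s t * cos (\<theta> t)) (at t)"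
   using s0 by (simp_all add: power2_eq_square mult_ac)
 qed (rule z)
 have eq: "- vector [x, y, k] = (vector [- x, - y, - k] :: real^3)" for x y k :: real
  by (simp add: vec_eq_iff forall_3)
 have inv: "((%t. \<omega> / s t) has_real_derivative - (\<omega> * s1 t / (s t)\<^sup>2)) (at t)"
  using s0 by (auto intro!: derivative_eq_intros s(2) simp: power2_eq_square)
 show "(v has_vector_derivative - vector [s t * cos (\<theta> t) * b t, s t * sin (\<theta> t) * b t, z t * a t]) (at t)"
  unfolding v_def eq
 proof (rule has_vector_derivative_vector3)
  have "((%t. s1 t * cos (\<theta> t) - \<omega> / s t * sin (\<theta> t)) has_real_derivative
    ((\<omega>^2 / s t ^ 3 - s t * b t) * cos (\<theta> t) + (- sin (\<theta> t) * (\<omega> / (s t)\<^sup>2)) * s1 t) -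
    (- (\<omega> * s1 t / (s t)\<^sup>2) * sin (\<theta> t) + (cos (\<theta> t) * (\<omega> / (s t)\<^sup>2)) * (\<omega> / s t))) (at t)"
   "((%t. s1 t * sin (\<theta> t) + \<omega> / s t * cos (\<theta> t)) has_real_derivative
    ((\<omega>^2 / s t ^ 3 - s t * b t) * sin (\<theta> t) + (cos (\<theta> t) * (\<omega> / (s t)\<^sup>2)) * s1 t) +
    (- (\<omega> * s1 t / (s t)\<^sup>2) * cos (\<theta> t) + (- sin (\<theta> t) * (\<omega> / (s t)\<^sup>2)) * (\<omega> / s t))) (at t)"
   by (intro DERIV_mult DERIV_diff DERIV_add s(3) inv DERIV_chain2[OF DERIV_cos \<theta>] DERIV_chain2[OF DERIV_sin \<theta>])+
  then show "((%t. s1 t * cos (\<theta> t) - \<omega> / s t * sin (\<theta> t)) has_real_derivative - (s t * cos (\<theta> t) * b t)) (at t)"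
   "((%t. s1 t * sin (\<theta> t) + \<omega> / s t * cos (\<theta> t)) has_real_derivative - (s t * sin (\<theta> t) * b t)) (at t)"
   by (auto elim!: DERIV_cong simp: algebra_simps power2_eq_square power3_eq_cube)
 qed (rule z)
qed

context orbit
begin

text \<open>The second entry is the rate of latitude, that is, the time derivative of
  \<open>sin \<phi>\<close> divided by \<open>cos \<phi>\<close>.\<close>

definition reduced :: "real => complex \<times> real => real \<times> real \<times> real \<times> real" where
 "reduced u y = (vel w u y, snd y * cos u * Lam w y / (rad w u y)\<^sup>2 / sqrt (1 - (lat u y)\<^sup>2), rad w u y, arcsin (lat u y))"

text \<open>The elements do not record the longitude of the node; the longitude is recovered by
  integrating \<open>\<omega> / s^2\<close>, and this is where the sign of \<omega>, invisible to
  \<open>w\<close>, comes back. The work lies in deriving the cylindrical equations of motion from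
  those of the elements.\<close>

theorem trajectory_orbit:
 assumes y: "trajectory y" and \<omega>: "w = \<bar>\<omega>\<bar>" and n: "n > 0" and per: "\<And>u. y (u + 2 * real n * pi) = y u"
 shows "range (%u. reduced u (y u)) \<in> relative_periodic_orbits R h \<omega> e"
proof -
 let ?p = "2 * real n * pi"
 have tr: "y u \<in> K" "(y has_vector_derivative e *\<^sub>R G e u (y u)) (at u)" "energy u (y u) = h" for u
  using y by (auto simp: trajectory_def)
 have sc: "sin (u + ?p) = sin u" "cos (u + ?p) = cos u" "cis (- u - ?p) = cis (- u)" for u
  by (simp_all add: sin_add cos_add cos_diff sin_diff complex_eq_iff)
 have perU: "Ups e (u + ?p) k = Ups e u k" "reduced (u + ?p) k = reduced u k" for u k
  using sc by (simp_all add: Ups_def reduced_def rad_def vel_def \<Delta>_def ecc_def lat_def)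
 obtain U T where U: "\<And>t. (U has_real_derivative Ups e (U t) (y (U t))) (at t)" "surj U" "T > 0" "\<And>t. U (t + T) = U t + ?p"
 proof (rule autonomous_reparametrization[of "%u. Ups e u (y u)" m M' ?p])
  have "continuous_on UNIV (%u. (u, y u))"
   by (intro continuous_at_imp_continuous_on ballI continuous_Pair has_vector_derivative_continuous[OF tr(2)] continuous_ident)
  from continuous_on_compose2[OF cont this] show "continuous_on UNIV (%u. Ups e u (y u))"
   using tr(1) by force
 qed (use m tr(1) n perU per in auto)
 define r v z L S b f where "r t = rad w (U t) (y (U t))" and "v t = vel w (U t) (y (U t))" and "z t = lat (U t) (y (U t))"
  and "L t = Lam w (y (U t))" and "S t = snd (y (U t))" and "b t = B (U t) (y (U t))" and "f t = F (U t) (y (U t))" for t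
 define u' where "u' t = L t / (r t)\<^sup>2 + (r t)\<^sup>2 * f t * (sin (U t))\<^sup>2 * w^2 / L t ^ 3" for t
 have pos: "L t > 0" "r t > 0" "1 - (z t)\<^sup>2 > 0" "\<bar>z t\<bar> < 1" "(L t)\<^sup>2 * (1 - (S t)\<^sup>2) = w^2" "(r t, z t) \<in> X" for t
  proof -
  have n: "norm (fst (y (U t))) <= e1" "\<bar>snd (y (U t))\<bar> <= e1" using tr(1)[of "U t"] by (simp_all add: K_iff)
  show "L t > 0" "r t > 0" "(r t, z t) \<in> X" unfolding L_def r_def z_def by (rule K_facts[OF n])+
  show "1 - (z t)\<^sup>2 > 0" "\<bar>z t\<bar> < 1" unfolding z_def by (rule lat_bound[OF tr(1)])+
  have "1 - (S t)\<^sup>2 ~= 0" using K_facts(3)[OF n] by (simp add: S_def)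
  then show "(L t)\<^sup>2 * (1 - (S t)\<^sup>2) = w^2" using K_facts(5)[OF n] by (simp add: L_def S_def)
 qed
 note ed = element_derivatives[OF tr(2) tr(1)]
 have chain: "((%t. g (U t)) has_real_derivative k) (at t)"
  if "(g has_real_derivative k / Ups e (U t) (y (U t))) (at (U t))" for g k t
  using DERIV_chain2[OF that U(1)[of t]] m(1) m(2)[OF tr(1)[of "U t"], of "U t"] by simp
 define z' where "z' t = S t * cos (U t) * L t / (r t)\<^sup>2" for t
 have d: "(r has_real_derivative v t) (at t)"
  "(v has_real_derivative (L t)\<^sup>2 / r t ^ 3 - r t * (b t + (z t)\<^sup>2 * f t)) (at t)"
  "(z has_real_derivative z' t) (at t)"
  "(L has_real_derivative - ((r t)\<^sup>2 * (S t)\<^sup>2 * sin (U t) * cos (U t) * f t)) (at t)"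
  "(S has_real_derivative - (w^2 / L t ^ 3 * (r t)\<^sup>2 * S t * sin (U t) * cos (U t) * f t)) (at t)"
  "(U has_real_derivative u' t) (at t)" for t
  using chain[OF ed(1)[of "U t"]] chain[OF ed(2)[of "U t"]] chain[OF ed(3)[of "U t"]] chain[OF ed(4)[of "U t"]] chain[OF ed(5)[of "U t"]]
   U(1)[of t] ed(6)[of "U t"]
  unfolding r_def[abs_def] v_def[abs_def] z_def[abs_def] L_def[abs_def] S_def[abs_def] b_def f_def z'_def u'_def by simp_all
 define q where "q t = sqrt (1 - (z t)\<^sup>2)" for t
 have q: "q t > 0" "(q t)\<^sup>2 = 1 - (z t)\<^sup>2" for t using pos(3)[of t] by (simp_all add: q_def)
 have dq: "(q has_real_derivative - (z t * z' t) / q t) (at t)" for t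
 proof -
  have "((%t. 1 - (z t)\<^sup>2) has_real_derivative - (2 * z t * z' t)) (at t)"
   by (rule DERIV_cong[OF DERIV_diff[OF DERIV_const DERIV_power[OF d(3), where n = 2]]]) simp
  note dr = DERIV_chain2[where f = sqrt and g = "%t. 1 - (z t)\<^sup>2", OF DERIV_real_sqrt[OF pos(3)] this]
  have "inverse (sqrt (1 - (z t)\<^sup>2)) / 2 * - (2 * z t * z' t) = - (z t * z' t) / q t"
   unfolding q_def by (simp only: divide_inverse) simp
  then show ?thesis using dr unfolding q_def[abs_def] by (simp only:)
 qed
 \<comment> \<open>Distance from the axis, height and their velocities; \<open>s1\<close> is
   obtained by differentiating \<open>s^2 + Z^2 = r^2\<close>.\<close>
 define s Z g Z1 s1 where "s t = r t * q t" and "Z t = r t * z t" and "g t = S t * cos (U t) * L t / r t"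
  and "Z1 t = v t * z t + g t" and "s1 t = (r t * v t - Z t * Z1 t) / s t" for t
 have s: "s t > 0" for t using pos(2) q(1) by (simp add: s_def)
 have gz: "g t = r t * z' t" for t using pos(2)[of t] by (simp add: g_def z'_def power2_eq_square)
 have ds: "(s has_real_derivative s1 t) (at t)" for t
 proof -
  have "(s has_real_derivative v t * q t + (- (z t * z' t) / q t) * r t) (at t)"
   unfolding s_def[abs_def] by (rule DERIV_mult[OF d(1) dq])
  moreover have "v t * q t + (- (z t * z' t) / q t) * r t = s1 t"
  proof -
   have "s1 t = (r t * (v t * (1 - (z t)\<^sup>2) - z t * (r t * z' t))) / (r t * q t)"
    by (simp add: s1_def Z_def Z1_def gz s_def algebra_simps power2_eq_square)
   also have "\<dots> = (v t * (q t)\<^sup>2 - z t * (r t * z' t)) / q t" using pos(2)[of t] q by simp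
   also have "\<dots> = v t * q t + (- (z t * z' t) / q t) * r t" using q(1)[of t] by (simp add: field_simps power2_eq_square)
   finally show ?thesis by simp
  qed
  ultimately show ?thesis by simp
 qed
 have dZ: "(Z has_real_derivative Z1 t) (at t)" for t
  unfolding Z_def[abs_def] using DERIV_mult[OF d(1) d(3), of t] by (simp add: Z1_def gz mult.commute)
 have dZ1: "(Z1 has_real_derivative - (Z t * (b t + f t))) (at t)" for t
 proof -
  define Sd Ld where "Sd = - (w^2 / L t ^ 3 * (r t)\<^sup>2 * S t * sin (U t) * cos (U t) * f t)"
   and "Ld = - ((r t)\<^sup>2 * (S t)\<^sup>2 * sin (U t) * cos (U t) * f t)"
  define c k where "c = cos (U t)" and "k = sin (U t)"
  have ck: "c^2 + k^2 = 1" by (simp add: c_def k_def)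
  have zk: "z t = S t * k" by (simp add: z_def lat_def S_def k_def)
  have "(g has_real_derivative ((Sd * c + - k * u' t * S t) * L t + Ld * (S t * c)) / r t - S t * c * L t * v t / (r t)\<^sup>2) (at t)"
  proof -
   have "((%t. S t * cos (U t) * L t) has_real_derivative (Sd * c + - k * u' t * S t) * L t + Ld * (S t * c)) (at t)"
    unfolding Sd_def Ld_def c_def k_def by (intro DERIV_mult d DERIV_chain2[OF DERIV_cos d(6)])
   from DERIV_divide[OF this d(1)] show ?thesis
    using pos(2)[of t] unfolding g_def[abs_def] c_def
    by (auto elim!: DERIV_cong simp: diff_divide_distrib power2_eq_square)
  qed
  then have "(Z1 has_real_derivative ((L t)\<^sup>2 / r t ^ 3 - r t * (b t + (z t)\<^sup>2 * f t)) * z t + z' t * v t +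
    (((Sd * c + - k * u' t * S t) * L t + Ld * (S t * c)) / r t - S t * c * L t * v t / (r t)\<^sup>2)) (at t)"
   unfolding Z1_def[abs_def] by (intro DERIV_add DERIV_mult d)
  moreover have "((L t)\<^sup>2 / r t ^ 3 - r t * (b t + (z t)\<^sup>2 * f t)) * z t + z' t * v t +
    (((Sd * c + - k * u' t * S t) * L t + Ld * (S t * c)) / r t - S t * c * L t * v t / (r t)\<^sup>2) = - (Z t * (b t + f t))"
  proof -
   have r0: "r t ~= 0" "L t ~= 0" using pos(1,2)[of t] by auto
   have e1: "Sd * L t / r t = - ((1 - (S t)\<^sup>2) * r t * S t * k * c * f t)"
   proof -
    have "Sd * L t / r t = - (w^2 / (L t)\<^sup>2 * (r t * S t * k * c * f t))"
     unfolding Sd_def c_def k_def using r0 by (simp add: field_simps power2_eq_square power3_eq_cube)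
    moreover have "w^2 / (L t)\<^sup>2 = 1 - (S t)\<^sup>2" using pos(5)[of t] r0(2) by (simp add: field_simps)
    ultimately show ?thesis by simp
   qed
   have e2: "u' t * L t / r t = (L t)\<^sup>2 / r t ^ 3 + r t * f t * k^2 * (1 - (S t)\<^sup>2)"
   proof -
    have "u' t * L t / r t = (L t)\<^sup>2 / r t ^ 3 + r t * f t * k^2 * (w^2 / (L t)\<^sup>2)"
     unfolding u'_def k_def using r0 by (simp add: field_simps power2_eq_square power3_eq_cube)
    moreover have "w^2 / (L t)\<^sup>2 = 1 - (S t)\<^sup>2" using pos(5)[of t] r0(2) by (simp add: field_simps)
    ultimately show ?thesis by simp
   qed
   have e3: "Ld / r t = - (r t * (S t)\<^sup>2 * k * c * f t)"
    unfolding Ld_def c_def k_def using r0 by (simp add: power2_eq_square)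
   have "(((Sd * c + - k * u' t * S t) * L t + Ld * (S t * c)) / r t)
    = (Sd * L t / r t) * c - k * S t * (u' t * L t / r t) + (Ld / r t) * (S t * c)"
    by (simp add: add_divide_distrib diff_divide_distrib algebra_simps)
   also have "\<dots> = - ((1 - (S t)\<^sup>2) * r t * S t * k * c * f t) * c - k * S t * ((L t)\<^sup>2 / r t ^ 3 + r t * f t * k^2 * (1 - (S t)\<^sup>2))
     + - (r t * (S t)\<^sup>2 * k * c * f t) * (S t * c)"
    unfolding e1 e2 e3 ..
   also have "\<dots> = - (S t * k * (L t)\<^sup>2 / r t ^ 3) - r t * f t * S t * k * (1 - (S t)\<^sup>2 * k^2)"
    using ck by (simp add: diff_divide_distrib) algebra
   finally have "((Sd * c + - k * u' t * S t) * L t + Ld * (S t * c)) / r t = \<dots>" .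
   then show ?thesis unfolding z'_def Z_def zk c_def[symmetric]
    by (simp add: algebra_simps power2_eq_square)
  qed
  ultimately show ?thesis by simp
 qed
 \<comment> \<open>The squared speed is \<open>v^2 + L^2 / r^2\<close>. Removing the vertical part
   \<open>Z1^2\<close> and the part \<open>s1^2\<close> away from the axis leaves the rotation
   \<open>\<omega>^2 / s^2\<close>.\<close>
 have key: "(s t)\<^sup>2 * ((v t)\<^sup>2 + (L t)\<^sup>2 / (r t)\<^sup>2 - (Z1 t)\<^sup>2) - (s t * s1 t)\<^sup>2 = \<omega>^2"
  and kin: "(z' t)\<^sup>2 * (r t)\<^sup>2 / (q t)\<^sup>2 + \<omega>^2 / (s t)\<^sup>2 = (L t)\<^sup>2 / (r t)\<^sup>2" for t
 proof -
  have w2: "w^2 = \<omega>^2" by (simp add: \<omega>)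
  have zk: "z t = S t * sin (U t)" by (simp add: z_def lat_def S_def)
  have rg: "r t * g t = S t * cos (U t) * L t" using pos(2)[of t] by (simp add: g_def)
  have L: "(L t)\<^sup>2 * (1 - (z t)\<^sup>2) - (r t * g t)\<^sup>2 = \<omega>^2"
  proof -
   have "(cos (U t))\<^sup>2 = 1 - (sin (U t))\<^sup>2" by (simp add: cos_squared_eq)
   then show ?thesis unfolding rg zk w2[symmetric] pos(5)[of t, symmetric] by algebra
  qed
  have ss1: "s t * s1 t = r t * v t - r t * z t * (v t * z t + g t)"
   using s[of t] by (simp add: s1_def Z_def Z1_def)
  have "(s t)\<^sup>2 * ((v t)\<^sup>2 + (L t)\<^sup>2 / (r t)\<^sup>2 - (Z1 t)\<^sup>2) = (r t)\<^sup>2 * (1 - (z t)\<^sup>2) * ((v t)\<^sup>2 - (Z1 t)\<^sup>2) + (1 - (z t)\<^sup>2) * (L t)\<^sup>2"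
   unfolding s_def power_mult_distrib q(2) using pos(2)[of t] by (simp add: field_simps)
  then show "(s t)\<^sup>2 * ((v t)\<^sup>2 + (L t)\<^sup>2 / (r t)\<^sup>2 - (Z1 t)\<^sup>2) - (s t * s1 t)\<^sup>2 = \<omega>^2"
   unfolding ss1 Z1_def using L by (simp only:) algebra
  have q0: "q t ~= 0" "r t ~= 0" using q(1) pos(2) by (simp_all add: less_imp_neq[THEN not_sym])
  have "(z' t)\<^sup>2 * (r t)\<^sup>2 / (q t)\<^sup>2 + \<omega>^2 / (s t)\<^sup>2 = ((r t * g t)\<^sup>2 + \<omega>^2) / ((r t)\<^sup>2 * (q t)\<^sup>2)"
   unfolding gz s_def using q0 by (simp add: field_simps power2_eq_square)
  also have "\<dots> = (L t)\<^sup>2 * (q t)\<^sup>2 / ((r t)\<^sup>2 * (q t)\<^sup>2)" proof -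
   have "(r t * g t)\<^sup>2 + \<omega>^2 = (L t)\<^sup>2 * (q t)\<^sup>2" using L unfolding q(2) by linarith
   then show ?thesis by simp
  qed
  finally show "(z' t)\<^sup>2 * (r t)\<^sup>2 / (q t)\<^sup>2 + \<omega>^2 / (s t)\<^sup>2 = (L t)\<^sup>2 / (r t)\<^sup>2" using q0 by simp
 qed
 have ds1: "(s1 has_real_derivative \<omega>\<^sup>2 / s t ^ 3 - s t * b t) (at t)" for t
 proof -
  have "((%t. r t * v t - Z t * Z1 t) has_real_derivative
    (v t * v t + ((L t)\<^sup>2 / r t ^ 3 - r t * (b t + (z t)\<^sup>2 * f t)) * r t) - (Z1 t * Z1 t + - (Z t * (b t + f t)) * Z t)) (at t)"
   by (intro DERIV_diff DERIV_mult d dZ dZ1)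
  from DERIV_divide[OF this ds] have "(s1 has_real_derivative
   (((v t * v t + ((L t)\<^sup>2 / r t ^ 3 - r t * (b t + (z t)\<^sup>2 * f t)) * r t) - (Z1 t * Z1 t + - (Z t * (b t + f t)) * Z t)) * s t
    - (r t * v t - Z t * Z1 t) * s1 t) / (s t * s t)) (at t)"
   using s[of t] unfolding s1_def[abs_def] by simp
  moreover have "(((v t * v t + ((L t)\<^sup>2 / r t ^ 3 - r t * (b t + (z t)\<^sup>2 * f t)) * r t) - (Z1 t * Z1 t + - (Z t * (b t + f t)) * Z t)) * s t
    - (r t * v t - Z t * Z1 t) * s1 t) / (s t * s t) = \<omega>^2 / s t ^ 3 - s t * b t"
  proof -
   define A where "A = (v t)\<^sup>2 + (L t)\<^sup>2 / (r t)\<^sup>2 - (Z1 t)\<^sup>2"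
   have s0: "s t ~= 0" using s[of t] by simp
   have "(L t)\<^sup>2 / r t ^ 3 * r t = (L t)\<^sup>2 / (r t)\<^sup>2" using pos(2)[of t] by (simp add: power2_eq_square power3_eq_cube)
   then have 1: "(v t * v t + ((L t)\<^sup>2 / r t ^ 3 - r t * (b t + (z t)\<^sup>2 * f t)) * r t) - (Z1 t * Z1 t + - (Z t * (b t + f t)) * Z t) = A - (s t)\<^sup>2 * b t"
    unfolding A_def s_def power_mult_distrib q(2) Z_def by (simp add: algebra_simps power2_eq_square)
   have 2: "r t * v t - Z t * Z1 t = s t * s1 t" using s0 by (simp add: s1_def)
   have 3: "A = (\<omega>^2 + (s t * s1 t)\<^sup>2) / (s t)\<^sup>2" using key[of t] s0 unfolding A_def[symmetric] by (simp add: field_simps)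
   show ?thesis unfolding 1 2 3 using s0 by (simp add: field_simps power2_eq_square power3_eq_cube)
  qed
  ultimately show ?thesis by simp
 qed
 have "continuous_on UNIV (%t. \<omega> / (s t)\<^sup>2)"
  using s by (intro continuous_intros continuous_at_imp_continuous_on ballI DERIV_isCont[OF ds]) (auto simp: less_imp_neq[THEN not_sym])
 then obtain \<theta> where \<theta>: "\<And>t. (\<theta> has_real_derivative \<omega> / (s t)\<^sup>2) (at t)" using antiderivative_exists by blast
 define \<phi> where "\<phi> t = arcsin (z t)" for t
 have cphi: "cos (\<phi> t) = q t" "sin (\<phi> t) = z t" "\<phi> t \<in> {- pi / 2<..<pi / 2}" for t
  using pos(4)[of t] arcsin_lt_bounded[of "z t"] by (auto simp: \<phi>_def q_def cos_arcsin abs_less_iff)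
 have dphi: "(\<phi> has_real_derivative z' t / q t) (at t)" for t
  unfolding \<phi>_def[abs_def] using DERIV_chain2[where f = arcsin and g = z, OF DERIV_arcsin d(3), of t] pos(4)[of t]
  by (simp add: abs_less_iff q_def divide_inverse mult.commute)
 have sph: "spherical (r t) (\<theta> t) (\<phi> t) = vector [s t * cos (\<theta> t), s t * sin (\<theta> t), Z t]"
  "spherical (r t) (\<theta> t) (\<phi> t) = rotz (\<theta> t) (meridian (r t, z t))" "spherical (r t) 0 (\<phi> t) = meridian (r t, z t)" for t
  by (simp_all add: spherical_def cphi s_def Z_def vec_eq_iff forall_3 meridian_def) (simp_all add: q_def)
 note newton = newton_cylindrical[OF s ds ds1 dZ dZ1 \<theta>]
 have sol: "ellipsoid_solution R e r \<theta> \<phi>"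
  unfolding ellipsoid_solution_def
 proof (intro conjI allI exI)
  fix t
  show "0 < r t" "\<phi> t \<in> {- pi / 2<..<pi / 2}" by (rule pos cphi)+
  show "spherical (r t) (\<theta> t) (\<phi> t) \<notin> ellipsoid R e" unfolding sph(2) by (rule outside[OF pos(6)])
  show "r differentiable at t" "\<theta> differentiable at t" "\<phi> differentiable at t"
   using d(1) \<theta> dphi real_differentiable_def by blast+
  show "((%t. spherical (r t) (\<theta> t) (\<phi> t)) has_vector_derivative
    vector [s1 t * cos (\<theta> t) - \<omega> / s t * sin (\<theta> t), s1 t * sin (\<theta> t) + \<omega> / s t * cos (\<theta> t), Z1 t]) (at t)"
   unfolding sph(1) by (rule newton(1))
  show "((%t. vector [s1 t * cos (\<theta> t) - \<omega> / s t * sin (\<theta> t), s1 t * sin (\<theta> t) + \<omega> / s t * cos (\<theta> t), Z1 t] :: real^3) has_vector_derivative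
   - vector [s t * cos (\<theta> t) * b t, s t * sin (\<theta> t) * b t, Z t * (b t + f t)]) (at t)"
   by (rule newton(2))
  have "(let b = 1 / fst (r t, z t) ^ 3 + e * E e (r t, z t); v = rotz (\<theta> t) (meridian (r t, z t)) in
    vector [v $ 1 * b, v $ 2 * b, v $ 3 * (b + e * D e (r t, z t))])
   = (vector [s t * cos (\<theta> t) * b t, s t * sin (\<theta> t) * b t, Z t * (b t + f t)] :: real^3)"
   unfolding Let_def sph(2)[symmetric] sph(1) by (simp add: b_def f_def B_def F_def \<Xi>_def \<Delta>_def r_def z_def)
  with grad[OF pos(6)[of t], of "\<theta> t"] show "GDERIV (potential R e) (spherical (r t) (\<theta> t) (\<phi> t)) :>
   vector [s t * cos (\<theta> t) * b t, s t * sin (\<theta> t) * b t, Z t * (b t + f t)]"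
   unfolding sph(2) by simp
 qed
 have red: "reduced_state r \<phi> t = reduced (U t) (y (U t))" for t
  unfolding reduced_state_def DERIV_imp_deriv[OF d(1)] DERIV_imp_deriv[OF dphi]
  by (simp add: reduced_def z'_def v_def r_def \<phi>_def z_def S_def L_def q_def)
 have rng: "range (reduced_state r \<phi>) = range (%u. reduced u (y u))"
 proof -
  have "range (reduced_state r \<phi>) = (%u. reduced u (y u)) ` range U" by (auto simp: red image_iff)
  then show ?thesis using U(2) by simp
 qed
 have "relative_periodic_solution R e r \<theta> \<phi>"
  unfolding relative_periodic_solution_def red using sol U(3) by (auto intro!: exI[of _ T] simp: U(4) per perU(2))
 moreover have "angular_momentum r \<theta> \<phi> t = \<omega>" for t
  unfolding angular_momentum_def DERIV_imp_deriv[OF \<theta>] cphi using pos(2)[of t] q(1)[of t] by (simp add: s_def power_mult_distrib)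
 moreover have "range (reduced_state r \<phi>) \<subseteq> energy_surface R h \<omega> e"
 proof (rule image_subsetI)
  fix t
  have "kinetic \<omega> (v t) (z' t / q t) (r t) (\<phi> t) = (v t)\<^sup>2 / 2 + ((z' t)\<^sup>2 * (r t)\<^sup>2 / (q t)\<^sup>2 + \<omega>^2 / (s t)\<^sup>2) / 2"
   unfolding kinetic_def cphi s_def by (simp add: power_mult_distrib power_divide add_divide_distrib mult_ac)
  also have "\<dots> = (v t)\<^sup>2 / 2 + (L t)\<^sup>2 / (2 * (r t)\<^sup>2)" unfolding kin by simp
  finally have k: "kinetic \<omega> (v t) (z' t / q t) (r t) (\<phi> t) + potential R e (spherical (r t) 0 (\<phi> t)) = h"
   using tr(3)[of "U t"] unfolding energy_def sph(3) by (simp add: v_def L_def r_def z_def)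
  have "rotz 0 x = x" for x by (simp add: vec_eq_iff forall_3)
  then have "spherical (r t) 0 (\<phi> t) \<notin> ellipsoid R e" unfolding sph(3) using outside[OF pos(6)[of t], of 0] by simp
  then show "reduced_state r \<phi> t \<in> energy_surface R h \<omega> e"
   unfolding energy_surface_def reduced_state_def DERIV_imp_deriv[OF d(1)] DERIV_imp_deriv[OF dphi]
   using k pos(2) cphi(3)[of t] by simp
 qed
 ultimately show ?thesis unfolding relative_periodic_orbits_def rng[symmetric] by blast
qed

end

section \<open>The equatorial section and the angle of rotation\<close>

text \<open>In \<open>x = S^2\<close> the rate is \<open>k\<close> times a cubic whose difference
  quotients on the unit interval are at most 14 in modulus; passing from \<open>x\<close> to
  \<open>S\<close> doubles this. The last bound is the twist: the rate falls off from its equatorial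
  value at least like \<open>S^2\<close>.\<close>

lemma rot_bounds:
 fixes k S S' :: real and rt :: "real => real"
 assumes "0 <= k" "\<And>S. rt S = k * (1 - S^2)\<^sup>2 * (1 - 5/4 * S^2)"
 shows "\<bar>S\<bar> <= 1 ==> \<bar>S'\<bar> <= 1 ==> \<bar>rt S - rt S'\<bar> <= 28 * k * \<bar>S - S'\<bar>"
  "\<bar>S\<bar> <= 1 ==> \<bar>rt S\<bar> <= k" "\<bar>S\<bar> <= 1 ==> k * S^2 <= rt 0 - rt S"
proof -
 have g: "rt S = k * (1 - 13/4 * S^2 + 7/2 * (S^2)\<^sup>2 - 5/4 * (S^2) ^ 3)" for S
  unfolding assms(2) by (simp add: power2_eq_square power3_eq_cube algebra_simps)
 show "\<bar>rt S - rt S'\<bar> <= 28 * k * \<bar>S - S'\<bar>" if S: "\<bar>S\<bar> <= 1" "\<bar>S'\<bar> <= 1"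
 proof -
  define x y where "x = S^2" and "y = S'\<^sup>2"
  have xy: "0 <= x" "x <= 1" "0 <= y" "y <= 1" using S by (simp_all add: x_def y_def abs_square_le_1)
  have "rt S - rt S' = k * ((x - y) * (- 13/4 + 7/2 * (x + y) - 5/4 * (x^2 + x * y + y^2)))"
   unfolding g x_def[symmetric] y_def[symmetric] by (simp add: field_simps power2_eq_square power3_eq_cube)
  moreover have "\<bar>- 13/4 + 7/2 * (x + y) - 5/4 * (x^2 + x * y + y^2)\<bar> <= 14"
  proof -
   have "0 <= x^2" "x^2 <= 1" "0 <= y^2" "y^2 <= 1" "0 <= x * y" "x * y <= 1"
    using xy by (auto simp: power_le_one mult_le_one)
   then have "0 <= x + y" "x + y <= 2" "0 <= x^2 + x * y + y^2" "x^2 + x * y + y^2 <= 3" using xy by simp_all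
   moreover have "\<bar>- 13/4 + 7/2 * t - 5/4 * q\<bar> <= 14" if "0 <= t" "t <= 2" "0 <= q" "q <= 3" for t q :: real
    using that by linarith
   ultimately show ?thesis by blast
  qed
  moreover have "\<bar>x - y\<bar> <= 2 * \<bar>S - S'\<bar>"
  proof -
   have "x - y = (S - S') * (S + S')" by (simp add: x_def y_def power2_eq_square algebra_simps)
   then have "\<bar>x - y\<bar> = \<bar>S - S'\<bar> * \<bar>S + S'\<bar>" by (simp add: abs_mult)
   also have "\<dots> <= \<bar>S - S'\<bar> * 2" using S by (intro mult_left_mono) auto
   finally show ?thesis by simp
  qed
  ultimately have "\<bar>rt S - rt S'\<bar> <= k * ((2 * \<bar>S - S'\<bar>) * 14)"
   using assms(1) by (simp only: abs_mult abs_of_nonneg) (intro mult_left_mono mult_mono, auto)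
  then show ?thesis by (simp add: mult_ac)
 qed
 show "\<bar>rt S\<bar> <= k" if "\<bar>S\<bar> <= 1"
 proof -
  have x: "0 <= S^2" "S^2 <= 1" using that by (simp_all add: abs_square_le_1)
  have "\<bar>(1 - S^2)\<^sup>2 * (1 - 5/4 * S^2)\<bar> <= 1 * 1"
   unfolding abs_mult using x by (intro mult_mono) (auto simp: abs_le_iff power_le_one)
  then have "k * \<bar>(1 - S^2)\<^sup>2 * (1 - 5/4 * S^2)\<bar> <= k * 1" using assms(1) by (intro mult_left_mono) auto
  then show ?thesis unfolding assms(2) using assms(1) by (simp add: abs_mult mult.assoc)
 qed
 show "k * S^2 <= rt 0 - rt S" if "\<bar>S\<bar> <= 1"
 proof -
  define x where "x = S^2"
  have x: "0 <= x" "x <= 1" using that by (simp_all add: x_def abs_square_le_1)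
  have "rt 0 - rt S = k * (x * (13/4 - 7/2 * x + 5/4 * x^2))"
   unfolding g x_def[symmetric] by (simp add: power2_eq_square power3_eq_cube algebra_simps)
  moreover have "1 <= 13/4 - 7/2 * x + 5/4 * x^2"
  proof -
   have "(1 - x) * (9/4 - 5/4 * x) \<ge> 0" using x by (intro mult_nonneg_nonneg) auto
   moreover have "(1 - x) * (9/4 - 5/4 * x) = 9/4 - 7/2 * x + 5/4 * x^2" by (simp add: field_simps power2_eq_square)
   ultimately show ?thesis by linarith
  qed
  then have "k * (x * 1) <= k * (x * (13/4 - 7/2 * x + 5/4 * x^2))" using x assms(1) by (intro mult_left_mono) auto
  ultimately show ?thesis by (simp add: x_def)
 qed
qed

text \<open>\<rho>0 is the semimajor axis belonging to \<open>h\<close>, and \<epsilon> the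
  eccentricity of the equatorial Kepler orbit with energy \<open>h\<close> and momentum
  \<open>w\<close>. \<open>C5\<close> is a Lipschitz constant of the perturbing potential on the
  equator, \<open>Cs\<close> one of \<open>S\<close> as a function of \<open>p\<close>,
  \<open>k0\<close> is \<open>rot 0\<close>, and \<open>C6\<close>, \<open>C7\<close> bound the
  second-order errors of displacement and angle in one turn. The inequalities \<open>small\<close>
  are the demands on the size of \<open>e\<close>.\<close>

locale near_kepler = orbit +
 fixes \<omega> \<epsilon> \<rho>0 C1 C2 Cr C4 C5 Cs C6 C7 k0 ra rb :: real
 assumes \<omega>: "w = \<bar>\<omega>\<bar>" and \<epsilon>: "0 < \<epsilon>" "\<epsilon> < e2" and \<rho>0: "\<rho>0 > 0" "h = - 1 / (2 * \<rho>0)" "w^2 = \<rho>0 * (1 - \<epsilon>^2)"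
  and ra: "ra = w^2 / (1 + e1)" and rb: "rb = w^2 / ((1 - e1^2) * (1 - e1))"
  and turn: "\<And>y y'. y \<in> K2 ==> y' \<in> K2 ==> norm ((flow e y (2 * pi) - y - (e * (2 * pi * rot (snd y))) *\<^sub>R (\<i> * fst y, 0))
    - (flow e y' (2 * pi) - y' - (e * (2 * pi * rot (snd y'))) *\<^sub>R (\<i> * fst y', 0))) <= C1 * e^2 * norm (y - y')"
  and near_flow: "\<And>y u. norm (flow e y u - y) <= C2 * \<bar>e\<bar> * \<bar>u\<bar>"
  and cont_flow: "\<And>u. continuous_on UNIV (%y. flow e y u)"
  and rad_lip: "\<And>y y' u. y \<in> K ==> y' \<in> K ==> \<bar>rad w u y - rad w u y'\<bar> <= Cr * norm (y - y')"
  and Eb: "\<And>x. x \<in> X ==> \<bar>E e x\<bar> <= C4"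
  and nonneg: "0 <= C0" "0 <= C1" "0 <= C2" "0 <= Cr" "0 <= C4"
  and constants: "C5 = \<bar>e\<bar> * (rb * C4)" "Cs = 12 / ((1 - e2^2) * \<epsilon>)" "k0 = 6 * c / w ^ 4"
   "C6 = C1 * (1 + Cs) + 2 * pi * (28 * k0 * Cs * (2 * C2))" "C7 = C6 + 2 * (2 * pi * k0 + C6)\<^sup>2"
  and small: "C0 + rb * C5 < 1 / (2 * \<rho>0)" "2 * rb * C0 + 2 * C2 * \<bar>e\<bar> < \<epsilon> / 2" "2 * rb^2 * C0 <= \<rho>0 * \<epsilon>^2 / 4"
   "2 * rb^2 * C0 < ((\<rho>0 - ra)\<^sup>2 - (\<rho>0 * \<epsilon>)\<^sup>2) / \<rho>0" "2 * w^2 * (C5 * Cr) <= 1" "2 * w^2 * (C5 * Cr) <= (1 - e2^2) * \<epsilon> / 4"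
   "\<bar>e\<bar> <= 1" "\<bar>e\<bar> * (2 * pi * k0 + C6) <= 1 / 2" "C7 * \<bar>e\<bar> <= k0 * (\<epsilon>^2 / 4)"
begin

lemma e2_1: "e2 < 1" "0 < 1 - e2^2" "\<epsilon> < 1" "0 < 1 - \<epsilon>^2"
 using e2 e1 \<epsilon> by (simp_all add: abs_square_less_1)

lemma range_facts: "0 < ra" "ra < \<rho>0 * (1 - \<epsilon>)" "\<rho>0 * (1 + \<epsilon>) < rb" "ra < \<rho>0" "0 < rb" "ra < rb"
proof -
 have e: "\<epsilon> < e1" "0 < 1 - e1" "0 < 1 - e1^2" "1 - e1^2 < 1" using \<epsilon> e2 e1 by (simp_all add: abs_square_less_1)
 show "0 < ra" using w e1 by (simp add: ra)
 have f: "1 - \<epsilon>^2 = (1 - \<epsilon>) * (1 + \<epsilon>)" by (simp add: power2_eq_square algebra_simps)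
 have "ra = \<rho>0 * (1 - \<epsilon>) * ((1 + \<epsilon>) / (1 + e1))" unfolding ra \<rho>0(3) f by simp
 also have "\<dots> < \<rho>0 * (1 - \<epsilon>) * 1" using e \<epsilon> e2_1 \<rho>0 e1 by (intro mult_strict_left_mono) auto
 finally show *: "ra < \<rho>0 * (1 - \<epsilon>)" by simp
 have "\<rho>0 * (1 - \<epsilon>) <= \<rho>0 * 1" using \<rho>0 \<epsilon> by (intro mult_left_mono) auto
 then show "ra < \<rho>0" using * by simp
 have "(1 - e1^2) * (1 - e1) < 1 * (1 - e1)" using e by (intro mult_strict_right_mono) auto
 also have "\<dots> < 1 - \<epsilon>" using e by simp
 finally have l: "(1 - e1^2) * (1 - e1) < 1 - \<epsilon>" .
 have "\<rho>0 * (1 + \<epsilon>) = w^2 / (1 - \<epsilon>)" unfolding \<rho>0(3) f using e2_1 by simp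
 also have "\<dots> < rb" unfolding rb using l e w by (intro divide_strict_left_mono) auto
 finally show "\<rho>0 * (1 + \<epsilon>) < rb" .
 moreover have "\<rho>0 * 1 <= \<rho>0 * (1 + \<epsilon>)" using \<rho>0 \<epsilon> by (intro mult_left_mono) auto
 ultimately show "0 < rb" "ra < rb" using \<rho>0(1) \<open>ra < \<rho>0\<close> by linarith+
qed

text \<open>At a node with vanishing radial velocity, solving the equation energy = \<open>h\<close>
  for the squared angular momentum at distance \<open>r\<close> gives \<open>sec r\<close>. Then
  \<open>p0\<close> follows from the conic equation at \<open>u = 0\<close>; without perturbation it
  is \<open>1 - r / \<rho>0\<close>.\<close>

definition psi :: "real => real" where "psi r = potential R e (meridian (r, 0)) + 1 / r"
definition p0 :: "real => real" where "p0 r = 1 - r / \<rho>0 - 2 * (r * psi r)"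
definition sec :: "real => real" where "sec r = r * (1 + p0 r)"

text \<open>The state at the ascending node at distance \<open>r\<close> with vanishing radial velocity and energy \<open>h\<close>.\<close>

definition init :: "real => complex \<times> real" where "init r = (of_real (p0 r), sqrt (1 - w^2 / sec r))"

lemma section_X: "r \<in> {ra..rb} ==> (r, 0) \<in> X"
 using e1 by (simp add: X_def ra rb)

text \<open>The Kepler part of the gradient cancels against the derivative of \<open>1 / r\<close>,
  which leaves \<open>e r E\<close>, a quantity of first order.\<close>

lemma psi_bounds:
 assumes r: "r \<in> {ra..rb}"
 shows "\<bar>psi r\<bar> <= C0" "r' \<in> {ra..rb} ==> \<bar>psi r - psi r'\<bar> <= C5 * \<bar>r - r'\<bar>" "continuous_on {ra..rb} psi"
proof -
 show "\<bar>psi r\<bar> <= C0" using near[OF section_X[OF r]] by (simp add: psi_def)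
 have d: "(psi has_real_derivative e * (r * E e (r, 0))) (at r)" if r: "r \<in> {ra..rb}" for r
 proof -
  have r0: "r > 0" using r range_facts(1) by auto
  have m: "meridian (r, 0) = vector [r, 0, 0]" for r by (simp add: meridian_def)
  have dx: "((%r. meridian (r, 0)) has_vector_derivative vector [1, 0, 0]) (at r)"
   unfolding m by (intro has_vector_derivative_vector3) (auto intro!: derivative_eq_intros)
  have "rotz 0 v = v" for v by (simp add: vec_eq_iff forall_3)
  then have "GDERIV (potential R e) (meridian (r, 0)) :> vector [r * (1 / r ^ 3 + e * E e (r, 0)), 0, 0]"
   using grad[OF section_X[OF r], of 0] by (simp add: Let_def)
  from GDERIV_compose[OF this dx] have "((%r. potential R e (meridian (r, 0))) has_real_derivative r * (1 / r ^ 3 + e * E e (r, 0))) (at r)"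
   by (simp add: inner_vec_def sum_3)
  moreover have "((%r. 1 / r) has_real_derivative - (1 / r^2)) (at r)"
   using r0 by (auto intro!: derivative_eq_intros simp: power2_eq_square)
  ultimately have "(psi has_real_derivative r * (1 / r ^ 3 + e * E e (r, 0)) + - (1 / r^2)) (at r)"
   unfolding psi_def[abs_def] by (rule DERIV_add)
  moreover have "r * (1 / r ^ 3 + e * E e (r, 0)) + - (1 / r^2) = e * (r * E e (r, 0))"
   using r0 by (simp add: field_simps power2_eq_square power3_eq_cube)
  ultimately show ?thesis by simp
 qed
 show "\<bar>psi r - psi r'\<bar> <= C5 * \<bar>r - r'\<bar>" if r': "r' \<in> {ra..rb}"
 proof -
  have "norm (psi r - psi r') <= C5 * norm (r - r')"
  proof (rule field_differentiable_bound[of "{ra..rb}" psi "%r. e * (r * E e (r, 0))"])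
   fix s assume s: "s \<in> {ra..rb}"
   show "(psi has_field_derivative e * (s * E e (s, 0))) (at s within {ra..rb})" by (rule has_field_derivative_at_within[OF d[OF s]])
   have "\<bar>s\<bar> * \<bar>E e (s, 0)\<bar> <= rb * C4" using s range_facts(1) Eb[OF section_X[OF s]] nonneg by (intro mult_mono) auto
   then show "norm (e * (s * E e (s, 0))) <= C5" unfolding constants(1) real_norm_def abs_mult by (intro mult_left_mono) auto
  qed (use r r' in auto)
  then show ?thesis by simp
 qed
 show "continuous_on {ra..rb} psi" by (intro continuous_at_imp_continuous_on ballI DERIV_isCont[OF d])
qed

lemma section_continuous: "continuous_on {ra..rb} p0" "continuous_on {ra..rb} sec"
proof -
 show "continuous_on {ra..rb} p0" unfolding p0_def[abs_def]
  using range_facts psi_bounds(3)[of ra] \<rho>0(1) by (intro continuous_intros) auto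
 then show "continuous_on {ra..rb} sec" unfolding sec_def[abs_def] by (intro continuous_intros)
qed

text \<open>Completing the square exhibits the squared angular momentum as a downward parabola with
  vertex at \<rho>0, up to the perturbation.\<close>

lemma sec_eq: "sec r = \<rho>0 - (r - \<rho>0)\<^sup>2 / \<rho>0 - 2 * (r^2 * psi r)"
 using \<rho>0(1) by (simp add: sec_def p0_def field_simps power2_eq_square)

lemma sec_error: "r \<in> {ra..rb} ==> \<bar>2 * (r^2 * psi r)\<bar> <= 2 * rb^2 * C0"
proof -
 assume r: "r \<in> {ra..rb}"
 have "\<bar>r\<^sup>2 * psi r\<bar> <= rb^2 * C0" unfolding abs_mult
  using r range_facts(1) psi_bounds(1)[OF r] nonneg by (intro mult_mono) (auto intro: power_mono)
 then show ?thesis by simp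
qed

text \<open>The Kepler slope \<open>- 1 / \<rho>0\<close> dominates the Lipschitz constant of the
  perturbation. It follows that no other starting radius of the curve has the same \<open>p\<close>
  as the centre.\<close>

lemma p0_decreasing:
 assumes "r \<in> {ra..rb}" "r' \<in> {ra..rb}" "r < r'" shows "p0 r' < p0 r"
proof -
 have "r * psi r - r' * psi r' = r * (psi r - psi r') + (r - r') * psi r'" by (simp add: algebra_simps)
 then have "\<bar>r * psi r - r' * psi r'\<bar> <= \<bar>r\<bar> * \<bar>psi r - psi r'\<bar> + \<bar>r - r'\<bar> * \<bar>psi r'\<bar>"
  by (metis abs_mult abs_triangle_ineq)
 also have "\<dots> <= rb * (C5 * \<bar>r - r'\<bar>) + \<bar>r - r'\<bar> * C0"
  using assms range_facts(1,5) psi_bounds(2)[OF assms(1,2)] psi_bounds(1)[OF assms(2)] by (intro add_mono mult_mono) auto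
 also have "\<dots> = (C0 + rb * C5) * (r' - r)" using assms(3) by (simp add: algebra_simps)
 also have "\<dots> < 1 / (2 * \<rho>0) * (r' - r)" using small(1) assms(3) by (intro mult_strict_right_mono) auto
 finally have "2 * (r * psi r - r' * psi r') < (r' - r) / \<rho>0" by (simp add: abs_less_iff)
 then show ?thesis by (simp add: p0_def diff_divide_distrib)
qed

text \<open>The definition of \<open>sec\<close> gives
  \<open>(1 - p0^2) (1 - S^2) = 1 - \<epsilon>^2 + 2 w^2 psi\<close> exactly. By \<open>gap\<close>
  this exceeds \<open>1 - e2^2\<close>, which places the state in \<open>K\<close>.\<close>

lemma init_facts:
 assumes r: "r \<in> {ra..rb}" and s: "w^2 <= sec r"
 shows "init r \<in> K" "energy 0 (init r) = h" "rad w 0 (init r) = r" "0 <= snd (init r)" "Im (fst (init r)) = 0" "(snd (init r))\<^sup>2 = 1 - w^2 / sec r"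
proof -
 have r0: "r > 0" using r range_facts(1) by auto
 have w2: "w\<^sup>2 > 0" using w by simp
 have s0: "sec r > 0" using s w2 by linarith
 then have q: "1 + p0 r > 0" using r0 by (simp add: sec_def zero_less_mult_iff)
 have S: "0 <= 1 - w^2 / sec r" using s s0 by simp
 then show S2: "(snd (init r))\<^sup>2 = 1 - w^2 / sec r" and "0 <= snd (init r)" by (simp_all add: init_def)
 show "Im (fst (init r)) = 0" by (simp add: init_def)
 have "(1 - (p0 r)\<^sup>2) * (w^2 / sec r) = (1 - \<epsilon>^2) + 2 * w^2 * psi r"
 proof -
  have "(1 - (p0 r)\<^sup>2) * (w^2 / sec r) = w^2 * ((1 - p0 r) * (1 + p0 r)) / (r * (1 + p0 r))"
   by (simp add: sec_def power2_eq_square algebra_simps)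
  also have "\<dots> = w^2 * (1 - p0 r) / r" using q by simp
  also have "\<dots> = w^2 / \<rho>0 + 2 * w^2 * psi r" using r0 \<rho>0(1) by (simp add: p0_def field_simps)
  also have "w^2 / \<rho>0 = 1 - \<epsilon>^2" using \<rho>0 by simp
  finally show ?thesis .
 qed
 moreover have "\<bar>2 * w^2 * psi r\<bar> <= 2 * w^2 * C0"
  unfolding abs_mult using psi_bounds(1)[OF r] by (simp add: mult_left_mono)
 moreover have "1 + 2 * h * w^2 = \<epsilon>^2" using \<rho>0 by simp
 ultimately have A: "(1 - (p0 r)\<^sup>2) * (w^2 / sec r) > 1 - e2^2" using gap by linarith
 have f: "0 < w^2 / sec r" "w^2 / sec r <= 1" using divide_pos_pos[OF w2 s0] s s0 by (simp_all add: divide_le_eq)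
 have p1: "0 < 1 - (p0 r)\<^sup>2" using A e2_1(2) f(1) by (smt (verit) mult_nonpos_nonneg)
 have "(1 - (p0 r)\<^sup>2) * (w^2 / sec r) <= (1 - (p0 r)\<^sup>2) * 1" "(1 - (p0 r)\<^sup>2) * (w^2 / sec r) <= 1 * (w^2 / sec r)"
  using p1 f by (intro mult_left_mono mult_right_mono; simp)+
 moreover define P where "P = (1 - (p0 r)\<^sup>2) * (w^2 / sec r)"
 ultimately have "P <= 1 - (p0 r)\<^sup>2" "P <= w^2 / sec r" "1 - e2^2 < P" using A by simp_all
 then have "(p0 r)\<^sup>2 <= e2^2" "(snd (init r))\<^sup>2 <= e2^2" using S2 by linarith+
 then have "\<bar>p0 r\<bar> <= e2" "\<bar>snd (init r)\<bar> <= e2" using e2 by (simp_all add: abs_le_square_iff[symmetric])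
 then have "init r \<in> K2" by (simp add: K2_iff) (simp add: init_def)
 then show iK: "init r \<in> K" by (rule K2_K)
 have L2: "(Lam w (init r))\<^sup>2 = sec r" using S2 s0 w2 S
  by (simp add: Lam_def power_divide)
 have ec: "ecc 0 (init r) = of_real (p0 r)" by (simp add: ecc_def init_def)
 show rr: "rad w 0 (init r) = r" unfolding rad_def L2 ec using q by (simp add: sec_def)
 have "vel w 0 (init r) = 0" by (simp add: vel_def ec)
 moreover have "lat 0 (init r) = 0" by (simp add: lat_def)
 ultimately have "energy 0 (init r) = sec r / (2 * r^2) + potential R e (meridian (r, 0))"
  by (simp add: energy_def L2 rr)
 also have "potential R e (meridian (r, 0)) = psi r - 1 / r" by (simp add: psi_def)
 also have "sec r / (2 * r^2) + (psi r - 1 / r) = h"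
  unfolding sec_def p0_def \<rho>0(2) using r0 \<rho>0(1) by (simp add: field_simps power2_eq_square)
 finally show "energy 0 (init r) = h" .
qed

lemma init_continuous:
 assumes "A \<subseteq> {ra..rb}" "\<And>r. r \<in> A ==> w\<^sup>2 <= sec r" shows "continuous_on A (%r. flow e (init r) u)"
proof -
 have "continuous_on A p0" "continuous_on A sec" using section_continuous assms(1) continuous_on_subset by blast+
 moreover have "\<forall>r\<in>A. sec r ~= 0" using assms(2) w by (smt (verit) zero_less_power)
 ultimately have "continuous_on A init" unfolding init_def[abs_def] by (intro continuous_intros)
 from continuous_on_compose2[OF cont_flow this] show ?thesis by simp
qed

text \<open>The reflection at \<open>pi / 2\<close> fixes the states with \<open>Re p = 0\<close>.
  At \<open>\<rho>0 (1 - \<epsilon>/2)\<close> and \<open>\<rho>0 (1 + \<epsilon>/2)\<close> the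
  initial \<open>p\<close> is about \<open>\<epsilon> / 2\<close> and
  \<open>- \<epsilon> / 2\<close>, and a quarter turn changes it by \<open>O(e)\<close>, so the real
  part changes sign in between. On this interval the inclination is bounded below.\<close>

lemma center_exists:
 obtains rc where "rc \<in> {ra<..<rb}" "\<rho>0 * (1 - \<epsilon>) < rc" "w^2 < sec rc" "\<epsilon> / 2 <= snd (init rc)" "\<bar>p0 rc\<bar> <= 2 * C2 * \<bar>e\<bar>"
  "Re (fst (flow e (init rc) (pi / 2))) = 0"
proof -
 define \<eta> where "\<eta> = \<rho>0 * \<epsilon> / 2"
 have \<eta>: "\<eta> > 0" "\<eta> < \<rho>0 * \<epsilon>" using \<rho>0 \<epsilon> by (simp_all add: \<eta>_def)
 have I: "\<rho>0 * (1 - \<epsilon>) < \<rho>0 - \<eta>" "\<rho>0 + \<eta> < \<rho>0 * (1 + \<epsilon>)" using \<eta> by (simp_all add: algebra_simps)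
 have IX: "{\<rho>0 - \<eta>..\<rho>0 + \<eta>} \<subseteq> {ra<..<rb}" using I range_facts by auto
 then have IX': "{\<rho>0 - \<eta>..\<rho>0 + \<eta>} \<subseteq> {ra..rb}" by (meson atLeastAtMost_iff greaterThanLessThan_iff less_imp_le subset_iff)
 have big: "w^2 + \<rho>0 * \<epsilon>^2 / 2 <= sec r" "sec r <= 2 * \<rho>0" if r: "r \<in> {\<rho>0 - \<eta>..\<rho>0 + \<eta>}" for r
 proof -
  have "\<bar>r - \<rho>0\<bar> <= \<bar>\<eta>\<bar>" using r \<eta> by auto
  then have "(r - \<rho>0)\<^sup>2 <= \<eta>\<^sup>2" by (simp only: abs_le_square_iff)
  then have "(r - \<rho>0)\<^sup>2 / \<rho>0 <= \<eta>\<^sup>2 / \<rho>0" using \<rho>0 by (simp add: divide_right_mono)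
  also have "\<eta>\<^sup>2 / \<rho>0 = \<rho>0 * \<epsilon>^2 / 4" using \<rho>0 by (simp add: \<eta>_def power2_eq_square field_simps)
  finally have q: "(r - \<rho>0)\<^sup>2 / \<rho>0 <= \<rho>0 * \<epsilon>^2 / 4" "0 <= (r - \<rho>0)\<^sup>2 / \<rho>0" using \<rho>0 by simp_all
  have er: "\<bar>2 * (r^2 * psi r)\<bar> <= \<rho>0 * \<epsilon>^2 / 4" using sec_error[of r] small(3) r IX' by force
  have w2: "w^2 = \<rho>0 - \<rho>0 * \<epsilon>^2" unfolding \<rho>0(3) by (simp add: algebra_simps)
  have "\<rho>0 * \<epsilon>^2 <= \<rho>0 * 1" using \<rho>0 e2_1 by (intro mult_left_mono) auto
  then show "w^2 + \<rho>0 * \<epsilon>^2 / 2 <= sec r" "sec r <= 2 * \<rho>0"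
   using q er unfolding sec_eq w2 abs_le_iff by linarith+
 qed
 have pos: "0 < \<rho>0 * \<epsilon>^2 / 2" using \<rho>0 \<epsilon> by simp
 then have w2: "w^2 < sec r" if "r \<in> {\<rho>0 - \<eta>..\<rho>0 + \<eta>}" for r using big(1)[OF that] by linarith
 define f where "f r = Re (fst (flow e (init r) (pi / 2)))" for r
 have cf: "continuous_on {\<rho>0 - \<eta>..\<rho>0 + \<eta>} f" unfolding f_def
  by (intro continuous_intros init_continuous IX') (use w2 in \<open>auto simp: less_imp_le\<close>)
 have fp: "\<bar>f r - p0 r\<bar> <= 2 * C2 * \<bar>e\<bar>" for r
 proof -
  have "\<bar>f r - p0 r\<bar> = \<bar>Re (fst (flow e (init r) (pi / 2) - init r))\<bar>" by (simp add: f_def init_def)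
  also have "\<dots> <= norm (flow e (init r) (pi / 2) - init r)"
   by (rule order_trans[OF abs_Re_le_cmod norm_fst_snd(1)])
  also have "\<dots> <= C2 * \<bar>e\<bar> * \<bar>pi / 2\<bar>" by (rule near_flow)
  also have "\<dots> <= C2 * \<bar>e\<bar> * 2" using nonneg pi_less_4 by (intro mult_left_mono) auto
  finally show ?thesis by simp
 qed
 have rp: "\<bar>2 * (r * psi r)\<bar> <= 2 * rb * C0" if r: "r \<in> {\<rho>0 - \<eta>..\<rho>0 + \<eta>}" for r
 proof -
  have r': "r \<in> {ra..rb}" using r IX' by blast
  have "\<bar>r * psi r\<bar> <= rb * C0" unfolding abs_mult using r' range_facts(1,5) psi_bounds(1)[OF r'] by (intro mult_mono) auto
  then show ?thesis by simp
 qed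
 have en: "\<rho>0 - \<eta> \<in> {\<rho>0 - \<eta>..\<rho>0 + \<eta>}" "\<rho>0 + \<eta> \<in> {\<rho>0 - \<eta>..\<rho>0 + \<eta>}" using \<eta> by auto
 have "\<eta> / \<rho>0 = \<epsilon> / 2" using \<rho>0 by (simp add: \<eta>_def)
 then have "p0 (\<rho>0 - \<eta>) = \<epsilon> / 2 - 2 * ((\<rho>0 - \<eta>) * psi (\<rho>0 - \<eta>))" "p0 (\<rho>0 + \<eta>) = - (\<epsilon> / 2) - 2 * ((\<rho>0 + \<eta>) * psi (\<rho>0 + \<eta>))"
  using \<rho>0(1) unfolding p0_def by (simp_all add: diff_divide_distrib add_divide_distrib)
 then have sg: "f (\<rho>0 + \<eta>) <= 0" "0 <= f (\<rho>0 - \<eta>)"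
  using rp[OF en(1)] rp[OF en(2)] fp[of "\<rho>0 - \<eta>"] fp[of "\<rho>0 + \<eta>"] small(2) unfolding abs_le_iff by linarith+
 obtain rc where rc: "\<rho>0 - \<eta> <= rc" "rc <= \<rho>0 + \<eta>" "f rc = 0" using IVT2'[OF sg _ cf] \<eta> by auto
 then have rcI: "rc \<in> {\<rho>0 - \<eta>..\<rho>0 + \<eta>}" by simp
 note ok = init_facts[OF subsetD[OF IX' rcI] less_imp_le[OF w2[OF rcI]]]
 have "(\<epsilon> / 2)\<^sup>2 <= (snd (init rc))\<^sup>2"
 proof -
  have s0: "sec rc > 0" using w2[OF rcI] w by (smt (verit) zero_less_power)
  have "\<epsilon>^2 / 4 = (\<rho>0 * \<epsilon>^2 / 2) / (2 * \<rho>0)" using \<rho>0 by simp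
  also have "\<dots> <= (sec rc - w^2) / sec rc" using big[OF rcI] pos s0 by (intro frac_le) auto
  also have "\<dots> = (snd (init rc))\<^sup>2" using s0 ok(6) by (simp add: diff_divide_distrib)
  finally show ?thesis by (simp add: power_divide)
 qed
 then have "\<epsilon> / 2 <= snd (init rc)" using ok(4) by (rule power2_le_imp_le)
 moreover have "\<bar>p0 rc\<bar> <= 2 * C2 * \<bar>e\<bar>" using fp[of rc] rc(3) by simp
 ultimately show thesis using that[of rc] rc rcI IX w2[OF rcI] I by (auto simp: f_def)
qed

text \<open>\<open>sec r = w^2\<close> means \<open>S = 0\<close>, an equatorial orbit. The last
  such radius before \<open>rc\<close> is taken, so that the inclination is positive on the whole
  arc from there to the centre.\<close>

lemma circular_exists:
 assumes rc: "rc \<in> {ra<..<rb}" "\<rho>0 * (1 - \<epsilon>) < rc" "w^2 < sec rc"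
 obtains r1 where "ra < r1" "r1 < rc" "sec r1 = w^2" "\<And>r. r1 < r ==> r <= rc ==> w\<^sup>2 < sec r"
proof -
 have low: "sec ra < w^2"
 proof -
  have "\<bar>2 * (ra^2 * psi ra)\<bar> < ((\<rho>0 - ra)\<^sup>2 - (\<rho>0 * \<epsilon>)\<^sup>2) / \<rho>0" using sec_error[of ra] small(4) rc by force
  moreover have "((\<rho>0 - ra)\<^sup>2 - (\<rho>0 * \<epsilon>)\<^sup>2) / \<rho>0 = (ra - \<rho>0)\<^sup>2 / \<rho>0 - \<rho>0 * \<epsilon>^2"
   using \<rho>0(1) by (simp add: power2_eq_square field_simps)
  moreover have "w^2 = \<rho>0 - \<rho>0 * \<epsilon>^2" unfolding \<rho>0(3) by (simp add: algebra_simps)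
  ultimately show ?thesis unfolding sec_eq abs_less_iff by linarith
 qed
 have c: "continuous_on {ra..rc} sec" by (rule continuous_on_subset[OF section_continuous(2)]) (use rc in auto)
 define A where "A = {r \<in> {ra..rc}. sec r <= w\<^sup>2}"
 have "closed A" unfolding A_def by (rule continuous_on_closed_Collect_le[OF c]) (auto intro: continuous_intros)
 moreover have A: "bdd_above A" "ra \<in> A" using low rc by (auto simp: A_def intro!: bdd_aboveI[of _ rc])
 ultimately have "Sup A \<in> A" using closed_contains_Sup by blast
 moreover define m where "m = Sup A"
 ultimately have s: "ra <= m" "m <= rc" "sec m <= w^2" by (simp_all add: A_def)
 have up: "w^2 < sec r" if "m < r" "r <= rc" for r
 proof (rule ccontr)
  assume "\<not> w\<^sup>2 < sec r"
  moreover have "ra <= r" using cSup_upper[OF A(2,1), folded m_def] that by linarith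
  ultimately have "r \<in> A" using that by (auto simp: A_def)
  then show False using cSup_upper[OF _ A(1), folded m_def] that by force
 qed
 have sr: "m < rc" using s rc(3) by (cases "m = rc") auto
 have "w^2 <= sec (m)"
 proof (rule ccontr)
  assume n: "\<not> w\<^sup>2 <= sec (m)"
  have "continuous_on {m..rc} sec" by (rule continuous_on_subset[OF c]) (use s in auto)
  then obtain x where x: "m <= x" "x <= rc" "sec x = (sec (m) + w^2) / 2"
   using IVT'[of sec "m" "(sec (m) + w^2) / 2" rc] n sr rc(3) by auto
  then have "x ~= m" using n by auto
  then show False using up[of x] x n by auto
 qed
 then have "sec (m) = w^2" using s by (simp add: A_def)
 moreover have "ra ~= m" using calculation low by auto
 ultimately show thesis using that[of m] s up sr by auto
qed

end

section \<open>Turns of the flow compared with the orbit of the centre\<close>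

context near_kepler
begin

lemma energy_turn: "energy (u + 2 * pi) y = energy u y"
proof -
 have "cis (- u - 2 * pi) = cis (- u)" by (simp add: complex_eq_iff cos_diff sin_diff)
 then show ?thesis by (simp add: energy_def rad_def vel_def ecc_def lat_def)
qed

text \<open>The field has period \<open>2 * pi\<close> in \<open>u\<close>, so a solution shifted by
  one turn is again a solution; the flow over one turn can be iterated.\<close>

lemma flow_turn:
 assumes "y \<in> K" "energy 0 y = h"
 shows "flow e y (u + 2 * pi) = flow e (flow e y (2 * pi)) u" "energy 0 (flow e y (2 * pi)) = h" "flow e y (2 * pi) \<in> K"
proof -
 show k: "flow e y (2 * pi) \<in> K" using K2_K flow_trapped(1)[OF assms] by blast
 show en: "energy 0 (flow e y (2 * pi)) = h" using flow_trapped(2)[OF assms, of "2 * pi"] energy_turn[of 0] by simp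
 show "flow e y (u + 2 * pi) = flow e (flow e y (2 * pi)) u"
 proof (rule solutions_unique[where a = 0 and y = "%u. flow e y (u + 2 * pi)"])
  fix v
  have "((%u. flow e y (u + 2 * pi)) has_vector_derivative 1 *\<^sub>R (e *\<^sub>R G e (v + 2 * pi) (flow e y (v + 2 * pi)))) (at v)"
   by (rule vector_diff_chain_at[unfolded o_def]) (auto intro!: derivative_eq_intros flow_trapped(3)[OF assms])
  then show "flow e y (v + 2 * pi) \<in> K \<and> ((%u. flow e y (u + 2 * pi)) has_vector_derivative e *\<^sub>R G e v (flow e y (v + 2 * pi))) (at v)"
   using K2_K flow_trapped(1)[OF assms] by (simp add: G_periodic)
  show "flow e (flow e y (2 * pi)) v \<in> K \<and> (flow e (flow e y (2 * pi)) has_vector_derivative e *\<^sub>R G e v (flow e (flow e y (2 * pi)) v)) (at v)"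
   using K2_K flow_trapped[OF k en] by blast
 qed (use fl(1) in simp)
qed

text \<open>\<open>GS\<close> vanishes with \<open>S\<close> and is bounded by a multiple of
  \<open>|S|\<close>; by the growth estimate \<open>S\<close> can neither reach nor leave
  zero.\<close>

lemma inclination_sign:
 assumes y: "y \<in> K" "energy 0 y = h"
 shows "snd y = 0 ==> snd (flow e y u) = 0" "0 <= snd y ==> 0 <= snd (flow e y u)" "snd (flow e y u) = 0 ==> snd (flow e y v) = 0"
proof -
 let ?s = "%u. snd (flow e y u)"
 have d: "(?s has_vector_derivative e *\<^sub>R GS e u (flow e y u)) (at u)" for u
  using bounded_linear.has_vector_derivative[OF bounded_linear_snd flow_trapped(3)[OF y, of u]] by (simp add: G_def)
 have b: "norm (e *\<^sub>R GS e u (flow e y u)) <= (\<bar>e\<bar> * M) * norm (?s u)" for u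
 proof -
  let ?z = "flow e y u"
  have k: "?z \<in> K" "(fst ?z, 0) \<in> K" using K2_K flow_trapped(1)[OF y, of u] e1 by (auto simp: K_iff)
  have "\<bar>GS e u ?z\<bar> <= norm (G e u ?z - G e u (fst ?z, 0))"
   using norm_fst_snd(2)[of "G e u ?z - G e u (fst ?z, 0)"] by (simp add: G_def GS_def)
  also have "\<dots> <= M * norm (?z - (fst ?z, 0))" by (rule lip[OF k])
  also have "norm (?z - (fst ?z, 0)) = \<bar>?s u\<bar>" by (simp add: minus_prod_def norm_Pair)
  finally have "\<bar>e\<bar> * \<bar>GS e u ?z\<bar> <= \<bar>e\<bar> * (M * \<bar>?s u\<bar>)" by (intro mult_left_mono) auto
  then show ?thesis by (simp add: abs_mult mult.assoc)
 qed
 have zero: "?s v = 0" if "?s u = 0" for u v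
  using norm_growth[OF d b, of v u] that by simp
 show "snd y = 0 ==> snd (flow e y u) = 0" using zero[of 0 u] fl(1) by simp
 show "snd (flow e y u) = 0 ==> snd (flow e y v) = 0" by (rule zero)
 show "0 <= snd (flow e y u)" if "0 <= snd y"
 proof (rule ccontr)
  assume n: "\<not> 0 <= ?s u"
  have c: "continuous_on A ?s" for A
   by (intro continuous_at_imp_continuous_on ballI has_vector_derivative_continuous[OF d])
  have "\<exists>v. ?s v = 0"
  proof (cases "0 <= u")
   case True
   have "?s u <= 0" "0 <= ?s 0" using n that fl(1) by auto
   from IVT2'[OF this True c] show ?thesis by blast
  next
   case False
   then have "u <= 0" by simp
   moreover have "?s u <= 0" "0 <= ?s 0" using n that fl(1) by auto
   ultimately show ?thesis using IVT'[of ?s u 0 0] c by blast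
  qed
  then show False using zero[of _ u] n by auto
 qed
qed

text \<open>On the energy surface \<open>S\<close> depends on \<open>p\<close> in a Lipschitz way as
  seen from states with \<open>S'\<close> at least \<open>\<epsilon> / 2\<close>. Subtracting the
  two energy equations isolates \<open>(1 - p^2) (S + S') (S - S')\<close>, whose coefficient is at
  least \<open>(1 - e2^2) \<epsilon> / 2\<close>; the perturbation takes away half of it, and three
  times the distance of the \<open>p\<close> is left on the other side, whence
  \<open>Cs\<close>.\<close>

lemma section_lipschitz:
 assumes y: "y \<in> K2" "energy 0 y = h" "0 <= snd y" and y': "y' \<in> K2" "energy 0 y' = h" "\<epsilon> / 2 <= snd y'"
 shows "\<bar>snd y - snd y'\<bar> <= Cs * norm (fst y - fst y')"
proof -
 define p p' S S' where "p = norm (fst y)" and "p' = norm (fst y')" and "S = snd y" and "S' = snd y'"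
 define d where "d = norm (fst y - fst y')"
 have k: "y \<in> K" "y' \<in> K" using y y' K2_K by auto
 have ra_le: "rad w 0 z \<in> {ra..rb}" if "z \<in> K" for z
  using K_facts(10)[of z 0] that K_iff by (auto simp: X_def ra rb)
 have A: "h = - ((1 - (norm (fst z))\<^sup>2) * (1 - (snd z)\<^sup>2)) / (2 * w^2) + psi (rad w 0 z)" if "z \<in> K" "energy 0 z = h" for z
  using energy_kepler[OF that(1), of 0] that(2) by (simp add: psi_def lat_def)
 have "(1 - p^2) * (1 - S^2) - (1 - p'\<^sup>2) * (1 - S'\<^sup>2) = 2 * w^2 * (psi (rad w 0 y) - psi (rad w 0 y'))"
  using A[OF k(1) y(2)] A[OF k(2) y'(2)] w by (simp add: p_def p'_def S_def S'_def field_simps)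
 moreover have "\<bar>2 * w^2 * (psi (rad w 0 y) - psi (rad w 0 y'))\<bar> <= 2 * w^2 * (C5 * Cr) * (d + \<bar>S - S'\<bar>)"
 proof -
  have C5: "0 <= C5" unfolding constants(1) using nonneg range_facts by simp
  have "norm (y - y') <= d + \<bar>S - S'\<bar>"
   using norm_Pair_le[of "fst y - fst y'" "snd y - snd y'"] by (simp add: d_def S_def S'_def minus_prod_def)
  then have "Cr * norm (y - y') <= Cr * (d + \<bar>S - S'\<bar>)" using nonneg by (intro mult_left_mono) auto
  then have "\<bar>rad w 0 y - rad w 0 y'\<bar> <= Cr * (d + \<bar>S - S'\<bar>)" using rad_lip[OF k, of 0] by linarith
  then have "C5 * \<bar>rad w 0 y - rad w 0 y'\<bar> <= C5 * (Cr * (d + \<bar>S - S'\<bar>))" using C5 by (intro mult_left_mono)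
  then have "\<bar>psi (rad w 0 y) - psi (rad w 0 y')\<bar> <= C5 * (Cr * (d + \<bar>S - S'\<bar>))"
   using psi_bounds(2)[OF ra_le[OF k(1)] ra_le[OF k(2)]] by linarith
  then have "2 * w^2 * \<bar>psi (rad w 0 y) - psi (rad w 0 y')\<bar> <= 2 * w^2 * (C5 * (Cr * (d + \<bar>S - S'\<bar>)))" by (intro mult_left_mono) auto
  then show ?thesis by (simp add: abs_mult mult.assoc)
 qed
 moreover have "2 * w^2 * (C5 * Cr) * (d + \<bar>S - S'\<bar>) <= d + (1 - e2^2) * \<epsilon> / 4 * \<bar>S - S'\<bar>"
 proof -
  have "2 * w^2 * (C5 * Cr) * d <= 1 * d" using small(5) by (intro mult_right_mono) (auto simp: d_def)
  moreover have "2 * w^2 * (C5 * Cr) * \<bar>S - S'\<bar> <= (1 - e2^2) * \<epsilon> / 4 * \<bar>S - S'\<bar>" using small(6) by (intro mult_right_mono) auto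
  ultimately show ?thesis by (simp add: distrib_left)
 qed
 moreover have "\<bar>(1 - S'\<^sup>2) * (p'\<^sup>2 - p^2)\<bar> <= 2 * d"
 proof -
  have n: "0 <= p" "p <= 1" "0 <= p'" "p' <= 1" "\<bar>S'\<bar> <= 1" using y(1) y'(1) e2_1(1) by (auto simp: K2_iff p_def p'_def S'_def)
  have "\<bar>p' - p\<bar> <= d" unfolding d_def p_def p'_def by (metis norm_minus_commute norm_triangle_ineq3)
  moreover have "p'\<^sup>2 - p^2 = (p' + p) * (p' - p)" by (simp add: power2_eq_square algebra_simps)
  then have "\<bar>p'\<^sup>2 - p\<^sup>2\<bar> = \<bar>p' + p\<bar> * \<bar>p' - p\<bar>" by (simp add: abs_mult)
  moreover have "\<bar>p' + p\<bar> * \<bar>p' - p\<bar> <= 2 * d" using n \<open>\<bar>p' - p\<bar> <= d\<close> by (intro mult_mono) auto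
  ultimately have q: "\<bar>p'\<^sup>2 - p\<^sup>2\<bar> <= 2 * d" by simp
  have "\<bar>1 - S'\<^sup>2\<bar> <= 1" using n(5) by (simp add: abs_square_le_1)
  then have "\<bar>1 - S'\<^sup>2\<bar> * \<bar>p'\<^sup>2 - p\<^sup>2\<bar> <= 1 * (2 * d)" using q by (intro mult_mono) auto
  then show ?thesis by (simp add: abs_mult)
 qed
 moreover have "(1 - p^2) * (1 - S^2) - (1 - p'\<^sup>2) * (1 - S'\<^sup>2) = (1 - S'\<^sup>2) * (p'\<^sup>2 - p^2) - (1 - p^2) * ((S + S') * (S - S'))"
  by (simp add: power2_eq_square algebra_simps)
 ultimately have "\<bar>(1 - p^2) * ((S + S') * (S - S'))\<bar> <= 3 * d + (1 - e2^2) * \<epsilon> / 4 * \<bar>S - S'\<bar>" by linarith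
 moreover have "(1 - e2^2) * ((\<epsilon> / 2) * \<bar>S - S'\<bar>) <= \<bar>(1 - p^2) * ((S + S') * (S - S'))\<bar>"
 proof -
  have "\<bar>p\<bar> <= \<bar>e2\<bar>" using y(1) e2 by (simp add: K2_iff p_def)
  then have p2: "1 - e2^2 <= 1 - p^2" by (simp add: abs_le_square_iff)
  have a: "\<bar>(1 - p^2) * ((S + S') * (S - S'))\<bar> = (1 - p^2) * ((S + S') * \<bar>S - S'\<bar>)"
   using p2 e2_1(2) y(3) y'(3) \<epsilon> by (simp add: abs_mult S_def S'_def)
  show ?thesis unfolding a using p2 e2_1(2) y(3) y'(3) \<epsilon> by (intro mult_mono) (auto simp: S_def S'_def)
 qed
 ultimately have "(1 - e2^2) * \<epsilon> / 4 * \<bar>S - S'\<bar> <= 3 * d" by (simp add: field_simps)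
 moreover have "0 < (1 - e2^2) * \<epsilon>" using e2_1 \<epsilon> by simp
 ultimately have "\<bar>S - S'\<bar> <= Cs * d" unfolding constants(2) by (simp add: field_simps)
 then show ?thesis by (simp add: S_def S'_def d_def)
qed

text \<open>
 Relative to the orbit through the centre, one turn multiplies \<open>p\<close> by a factor whose argument is
 known up to an error of second order.
\<close>

lemma one_turn:
 assumes y: "y \<in> K2" "energy 0 y = h" "0 <= snd y" and z: "z \<in> K2" "energy 0 z = h" "\<epsilon> / 2 <= snd z"
  and fixed: "flow e z (2 * pi) = z" and pz: "norm (fst z) <= 2 * C2 * \<bar>e\<bar>"
 defines "d \<equiv> fst y - fst z" and "d' \<equiv> fst (flow e y (2 * pi)) - fst z"
 assumes d0: "d ~= 0"
 shows "\<bar>Im (Ln (d' / d)) - 2 * pi * e * rot (snd y)\<bar> <= C7 * e^2" "norm (d' / d - 1) <= 1 / 2" "norm d' <= 2 * norm d"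
proof -
 define s s' where "s = rot (snd y)" and "s' = rot (snd z)"
 have k0: "0 <= k0" unfolding constants(3) using c w by simp
 have rt: "rot S = k0 * (1 - S^2)\<^sup>2 * (1 - 5/4 * S^2)" for S by (simp add: rot_def constants(3))
 have S1: "\<bar>snd y\<bar> <= 1" "\<bar>snd z\<bar> <= 1" using y(1) z(1) e2_1 by (auto simp: K2_iff)
 have Cs0: "0 <= Cs" unfolding constants(2) using e2_1 \<epsilon> by simp
 have C6: "0 <= C6" unfolding constants(4) using nonneg k0 Cs0 by simp
 have SS: "\<bar>snd y - snd z\<bar> <= Cs * norm d" unfolding d_def by (rule section_lipschitz[OF y z])
 have ss: "\<bar>s - s'\<bar> <= 28 * k0 * (Cs * norm d)"
 proof -
  have "\<bar>s - s'\<bar> <= 28 * k0 * \<bar>snd y - snd z\<bar>" unfolding s_def s'_def by (rule rot_bounds(1)[OF k0 rt S1])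
  also have "\<dots> <= 28 * k0 * (Cs * norm d)" using SS k0 by (intro mult_left_mono) auto
  finally show ?thesis .
 qed
 \<comment> \<open>The difference of the two second-order remainders. As \<open>z\<close> is fixed
   by the turn, what it leaves besides the rotation of \<open>d\<close> is the term with
   \<open>(s - s') * fst z\<close>, which is of size \<open>e^2 |d|\<close> because
   \<open>fst z\<close> is itself \<open>O(e)\<close>.\<close>
 define v where "v = (flow e y (2 * pi) - y - (e * (2 * pi * s)) *\<^sub>R (\<i> * fst y, 0)) - (flow e z (2 * pi) - z - (e * (2 * pi * s')) *\<^sub>R (\<i> * fst z, 0))"
 have v: "norm v <= C1 * e^2 * norm (y - z)" unfolding v_def s_def s'_def by (rule turn[OF y(1) z(1)])
 have "norm (y - z) <= norm d + \<bar>snd y - snd z\<bar>"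
  using norm_Pair_le[of "fst y - fst z" "snd y - snd z"] by (simp add: d_def minus_prod_def)
 then have yz: "norm (y - z) <= (1 + Cs) * norm d" using SS by (simp add: algebra_simps)
 have "fst v = d' - d - of_real (2 * pi * e * s) * \<i> * d - of_real (2 * pi * e * (s - s')) * \<i> * fst z"
  unfolding v_def fixed d_def d'_def by (simp add: scaleR_conv_of_real algebra_simps)
 then have "d' - d - of_real (2 * pi * e * s) * \<i> * d = fst v + of_real (2 * pi * e * (s - s')) * \<i> * fst z" by simp
 then have "norm (d' - d - of_real (2 * pi * e * s) * \<i> * d) <= norm (fst v) + norm (of_real (2 * pi * e * (s - s')) * \<i> * fst z)"
  by (metis norm_triangle_ineq)
 also have "\<dots> <= C6 * e^2 * norm d"
 proof -
  have "norm (fst v) <= C1 * e^2 * ((1 + Cs) * norm d)"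
   by (rule order_trans[OF norm_fst_snd(1) order_trans[OF v]]) (use yz nonneg in \<open>intro mult_left_mono; simp\<close>)
  moreover have "norm (of_real (2 * pi * e * (s - s')) * \<i> * fst z) <= 2 * pi * (28 * k0 * Cs * (2 * C2)) * e^2 * norm d"
  proof -
   have e2: "\<bar>e\<bar> * \<bar>e\<bar> = e^2" by (simp add: power2_eq_square)
   have "norm (of_real (2 * pi * e * (s - s')) * \<i> * fst z) = (2 * pi * \<bar>e\<bar> * \<bar>s - s'\<bar>) * norm (fst z)"
    by (simp add: norm_mult abs_mult del: of_real_diff)
   also have "\<dots> <= (2 * pi * \<bar>e\<bar> * (28 * k0 * (Cs * norm d))) * (2 * C2 * \<bar>e\<bar>)"
    using ss pz k0 Cs0 by (intro mult_mono mult_left_mono) auto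
   also have "\<dots> = 2 * pi * (28 * k0 * Cs * (2 * C2)) * (\<bar>e\<bar> * \<bar>e\<bar>) * norm d" by (simp only: mult_ac)
   finally show ?thesis unfolding e2 .
  qed
  moreover have "C6 * e^2 * norm d = C1 * e^2 * ((1 + Cs) * norm d) + 2 * pi * (28 * k0 * Cs * (2 * C2)) * e^2 * norm d"
   unfolding constants(4) by (simp add: algebra_simps)
  ultimately show ?thesis by (simp only: add_mono)
 qed
 finally have main: "norm (d' - d - of_real (2 * pi * e * s) * \<i> * d) <= C6 * e^2 * norm d" .
 define x where "x = d' / d - 1"
 have "x - of_real (2 * pi * e * s) * \<i> = (d' - d - of_real (2 * pi * e * s) * \<i> * d) / d"
  using d0 by (simp add: x_def field_simps)
 then have "norm (x - of_real (2 * pi * e * s) * \<i>) = norm (d' - d - of_real (2 * pi * e * s) * \<i> * d) / norm d" by (simp add: norm_divide)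
 also have "\<dots> <= C6 * e^2" using main d0 by (simp add: divide_le_eq)
 finally have x1: "norm (x - of_real (2 * pi * e * s) * \<i>) <= C6 * e^2" .
 have "\<bar>s\<bar> <= k0" unfolding s_def by (rule rot_bounds(2)[OF k0 rt S1(1)])
 then have "norm (of_real (2 * pi * e * s) * \<i>) <= 2 * pi * \<bar>e\<bar> * k0" by (simp add: norm_mult abs_mult mult_left_mono)
 moreover have "norm x <= norm (x - of_real (2 * pi * e * s) * \<i>) + norm (of_real (2 * pi * e * s) * \<i>)"
  by (metis diff_add_cancel norm_triangle_ineq)
 moreover have "C6 * e^2 <= C6 * (\<bar>e\<bar> * 1)"
  unfolding power2_eq_square using small(7) C6 abs_mult_self_eq[of e] mult_left_mono[of "\<bar>e\<bar>" 1 "\<bar>e\<bar>"] by (intro mult_left_mono) auto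
 ultimately have xn: "norm x <= \<bar>e\<bar> * (2 * pi * k0 + C6)" using x1 by (simp add: algebra_simps)
 then have xh: "norm x <= 1 / 2" using small(8) by linarith
 then show "norm (d' / d - 1) <= 1 / 2" by (simp add: x_def)
 \<comment> \<open>The imaginary part of \<open>Ln (1 + x)\<close> is the angle by which the
   difference vector turns; for \<open>|x| <= 1/2\<close> the principal branch is safe.\<close>
 have "norm (Ln (1 + x) - x) <= (norm x)\<^sup>2 / (1 - norm x)" by (rule Ln_approx_linear) (use xh in linarith)
 also have "\<dots> <= (norm x)\<^sup>2 / (1 / 2)" using xh by (intro divide_left_mono) auto
 also have "\<dots> <= 2 * (\<bar>e\<bar> * (2 * pi * k0 + C6))\<^sup>2" using xn by (simp add: power_mono)
 finally have l: "norm (Ln (1 + x) - x) <= 2 * (2 * pi * k0 + C6)\<^sup>2 * e^2" by (simp add: power_mult_distrib mult_ac)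
 have "\<bar>Im (Ln (1 + x)) - 2 * pi * e * s\<bar> = \<bar>Im ((Ln (1 + x) - x) + (x - of_real (2 * pi * e * s) * \<i>))\<bar>" by simp
 also have "\<dots> <= norm ((Ln (1 + x) - x) + (x - of_real (2 * pi * e * s) * \<i>))" by (rule abs_Im_le_cmod)
 also have "\<dots> <= norm (Ln (1 + x) - x) + norm (x - of_real (2 * pi * e * s) * \<i>)" by (rule norm_triangle_ineq)
 also have "\<dots> <= C7 * e^2" unfolding constants(5) using l x1 by (simp add: distrib_right)
 finally show "\<bar>Im (Ln (d' / d)) - 2 * pi * e * rot (snd y)\<bar> <= C7 * e^2" by (simp add: x_def s_def)
 have "norm (d' / d) <= norm x + norm (1::complex)" using norm_triangle_ineq[of x 1] by (simp add: x_def)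
 then have "norm d' / norm d <= 2" using xh by (simp add: norm_divide)
 then show "norm d' <= 2 * norm d" using d0 by (simp add: divide_le_eq)
qed

end

section \<open>Counting symmetric orbits\<close>

context near_kepler
begin

lemma flow_turns:
 assumes "y \<in> K" "energy 0 y = h"
 shows "flow e y (u + 2 * pi * real j) = flow e (flow e y (2 * pi * real j)) u" "energy 0 (flow e y (2 * pi * real j)) = h"
proof -
 have "flow e y (u + 2 * pi * real j) = flow e (flow e y (2 * pi * real j)) u \<and> energy 0 (flow e y (2 * pi * real j)) = h" for u
  using assms
 proof (induction j arbitrary: y u)
  case 0
  then show ?case using fl(1) by simp
 next
  case (Suc j)
  note t = flow_turn[OF Suc.prems]
  note IH = Suc.IH[OF t(3,2)]
  have r: "x + 2 * pi * real (Suc j) = (x + 2 * pi * real j) + 2 * pi" for x by (simp add: algebra_simps)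
  have s: "flow e y (2 * pi * real (Suc j)) = flow e (flow e y (2 * pi)) (2 * pi * real j)"
   using t(1)[of "2 * pi * real j"] r[of 0] by simp
  show ?case unfolding s r t(1) using IH by blast
 qed
 then show "flow e y (u + 2 * pi * real j) = flow e (flow e y (2 * pi * real j)) u" "energy 0 (flow e y (2 * pi * real j)) = h" by blast+
qed

lemma reduced_shift:
 assumes "\<And>u. y (u + p) = y u" "p = 2 * real n * pi" shows "reduced (u + real_of_int i * p) (y (u + real_of_int i * p)) = reduced u (y u)"
proof -
 have "cos (u + p) = cos u" "sin (u + p) = sin u" for u by (simp_all add: assms(2) sin_add cos_add)
 moreover have "cis (- u - p) = cis (- u)" for u by (simp add: assms(2) complex_eq_iff cos_diff sin_diff)
 ultimately have r: "reduced (u + p) k = reduced u k" for u k by (simp add: reduced_def rad_def vel_def ecc_def lat_def)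
 then have one: "reduced (u + p) (y (u + p)) = reduced u (y u)" for u by (simp add: assms(1))
 have nat: "reduced (u + real j * p) (y (u + real j * p)) = reduced u (y u)" for u j
 proof (induction j)
  case (Suc j)
  have "u + real (Suc j) * p = (u + real j * p) + p" by (simp add: algebra_simps)
  show ?case unfolding \<open>u + real (Suc j) * p = (u + real j * p) + p\<close> one by (rule Suc)
 qed simp
 show ?thesis
 proof (cases "0 <= i")
  case True
  then show ?thesis using nat[of u "nat i"] by simp
 next
  case False
  then show ?thesis using nat[of "u + real_of_int i * p" "nat (- i)"] by simp
 qed
qed

text \<open>With \<open>S\<close> never zero the latitude vanishes only when \<open>u\<close> is a
  multiple of \<open>pi\<close>, and modulo the period there are \<open>2 * n\<close> of
  these.\<close>

lemma equator_crossings_finite: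
 assumes y: "trajectory y" "\<And>u. y (u + 2 * real n * pi) = y u" "n > 0" and S: "\<And>u. snd (y u) ~= 0"
 shows "finite {x \<in> range (%u. reduced u (y u)). snd (snd (snd x)) = 0}"
proof -
 let ?f = "%i::int. reduced (real_of_int i * pi) (y (real_of_int i * pi))"
 have "{x \<in> range (%u. reduced u (y u)). snd (snd (snd x)) = 0} \<subseteq> ?f ` {0..<2 * int n}"
 proof
  fix x assume "x \<in> {x \<in> range (%u. reduced u (y u)). snd (snd (snd x)) = 0}"
  then obtain u where u: "x = reduced u (y u)" "arcsin (lat u (y u)) = 0" by (auto simp: reduced_def)
  have "y u \<in> K" using y(1) by (simp add: trajectory_def)
  then have "\<bar>lat u (y u)\<bar> < 1" by (rule lat_bound(3))
  then have "lat u (y u) = sin (arcsin (lat u (y u)))" by (intro sin_arcsin[symmetric]) auto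
  then have "sin u = 0" using u(2) S[of u] by (simp add: lat_def)
  then obtain i where i: "u = real_of_int i * pi" using sin_zero_iff_int2 by blast
  define k where "k = i div (2 * int n)"
  have "i = i mod (2 * int n) + k * (2 * int n)" unfolding k_def by (rule mod_div_mult_eq[symmetric])
  then have "u = real_of_int (i mod (2 * int n)) * pi + real_of_int k * (2 * real n * pi)"
   unfolding i by (metis (no_types, opaque_lifting) distrib_right mult.assoc of_int_add of_int_mult of_int_numeral of_int_of_nat_eq)
  then have "x = ?f (i mod (2 * int n))"
   using u(1) reduced_shift[where y = y and p = "2 * real n * pi" and n = n, OF y(2) HOL.refl, of "real_of_int (i mod (2 * int n)) * pi" k] by simp
  moreover have "i mod (2 * int n) \<in> {0..<2 * int n}" using y(3) by simp
  ultimately show "x \<in> ?f ` {0..<2 * int n}" by blast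
 qed
 then show ?thesis by (rule finite_subset) simp
qed

theorem infinite_orbits: "infinite (relative_periodic_orbits R h \<omega> e)"
proof -
 obtain rc where rc: "rc \<in> {ra<..<rb}" "\<rho>0 * (1 - \<epsilon>) < rc" "w^2 < sec rc" "\<epsilon> / 2 <= snd (init rc)" "\<bar>p0 rc\<bar> <= 2 * C2 * \<bar>e\<bar>"
  "Re (fst (flow e (init rc) (pi / 2))) = 0" using center_exists .
 obtain r1 where r1: "ra < r1" "r1 < rc" "sec r1 = w^2" "\<And>r. r1 < r ==> r <= rc ==> w\<^sup>2 < sec r"
  using circular_exists[OF rc(1-3)] by blast
 have I: "r \<in> {ra..rb}" "w^2 <= sec r" if "r \<in> {r1..rc}" for r
 proof -
  show "r \<in> {ra..rb}" using that r1(1) rc(1) by auto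
  show "w^2 <= sec r" using r1(3) r1(4)[of r] that by (cases "r = r1") auto
 qed
 note ok = init_facts[OF I]
 define z where "z = init rc"
 have rcI: "rc \<in> {r1..rc}" using r1(2) by simp
 have z: "z \<in> K2" "energy 0 z = h" "\<epsilon> / 2 <= snd z" "norm (fst z) <= 2 * C2 * \<bar>e\<bar>"
  using energy_trap(2)[OF ok(1,2)[OF rcI rcI]] ok(2)[OF rcI rcI] rc(4,5) by (simp_all add: z_def) (simp add: init_def)
 have zp: "fst z = of_real (p0 rc)" by (simp add: z_def init_def)
 \<comment> \<open>Symmetry at the node and at the point of highest latitude makes \<open>p\<close>
   change sign after half a turn, so the orbit closes after a full one.\<close>
 have zper: "flow e z (2 * pi) = z"
 proof -
  have t: "trajectory (flow e z)" by (rule trajectory_flow[OF K2_K[OF z(1)] z(2)])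
  have "refl (pi / 2) (flow e z (pi / 2)) = flow e z (pi / 2)"
   using rc(6) by (simp add: refl_def prod_eq_iff complex_eq_iff z_def)
  from trajectory_symmetric_periodic[OF t _ _ this]
  have "flow e z (u + pi) = (- fst (flow e z u), snd (flow e z u))" for u
   using fl(1) zp by simp
  from this[of pi] this[of 0] show ?thesis using fl(1) by simp
 qed
 define P where "P j r = flow e (init r) (2 * pi * real j)" for j r
 have P0: "P 0 r = init r" for r using fl(1) by (simp add: P_def)
 have P: "P j r \<in> K2" "energy 0 (P j r) = h" "0 <= snd (P j r)" "P (Suc j) r = flow e (P j r) (2 * pi)" if r: "r \<in> {r1..rc}" for j r
 proof -
  note k = ok(1,2)[OF r r]
  show "P j r \<in> K2" unfolding P_def by (rule flow_trapped(1)[OF k])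
  show "energy 0 (P j r) = h" unfolding P_def by (rule flow_turns(2)[OF k])
  show "0 <= snd (P j r)" unfolding P_def by (rule inclination_sign(2)[OF k ok(4)[OF r r]])
  show "P (Suc j) r = flow e (P j r) (2 * pi)" using flow_turns(1)[OF k, of "2 * pi" j] by (simp add: P_def algebra_simps)
 qed
 have orbit: "range (%u. reduced u (flow e (init r) u)) \<in> relative_periodic_orbits R h \<omega> e"
  "flow e (init r) (u + 2 * real (2 * n) * pi) = flow e (init r) u"
  if r: "r \<in> {r1..rc}" and n: "n \<ge> 1" "Im (fst (P n r)) = 0" for r n u
 proof -
  have t: "trajectory (flow e (init r))" by (rule trajectory_flow[OF ok(1,2)[OF r r]])
  have sc: "sin (2 * (2 * pi * real n)) = 0" "cos (2 * (2 * pi * real n)) = 1"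
   using sin_2npi[of "2 * n"] cos_2npi[of "2 * n"] by (simp_all add: mult_ac)
  have "refl (2 * pi * real n) (flow e (init r) (2 * pi * real n)) = flow e (init r) (2 * pi * real n)"
   using n(2) sc by (simp add: refl_def prod_eq_iff complex_eq_iff P_def)
  from trajectory_symmetric_periodic[OF t _ sc(1) this]
  have per: "flow e (init r) (u + 2 * (2 * pi * real n)) = flow e (init r) u" for u
   using fl(1) ok(5)[OF r r] sc by (simp add: prod_eq_iff complex_eq_iff)
  have eq: "2 * real (2 * n) * pi = 2 * (2 * pi * real n)" by simp
  show "flow e (init r) (u + 2 * real (2 * n) * pi) = flow e (init r) u" unfolding eq by (rule per)
  show "range (%u. reduced u (flow e (init r) u)) \<in> relative_periodic_orbits R h \<omega> e"
   by (rule trajectory_orbit[OF t \<omega>, of "2 * n"]) (use n(1) per in \<open>simp_all add: eq del: of_nat_mult\<close>)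
 qed
 \<comment> \<open>Starting radii whose orbit is again symmetric at the ascending node some turns
   later. The equatorial orbit at \<open>r1\<close> is left out, since it lies in the equatorial
   plane for all time.\<close>
 define Q where "Q = {r \<in> {r1<..<rc}. \<exists>n\<ge>1. Im (fst (P n r)) = 0}"
 have "infinite Q"
 proof (cases "e = 0")
  case True
  \<comment> \<open>In the round case the elements are constant, so every orbit of the curve is
    closed.\<close>
  have "P n r = init r" for n r using near_flow[of "init r" "2 * pi * real n"] True by (simp add: P_def)
  then have "Q = {r1<..<rc}" using ok(5) by (auto simp: Q_def intro!: exI[of _ 1])
  then show ?thesis using r1(2) by (simp add: infinite_Ioo)
 next
  case False
  define d where "d j r = fst (P j r) - fst z" for j r
  define a where "a j r = Ln (d (Suc j) r / d j r)" for j r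
  \<comment> \<open>The angle swept about the centre in \<open>n\<close> turns. Being a sum of small
    angles it depends continuously on \<open>r\<close>, without a choice of branch for the total; as
    \<open>d 0 r\<close> is real, the orbit is symmetric as soon as this angle is a multiple of
    \<open>pi\<close>.\<close>
  define \<alpha> where "\<alpha> n r = (\<Sum>j<n. Im (a j r))" for n r
  define \<gamma> where "\<gamma> = k0 * (\<epsilon>^2 / 4)"
  have k0: "0 < k0" unfolding constants(3) using c w by simp
  have rt: "rot S = k0 * (1 - S^2)\<^sup>2 * (1 - 5/4 * S^2)" for S by (simp add: rot_def constants(3))
  have \<gamma>: "\<gamma> > 0" using k0 \<epsilon> by (simp add: \<gamma>_def)
  have Cs: "0 <= Cs" unfolding constants(2) using e2_1 \<epsilon> by simp
  have d00: "d 0 r = of_real (p0 r - p0 rc)" for r by (simp add: d_def P0 zp init_def)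
  have d0: "d 0 r ~= 0" "p0 rc < p0 r" if "r \<in> {r1..<rc}" for r
  proof -
   show "p0 rc < p0 r" by (rule p0_decreasing) (use that I[of r] I[OF rcI] in auto)
   then show "d 0 r ~= 0" by (simp add: d00)
  qed
  have step: "d (Suc j) r ~= 0 \<and> \<bar>Im (a j r) - 2 * pi * e * rot (snd (P j r))\<bar> <= C7 * e\<^sup>2 \<and>
    norm (d (Suc j) r / d j r - 1) <= 1 / 2 \<and> norm (d (Suc j) r) <= 2 * norm (d j r)" if r: "r \<in> {r1..<rc}" "d j r ~= 0" for j r
  proof -
   have r': "r \<in> {r1..rc}" using r(1) by simp
   note o = one_turn[OF P(1-3)[OF r', of j] z(1-3) zper z(4), folded P(4)[OF r', of j], folded d_def, OF r(2), folded a_def]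
   have "d (Suc j) r ~= 0" using o(2) by auto
   then show ?thesis using o by blast
  qed
  have dn: "d j r ~= 0" if "r \<in> {r1..<rc}" for j r
   by (induction j) (use d0 step that in blast)+
  have dexp: "d n r = d 0 r * exp (\<Sum>j<n. a j r)" if "r \<in> {r1..<rc}" for n r
  proof (induction n)
   case (Suc n)
   have "exp (a n r) = d (Suc n) r / d n r" unfolding a_def using dn[OF that] by (intro exp_Ln) simp
   then have "d (Suc n) r = d n r * exp (a n r)" using dn[OF that, of n] by simp
   then show ?case unfolding Suc by (simp add: exp_add mult.assoc)
  qed simp
  have zero: "r \<in> Q" if r: "r1 < r" "r < rc" and n: "n \<ge> 1" and s: "sin (\<alpha> n r) = 0" for r n
  proof -
   have "Im (exp (\<Sum>j<n. a j r)) = 0" using s by (simp add: Im_exp \<alpha>_def Im_sum)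
   then have "Im (d n r) = 0" using r by (simp add: dexp d00)
   then have "Im (fst (P n r)) = 0" by (simp add: d_def zp)
   then show ?thesis using r n by (auto simp: Q_def)
  qed
  have total: "\<bar>\<alpha> n r - real n * (2 * pi * e * s)\<bar> <= real n * (C7 * e^2 + 2 * pi * \<bar>e\<bar> * \<delta>)"
   if r: "r \<in> {r1..<rc}" and s: "\<And>j. j < n ==> \<bar>rot (snd (P j r)) - s\<bar> <= \<delta>" for n r s \<delta>
  proof -
   have "\<alpha> n r - real n * (2 * pi * e * s) = (\<Sum>j<n. Im (a j r) - 2 * pi * e * s)" by (simp add: \<alpha>_def sum_subtractf)
   also have "\<bar>\<dots>\<bar> <= (\<Sum>j<n. \<bar>Im (a j r) - 2 * pi * e * s\<bar>)" by (rule sum_abs)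
   also have "\<dots> <= (\<Sum>j<n. C7 * e^2 + 2 * pi * \<bar>e\<bar> * \<delta>)"
   proof (rule sum_mono)
    fix j assume "j \<in> {..<n}"
    then have f1: "\<bar>2 * pi * e * (rot (snd (P j r)) - s)\<bar> <= 2 * pi * \<bar>e\<bar> * \<delta>"
     unfolding abs_mult using s[of j] by (simp add: mult_left_mono)
    have f2: "\<bar>Im (a j r) - 2 * pi * e * rot (snd (P j r))\<bar> <= C7 * e^2" using step[OF r dn[OF r]] by blast
    have eq: "Im (a j r) - 2 * pi * e * s = (Im (a j r) - 2 * pi * e * rot (snd (P j r))) + 2 * pi * e * (rot (snd (P j r)) - s)"
     by (simp add: algebra_simps)
    show "\<bar>Im (a j r) - 2 * pi * e * s\<bar> <= C7 * e^2 + 2 * pi * \<bar>e\<bar> * \<delta>"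
     unfolding eq by (rule order_trans[OF abs_triangle_ineq add_mono[OF f2 f1]])
   qed
   finally show ?thesis by simp
  qed
  show ?thesis
  proof
   assume fin: "finite Q"
   \<comment> \<open>Any supposed size \<open>N\<close> of \<open>Q\<close> is refuted:
     \<open>n\<close> is taken so large that the angle varies by more than
     \<open>pi * real (N + 2)\<close>, which leaves at least \<open>N + 1\<close> multiples of
     \<open>pi\<close> strictly in between.\<close>
   define N where "N = card Q"
   have eg: "\<bar>e\<bar> * \<gamma> > 0" using False \<gamma> by simp
   obtain n where n: "pi * real (N + 2) / (\<bar>e\<bar> * \<gamma>) < real n" using reals_Archimedean2 by blast
   then have n1: "pi * real (N + 2) < real n * (\<bar>e\<bar> * \<gamma>)" using eg by (simp add: divide_less_eq)
   have n0: "n \<ge> 1"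
   proof (rule ccontr)
    assume "\<not> n \<ge> 1"
    then have "n = 0" by simp
    then have "pi * real (N + 2) < 0" using n1 by simp
    moreover have "0 <= pi * real (N + 2)" by (intro mult_nonneg_nonneg) auto
    ultimately show False by linarith
   qed
   \<comment> \<open>At \<open>rc\<close> the difference \<open>d\<close> vanishes and has no angle,
     so the curve is cut at some \<open>r2\<close> just before it. The difference at most doubles
     per turn; starting below \<kappa> it stays so small for \<open>n\<close> turns that the rates
     differ from that of the centre by at most \<open>\<gamma> / 2\<close>.\<close>
   define \<kappa> where "\<kappa> = (\<gamma> / 2) / (28 * k0 * Cs * 2 ^ n + 1)"
   have den: "28 * k0 * Cs * 2 ^ n + 1 > 0" using k0 Cs by (simp add: add_nonneg_pos)
   have \<kappa>: "\<kappa> > 0" unfolding \<kappa>_def using \<gamma> den by simp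
   have "continuous_on {r1..rc} p0" by (rule continuous_on_subset[OF section_continuous(1)]) (use I in blast)
   then obtain \<delta> where \<delta>: "\<delta> > 0" "\<And>x. x \<in> {r1..rc} ==> dist x rc < \<delta> ==> dist (p0 x) (p0 rc) < \<kappa>"
    unfolding continuous_on_iff using rcI \<kappa> by blast
   define r2 where "r2 = max ((r1 + rc) / 2) (rc - \<delta> / 2)"
   have "(r1 + rc) / 2 <= r2" "rc - \<delta> / 2 <= r2" by (simp_all add: r2_def)
   moreover have "r2 < rc" using r1(2) \<delta>(1) by (simp add: r2_def)
   ultimately have r2: "r1 < r2" "r2 < rc" "dist r2 rc < \<delta>" using r1(2) \<delta>(1) by (simp_all add: dist_real_def)
   have r2I: "r2 \<in> {r1..<rc}" "r2 \<in> {r1..rc}" using r2 by auto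
   have d2: "norm (d 0 r2) < \<kappa>" using \<delta>(2)[OF r2I(2) r2(3)] by (simp add: d00 dist_real_def norm_of_real del: of_real_diff)
   have dj: "norm (d j r2) <= 2 ^ j * norm (d 0 r2)" for j
   proof (induction j)
    case (Suc j)
    have "norm (d (Suc j) r2) <= 2 * norm (d j r2)" using step[OF r2I(1) dn[OF r2I(1)]] by blast
    then show ?case using Suc by simp
   qed simp
   have near2: "\<bar>rot (snd (P j r2)) - rot (snd z)\<bar> <= \<gamma> / 2" if "j < n" for j
   proof -
    have S: "\<bar>snd (P j r2)\<bar> <= 1" "\<bar>snd z\<bar> <= 1" using P(1)[OF r2I(2), of j] z(1) e2_1 by (auto simp: K2_iff)
    have "\<bar>snd (P j r2) - snd z\<bar> <= Cs * norm (d j r2)"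
     unfolding d_def by (rule section_lipschitz[OF P(1-3)[OF r2I(2), of j] z(1-3)])
    also have "\<dots> <= Cs * (2 ^ n * \<kappa>)"
    proof (rule mult_left_mono[OF _ Cs])
     have "norm (d j r2) <= 2 ^ j * norm (d 0 r2)" by (rule dj)
     also have "\<dots> <= 2 ^ n * \<kappa>" using that d2 by (intro mult_mono power_increasing) auto
     finally show "norm (d j r2) <= 2 ^ n * \<kappa>" .
    qed
    finally have "28 * k0 * \<bar>snd (P j r2) - snd z\<bar> <= 28 * k0 * (Cs * (2 ^ n * \<kappa>))" using k0 by (intro mult_left_mono) auto
    also have "\<dots> = (28 * k0 * Cs * 2 ^ n) * \<kappa>" by (simp add: mult_ac)
    also have "\<dots> <= (28 * k0 * Cs * 2 ^ n + 1) * \<kappa>" using \<kappa> by (intro mult_right_mono) auto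
    also have "\<dots> = \<gamma> / 2"
    proof -
     have "x * (y / x) = y" if "0 < x" for x y :: real using that by simp
     from this[OF den] show ?thesis unfolding \<kappa>_def .
    qed
    finally show ?thesis using rot_bounds(1)[OF less_imp_le[OF k0] rt S] by linarith
   qed
   have t2: "\<bar>\<alpha> n r2 - real n * (2 * pi * e * rot (snd z))\<bar> <= real n * (C7 * e^2 + 2 * pi * \<bar>e\<bar> * (\<gamma> / 2))"
    by (rule total[OF r2I(1) near2])
   have r1I: "r1 \<in> {r1..<rc}" "r1 \<in> {r1..rc}" using r1(2) by auto
   have "snd (P j r1) = 0" for j
   proof -
    have "w\<^sup>2 ~= 0" using w by simp
    then have "snd (init r1) = 0" by (simp add: init_def r1(3))
    then show ?thesis unfolding P_def by (rule inclination_sign(1)[OF ok(1,2)[OF r1I(2) r1I(2)]])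
   qed
   then have t1: "\<bar>\<alpha> n r1 - real n * (2 * pi * e * rot 0)\<bar> <= real n * (C7 * e^2 + 2 * pi * \<bar>e\<bar> * 0)"
    by (intro total[OF r1I(1)]) simp
   have gap_rot: "\<gamma> <= rot 0 - rot (snd z)"
   proof -
    have "\<bar>snd z\<bar> <= 1" using z(1) e2_1 by (auto simp: K2_iff)
    from rot_bounds(3)[OF less_imp_le[OF k0] rt this] have "k0 * (snd z)\<^sup>2 <= rot 0 - rot (snd z)" .
    moreover have "(\<epsilon> / 2)\<^sup>2 <= (snd z)\<^sup>2" using z(3) \<epsilon> by (intro power_mono) auto
    then have "k0 * (\<epsilon>^2 / 4) <= k0 * (snd z)\<^sup>2" using k0 by (simp add: power_divide)
    ultimately show ?thesis by (simp add: \<gamma>_def)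
   qed
   \<comment> \<open>With \<open>A = n |e|\<close> the main terms differ by at least
     \<open>2 pi A \<gamma>\<close> and the errors sum to at most
     \<open>(2 + pi) A \<gamma>\<close>; as \<open>pi > 3\<close>, at least
     \<open>A \<gamma>\<close> remains.\<close>
   have sep: "pi * real (N + 2) < \<bar>\<alpha> n r1 - \<alpha> n r2\<bar>"
   proof -
    define A where "A = real n * \<bar>e\<bar>"
    define X1 X2 where "X1 = real n * (2 * pi * e * rot 0)" and "X2 = real n * (2 * pi * e * rot (snd z))"
    have A0: "A \<ge> 0" by (simp add: A_def)
    have "X1 - X2 = real n * (2 * pi) * e * (rot 0 - rot (snd z))" by (simp add: X1_def X2_def algebra_simps)
    then have "\<bar>X1 - X2\<bar> = \<bar>real n * (2 * pi) * e\<bar> * \<bar>rot 0 - rot (snd z)\<bar>" by (simp only: abs_mult)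
    moreover have "\<bar>real n * (2 * pi) * e\<bar> = 2 * pi * A" by (simp add: abs_mult A_def)
    ultimately have "\<bar>X1 - X2\<bar> = (2 * pi * A) * \<bar>rot 0 - rot (snd z)\<bar>" by (simp only:)
    moreover have "(2 * pi * A) * \<gamma> <= (2 * pi * A) * \<bar>rot 0 - rot (snd z)\<bar>" using gap_rot A0 by (intro mult_left_mono) auto
    ultimately have x: "2 * (pi * (A * \<gamma>)) <= \<bar>X1 - X2\<bar>" by (simp add: mult_ac)
    have C7: "real n * (C7 * e^2) <= A * \<gamma>"
    proof -
     have "real n * (C7 * e^2) = A * (C7 * \<bar>e\<bar>)" by (simp add: A_def power2_eq_square mult_ac)
     also have "\<dots> <= A * \<gamma>" using small(9) A0 unfolding \<gamma>_def by (intro mult_left_mono)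
     finally show ?thesis .
    qed
    have p3: "3 * (A * \<gamma>) <= pi * (A * \<gamma>)" using pi_gt3 A0 \<gamma> by (intro mult_right_mono) auto
    have h: "real n * (C7 * e^2 + 2 * pi * \<bar>e\<bar> * (\<gamma> / 2)) = real n * (C7 * e^2) + pi * (A * \<gamma>)"
     by (simp add: A_def algebra_simps)
    have 1: "\<bar>\<alpha> n r1 - X1\<bar> <= A * \<gamma>" using t1 C7 by (simp add: X1_def)
    have 2: "\<bar>\<alpha> n r2 - X2\<bar> <= A * \<gamma> + pi * (A * \<gamma>)" using t2 C7 unfolding h X2_def by linarith
    have "\<bar>X1 - X2\<bar> <= \<bar>\<alpha> n r1 - \<alpha> n r2\<bar> + \<bar>\<alpha> n r1 - X1\<bar> + \<bar>\<alpha> n r2 - X2\<bar>" by linarith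
    then have "A * \<gamma> <= \<bar>\<alpha> n r1 - \<alpha> n r2\<bar>" using x 1 2 p3 by linarith
    then show ?thesis using n1 by (simp add: A_def mult_ac)
   qed
   have cont\<alpha>: "continuous_on {r1..r2} (\<alpha> n)"
   proof -
    have sub: "{r1..r2} \<subseteq> {ra..rb}" "\<And>r. r \<in> {r1..r2} ==> w\<^sup>2 <= sec r" using I r2(2) by auto
    have cd: "continuous_on {r1..r2} (d j)" for j
     unfolding d_def[abs_def] P_def by (intro continuous_intros init_continuous[OF sub])
    have dnz: "\<forall>r\<in>{r1..r2}. d j r ~= 0" for j using dn r2(2) by auto
    have "continuous_on {r1..r2} (a j)" for j
     unfolding a_def[abs_def]
    proof (rule continuous_on_Ln')
     show "continuous_on {r1..r2} (%r. d (Suc j) r / d j r)" by (intro continuous_intros cd dnz)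
     fix r assume "r \<in> {r1..r2}"
     then have r: "r \<in> {r1..<rc}" using r2(2) by auto
     have "norm (d (Suc j) r / d j r - 1) <= 1 / 2" using step[OF r dn[OF r]] by blast
     then have "\<bar>Re (d (Suc j) r / d j r - 1)\<bar> <= 1 / 2" by (rule order_trans[OF abs_Re_le_cmod])
     then have "\<bar>Re (d (Suc j) r / d j r) - 1\<bar> <= 1 / 2" by (simp only: minus_complex.simps one_complex.simps)
     then have "Re (d (Suc j) r / d j r) > 0" by (simp only: abs_le_iff) linarith
     then show "d (Suc j) r / d j r \<notin> \<real>\<^sub>\<le>\<^sub>0" by (simp only: complex_nonpos_Reals_iff not_le) simp
    qed
    then show ?thesis unfolding \<alpha>_def[abs_def] by (intro continuous_on_sum continuous_on_Im)
   qed
   define lo hi where "lo = min (\<alpha> n r1) (\<alpha> n r2)" and "hi = max (\<alpha> n r1) (\<alpha> n r2)"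
   have lohi: "lo + pi * real (N + 2) < hi" proof -
    have "\<bar>\<alpha> n r1 - \<alpha> n r2\<bar> = hi - lo" by (auto simp: lo_def hi_def min_def max_def abs_if)
    from sep[unfolded this] show ?thesis by linarith
   qed
   \<comment> \<open>For \<open>k <= N\<close> these are the first \<open>N + 1\<close> multiples of
     \<open>pi\<close> above \<open>lo\<close>.\<close>
   define v where "v k = of_int (\<lfloor>lo / pi\<rfloor> + 1 + int k) * pi" for k
   have v: "lo < v k \<and> v k < hi" if "k <= N" for k
   proof
    have "lo / pi < of_int (\<lfloor>lo / pi\<rfloor> + 1)" by linarith
    also have "\<dots> <= of_int (\<lfloor>lo / pi\<rfloor> + 1 + int k)" by simp
    finally show "lo < v k" by (simp add: v_def divide_less_eq)
    have "real_of_int (\<lfloor>lo / pi\<rfloor> + 1 + int k) = real_of_int \<lfloor>lo / pi\<rfloor> + 1 + real k" "real k <= real N" "real (N + 1) = real N + 1"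
     using that by simp_all
    then have "of_int (\<lfloor>lo / pi\<rfloor> + 1 + int k) <= lo / pi + real (N + 1)" using of_int_floor_le[of "lo / pi"] by linarith
    then have "v k <= (lo / pi + real (N + 1)) * pi" unfolding v_def by (intro mult_right_mono) auto
    also have "\<dots> = lo + pi * real (N + 1)" by (simp add: algebra_simps)
    also have "\<dots> < hi"
    proof -
     have "pi * real (N + 2) = pi * real (N + 1) + pi" by (simp add: algebra_simps)
     then show ?thesis using lohi pi_gt_zero by linarith
    qed
    finally show "v k < hi" .
   qed
   have "\<exists>r. r \<in> Q \<and> \<alpha> n r = v k" if k: "k <= N" for k
   proof -
    have "\<exists>r. r1 <= r \<and> r <= r2 \<and> \<alpha> n r = v k"
    proof (cases "\<alpha> n r1 <= \<alpha> n r2")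
     case True
     then show ?thesis using IVT'[of "\<alpha> n" r1 "v k" r2] v[OF k] cont\<alpha> r2(1) by (auto simp: lo_def hi_def)
    next
     case False
     then show ?thesis using IVT2'[of "\<alpha> n" r2 "v k" r1] v[OF k] cont\<alpha> r2(1) by (auto simp: lo_def hi_def)
    qed
    then obtain r where r: "r1 <= r" "r <= r2" "\<alpha> n r = v k" by blast
    have "r ~= r1" using r(3) v[OF k] by (auto simp: lo_def hi_def)
    moreover have "sin (\<alpha> n r) = 0" unfolding r(3) v_def using sin_zero_iff_int2 by blast
    ultimately have "r \<in> Q" using r r2(2) by (intro zero[OF _ _ n0]) auto
    then show ?thesis using r(3) by blast
   qed
   then obtain f where f: "\<And>k. k <= N ==> f k \<in> Q \<and> \<alpha> n (f k) = v k" by metis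
   have "inj_on f {..N}"
   proof (rule inj_onI)
    fix i j assume "i \<in> {..N}" "j \<in> {..N}" "f i = f j"
    then have "v i = v j" using f by (metis atMost_iff)
    then show "i = j" by (simp add: v_def)
   qed
   then have "card {..N} <= card Q" by (rule card_inj_on_le) (use f fin in auto)
   then show False by (simp add: N_def)
  qed
 qed
 define orb where "orb r = range (%u. reduced u (flow e (init r) u))" for r
 \<comment> \<open>The radii at which an orbit meets the equator. For an orbit from \<open>Q\<close>
   this set is finite and contains the starting radius, so each orbit comes from finitely many
   elements of \<open>Q\<close>.\<close>
 define T where "T O' = (%x. fst (snd (snd x))) ` {x \<in> O'. snd (snd (snd x)) = (0::real)}" for O' :: "(real \<times> real \<times> real \<times> real) set"
 have fib: "finite (T (orb r)) \<and> r \<in> T (orb r) \<and> orb r \<in> relative_periodic_orbits R h \<omega> e" if "r \<in> Q" for r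
 proof -
  from that obtain n where r: "r1 < r" "r < rc" and n: "n \<ge> 1" "Im (fst (P n r)) = 0" by (auto simp: Q_def)
  have rI: "r \<in> {r1..rc}" using r by simp
  note k = ok(1,2)[OF rI rI]
  have t: "trajectory (flow e (init r))" by (rule trajectory_flow[OF k])
  have "snd (init r) ~= 0"
  proof -
   have "w^2 < sec r" using r1(4)[of r] r by simp
   moreover have "0 < sec r" using calculation w by (smt (verit) zero_less_power)
   ultimately show ?thesis by (simp add: init_def)
  qed
  moreover have "snd (init r) = 0" if z: "snd (flow e (init r) u) = 0" for u
  proof -
   show ?thesis using inclination_sign(3)[OF k z, of 0] fl(1) by simp
  qed
  ultimately have S: "snd (flow e (init r) u) ~= 0" for u by blast
  have "finite {x \<in> orb r. snd (snd (snd x)) = 0}"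
   unfolding orb_def by (rule equator_crossings_finite[OF t orbit(2)[OF rI n] _ S]) (use n in simp)
  then have "finite (T (orb r))" unfolding T_def by (rule finite_imageI)
  moreover have "reduced 0 (init r) \<in> orb r" unfolding orb_def by (rule range_eqI[of _ _ 0]) (simp only: fl(1))
  then have "r \<in> T (orb r)" unfolding T_def
   by (intro image_eqI[of _ _ "reduced 0 (init r)"]) (simp_all add: reduced_def ok(3)[OF rI rI] lat_def)
  ultimately show ?thesis using orbit(1)[OF rI n] by (simp add: orb_def)
 qed
 show ?thesis
 proof
  assume "finite (relative_periodic_orbits R h \<omega> e)"
  then have "finite (orb ` Q)" by (rule rev_finite_subset) (use fib in blast)
  then have "finite (\<Union>O'\<in>orb ` Q. T O')" using fib by blast
  moreover have "Q \<subseteq> (\<Union>O'\<in>orb ` Q. T O')" using fib by blast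
  ultimately show False using \<open>infinite Q\<close> finite_subset by blast
 qed
qed

end

section \<open>The round energy surface and the choice of constants\<close>

lemma eventually_small:
 fixes A b :: real assumes "b > 0" shows "\<forall>\<^sub>F e in nhds 0. A * \<bar>e\<bar> < b"
proof -
 have "((%e::real. A * \<bar>e\<bar>) \<longlongrightarrow> A * \<bar>0\<bar>) (nhds 0)" by (intro tendsto_intros filterlim_ident)
 then show ?thesis using assms by (intro order_tendstoD(2)) auto
qed

lemma sphere_not_singleton:
 fixes X :: "'a::euclidean_space set"
 assumes "diffeomorphic X (sphere (0::real^4) 1)" shows "X ~= {}" "\<not> X \<subseteq> {x}"
proof -
 obtain f where f: "f ` X = sphere (0::real^4) 1" using assms by (auto simp: diffeomorphic_def)
 have s: "axis 1 1 \<in> sphere (0::real^4) 1" "- axis 1 1 \<in> sphere (0::real^4) 1" by (simp_all add: norm_axis_1)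
 show "X ~= {}" using s(1) unfolding f[symmetric] by blast
 show "\<not> X \<subseteq> {x}"
 proof
  assume "X \<subseteq> {x}"
  then have sub: "sphere (0::real^4) 1 \<subseteq> {f x}" unfolding f[symmetric] by blast
  have "axis 1 1 = - (axis 1 1 :: real^4)"
   by (rule trans[OF singletonD[OF subsetD[OF sub s(1)]] singletonD[OF subsetD[OF sub s(2)], symmetric]])
  then have "(axis 1 1 :: real^4) $ 1 = - (axis 1 1 :: real^4) $ 1" by (metis vector_uminus_component)
  then show False by (simp add: axis_def)
 qed
qed

text \<open>
 In the round case the energy surface is explicit. It is a compact sphere only if the lower apsis
 of the Kepler annulus lies outside the body and the annulus is not a single circle.
\<close>

lemma (in homogeneous_ball) round_case:
 assumes h: "h < 0" and \<omega>: "\<omega> ~= 0" and comp: "compact (energy_surface R h \<omega> 0)"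
  and diff: "diffeomorphic (energy_surface R h \<omega> 0) (sphere (0::real^4) 1)"
 shows "0 < 1 + 2 * h * \<omega>^2" "R < \<omega>^2 / (1 + sqrt (1 + 2 * h * \<omega>^2))"
proof -
 let ?M = "energy_surface R h \<omega> 0"
 have iff: "(a, b, \<rho>, \<phi>) \<in> ?M \<longleftrightarrow> R < \<rho> \<and> \<phi> \<in> {- pi / 2<..<pi / 2} \<and> kinetic \<omega> a b \<rho> \<phi> - 1 / \<rho> = h" for a b \<rho> \<phi>
 proof -
  have "norm (spherical \<rho> 0 \<phi>) = \<rho>" if "0 < \<rho>" using norm_spherical that by simp
  then show ?thesis
   using R potential_round[of "spherical \<rho> 0 \<phi>"] unfolding energy_surface_def ellipsoid_0[OF R] by (cases "R < \<rho>") auto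
 qed
 have w2: "\<omega>\<^sup>2 > 0" using \<omega> by simp
 have sq: "\<omega>^2 * (\<omega>^2 / (2 * \<rho>^2) - 1 / \<rho> - h) = ((\<omega>^2 / \<rho> - 1)\<^sup>2 - (1 + 2 * h * \<omega>^2)) / 2" if "\<rho> > 0" for \<rho>
  using that by (simp add: field_simps power2_eq_square)
 \<comment> \<open>Solved for \<open>(\<omega>^2 / \<rho> - 1)^2\<close>, the energy equation gives
   \<open>1 + 2 h \<omega>^2\<close> minus nonnegative terms which vanish together only for zero
   velocities and zero latitude.\<close>
 have kin: "(\<omega>^2 / \<rho> - 1)\<^sup>2 <= 1 + 2 * h * \<omega>\<^sup>2 \<and> R < \<rho> \<and> ((\<omega>^2 / \<rho> - 1)\<^sup>2 = 1 + 2 * h * \<omega>^2 --> a = 0 \<and> b = 0 \<and> \<phi> = 0)"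
  if m: "(a, b, \<rho>, \<phi>) \<in> ?M" for a b \<rho> \<phi>
 proof -
  have p: "R < \<rho>" "\<rho> > 0" "cos \<phi> > 0" "kinetic \<omega> a b \<rho> \<phi> - 1 / \<rho> = h" and ph: "\<bar>\<phi>\<bar> < pi / 2"
   using m R by (auto simp: iff intro!: cos_gt_zero_pi)
  define k where "k = \<omega>^2 / (2 * \<rho>^2)"
  have k: "k > 0" using w2 p by (simp add: k_def)
  define q where "q = 1 / (cos \<phi>)\<^sup>2 - 1"
  have c1: "(cos \<phi>)\<^sup>2 <= 1" by (simp add: abs_square_le_1)
  have c0: "(cos \<phi>)\<^sup>2 > 0" using p(3) by simp
  have q: "q \<ge> 0" using c0 c1 by (simp add: q_def)
  have K: "kinetic \<omega> a b \<rho> \<phi> = (a^2 + (\<rho> * b)\<^sup>2) / 2 + k * (1 + q)"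
   by (simp add: kinetic_def k_def q_def power_mult_distrib)
  then have le: "k - 1 / \<rho> - h = - ((a^2 + (\<rho> * b)\<^sup>2) / 2 + k * q)" using p(4) by (simp add: algebra_simps)
  have pos: "0 <= (a^2 + (\<rho> * b)\<^sup>2) / 2" "0 <= k * q" using k q by simp_all
  then have "0 <= \<omega>^2 * ((a^2 + (\<rho> * b)\<^sup>2) / 2 + k * q)" by (intro mult_nonneg_nonneg[OF less_imp_le[OF w2] add_nonneg_nonneg[OF pos]])
  then have "\<omega>^2 * (k - 1 / \<rho> - h) <= 0" unfolding le by (simp only: mult_minus_right neg_le_0_iff_le)
  then have 1: "(\<omega>^2 / \<rho> - 1)\<^sup>2 <= 1 + 2 * h * \<omega>^2" using sq[OF p(2)] by (simp add: k_def)
  have "a = 0 \<and> b = 0 \<and> \<phi> = 0" if eq: "(\<omega>^2 / \<rho> - 1)\<^sup>2 = 1 + 2 * h * \<omega>^2"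
  proof -
   have "\<omega>^2 * (k - 1 / \<rho> - h) = 0" using sq[OF p(2)] eq by (simp add: k_def)
   then have z: "(a^2 + (\<rho> * b)\<^sup>2) / 2 + k * q = 0" unfolding le using w2 by simp
   then have "(a^2 + (\<rho> * b)\<^sup>2) / 2 = 0 \<and> k * q = 0" using add_nonneg_eq_0_iff[OF pos] by blast
   then have "a^2 + (\<rho> * b)\<^sup>2 = 0" "k * q = 0" by simp_all
   then have ab: "a = 0" "\<rho> * b = 0" "q = 0" using k by (simp_all add: sum_power2_eq_zero_iff)
   then have "(cos \<phi>)\<^sup>2 = 1" using c0 by (simp add: q_def)
   then have "sin \<phi> = 0" using sin_cos_squared_add[of \<phi>] by simp
   then have "\<phi> = 0" using ph sin_eq_0_pi[of \<phi>] pi_gt_zero by (auto simp: abs_less_iff)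
   then show ?thesis using ab p(2) by simp
  qed
  then show ?thesis using 1 p(1) by blast
 qed
 obtain a b \<rho> \<phi> where m: "(a, b, \<rho>, \<phi>) \<in> ?M" using sphere_not_singleton(1)[OF diff] by auto
 have ge: "0 <= 1 + 2 * h * \<omega>^2" using kin[OF m] zero_le_power2[of "\<omega>^2 / \<rho> - 1"] by linarith
 \<comment> \<open>Otherwise the annulus shrinks to one radius and the surface to a single point,
   the circular equatorial orbit.\<close>
 show pos: "0 < 1 + 2 * h * \<omega>^2"
 proof (rule ccontr)
  assume "\<not> 0 < 1 + 2 * h * \<omega>^2"
  then have z: "1 + 2 * h * \<omega>^2 = 0" using ge by linarith
  have "?M \<subseteq> {(0, 0, \<omega>\<^sup>2, 0)}"
  proof
   fix x assume x: "x \<in> ?M"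
   obtain a b \<rho> \<phi> where xe: "x = (a, b, \<rho>, \<phi>)" by (cases x) auto
   note k = kin[OF x[unfolded xe], unfolded z]
   then have k0: "(\<omega>^2 / \<rho> - 1)\<^sup>2 = 0" using zero_le_power2[of "\<omega>^2 / \<rho> - 1"] by linarith
   then have "\<omega>^2 / \<rho> - 1 = 0" by (simp only: zero_eq_power2)
   then have "\<omega>^2 / \<rho> = 1" by linarith
   moreover have "\<rho> > 0" using k R by linarith
   ultimately have "\<rho> = \<omega>^2" by (simp add: divide_eq_eq)
   then show "x \<in> {(0, 0, \<omega>\<^sup>2, 0)}" using k k0 xe by simp
  qed
  then show False using sphere_not_singleton(2)[OF diff] by blast
 qed
 define \<epsilon> where "\<epsilon> = sqrt (1 + 2 * h * \<omega>^2)"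
 have \<epsilon>: "\<epsilon> > 0" "\<epsilon>^2 = 1 + 2 * h * \<omega>^2" using pos by (simp_all add: \<epsilon>_def)
 show "R < \<omega>^2 / (1 + sqrt (1 + 2 * h * \<omega>^2))"
 proof (rule ccontr)
  assume "\<not> R < \<omega>^2 / (1 + sqrt (1 + 2 * h * \<omega>^2))"
  then have lo: "\<omega>^2 / (1 + \<epsilon>) <= R" by (simp add: \<epsilon>_def)
  have \<rho>: "R < \<rho>" "(\<omega>^2 / \<rho> - 1)\<^sup>2 <= \<epsilon>^2" using kin[OF m] \<epsilon>(2) by auto
  \<comment> \<open>If the lower apsis were not outside the ball, the surface would contain points
    at all radii between \<open>R\<close> and \<rho>, with \<open>R\<close> itself excluded. This
    contradicts the least radius that compactness provides.\<close>
  have pts: "(sqrt (2 * (h + 1 / r - \<omega>^2 / (2 * r^2))), 0, r, 0) \<in> ?M" if r: "R < r" "r <= \<rho>" for r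
  proof -
   have r0: "r > 0" using r R by linarith
   have "\<bar>\<omega>\<^sup>2 / \<rho> - 1\<bar> <= \<bar>\<epsilon>\<bar>" using \<rho>(2) by (simp only: abs_le_square_iff)
   then have "1 - \<epsilon> <= \<omega>^2 / \<rho>" using \<epsilon>(1) by linarith
   also have "\<dots> <= \<omega>^2 / r" using r r0 w2 by (intro divide_left_mono) auto
   finally have 1: "1 - \<epsilon> <= \<omega>^2 / r" .
   have "\<omega>^2 <= R * (1 + \<epsilon>)" using lo \<epsilon>(1) by (simp add: divide_le_eq)
   also have "\<dots> <= r * (1 + \<epsilon>)" using r \<epsilon>(1) by (intro mult_right_mono) auto
   finally have "\<omega>^2 / r <= 1 + \<epsilon>" using r0 by (simp add: divide_le_eq mult.commute)
   then have "\<bar>\<omega>\<^sup>2 / r - 1\<bar> <= \<bar>\<epsilon>\<bar>" using 1 \<epsilon>(1) by linarith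
   then have "(\<omega>^2 / r - 1)\<^sup>2 <= \<epsilon>^2" by (simp only: abs_le_square_iff)
   then have "\<omega>^2 * (\<omega>^2 / (2 * r^2) - 1 / r - h) <= 0" unfolding sq[OF r0] \<epsilon>(2) by simp
   then have "\<omega>^2 / (2 * r^2) - 1 / r - h <= 0" using w2 by (simp add: mult_le_0_iff)
   then have nn: "0 <= h + 1 / r - \<omega>^2 / (2 * r^2)" (is "0 <= ?x") by simp
   have "kinetic \<omega> (sqrt (2 * x)) 0 r 0 = x + \<omega>^2 / (2 * r^2)" if "0 <= x" for x
    using that by (simp add: kinetic_def)
   from this[OF nn] have "kinetic \<omega> (sqrt (2 * ?x)) 0 r 0 - 1 / r = h" by simp
   then show ?thesis unfolding iff using r pi_gt_zero by simp
  qed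
  have "continuous_on ?M (%x. fst (snd (snd x)))" by (intro continuous_intros)
  then have cM: "compact ((%x. fst (snd (snd x))) ` ?M)" using comp by (rule compact_continuous_image)
  have nM: "(%x. fst (snd (snd x))) ` ?M ~= {}" using m by blast
  obtain s where s: "s \<in> (%x. fst (snd (snd x))) ` ?M" "\<And>t. t \<in> (%x. fst (snd (snd x))) ` ?M ==> s <= t"
   using compact_attains_inf[OF cM nM] by blast
  have "R < s" using s(1) iff by auto
  define r where "r = min \<rho> ((R + s) / 2)"
  have r: "R < r" "r <= \<rho>" "r < s" using \<rho>(1) \<open>R < s\<close> by (auto simp: r_def min_def)
  have "r \<in> (%x. fst (snd (snd x))) ` ?M" using pts[OF r(1,2)] by force
  then show False using s(2)[of r] r(3) by simp
 qed
qed

theorem theorem1p1: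
  fixes R h \<omega> :: real
  assumes "R > 0" and "h < 0" and "\<omega> \<noteq> 0"
    and "\<exists>\<delta>>0. \<forall>e. \<bar>e\<bar> < \<delta> \<longrightarrow>
           compact (energy_surface R h \<omega> e) \<and>
           diffeomorphic (energy_surface R h \<omega> e) (sphere (0 :: real^4) 1)"
  shows "\<exists>\<epsilon>>0. \<forall>e. \<bar>e\<bar> < \<epsilon> \<longrightarrow> infinite (relative_periodic_orbits R h \<omega> e)"
proof -
 interpret body: homogeneous_ball R by unfold_locales (rule assms(1))
 have "compact (energy_surface R h \<omega> 0)" "diffeomorphic (energy_surface R h \<omega> 0) (sphere (0 :: real^4) 1)"
  using assms(4) by auto
 note round = body.round_case[OF assms(2,3) this]
 define w \<epsilon> \<rho>0 where "w = \<bar>\<omega>\<bar>" and "\<epsilon> = sqrt (1 + 2 * h * \<omega>^2)" and "\<rho>0 = - 1 / (2 * h)"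
 have w: "w > 0" "w^2 = \<omega>^2" using assms(3) by (simp_all add: w_def)
 have \<epsilon>: "0 < \<epsilon>" "\<epsilon>^2 = 1 + 2 * h * w^2" using round(1) by (simp_all add: \<epsilon>_def w(2))
 have "2 * h * w^2 < 0" using assms(2) w(1) by (simp add: mult_neg_pos)
 then have "\<epsilon>^2 < 1\<^sup>2" using \<epsilon>(2) by simp
 then have \<epsilon>1: "\<epsilon> < 1" by (rule power2_less_imp_less) simp
 have \<rho>0: "\<rho>0 > 0" "h = - 1 / (2 * \<rho>0)" "w^2 = \<rho>0 * (1 - \<epsilon>^2)"
  unfolding \<epsilon>(2) using assms(2) by (simp_all add: \<rho>0_def field_simps)
 have "R < w^2 / (1 + \<epsilon>)" using round(2) by (simp only: \<epsilon>_def w(2))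
 then have Rw: "R * (1 + \<epsilon>) < w^2" using \<epsilon>(1) by (simp add: pos_less_divide_eq)
 define W where "W = w^2 / R"
 \<comment> \<open>\<open>e1\<close> lies between \<epsilon> and the smaller of \<open>1\<close> and
   \<open>W - 1\<close>: below \<open>1\<close> the orbits are ellipses, and below
   \<open>W - 1\<close> the least radius \<open>w^2 / (1 + e1)\<close> exceeds \<open>R\<close>. The
   midpoint \<open>e2\<close> of \<epsilon> and \<open>e1\<close> gives the energy trap its margin
   on both sides.\<close>
 define e1 e2 where "e1 = min ((\<epsilon> + 1) / 2) ((\<epsilon> + (W - 1)) / 2)" and "e2 = (\<epsilon> + e1) / 2"
 have "1 + \<epsilon> < W" using Rw assms(1) by (simp add: W_def less_divide_eq mult.commute)
 have e1': "\<epsilon> < e1" "e1 < 1" "1 + e1 < W"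
 proof -
  have m: "2 * e1 <= \<epsilon> + 1" "2 * e1 <= \<epsilon> + W - 1" "2 * e1 = \<epsilon> + 1 \<or> 2 * e1 = \<epsilon> + W - 1"
   by (auto simp: e1_def min_def)
  show "\<epsilon> < e1" using m(3) \<open>1 + \<epsilon> < W\<close> \<epsilon>1 by (elim disjE) linarith+
  show "e1 < 1" using m(1) \<epsilon>1 by linarith
  show "1 + e1 < W" using m(2) \<open>1 + \<epsilon> < W\<close> by linarith
 qed
 have e: "\<epsilon> < e1" "e1 < 1" "1 + e1 < w^2 / R" "0 < e1" "\<epsilon> < e2" "e2 < e1" "0 < e2"
  using e1' \<epsilon>(1) unfolding e2_def W_def by simp_all
 define ra rb where "ra = w^2 / (1 + e1)" and "rb = w^2 / ((1 - e1^2) * (1 - e1))"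
 have q: "0 < 1 - e1^2" "0 < 1 - e2^2" using e by (simp_all add: abs_square_less_1)
 have Rra: "R < ra" using e(3,4) assms(1) by (simp add: ra_def less_divide_eq mult.commute)
 have rab: "ra <= rb"
 proof -
  have "(1 - e1^2) * (1 - e1) <= 1 * 1" using q e by (intro mult_mono) auto
  then show ?thesis unfolding ra_def rb_def using q e w(1) by (intro divide_left_mono) auto
 qed
 define X where "X = {ra..rb} \<times> {- e1..e1}"
 obtain c C3 D E where c: "c > 0" "C3 > 0"
  and DE: "expands 1 (UNIV :: unit set) X (%e _. D e)" "expands 1 (UNIV :: unit set) X (%e _. E e)"
  and D0: "\<And>y. y \<in> X ==> D 0 y = 6 * c / fst y ^ 5"
  and E0: "\<And>y. y \<in> X ==> E 0 y = c * (3 - 15 * (snd y)\<^sup>2) / fst y ^ 5"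
  and grad: "\<forall>\<^sub>F e in nhds 0. \<forall>y\<in>X. \<forall>t. rotz t (meridian y) \<notin> ellipsoid R e \<and>
    GDERIV (potential R e) (rotz t (meridian y)) :> (let b = 1 / fst y ^ 3 + e * E e y; x = rotz t (meridian y) in
     vector [x $ 1 * b, x $ 2 * b, x $ 3 * (b + e * D e y)])"
  and near: "\<forall>\<^sub>F e in nhds 0. \<forall>y\<in>X. \<bar>potential R e (meridian y) + 1 / fst y\<bar> <= C3 * \<bar>e\<bar>"
  using body.potential_expansion[OF Rra rab e(4,2), folded X_def] by blast
 have XX: "X = {w\<^sup>2 / (1 + e1)..w\<^sup>2 / ((1 - e1^2) * (1 - e1))} \<times> {- e1..e1}" by (simp add: X_def ra_def rb_def)
 have pert: "perturbed w e1 c D E"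
  by (unfold_locales; (fold XX)?) (use w e c DE D0 E0 in auto)
 interpret p: perturbed w e1 c D E "cball 0 e1 \<times> {- e1..e1}" X
  unfolding XX by (rule pert) (simp_all)
 let ?K = "cball (0::complex) e1 \<times> {- e1..e1}"
 obtain M where M: "M > 0" "\<forall>\<^sub>F e in nhds 0. \<forall>u. \<forall>y\<in>?K. norm (p.G e u y) <= M \<and> (\<forall>y'\<in>?K. norm (p.G e u y - p.G e u y') <= M * norm (y - y'))"
  using p.G_lipschitz .
 obtain C2 where C2: "C2 > 0" "\<forall>\<^sub>F e in nhds 0.
  (\<forall>y. p.flow e y 0 = y) \<and> (\<forall>y u. (p.flow e y has_vector_derivative e *\<^sub>R p.G e u (closest_point ?K (p.flow e y u))) (at u)) \<and>
  (\<forall>y u. norm (p.flow e y u - y) <= C2 * \<bar>e\<bar> * \<bar>u\<bar>) \<and>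
  (\<forall>y y' u. norm ((p.flow e y u - y) - (p.flow e y' u - y')) <= norm (y - y') * (exp (C2 * \<bar>e\<bar> * \<bar>u\<bar>) - 1))"
  using p.flow_estimates .
 obtain C1 where C1: "C1 > 0" "\<forall>\<^sub>F e in nhds 0. \<forall>y\<in>cball 0 e2 \<times> {- e2..e2}. \<forall>y'\<in>cball 0 e2 \<times> {- e2..e2}.
   norm ((p.flow e y (2 * pi) - y - (e * (2 * pi * p.rot (snd y))) *\<^sub>R (\<i> * fst y, 0))
    - (p.flow e y' (2 * pi) - y' - (e * (2 * pi * p.rot (snd y'))) *\<^sub>R (\<i> * fst y', 0))) <= C1 * e^2 * norm (y - y')"
  using p.turn_expansion[OF e(7,6)] .
 have comps: "expands 1 (UNIV :: real set) ?K (%_ _ y. fst y)" "expands 1 (UNIV :: real set) ?K (%_ _ y. snd y)"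
  "\<forall>\<^sub>F e in nhds (0::real). \<forall>v\<in>(UNIV :: real set). \<forall>y\<in>?K. norm (fst y) <= e1 \<and> \<bar>snd y\<bar> <= e1"
  using p.ulip_components by (auto intro!: ulip_imp_expands_const always_eventually simp: p.K_iff)
 obtain M' where M': "M' > 0" "\<forall>\<^sub>F e in nhds 0. \<forall>u\<in>UNIV. \<forall>y\<in>?K. norm (p.Ups e u (fst y, snd y)) <= M' \<and> (\<forall>y'\<in>?K. norm (p.Ups e u (fst y, snd y) - p.Ups e u (fst y', snd y')) <= M' * dist y y')"
  using ulipE[OF expands_ulip[OF p.ex_Ups[OF comps, of "%u. u"]]] by blast
 obtain Cr where Cr: "Cr > 0" "\<forall>\<^sub>F e in nhds (0::real). \<forall>u\<in>UNIV. \<forall>y\<in>?K. norm (rad w u (fst y, snd y)) <= Cr \<and> (\<forall>y'\<in>?K. norm (rad w u (fst y, snd y) - rad w u (fst y', snd y')) <= Cr * dist y y')"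
  using ulipE[OF expands_ulip[OF p.ex_rad[OF comps, of "%u. u"]]] by blast
 obtain C4 where C4: "C4 > 0" "\<forall>\<^sub>F e in nhds 0. \<forall>v\<in>(UNIV :: unit set). \<forall>y\<in>X. norm (E e y) <= C4 \<and> (\<forall>y'\<in>X. norm (E e y - E e y') <= C4 * dist y y')"
  using ulipE[OF expands_ulip[OF DE(2)]] .
 define m where "m = w / (w^2 / ((1 - e1^2) * (1 - e1)))\<^sup>2 / 2"
 have m: "m > 0" unfolding m_def using w(1) q e by simp
 define k0 Cs C6 C7 where "k0 = 6 * c / w ^ 4" and "Cs = 12 / ((1 - e2^2) * \<epsilon>)"
  and "C6 = C1 * (1 + Cs) + 2 * pi * (28 * k0 * Cs * (2 * C2))" and "C7 = C6 + 2 * (2 * pi * k0 + C6)\<^sup>2"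
 have k0: "k0 > 0" using c w(1) by (simp add: k0_def)
 have ra\<rho>: "\<rho>0 * \<epsilon> < \<rho>0 - ra"
 proof -
  have "ra < w^2 / (1 + \<epsilon>)" unfolding ra_def using e(1) \<epsilon>(1) w(1) by (intro divide_strict_left_mono) auto
  also have "\<dots> = \<rho>0 * (1 - \<epsilon>)"
  proof -
   have "w^2 = \<rho>0 * (1 - \<epsilon>) * (1 + \<epsilon>)" unfolding \<rho>0(3) by (simp add: power2_eq_square algebra_simps)
   then show ?thesis using \<epsilon>(1) by simp
  qed
  finally show ?thesis by (simp add: algebra_simps)
 qed
 \<comment> \<open>\<open>ra\<close> is smaller than the pericentre distance of the equatorial
   Kepler orbit; the margin is what forces \<open>sec ra < w^2\<close> under the
   perturbation.\<close>
 have b4: "0 < ((\<rho>0 - ra)\<^sup>2 - (\<rho>0 * \<epsilon>)\<^sup>2) / \<rho>0"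
 proof -
  have "(\<rho>0 * \<epsilon>)\<^sup>2 < (\<rho>0 - ra)\<^sup>2" using ra\<rho> \<rho>0(1) \<epsilon>(1) by (intro power_strict_mono) auto
  then show ?thesis using \<rho>0(1) by simp
 qed
 have "0 < e2^2 - \<epsilon>^2" using e(5) \<epsilon>(1) by (simp add: power_strict_mono)
 \<comment> \<open>With \<open>C0 = C3 |e|\<close> and \<open>C5 = |e| rb C4\<close>, every
   smallness condition of \<open>near_kepler\<close> is a multiple of \<open>|e|\<close> against a
   positive constant.\<close>
 note sm = eventually_small[OF this, of "2 * w^2 * C3"] eventually_small[of "1 / (2 * \<rho>0)" "C3 + rb * (rb * C4)"]
  eventually_small[of "\<epsilon> / 2" "2 * rb * C3 + 2 * C2"] eventually_small[of "\<rho>0 * \<epsilon>^2 / 4" "2 * rb^2 * C3"]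
  eventually_small[OF b4, of "2 * rb^2 * C3"] eventually_small[of 1 "2 * w^2 * ((rb * C4) * Cr)"]
  eventually_small[of "(1 - e2^2) * \<epsilon> / 4" "2 * w^2 * ((rb * C4) * Cr)"] eventually_small[of 1 1]
  eventually_small[of "1 / 2" "2 * pi * k0 + C6"] eventually_small[of "k0 * (\<epsilon>^2 / 4)" C7] eventually_small[of "1 / 16" 1]
 have "\<forall>\<^sub>F e in nhds 0. 2 * w^2 * C3 * \<bar>e\<bar> < e2^2 - \<epsilon>\<^sup>2 \<and> (C3 + rb * (rb * C4)) * \<bar>e\<bar> < 1 / (2 * \<rho>0) \<and>
  (2 * rb * C3 + 2 * C2) * \<bar>e\<bar> < \<epsilon> / 2 \<and> 2 * rb^2 * C3 * \<bar>e\<bar> < \<rho>0 * \<epsilon>^2 / 4 \<and>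
  2 * rb^2 * C3 * \<bar>e\<bar> < ((\<rho>0 - ra)\<^sup>2 - (\<rho>0 * \<epsilon>)\<^sup>2) / \<rho>0 \<and> 2 * w^2 * ((rb * C4) * Cr) * \<bar>e\<bar> < 1 \<and>
  2 * w^2 * ((rb * C4) * Cr) * \<bar>e\<bar> < (1 - e2^2) * \<epsilon> / 4 \<and> 1 * \<bar>e\<bar> < 1 \<and>
  (2 * pi * k0 + C6) * \<bar>e\<bar> < 1 / 2 \<and> C7 * \<bar>e\<bar> < k0 * (\<epsilon>^2 / 4) \<and> 1 * \<bar>e\<bar> < 1 / 16"
  by (intro eventually_conj sm) (use \<rho>0(1) \<epsilon>(1) q k0 in simp_all)
 then have "\<forall>\<^sub>F e in nhds 0. infinite (relative_periodic_orbits R h \<omega> e)"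
  using grad near M(2) C2(2) C1(2) M'(2) Cr(2) C4(2) p.Ups_pos p.G_continuous
 proof eventually_elim
  case (elim e)
  note sml = elim(1)
  have grad: "GDERIV (potential R e) (rotz t (meridian x)) :>
   (let b = 1 / fst x ^ 3 + e * E e x; v = rotz t (meridian x) in vector [v $ 1 * b, v $ 2 * b, v $ 3 * (b + e * D e x)])"
   and outside: "rotz t (meridian x) \<notin> ellipsoid R e" if "x \<in> X" for x t
   using elim(2) that by blast+
  \<comment> \<open>At \<open>e = 0\<close> the gradient carries no information on \<open>D\<close>
    and \<open>E\<close>, so evenness is read from their explicit values there; for
    \<open>snd x = 0\<close> it is trivial, and otherwise the reflected gradient gives it.\<close>
  have even: "D e (fst x, - snd x) = D e x \<and> E e (fst x, - snd x) = E e x" if x: "x \<in> X" for x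
  proof -
   have x': "(fst x, - snd x) \<in> X" using x by (auto simp: X_def)
   show ?thesis
   proof (cases "e = 0 \<or> snd x = 0")
    case True
    then show ?thesis using D0[OF x] D0[OF x'] E0[OF x] E0[OF x'] by (cases x) auto
   next
    case False
    have rz: "rotz 0 v = v" for v by (simp add: vec_eq_iff forall_3)
    have rf: "refl3 (meridian x) = meridian (fst x, - snd x)" by (simp add: vec_eq_iff forall_3)
    have "fst x > 0" "\<bar>snd x\<bar> < 1" using x Rra assms(1) e(2) by (auto simp: X_def)
    then have n: "meridian x $ 1 ~= 0" "meridian x $ 3 ~= 0" using False by (auto simp: abs_square_less_1 less_imp_neq[THEN not_sym])
    have out: "meridian x \<notin> ellipsoid R e" using outside[OF x, of 0] by (simp add: rz)
    have ee: "\<bar>e\<bar> <= 1 / 16" using sml by simp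
    note ge = body.gradient_even[OF ee out grad[OF x, of 0, unfolded rz Let_def] grad[OF x', of 0, unfolded rz Let_def, folded rf]]
    have E: "E e (fst x, - snd x) = E e x" using ge(1)[OF n(1)] False by simp
    then show ?thesis using ge(2)[OF n(2)] False by simp
   qed
  qed
  have C0w: "2 * w^2 * (C3 * \<bar>e\<bar>) < e2^2 - (1 + 2 * h * w^2)" using sml unfolding \<epsilon>(2)[symmetric] by (simp add: mult.assoc)
  have m2: "m <= p.Ups e u y" "p.Ups e u y <= M'" if "y \<in> ?K" for y u
  proof -
   show "m <= p.Ups e u y" using elim(10) that unfolding m_def by blast
   have "norm (p.Ups e u (fst y, snd y)) <= M'" using elim(7) that by blast
   then show "p.Ups e u y <= M'" by simp
  qed
  have liprad: "\<bar>rad w u y - rad w u y'\<bar> <= Cr * norm (y - y')" if "y \<in> ?K" "y' \<in> ?K" for y y' u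
  proof -
   have "norm (rad w u (fst y, snd y) - rad w u (fst y', snd y')) <= Cr * dist y y'" using elim(8) that by blast
   then show ?thesis by (simp add: dist_norm)
  qed
  have cf: "continuous_on UNIV (%y. p.flow e y u)" for u
  proof (rule lipschitz_on_continuous_on)
   show "(exp (C2 * \<bar>e\<bar> * \<bar>u\<bar>))-lipschitz_on UNIV (%y. p.flow e y u)"
   proof (rule lipschitz_onI)
    fix y y' :: "complex \<times> real"
    have "norm ((p.flow e y u - y) - (p.flow e y' u - y')) <= norm (y - y') * (exp (C2 * \<bar>e\<bar> * \<bar>u\<bar>) - 1)" using elim(5) by blast
    moreover have "norm (p.flow e y u - p.flow e y' u) <= norm ((p.flow e y u - y) - (p.flow e y' u - y')) + norm (y - y')"
     using norm_triangle_ineq[of "(p.flow e y u - y) - (p.flow e y' u - y')" "y - y'"] by simp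
    ultimately show "dist (p.flow e y u) (p.flow e y' u) <= exp (C2 * \<bar>e\<bar> * \<bar>u\<bar>) * dist y y'"
     by (simp add: dist_norm algebra_simps)
   qed simp
  qed
  have orb: "orbit w e1 c D E e h e2 M M' m (C3 * \<bar>e\<bar>) R"
  proof (rule orbit.intro[OF pert], rule orbit_axioms.intro, fold XX)
   show "\<bar>potential R e (meridian x) + 1 / fst x\<bar> <= C3 * \<bar>e\<bar>" if "x \<in> X" for x using elim(3) that by blast
   show "D e (fst x, - snd x) = D e x" "E e (fst x, - snd x) = E e x" if "x \<in> X" for x using even[OF that] by auto
   show "norm (p.G e u y - p.G e u y') <= M * norm (y - y')" if "y \<in> ?K" "y' \<in> ?K" for y y' u using elim(4) that by blast
   show "p.flow e y 0 = y" "(p.flow e y has_vector_derivative e *\<^sub>R p.G e u (closest_point ?K (p.flow e y u))) (at u)" for y u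
    using elim(5) by blast+
   show "continuous_on (UNIV \<times> ?K) (%(u, y). p.Ups e u y)" using elim(11) by blast
  qed (use grad outside m m2 e C0w in blast)+
  interpret o: orbit w e1 c D E ?K X e h e2 M M' m "C3 * \<bar>e\<bar>" R
   unfolding XX by (rule orb) simp_all
  have "near_kepler w e1 c D E e h e2 M M' m (C3 * \<bar>e\<bar>) R \<omega> \<epsilon> \<rho>0 C1 C2 Cr C4 (\<bar>e\<bar> * (rb * C4)) Cs C6 C7 k0 ra rb"
  proof (rule near_kepler.intro[OF orb], rule near_kepler_axioms.intro, fold XX)
   show "norm ((p.flow e y (2 * pi) - y - (e * (2 * pi * p.rot (snd y))) *\<^sub>R (\<i> * fst y, 0))
    - (p.flow e y' (2 * pi) - y' - (e * (2 * pi * p.rot (snd y'))) *\<^sub>R (\<i> * fst y', 0))) <= C1 * e^2 * norm (y - y')"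
    if "y \<in> o.K2" "y' \<in> o.K2" for y y' using elim(6) that unfolding o.K2_def by blast
   show "norm (p.flow e y u - y) <= C2 * \<bar>e\<bar> * \<bar>u\<bar>" for y u using elim(5) by blast
   show "\<bar>E e x\<bar> <= C4" if "x \<in> X" for x
   proof -
    have "norm (E e x) <= C4" using elim(9) that by blast
    then show ?thesis by simp
   qed
   show "C3 * \<bar>e\<bar> + rb * (\<bar>e\<bar> * (rb * C4)) < 1 / (2 * \<rho>0)" "2 * rb * (C3 * \<bar>e\<bar>) + 2 * C2 * \<bar>e\<bar> < \<epsilon> / 2"
    "2 * rb^2 * (C3 * \<bar>e\<bar>) <= \<rho>0 * \<epsilon>^2 / 4" "2 * rb^2 * (C3 * \<bar>e\<bar>) < ((\<rho>0 - ra)\<^sup>2 - (\<rho>0 * \<epsilon>)\<^sup>2) / \<rho>0"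
    "2 * w^2 * (\<bar>e\<bar> * (rb * C4) * Cr) <= 1" "2 * w^2 * (\<bar>e\<bar> * (rb * C4) * Cr) <= (1 - e2^2) * \<epsilon> / 4"
    "\<bar>e\<bar> <= 1" "\<bar>e\<bar> * (2 * pi * k0 + C6) <= 1 / 2" "C7 * \<bar>e\<bar> <= k0 * (\<epsilon>^2 / 4)"
    using sml by (simp_all add: algebra_simps)
  qed (use w w_def \<epsilon> e \<rho>0 c C1 C2 Cr C4 ra_def rb_def k0_def Cs_def C6_def C7_def liprad cf in auto)
  then interpret n: near_kepler w e1 c D E ?K X e h e2 M M' m "C3 * \<bar>e\<bar>" R \<omega> \<epsilon> \<rho>0 C1 C2 Cr C4 "\<bar>e\<bar> * (rb * C4)" Cs C6 C7 k0 ra rb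
   unfolding XX by simp_all
  show ?case by (rule n.infinite_orbits)
 qed
 then show ?thesis by (auto simp: eventually_nhds_metric dist_real_def)
qed

end
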